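(* (Hausser and Nill) Let $H$ be a quasi-bialgebra, $\mathcal A$ an $H$-bimodule algebra, $\mathfrak A$ a right $H$-comodule algebra, $\mathbb B$ an $H$-bicomodule algebra and $\mathfrak C$ a left $H$-comodule algebra. Then: (i) $\mathfrak A>\!\!\triangleleft\,\mathcal A\,\triangleright\!\!<\mathbb B$ admits a right $H$-comodule algebra structure; (ii) $\mathbb B>\!\!\triangleleft\,\mathcal A\,\triangleright\!\!<\mathfrak C$ admits a left $H$-comodule algebra structure; (iii) there is an algebra isomorphism (given by the trivial identification) $$(\mathfrak A>\!\!\triangleleft\,\mathcal A\,\triangleright\!\!<\mathbb B)>\!\!\triangleleft\,\mathcal A\,\triangleright\!\!<\mathfrak C\equiv\mathfrak A>\!\!\triangleleft\,\mathcal A\,\triangleright\!\!<(\mathbb B>\!\!\triangleleft\,\mathcal A\,\triangleright\!\!<\mathfrak C).$$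
   Context: All algebras and spaces are over a field $k$, $\otimes=\otimes_k$; summation is understood. A quasi-bialgebra $(H,\Delta,\varepsilon,\Phi)$: a unital associative algebra $H$, algebra maps $\Delta:H\to H\otimes H$ ($\Delta(h)=h_1\otimes h_2$), $\varepsilon:H\to k$, and an invertible $\Phi=X^1\otimes X^2\otimes X^3\in H^{\otimes3}$, $\Phi^{-1}=x^1\otimes x^2\otimes x^3$, with $(id\otimes\Delta)(\Delta(h))=\Phi(\Delta\otimes id)(\Delta(h))\Phi^{-1}$, $(id\otimes\varepsilon)\Delta=id=(\varepsilon\otimes id)\Delta$, $(1\otimes\Phi)(id\otimes\Delta\otimes id)(\Phi)(\Phi\otimes1)=(id\otimes id\otimes\Delta)(\Phi)(\Delta\otimes id\otimes id)(\Phi)$, $(id\otimes\varepsilon\otimes id)(\Phi)=1\otimes1$. An $H$-bimodule algebra: an $H$-bimodule $\mathcal A$ with a bilinear multiplication and a two-sided unit $1_{\mathcal A}$ such that $(\varphi\varphi')\varphi''=(X^1\cdot\varphi\cdot x^1)[(X^2\cdot\varphi'\cdot x^2)(X^3\cdot\varphi''\cdot x^3)]$, $h\cdot(\varphi\varphi')=(h_1\cdot\varphi)(h_2\cdot\varphi')$, $(\varphi\varphi')\cdot h=(\varphi\cdot h_1)(\varphi'\cdot h_2)$, $h\cdot1_{\mathcal A}=\varepsilon(h)1_{\mathcal A}=1_{\mathcal A}\cdot h$. A right $H$-comodule algebra: a unital associative algebra $\mathfrak A$, an algebra map $\rho:\mathfrak A\to\mathfrak A\otimes H$, $\rho(a)=a_{\langle0\rangle}\otimes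 a_{\langle1\rangle}$, and an invertible $\Phi_\rho=\tilde X^1_\rho\otimes\tilde X^2_\rho\otimes\tilde X^3_\rho\in\mathfrak A\otimes H\otimes H$, $\Phi_\rho^{-1}=\tilde x^1_\rho\otimes\tilde x^2_\rho\otimes\tilde x^3_\rho$, with $\Phi_\rho(\rho\otimes id)(\rho(a))=(id\otimes\Delta)(\rho(a))\Phi_\rho$, $(1\otimes\Phi)(id\otimes\Delta\otimes id)(\Phi_\rho)(\Phi_\rho\otimes1)=(id\otimes id\otimes\Delta)(\Phi_\rho)(\rho\otimes id\otimes id)(\Phi_\rho)$, $(id\otimes\varepsilon)\rho=id$, $(id\otimes\varepsilon\otimes id)(\Phi_\rho)=(id\otimes id\otimes\varepsilon)(\Phi_\rho)=1\otimes1$. A left $H$-comodule algebra: a unital associative algebra $\mathfrak B$, an algebra map $\lambda:\mathfrak B\to H\otimes\mathfrak B$, $\lambda(b)=b_{[-1]}\otimes b_{[0]}$, and an invertible $\Phi_\lambda=\tilde X^1_\lambda\otimes\tilde X^2_\lambda\otimes\tilde X^3_\lambda\in H\otimes H\otimes\mathfrak B$, $\Phi_\lambda^{-1}=\tilde x^1_\lambda\otimes\tilde x^2_\lambda\otimes\tilde x^3_\lambda$, with $(id\otimes\lambda)(\lambda(b))\Phi_\lambda=\Phi_\lambda(\Delta\otimes id)(\lambda(b))$, $(1\otimes\Phi_\lambda)(id\otimes\Delta\otimes id)(\Phi_\lambda)(\Phi\otimes1)=(id\otimes id\otimes\lambda)(\Phi_\lambda)(\Delta\otimes id\otimes id)(\Phi_\lambda)$,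 $(\varepsilon\otimes id)\lambda=id$, $(id\otimes\varepsilon\otimes id)(\Phi_\lambda)=(\varepsilon\otimes id\otimes id)(\Phi_\lambda)=1\otimes1$. An $H$-bicomodule algebra $(\mathbb B,\lambda,\rho,\Phi_\lambda,\Phi_\rho,\Phi_{\lambda,\rho})$: $(\mathbb B,\lambda,\Phi_\lambda)$ is a left and $(\mathbb B,\rho,\Phi_\rho)$ a right $H$-comodule algebra, and $\Phi_{\lambda,\rho}\in H\otimes\mathbb B\otimes H$ is invertible, $\Phi_{\lambda,\rho}^{-1}=\theta^1\otimes\theta^2\otimes\theta^3$, with $\Phi_{\lambda,\rho}(\lambda\otimes id)(\rho(u))=(id\otimes\rho)(\lambda(u))\Phi_{\lambda,\rho}$, $(1\otimes\Phi_{\lambda,\rho})(id\otimes\lambda\otimes id)(\Phi_{\lambda,\rho})(\Phi_\lambda\otimes1)=(id\otimes id\otimes\rho)(\Phi_\lambda)(\Delta\otimes id\otimes id)(\Phi_{\lambda,\rho})$, $(1\otimes\Phi_\rho)(id\otimes\rho\otimes id)(\Phi_{\lambda,\rho})(\Phi_{\lambda,\rho}\otimes1)=(id\otimes id\otimes\Delta)(\Phi_{\lambda,\rho})(\lambda\otimes id\otimes id)(\Phi_\rho)$. Generalized two-sided crossed product: for a right $H$-comodule algebra $\mathfrak A$ and a left $H$-comodule algebra $\mathfrak B$, $\mathfrak A>\!\!\triangleleft\,\mathcal A\,\triangleright\!\!<\mathfrak B$ is $\mathfrak A\otimes\mathcal A\otimes\mathfrak B$ with the (associative, unital) multiplication $(a>\!\!\triangleleft\varphi\triangleright\!\!<b)(a'>\!\!\triangleleft\varphi'\triangleright\!\!<b')=aa'_{\langle0\rangle}\tilde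 x^1_\rho>\!\!\triangleleft(\tilde x^1_\lambda\cdot\varphi\cdot a'_{\langle1\rangle}\tilde x^2_\rho)(\tilde x^2_\lambda b_{[-1]}\cdot\varphi'\cdot\tilde x^3_\rho)\triangleright\!\!<\tilde x^3_\lambda b_{[0]}b'$ (here $\tilde x_\rho$ are the components of $\Phi_\rho^{-1}$ of $\mathfrak A$ and $\tilde x_\lambda$ those of $\Phi_\lambda^{-1}$ of $\mathfrak B$). Meaning of the iterated products in (iii): the outer crossed products are formed using the comodule algebra structures of (i) and (ii), which are taken to be the following ones. On $\mathfrak A>\!\!\triangleleft\,\mathcal A\,\triangleright\!\!<\mathbb B$: coaction $a>\!\!\triangleleft\varphi\triangleright\!\!<b\mapsto(a>\!\!\triangleleft\theta^1\cdot\varphi\triangleright\!\!<\theta^2b_{\langle0\rangle})\otimes\theta^3b_{\langle1\rangle}$ with reassociating element $(1_{\mathfrak A}>\!\!\triangleleft1_{\mathcal A}\triangleright\!\!<\tilde X^1_\rho)\otimes\tilde X^2_\rho\otimes\tilde X^3_\rho$. On $\mathbb B>\!\!\triangleleft\,\mathcal A\,\triangleright\!\!<\mathfrak C$: coaction $b>\!\!\triangleleft\varphi\triangleright\!\!<c\mapsto b_{[-1]}\theta^1\otimes(b_{[0]}\theta^2>\!\!\triangleleft\varphi\cdot\theta^3\triangleright\!\!<c)$ with reassociating element $\tilde X^1_\lambda\otimes\tilde X^2_\lambda\otimes(\tilde X^3_\lambda>\!\!\triangleleft1_{\mathcal A}\triangleright\!\!<1_{\mathfrak C})$. Here $\theta^1\otimes\theta^2\otimes\theta^3$,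 $\tilde X^1_\rho\otimes\tilde X^2_\rho\otimes\tilde X^3_\rho$ and $\tilde X^1_\lambda\otimes\tilde X^2_\lambda\otimes\tilde X^3_\lambda$ are $\Phi_{\lambda,\rho}^{-1}$, $\Phi_\rho$ and $\Phi_\lambda$ of $\mathbb B$. The trivial identification is the identity of $\mathfrak A\otimes\mathcal A\otimes\mathbb B\otimes\mathcal A\otimes\mathfrak C$. *)

theory Defs
  imports "HOL-Algebra.Module"
begin

text \<open>
  Vector spaces over a field \<open>K\<close> are modules over \<open>K\<close> in the sense of HOL-Algebra. The record type
  \<open>module\<close> also carries a multiplication and a unit. \<open>module K V\<close> says nothing about these two fields,
  so the same record type serves for plain vector spaces, for associative algebras and for
  non-associative algebras.
\<close>

section \<open>Algebras over a field\<close>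

locale k_algebra = K: field K + A: ring A + module K A
  for K :: "('k, 'z) ring_scheme" and A :: "('k, 'a, 'y) module_scheme" +
  assumes smult_mult_left: "\<lbrakk>c \<in> carrier K; x \<in> carrier A; y \<in> carrier A\<rbrakk> \<Longrightarrow>
      (c \<odot>\<^bsub>A\<^esub> x) \<otimes>\<^bsub>A\<^esub> y = c \<odot>\<^bsub>A\<^esub> (x \<otimes>\<^bsub>A\<^esub> y)"
    and smult_mult_right: "\<lbrakk>c \<in> carrier K; x \<in> carrier A; y \<in> carrier A\<rbrakk> \<Longrightarrow>
      x \<otimes>\<^bsub>A\<^esub> (c \<odot>\<^bsub>A\<^esub> y) = c \<odot>\<^bsub>A\<^esub> (x \<otimes>\<^bsub>A\<^esub> y)"

definition algebra_map :: "('k, 'z) ring_scheme \<Rightarrow> ('k, 'a) module \<Rightarrow> ('k, 'b) module \<Rightarrow> ('a \<Rightarrow> 'b) set"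
  where "algebra_map K A B =
    {f \<in> ring_hom A B. \<forall>c \<in> carrier K. \<forall>x \<in> carrier A. f (c \<odot>\<^bsub>A\<^esub> x) = c \<odot>\<^bsub>B\<^esub> f x}"

definition algebra_iso ::
    "('k, 'z) ring_scheme \<Rightarrow> ('k, 'a) module \<Rightarrow> ('k, 'b) module \<Rightarrow> ('a \<Rightarrow> 'b) \<Rightarrow> bool"
  where "algebra_iso K A B f \<longleftrightarrow> k_algebra K A \<and> k_algebra K B \<and>
    f \<in> algebra_map K A B \<and> bij_betw f (carrier A) (carrier B)"

definition bilinear_map :: "('k, 'z) ring_scheme \<Rightarrow> ('k, 'u) module \<Rightarrow> ('k, 'v) module \<Rightarrow>
    ('k, 'w) module \<Rightarrow> ('u \<Rightarrow> 'v \<Rightarrow> 'w) \<Rightarrow> bool"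
  where "bilinear_map K U V W f \<longleftrightarrow>
    (\<forall>x \<in> carrier U. \<forall>y \<in> carrier V. f x y \<in> carrier W) \<and>
    (\<forall>x \<in> carrier U. \<forall>x' \<in> carrier U. \<forall>y \<in> carrier V.
      f (x \<oplus>\<^bsub>U\<^esub> x') y = f x y \<oplus>\<^bsub>W\<^esub> f x' y) \<and>
    (\<forall>x \<in> carrier U. \<forall>y \<in> carrier V. \<forall>y' \<in> carrier V.
      f x (y \<oplus>\<^bsub>V\<^esub> y') = f x y \<oplus>\<^bsub>W\<^esub> f x y') \<and>
    (\<forall>c \<in> carrier K. \<forall>x \<in> carrier U. \<forall>y \<in> carrier V.
      f (c \<odot>\<^bsub>U\<^esub> x) y = c \<odot>\<^bsub>W\<^esub> f x y \<and> f x (c \<odot>\<^bsub>V\<^esub> y) = c \<odot>\<^bsub>W\<^esub> f x y)"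


section \<open>Tensor products\<close>

text \<open>
  A list \<open>[(v\<^sub>1, w\<^sub>1), \<dots>, (v\<^sub>n, w\<^sub>n)]\<close> stands for the formal sum \<open>\<Sum> v\<^sub>i \<otimes> w\<^sub>i\<close>, and \<open>tensor_rel K V W\<close> is
  the congruence (for concatenation) generated by commutativity and \<open>K\<close>-bilinearity.
\<close>

inductive_set tensor_rel :: "('k, 'z) ring_scheme \<Rightarrow> ('k, 'v) module \<Rightarrow> ('k, 'w) module \<Rightarrow>
    (('v \<times> 'w) list \<times> ('v \<times> 'w) list) set"
  for K :: "('k, 'z) ring_scheme" and V :: "('k, 'v) module" and W :: "('k, 'w) module"
where
  refl: "l \<in> lists (carrier V \<times> carrier W) \<Longrightarrow> (l, l) \<in> tensor_rel K V W"
| sym: "(l, m) \<in> tensor_rel K V W \<Longrightarrow> (m, l) \<in> tensor_rel K V W"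
| trans: "\<lbrakk>(l, m) \<in> tensor_rel K V W; (m, n) \<in> tensor_rel K V W\<rbrakk> \<Longrightarrow> (l, n) \<in> tensor_rel K V W"
| append: "\<lbrakk>(l, m) \<in> tensor_rel K V W; (l', m') \<in> tensor_rel K V W\<rbrakk> \<Longrightarrow>
    (l @ l', m @ m') \<in> tensor_rel K V W"
| commute: "\<lbrakk>l \<in> lists (carrier V \<times> carrier W); m \<in> lists (carrier V \<times> carrier W)\<rbrakk> \<Longrightarrow>
    (l @ m, m @ l) \<in> tensor_rel K V W"
| zero: "w \<in> carrier W \<Longrightarrow> ([(\<zero>\<^bsub>V\<^esub>, w)], []) \<in> tensor_rel K V W"
| add_left: "\<lbrakk>v \<in> carrier V; v' \<in> carrier V; w \<in> carrier W\<rbrakk> \<Longrightarrow>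
    ([(v \<oplus>\<^bsub>V\<^esub> v', w)], [(v, w), (v', w)]) \<in> tensor_rel K V W"
| add_right: "\<lbrakk>v \<in> carrier V; w \<in> carrier W; w' \<in> carrier W\<rbrakk> \<Longrightarrow>
    ([(v, w \<oplus>\<^bsub>W\<^esub> w')], [(v, w), (v, w')]) \<in> tensor_rel K V W"
| smult: "\<lbrakk>c \<in> carrier K; v \<in> carrier V; w \<in> carrier W\<rbrakk> \<Longrightarrow>
    ([(c \<odot>\<^bsub>V\<^esub> v, w)], [(v, c \<odot>\<^bsub>W\<^esub> w)]) \<in> tensor_rel K V W"

text \<open>
  The multiplication and unit are the factorwise ones; they are meaningful only when \<open>V\<close> and \<open>W\<close> are
  algebras.
\<close>

definition tensor :: "('k, 'z) ring_scheme \<Rightarrow> ('k, 'v) module \<Rightarrow> ('k, 'w) module \<Rightarrow>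
    ('k, ('v \<times> 'w) list set) module"
  where "tensor K V W = \<lparr>
    carrier = lists (carrier V \<times> carrier W) // tensor_rel K V W,
    monoid.mult = (\<lambda>s t. \<Union>l\<in>s. \<Union>m\<in>t.
      tensor_rel K V W `` {[(v \<otimes>\<^bsub>V\<^esub> v', w \<otimes>\<^bsub>W\<^esub> w'). (v, w) \<leftarrow> l, (v', w') \<leftarrow> m]}),
    one = tensor_rel K V W `` {[(\<one>\<^bsub>V\<^esub>, \<one>\<^bsub>W\<^esub>)]},
    zero = tensor_rel K V W `` {[]},
    add = (\<lambda>s t. \<Union>l\<in>s. \<Union>m\<in>t. tensor_rel K V W `` {l @ m}),
    smult = (\<lambda>c t. \<Union>l\<in>t. tensor_rel K V W `` {[(c \<odot>\<^bsub>V\<^esub> v, w). (v, w) \<leftarrow> l]})\<rparr>"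

text \<open>Iterated tensor products are nested to the right.\<close>

abbreviation tensor3 where
  "tensor3 K U V W \<equiv> tensor K U (tensor K V W)"

abbreviation tensor4 where
  "tensor4 K U V W X \<equiv> tensor K U (tensor3 K V W X)"

definition pure2 :: "('k, 'z) ring_scheme \<Rightarrow> ('k, 'v) module \<Rightarrow> ('k, 'w) module \<Rightarrow>
    'v \<Rightarrow> 'w \<Rightarrow> ('v \<times> 'w) list set"
  where "pure2 K V W v w = tensor_rel K V W `` {[(v, w)]}"

abbreviation pure3 where
  "pure3 K U V W u v w \<equiv> pure2 K U (tensor K V W) u (pure2 K V W v w)"

abbreviation pure4 where
  "pure4 K U V W X u v w x \<equiv> pure2 K U (tensor3 K V W X) u (pure3 K V W X v w x)"

text \<open>
  Sweedler notation: for \<open>t = \<Sum> v\<^sub>i \<otimes> w\<^sub>i\<close> and a bilinear \<open>f\<close> with values in \<open>X\<close>,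
  \<open>lift2 X t f = \<Sum> f v\<^sub>i w\<^sub>i\<close> is the value at \<open>t\<close> of the linear map induced by \<open>f\<close>. It does not depend
  on the chosen representative of \<open>t\<close>; see \<open>lift2_class\<close>.
\<close>

definition formal_sum :: "('x, 'm) ring_scheme \<Rightarrow> ('v \<Rightarrow> 'w \<Rightarrow> 'x) \<Rightarrow> ('v \<times> 'w) list \<Rightarrow> 'x"
  where "formal_sum X f l = foldr (\<lambda>(v, w) s. f v w \<oplus>\<^bsub>X\<^esub> s) l \<zero>\<^bsub>X\<^esub>"

definition lift2 :: "('x, 'm) ring_scheme \<Rightarrow> ('v \<times> 'w) list set \<Rightarrow> ('v \<Rightarrow> 'w \<Rightarrow> 'x) \<Rightarrow> 'x"
  where "lift2 X t f = formal_sum X f (SOME l. l \<in> t)"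

definition lift3 :: "('x, 'm) ring_scheme \<Rightarrow> ('u \<times> ('v \<times> 'w) list set) list set \<Rightarrow>
    ('u \<Rightarrow> 'v \<Rightarrow> 'w \<Rightarrow> 'x) \<Rightarrow> 'x"
  where "lift3 X t f = lift2 X t (\<lambda>u s. lift2 X s (\<lambda>v w. f u v w))"

lemma tensor_rel_lists:
  assumes "module K V" "module K W" "(l, m) \<in> tensor_rel K V W"
  shows "l \<in> lists (carrier V \<times> carrier W) \<and> m \<in> lists (carrier V \<times> carrier W)"
proof -
  interpret V: module K V by fact
  interpret W: module K W by fact
  show ?thesis using assms(3) by induction auto
qed

lemma formal_sum_closed:
  assumes "module K X" "bilinear_map K V W X f" "l \<in> lists (carrier V \<times> carrier W)"
  shows "formal_sum X f l \<in> carrier X"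
proof -
  interpret X: module K X by fact
  show ?thesis using assms(2,3)
    by (induction l) (auto simp: formal_sum_def bilinear_map_def)
qed

lemma formal_sum_append:
  assumes "module K X" "bilinear_map K V W X f"
    "l \<in> lists (carrier V \<times> carrier W)" "m \<in> lists (carrier V \<times> carrier W)"
  shows "formal_sum X f (l @ m) = formal_sum X f l \<oplus>\<^bsub>X\<^esub> formal_sum X f m"
proof -
  interpret X: module K X by fact
  show ?thesis using assms(3)
  proof (induction l rule: list.induct)
    case Nil
    then show ?case using formal_sum_closed[OF assms(1,2,4)] by (simp add: formal_sum_def)
  next
    case (Cons p l)
    obtain v w where p: "p = (v, w)" "v \<in> carrier V" "w \<in> carrier W" using Cons.prems by (cases p) auto
    have f: "f v w \<in> carrier X" using assms(2) p by (auto simp: bilinear_map_def)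
    have l: "formal_sum X f l \<in> carrier X" using Cons.prems formal_sum_closed[OF assms(1,2)] by auto
    show ?case using Cons f l formal_sum_closed[OF assms(1,2,4)] p(1)
      by (simp add: formal_sum_def X.a_assoc)
  qed
qed

lemma formal_sum_respects:
  assumes "module K V" "module K W" "module K X" "bilinear_map K V W X f"
    "(l, m) \<in> tensor_rel K V W"
  shows "formal_sum X f l = formal_sum X f m"
proof -
  interpret V: module K V by fact
  interpret W: module K W by fact
  interpret X: module K X by fact
  note app = formal_sum_append[OF assms(3,4)] and cl = formal_sum_closed[OF assms(3,4)]
  have fc: "f v w \<in> carrier X" if "v \<in> carrier V" "w \<in> carrier W" for v w
    using assms(4) that by (auto simp: bilinear_map_def)
  show ?thesis using assms(5)
  proof induction
    case (append l m l' m')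
    then show ?case using tensor_rel_lists[OF assms(1,2)] by (metis app)
  next
    case (commute l m)
    then show ?case by (simp add: app cl X.a_comm)
  next
    case (zero w)
    have "f (\<zero>\<^bsub>K\<^esub> \<odot>\<^bsub>V\<^esub> \<zero>\<^bsub>V\<^esub>) w = \<zero>\<^bsub>K\<^esub> \<odot>\<^bsub>X\<^esub> f \<zero>\<^bsub>V\<^esub> w"
      using assms(4) zero unfolding bilinear_map_def by blast
    then show ?case using zero fc by (simp add: formal_sum_def)
  next
    case (add_left v v' w)
    then have "f (v \<oplus>\<^bsub>V\<^esub> v') w = f v w \<oplus>\<^bsub>X\<^esub> f v' w"
      using assms(4) unfolding bilinear_map_def by blast
    then show ?case using add_left fc by (simp add: formal_sum_def)
  next
    case (add_right v w w')
    then have "f v (w \<oplus>\<^bsub>W\<^esub> w') = f v w \<oplus>\<^bsub>X\<^esub> f v w'"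
      using assms(4) unfolding bilinear_map_def by blast
    then show ?case using add_right fc by (simp add: formal_sum_def)
  next
    case (smult c v w)
    then have "f (c \<odot>\<^bsub>V\<^esub> v) w = f v (c \<odot>\<^bsub>W\<^esub> w)"
      using assms(4) unfolding bilinear_map_def by metis
    then show ?case by (simp add: formal_sum_def)
  qed auto
qed

lemma lift2_class:
  assumes "module K V" "module K W" "module K X" "bilinear_map K V W X f"
    "l \<in> lists (carrier V \<times> carrier W)"
  shows "lift2 X (tensor_rel K V W `` {l}) f = formal_sum X f l"
proof -
  have "l \<in> tensor_rel K V W `` {l}" using assms(5) by (simp add: tensor_rel.refl)
  then have "(SOME m. m \<in> tensor_rel K V W `` {l}) \<in> tensor_rel K V W `` {l}" by (rule someI)
  then show ?thesis using formal_sum_respects[OF assms(1-4)] unfolding lift2_def by auto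
qed

text \<open>
  Applying \<open>f : _ \<rightarrow> P \<otimes> Q\<close> to the indicated factor of a two- or threefold tensor, e.g.
  \<open>split2_3 K U P Q W f\<close> is \<open>id \<otimes> f \<otimes> id\<close>. The space arguments are the factors of the target in
  their order; the canonical rebracketing to the right is included.
\<close>

definition split1_2 where
  "split1_2 K P Q V f t = lift2 (tensor3 K P Q V) t
    (\<lambda>u v. lift2 (tensor3 K P Q V) (f u) (\<lambda>p q. pure3 K P Q V p q v))"

definition split2_2 where
  "split2_2 K U P Q f t = lift2 (tensor3 K U P Q) t
    (\<lambda>u v. lift2 (tensor3 K U P Q) (f v) (\<lambda>p q. pure3 K U P Q u p q))"

definition split1_3 where
  "split1_3 K P Q V W f t = lift3 (tensor4 K P Q V W) t
    (\<lambda>u v w. lift2 (tensor4 K P Q V W) (f u) (\<lambda>p q. pure4 K P Q V W p q v w))"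

definition split2_3 where
  "split2_3 K U P Q W f t = lift3 (tensor4 K U P Q W) t
    (\<lambda>u v w. lift2 (tensor4 K U P Q W) (f v) (\<lambda>p q. pure4 K U P Q W u p q w))"

definition split3_3 where
  "split3_3 K U V P Q f t = lift3 (tensor4 K U V P Q) t
    (\<lambda>u v w. lift2 (tensor4 K U V P Q) (f w) (\<lambda>p q. pure4 K U V P Q u v p q))"

text \<open>\<open>t \<otimes> x\<close> for a threefold tensor \<open>t\<close>.\<close>

definition append_factor where
  "append_factor K U V W X t x = lift3 (tensor4 K U V W X) t (\<lambda>u v w. pure4 K U V W X u v w x)"

text \<open>
  Applying a linear form \<open>e\<close> to the indicated factor, with \<open>K \<otimes> V\<close> and \<open>V \<otimes> K\<close> identified with \<open>V\<close>.
  The space arguments are the remaining factors.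
\<close>

definition contract1_2 where
  "contract1_2 V e t = lift2 V t (\<lambda>u v. e u \<odot>\<^bsub>V\<^esub> v)"

definition contract2_2 where
  "contract2_2 U e t = lift2 U t (\<lambda>u v. e v \<odot>\<^bsub>U\<^esub> u)"

definition contract1_3 where
  "contract1_3 K V W e t = lift3 (tensor K V W) t (\<lambda>u v w. e u \<odot>\<^bsub>tensor K V W\<^esub> pure2 K V W v w)"

definition contract2_3 where
  "contract2_3 K U W e t = lift3 (tensor K U W) t (\<lambda>u v w. e v \<odot>\<^bsub>tensor K U W\<^esub> pure2 K U W u w)"

definition contract3_3 where
  "contract3_3 K U V e t = lift3 (tensor K U V) t (\<lambda>u v w. e w \<odot>\<^bsub>tensor K U V\<^esub> pure2 K U V u v)"


section \<open>Quasi-bialgebras, bimodule algebras and comodule algebras\<close>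

locale quasi_bialgebra = H: k_algebra K H
  for K :: "'k ring" and H :: "('k, 'h) module" +
  fixes \<Delta> :: "'h \<Rightarrow> ('h \<times> 'h) list set" and \<epsilon> :: "'h \<Rightarrow> 'k"
    and \<Phi> :: "('h \<times> ('h \<times> 'h) list set) list set"
  assumes comult_map: "\<Delta> \<in> algebra_map K H (tensor K H H)"
    and counit_hom: "\<epsilon> \<in> ring_hom H K"
    and counit_smult: "\<lbrakk>c \<in> carrier K; h \<in> carrier H\<rbrakk> \<Longrightarrow> \<epsilon> (c \<odot>\<^bsub>H\<^esub> h) = c \<otimes>\<^bsub>K\<^esub> \<epsilon> h"
    and reassoc_invertible: "\<Phi> \<in> Units (tensor3 K H H H)"
    and quasi_coassoc: "h \<in> carrier H \<Longrightarrow>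
      split2_2 K H H H \<Delta> (\<Delta> h) =
      \<Phi> \<otimes>\<^bsub>tensor3 K H H H\<^esub> split1_2 K H H H \<Delta> (\<Delta> h)
        \<otimes>\<^bsub>tensor3 K H H H\<^esub> inv\<^bsub>tensor3 K H H H\<^esub> \<Phi>"
    and counit_right: "h \<in> carrier H \<Longrightarrow> contract2_2 H \<epsilon> (\<Delta> h) = h"
    and counit_left: "h \<in> carrier H \<Longrightarrow> contract1_2 H \<epsilon> (\<Delta> h) = h"
    and pentagon:
      "pure2 K H (tensor3 K H H H) \<one>\<^bsub>H\<^esub> \<Phi>
        \<otimes>\<^bsub>tensor4 K H H H H\<^esub> split2_3 K H H H H \<Delta> \<Phi>
        \<otimes>\<^bsub>tensor4 K H H H H\<^esub> append_factor K H H H H \<Phi> \<one>\<^bsub>H\<^esub> =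
       split3_3 K H H H H \<Delta> \<Phi> \<otimes>\<^bsub>tensor4 K H H H H\<^esub> split1_3 K H H H H \<Delta> \<Phi>"
    and reassoc_counit: "contract2_3 K H H \<epsilon> \<Phi> = \<one>\<^bsub>tensor K H H\<^esub>"

text \<open>
  \<open>M\<close> carries the vector space together with the (non-associative) multiplication and the unit;
  \<open>la h x\<close> is \<open>h \<cdot> x\<close> and \<open>ra x h\<close> is \<open>x \<cdot> h\<close>.
\<close>

locale bimodule_algebra = quasi_bialgebra K H \<Delta> \<epsilon> \<Phi> + M: module K M
  for K :: "'k ring" and H :: "('k, 'h) module"
    and \<Delta> :: "'h \<Rightarrow> ('h \<times> 'h) list set" and \<epsilon> :: "'h \<Rightarrow> 'k"
    and \<Phi> :: "('h \<times> ('h \<times> 'h) list set) list set"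
    and M :: "('k, 'm) module" +
  fixes la :: "'h \<Rightarrow> 'm \<Rightarrow> 'm" and ra :: "'m \<Rightarrow> 'h \<Rightarrow> 'm"
  assumes la_bilinear: "bilinear_map K H M M la"
    and ra_bilinear: "bilinear_map K M H M ra"
    and la_one: "x \<in> carrier M \<Longrightarrow> la \<one>\<^bsub>H\<^esub> x = x"
    and ra_one: "x \<in> carrier M \<Longrightarrow> ra x \<one>\<^bsub>H\<^esub> = x"
    and la_mult: "\<lbrakk>h \<in> carrier H; h' \<in> carrier H; x \<in> carrier M\<rbrakk> \<Longrightarrow>
      la (h \<otimes>\<^bsub>H\<^esub> h') x = la h (la h' x)"
    and ra_mult: "\<lbrakk>h \<in> carrier H; h' \<in> carrier H; x \<in> carrier M\<rbrakk> \<Longrightarrow>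
      ra x (h \<otimes>\<^bsub>H\<^esub> h') = ra (ra x h) h'"
    and la_ra: "\<lbrakk>h \<in> carrier H; h' \<in> carrier H; x \<in> carrier M\<rbrakk> \<Longrightarrow>
      ra (la h x) h' = la h (ra x h')"
    and M_mult_bilinear: "bilinear_map K M M M (\<otimes>\<^bsub>M\<^esub>)"
    and M_one_closed: "\<one>\<^bsub>M\<^esub> \<in> carrier M"
    and M_one_left: "x \<in> carrier M \<Longrightarrow> \<one>\<^bsub>M\<^esub> \<otimes>\<^bsub>M\<^esub> x = x"
    and M_one_right: "x \<in> carrier M \<Longrightarrow> x \<otimes>\<^bsub>M\<^esub> \<one>\<^bsub>M\<^esub> = x"
    and M_quasi_assoc: "\<lbrakk>x \<in> carrier M; y \<in> carrier M; z \<in> carrier M\<rbrakk> \<Longrightarrow>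
      (x \<otimes>\<^bsub>M\<^esub> y) \<otimes>\<^bsub>M\<^esub> z =
      lift3 M \<Phi> (\<lambda>X1 X2 X3. lift3 M (inv\<^bsub>tensor3 K H H H\<^esub> \<Phi>) (\<lambda>x1 x2 x3.
        ra (la X1 x) x1 \<otimes>\<^bsub>M\<^esub> (ra (la X2 y) x2 \<otimes>\<^bsub>M\<^esub> ra (la X3 z) x3)))"
    and la_M_mult: "\<lbrakk>h \<in> carrier H; x \<in> carrier M; y \<in> carrier M\<rbrakk> \<Longrightarrow>
      la h (x \<otimes>\<^bsub>M\<^esub> y) = lift2 M (\<Delta> h) (\<lambda>h1 h2. la h1 x \<otimes>\<^bsub>M\<^esub> la h2 y)"
    and ra_M_mult: "\<lbrakk>h \<in> carrier H; x \<in> carrier M; y \<in> carrier M\<rbrakk> \<Longrightarrow>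
      ra (x \<otimes>\<^bsub>M\<^esub> y) h = lift2 M (\<Delta> h) (\<lambda>h1 h2. ra x h1 \<otimes>\<^bsub>M\<^esub> ra y h2)"
    and la_M_one: "h \<in> carrier H \<Longrightarrow> la h \<one>\<^bsub>M\<^esub> = \<epsilon> h \<odot>\<^bsub>M\<^esub> \<one>\<^bsub>M\<^esub>"
    and ra_M_one: "h \<in> carrier H \<Longrightarrow> ra \<one>\<^bsub>M\<^esub> h = \<epsilon> h \<odot>\<^bsub>M\<^esub> \<one>\<^bsub>M\<^esub>"

locale right_comodule_algebra = quasi_bialgebra K H \<Delta> \<epsilon> \<Phi> + A: k_algebra K A
  for K :: "'k ring" and H :: "('k, 'h) module"
    and \<Delta> :: "'h \<Rightarrow> ('h \<times> 'h) list set" and \<epsilon> :: "'h \<Rightarrow> 'k"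
    and \<Phi> :: "('h \<times> ('h \<times> 'h) list set) list set"
    and A :: "('k, 'a) module" +
  fixes rho :: "'a \<Rightarrow> ('a \<times> 'h) list set" and \<Phi>r :: "('a \<times> ('h \<times> 'h) list set) list set"
  assumes coaction_map: "rho \<in> algebra_map K A (tensor K A H)"
    and coaction_reassoc_invertible: "\<Phi>r \<in> Units (tensor3 K A H H)"
    and coaction_quasi_coassoc: "a \<in> carrier A \<Longrightarrow>
      \<Phi>r \<otimes>\<^bsub>tensor3 K A H H\<^esub> split1_2 K A H H rho (rho a) =
      split2_2 K A H H \<Delta> (rho a) \<otimes>\<^bsub>tensor3 K A H H\<^esub> \<Phi>r"
    and coaction_pentagon:
      "pure2 K A (tensor3 K H H H) \<one>\<^bsub>A\<^esub> \<Phi>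
        \<otimes>\<^bsub>tensor4 K A H H H\<^esub> split2_3 K A H H H \<Delta> \<Phi>r
        \<otimes>\<^bsub>tensor4 K A H H H\<^esub> append_factor K A H H H \<Phi>r \<one>\<^bsub>H\<^esub> =
       split3_3 K A H H H \<Delta> \<Phi>r \<otimes>\<^bsub>tensor4 K A H H H\<^esub> split1_3 K A H H H rho \<Phi>r"
    and coaction_counit: "a \<in> carrier A \<Longrightarrow> contract2_2 A \<epsilon> (rho a) = a"
    and coaction_reassoc_counit_middle: "contract2_3 K A H \<epsilon> \<Phi>r = \<one>\<^bsub>tensor K A H\<^esub>"
    and coaction_reassoc_counit_outer: "contract3_3 K A H \<epsilon> \<Phi>r = \<one>\<^bsub>tensor K A H\<^esub>"

locale left_comodule_algebra = quasi_bialgebra K H \<Delta> \<epsilon> \<Phi> + B: k_algebra K B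
  for K :: "'k ring" and H :: "('k, 'h) module"
    and \<Delta> :: "'h \<Rightarrow> ('h \<times> 'h) list set" and \<epsilon> :: "'h \<Rightarrow> 'k"
    and \<Phi> :: "('h \<times> ('h \<times> 'h) list set) list set"
    and B :: "('k, 'b) module" +
  fixes lam :: "'b \<Rightarrow> ('h \<times> 'b) list set" and \<Phi>l :: "('h \<times> ('h \<times> 'b) list set) list set"
  assumes coaction_map: "lam \<in> algebra_map K B (tensor K H B)"
    and coaction_reassoc_invertible: "\<Phi>l \<in> Units (tensor3 K H H B)"
    and coaction_quasi_coassoc: "b \<in> carrier B \<Longrightarrow>
      split2_2 K H H B lam (lam b) \<otimes>\<^bsub>tensor3 K H H B\<^esub> \<Phi>l =
      \<Phi>l \<otimes>\<^bsub>tensor3 K H H B\<^esub> split1_2 K H H B \<Delta> (lam b)"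
    and coaction_pentagon:
      "pure2 K H (tensor3 K H H B) \<one>\<^bsub>H\<^esub> \<Phi>l
        \<otimes>\<^bsub>tensor4 K H H H B\<^esub> split2_3 K H H H B \<Delta> \<Phi>l
        \<otimes>\<^bsub>tensor4 K H H H B\<^esub> append_factor K H H H B \<Phi> \<one>\<^bsub>B\<^esub> =
       split3_3 K H H H B lam \<Phi>l \<otimes>\<^bsub>tensor4 K H H H B\<^esub> split1_3 K H H H B \<Delta> \<Phi>l"
    and coaction_counit: "b \<in> carrier B \<Longrightarrow> contract1_2 B \<epsilon> (lam b) = b"
    and coaction_reassoc_counit_middle: "contract2_3 K H B \<epsilon> \<Phi>l = \<one>\<^bsub>tensor K H B\<^esub>"
    and coaction_reassoc_counit_outer: "contract1_3 K H B \<epsilon> \<Phi>l = \<one>\<^bsub>tensor K H B\<^esub>"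

locale bicomodule_algebra =
  left: left_comodule_algebra K H \<Delta> \<epsilon> \<Phi> B lam \<Phi>l +
  right: right_comodule_algebra K H \<Delta> \<epsilon> \<Phi> B rho \<Phi>r
  for K :: "'k ring" and H :: "('k, 'h) module"
    and \<Delta> :: "'h \<Rightarrow> ('h \<times> 'h) list set" and \<epsilon> :: "'h \<Rightarrow> 'k"
    and \<Phi> :: "('h \<times> ('h \<times> 'h) list set) list set"
    and B :: "('k, 'b) module"
    and lam :: "'b \<Rightarrow> ('h \<times> 'b) list set" and rho :: "'b \<Rightarrow> ('b \<times> 'h) list set"
    and \<Phi>l :: "('h \<times> ('h \<times> 'b) list set) list set"
    and \<Phi>r :: "('b \<times> ('h \<times> 'h) list set) list set" +
  fixes \<Phi>lr :: "('h \<times> ('b \<times> 'h) list set) list set"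
  assumes bi_reassoc_invertible: "\<Phi>lr \<in> Units (tensor3 K H B H)"
    and bi_quasi_coassoc: "u \<in> carrier B \<Longrightarrow>
      \<Phi>lr \<otimes>\<^bsub>tensor3 K H B H\<^esub> split1_2 K H B H lam (rho u) =
      split2_2 K H B H rho (lam u) \<otimes>\<^bsub>tensor3 K H B H\<^esub> \<Phi>lr"
    and bi_pentagon_left:
      "pure2 K H (tensor3 K H B H) \<one>\<^bsub>H\<^esub> \<Phi>lr
        \<otimes>\<^bsub>tensor4 K H H B H\<^esub> split2_3 K H H B H lam \<Phi>lr
        \<otimes>\<^bsub>tensor4 K H H B H\<^esub> append_factor K H H B H \<Phi>l \<one>\<^bsub>H\<^esub> =
       split3_3 K H H B H rho \<Phi>l \<otimes>\<^bsub>tensor4 K H H B H\<^esub> split1_3 K H H B H \<Delta> \<Phi>lr"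
    and bi_pentagon_right:
      "pure2 K H (tensor3 K B H H) \<one>\<^bsub>H\<^esub> \<Phi>r
        \<otimes>\<^bsub>tensor4 K H B H H\<^esub> split2_3 K H B H H rho \<Phi>lr
        \<otimes>\<^bsub>tensor4 K H B H H\<^esub> append_factor K H B H H \<Phi>lr \<one>\<^bsub>H\<^esub> =
       split3_3 K H B H H \<Delta> \<Phi>lr \<otimes>\<^bsub>tensor4 K H B H H\<^esub> split1_3 K H B H H lam \<Phi>r"


section \<open>Generalized two-sided crossed products\<close>

text \<open>
  Only the multiplication and the unit differ from those of the tensor product; the vector space
  structure is that of \<open>A \<otimes> M \<otimes> B\<close>.
\<close>

definition crossed_product :: "'k ring \<Rightarrow> ('k, 'h) module \<Rightarrow>
    ('k, 'a) module \<Rightarrow> ('a \<Rightarrow> ('a \<times> 'h) list set) \<Rightarrow> ('a \<times> ('h \<times> 'h) list set) list set \<Rightarrow>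
    ('k, 'm) module \<Rightarrow> ('h \<Rightarrow> 'm \<Rightarrow> 'm) \<Rightarrow> ('m \<Rightarrow> 'h \<Rightarrow> 'm) \<Rightarrow>
    ('k, 'b) module \<Rightarrow> ('b \<Rightarrow> ('h \<times> 'b) list set) \<Rightarrow> ('h \<times> ('h \<times> 'b) list set) list set \<Rightarrow>
    ('k, ('a \<times> ('m \<times> 'b) list set) list set) module"
  where "crossed_product K H A rho \<Phi>r M la ra B lam \<Phi>l =
    (let T = tensor3 K A M B in
     T\<lparr>monoid.mult := (\<lambda>s t.
          lift3 T s (\<lambda>a x b. lift3 T t (\<lambda>a' x' b'.
          lift2 T (rho a') (\<lambda>a'0 a'1. lift2 T (lam b) (\<lambda>b_1 b0.
          lift3 T (inv\<^bsub>tensor3 K A H H\<^esub> \<Phi>r) (\<lambda>r1 r2 r3.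
          lift3 T (inv\<^bsub>tensor3 K H H B\<^esub> \<Phi>l) (\<lambda>l1 l2 l3.
            pure3 K A M B
              (a \<otimes>\<^bsub>A\<^esub> a'0 \<otimes>\<^bsub>A\<^esub> r1)
              (ra (la l1 x) (a'1 \<otimes>\<^bsub>H\<^esub> r2) \<otimes>\<^bsub>M\<^esub> ra (la (l2 \<otimes>\<^bsub>H\<^esub> b_1) x') r3)
              (l3 \<otimes>\<^bsub>B\<^esub> b0 \<otimes>\<^bsub>B\<^esub> b')))))))),
       one := pure3 K A M B \<one>\<^bsub>A\<^esub> \<one>\<^bsub>M\<^esub> \<one>\<^bsub>B\<^esub>\<rparr>)"

text \<open>
  The comodule algebra structures on crossed products with a bicomodule algebra \<open>B\<close>. The argument \<open>P\<close>
  is the crossed product on \<open>A \<otimes> M \<otimes> B\<close>, respectively on \<open>B \<otimes> M \<otimes> C\<close>.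
\<close>

definition crossed_coaction_right where
  "crossed_coaction_right K H P A M la B rho \<Phi>lr t =
    (let Y = tensor K P H in
     lift3 Y t (\<lambda>a x b.
     lift3 Y (inv\<^bsub>tensor3 K H B H\<^esub> \<Phi>lr) (\<lambda>\<theta>1 \<theta>2 \<theta>3.
     lift2 Y (rho b) (\<lambda>b0 b1.
       pure2 K P H (pure3 K A M B a (la \<theta>1 x) (\<theta>2 \<otimes>\<^bsub>B\<^esub> b0)) (\<theta>3 \<otimes>\<^bsub>H\<^esub> b1)))))"

definition crossed_reassoc_right where
  "crossed_reassoc_right K H P A M B \<Phi>r = lift3 (tensor3 K P H H) \<Phi>r
    (\<lambda>X1 X2 X3. pure3 K P H H (pure3 K A M B \<one>\<^bsub>A\<^esub> \<one>\<^bsub>M\<^esub> X1) X2 X3)"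

definition crossed_coaction_left where
  "crossed_coaction_left K H P B lam \<Phi>lr M ra C t =
    (let Y = tensor K H P in
     lift3 Y t (\<lambda>b x c.
     lift3 Y (inv\<^bsub>tensor3 K H B H\<^esub> \<Phi>lr) (\<lambda>\<theta>1 \<theta>2 \<theta>3.
     lift2 Y (lam b) (\<lambda>b_1 b0.
       pure2 K H P (b_1 \<otimes>\<^bsub>H\<^esub> \<theta>1) (pure3 K B M C (b0 \<otimes>\<^bsub>B\<^esub> \<theta>2) (ra x \<theta>3) c)))))"

definition crossed_reassoc_left where
  "crossed_reassoc_left K H P B M C \<Phi>l = lift3 (tensor3 K H H P) \<Phi>l
    (\<lambda>X1 X2 X3. pure3 K H H P X1 X2 (pure3 K B M C X3 \<one>\<^bsub>M\<^esub> \<one>\<^bsub>C\<^esub>))"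

text \<open>
  The trivial identification \<open>(A \<otimes> M \<otimes> B) \<otimes> M \<otimes> C \<rightarrow> A \<otimes> M \<otimes> (B \<otimes> M \<otimes> C)\<close>; \<open>P\<close> is the crossed
  product on \<open>B \<otimes> M \<otimes> C\<close>.
\<close>

definition trivial_identification where
  "trivial_identification K A M B C P s =
    lift3 (tensor3 K A M P) s (\<lambda>t y c. lift3 (tensor3 K A M P) t (\<lambda>a x b.
      pure3 K A M P a x (pure3 K B M C b y c)))"

end

theory Submission
  imports Defs
begin

text \<open>Every identity is linear in the elements of the iterated tensor products involved, hence needs to be
  checked on pure tensors only. The product of two pure elements of a crossed product has the form
  \<open>G x x' R L\<close>: it is obtained from \<open>x\<close>, \<open>x'\<close> by letting a tensor \<open>R\<close>, built from the right coaction and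
  \<open>\<Phi>\<^sub>\<rho>\<close>, act from the right and a tensor \<open>L\<close>, built from the left coaction and \<open>\<Phi>\<^sub>\<lambda>\<close>, act from the left.
  So associativity and the comodule algebra axioms become identities in the tensor product algebras, where they
  follow from the quasi-coassociativity and pentagon axioms, mostly in the form satisfied by the
  inverse reassociators. The reassociator of a crossed product is the image of the one of \<open>B\<close>
  under the algebra map \<open>b \<mapsto> 1 \<otimes> 1 \<otimes> b\<close>, so its pentagon is transported from \<open>B\<close>. That
  \<open>\<Phi>\<^bsub>\<lambda>,\<rho>\<^esub>\<close> becomes trivial when the counit is applied to an outer factor is not an axiom; it
  results from applying the counit in the mixed pentagons and cancelling. Finally, the products in the
  two iterated crossed products are expanded, on pure elements, into the same expression.\<close>

text \<open>Sweedler expressions are values of \<open>lift2\<close>, which evaluates one chosen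
  representative; they can be transformed only where the integrand is known to be bilinear. Hence a
  calculus of linear maps, whose rules discharge these conditions. Values such as
  \<open>rho a\<close> are not pure, so identities about them are proved with an arbitrary tensor in
  that place and then specialised. The multiplication of \<open>M\<close> is not associative,
  whereas \<open>R\<close> and \<open>L\<close> lie in associative algebras. Once everything is
  moved into \<open>R\<close> and \<open>L\<close>, a single rebracketing in \<open>M\<close>
  remains, where \<Phi> acts from the left and its inverse from the right. This asymmetry decides
  how the pentagons of the two coactions are rearranged for associativity: on the side of the right
  coaction all reassociators are inverted, on the side of the left one \<Phi> itself stays. The
  comparison of the two iterated products needs no further pentagon: after the reassociators of the
  inner products are traced back to \<open>B\<close>, both sides have the same legs up to
  associativity in \<open>H\<close> and \<open>B\<close>.\<close>

definition lin :: "'k ring \<Rightarrow> ('k, 'v) module \<Rightarrow> ('k, 'w) module \<Rightarrow> ('v \<Rightarrow> 'w) \<Rightarrow> bool"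
  where "lin K V X f \<longleftrightarrow> module K V \<and> module K X \<and> (\<forall>x\<in>carrier V. f x \<in> carrier X) \<and>
    (\<forall>x\<in>carrier V. \<forall>y\<in>carrier V. f (x \<oplus>\<^bsub>V\<^esub> y) = f x \<oplus>\<^bsub>X\<^esub> f y) \<and>
    (\<forall>c\<in>carrier K. \<forall>x\<in>carrier V. f (c \<odot>\<^bsub>V\<^esub> x) = c \<odot>\<^bsub>X\<^esub> f x)"

lemma linI:
  assumes "module K V" "module K X" "\<And>x. x \<in> carrier V \<Longrightarrow> f x \<in> carrier X"
    "\<And>x y. x \<in> carrier V \<Longrightarrow> y \<in> carrier V \<Longrightarrow> f (x \<oplus>\<^bsub>V\<^esub> y) = f x \<oplus>\<^bsub>X\<^esub> f y"
    "\<And>c x. c \<in> carrier K \<Longrightarrow> x \<in> carrier V \<Longrightarrow> f (c \<odot>\<^bsub>V\<^esub> x) = c \<odot>\<^bsub>X\<^esub> f x"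
  shows "lin K V X f"
  using assms unfolding lin_def by blast

lemma lin_module: assumes "lin K V X f" shows "module K V" "module K X"
  using assms unfolding lin_def by auto

lemma lin_closed: "lin K V X f \<Longrightarrow> x \<in> carrier V \<Longrightarrow> f x \<in> carrier X"
  unfolding lin_def by auto

lemma lin_add: "lin K V X f \<Longrightarrow> x \<in> carrier V \<Longrightarrow> y \<in> carrier V \<Longrightarrow> f (x \<oplus>\<^bsub>V\<^esub> y) = f x \<oplus>\<^bsub>X\<^esub> f y"
  unfolding lin_def by auto

lemma lin_smult: "lin K V X f \<Longrightarrow> c \<in> carrier K \<Longrightarrow> x \<in> carrier V \<Longrightarrow> f (c \<odot>\<^bsub>V\<^esub> x) = c \<odot>\<^bsub>X\<^esub> f x"
  unfolding lin_def by auto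

lemma lin_zero:
  assumes "lin K V X f"
  shows "f \<zero>\<^bsub>V\<^esub> = \<zero>\<^bsub>X\<^esub>"
proof -
  interpret V: module K V using assms by (rule lin_module)
  interpret X: module K X using assms by (rule lin_module)
  have "f (\<zero>\<^bsub>K\<^esub> \<odot>\<^bsub>V\<^esub> \<zero>\<^bsub>V\<^esub>) = \<zero>\<^bsub>K\<^esub> \<odot>\<^bsub>X\<^esub> f \<zero>\<^bsub>V\<^esub>"
    by (rule lin_smult[OF assms]) auto
  then show ?thesis using lin_closed[OF assms, of "\<zero>\<^bsub>V\<^esub>"] by simp
qed

lemma lin_comp:
  assumes "lin K V X g" "lin K U V f"
  shows "lin K U X (\<lambda>u. g (f u))"
  using assms unfolding lin_def by auto

lemma lin_id: "module K V \<Longrightarrow> lin K V V (\<lambda>x. x)"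
  unfolding lin_def by auto

lemma lin_plus:
  assumes "lin K V X f" "lin K V X g"
  shows "lin K V X (\<lambda>x. f x \<oplus>\<^bsub>X\<^esub> g x)"
proof -
  interpret V: module K V using assms(1) by (rule lin_module)
  interpret X: module K X using assms(1) by (rule lin_module)
  show ?thesis
    by (rule linI)
      (use assms in \<open>auto simp: lin_add[OF assms(1)] lin_add[OF assms(2)] lin_closed[OF assms(1)]
          lin_closed[OF assms(2)] lin_smult[OF assms(1)] lin_smult[OF assms(2)] X.a_ac
          X.smult_r_distr V.module_axioms X.module_axioms\<close>)
qed

lemma lin_const_zero: "module K V \<Longrightarrow> module K X \<Longrightarrow> lin K V X (\<lambda>x. \<zero>\<^bsub>X\<^esub>)"
proof -
  assume V: "module K V" and X: "module K X"
  interpret X: module K X by fact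
  show ?thesis by (rule linI) (use V X in auto)
qed

lemma lin_smult_const:
  assumes "lin K V X f" "c \<in> carrier K"
  shows "lin K V X (\<lambda>x. c \<odot>\<^bsub>X\<^esub> f x)"
proof -
  interpret V: module K V using assms(1) by (rule lin_module)
  interpret X: module K X using assms(1) by (rule lin_module)
  show ?thesis
  proof (rule linI)
    fix d x assume "d \<in> carrier K" "x \<in> carrier V"
    then show "c \<odot>\<^bsub>X\<^esub> f (d \<odot>\<^bsub>V\<^esub> x) = d \<odot>\<^bsub>X\<^esub> (c \<odot>\<^bsub>X\<^esub> f x)"
      using assms(2) by (simp add: lin_smult[OF assms(1)] lin_closed[OF assms(1)]
          X.smult_assoc1[symmetric] V.R.m_comm)
  qed (use assms in \<open>auto simp: lin_add[OF assms(1)] lin_closed[OF assms(1)]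
          X.smult_r_distr V.module_axioms X.module_axioms\<close>)
qed

lemma bilinear_mapI:
  assumes "\<And>w. w \<in> carrier W \<Longrightarrow> lin K V X (\<lambda>v. f v w)" "\<And>v. v \<in> carrier V \<Longrightarrow> lin K W X (f v)"
  shows "bilinear_map K V W X f"
  unfolding bilinear_map_def
proof (intro conjI ballI)
  fix x y assume "x \<in> carrier V" "y \<in> carrier W"
  then show "f x y \<in> carrier X" using lin_closed[OF assms(2)] by blast
next
  fix x x' y assume "x \<in> carrier V" "x' \<in> carrier V" "y \<in> carrier W"
  then show "f (x \<oplus>\<^bsub>V\<^esub> x') y = f x y \<oplus>\<^bsub>X\<^esub> f x' y" using lin_add[OF assms(1)] by blast
next
  fix x y y' assume "x \<in> carrier V" "y \<in> carrier W" "y' \<in> carrier W"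
  then show "f x (y \<oplus>\<^bsub>W\<^esub> y') = f x y \<oplus>\<^bsub>X\<^esub> f x y'" using lin_add[OF assms(2)] by blast
next
  fix c x y assume "c \<in> carrier K" "x \<in> carrier V" "y \<in> carrier W"
  then show "f (c \<odot>\<^bsub>V\<^esub> x) y = c \<odot>\<^bsub>X\<^esub> f x y" "f x (c \<odot>\<^bsub>W\<^esub> y) = c \<odot>\<^bsub>X\<^esub> f x y"
    using lin_smult[OF assms(1)] lin_smult[OF assms(2)] by blast+
qed

lemma bilinear_lin:
  assumes "bilinear_map K V W X b" "module K V" "module K W" "module K X"
  shows "w \<in> carrier W \<Longrightarrow> lin K V X (\<lambda>v. b v w)" "v \<in> carrier V \<Longrightarrow> lin K W X (b v)"
  by (intro linI; use assms in \<open>auto simp: bilinear_map_def\<close>)+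

section \<open>Tensor products\<close>

locale two_modules = V: module K V + W: module K W
  for K :: "'k ring" and V :: "('k, 'v) module" and W :: "('k, 'w) module"
begin

abbreviation "L \<equiv> lists (carrier V \<times> carrier W)"
abbreviation "R \<equiv> tensor_rel K V W"
abbreviation "T \<equiv> tensor K V W"
abbreviation "cls l \<equiv> R `` {l}"
abbreviation "negl l \<equiv> map (\<lambda>(v, w). (\<ominus>\<^bsub>V\<^esub> v, w)) l"
abbreviation "scal c l \<equiv> map (\<lambda>(v, w). (c \<odot>\<^bsub>V\<^esub> v, w)) l"

lemma rel_lists: "(l, m) \<in> R \<Longrightarrow> l \<in> L \<and> m \<in> L"
  by (rule tensor_rel_lists[OF V.module_axioms W.module_axioms])

lemma rel_equiv: "equiv L R"
proof (rule equivI)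
  show "refl_on L R" using tensor_rel.refl by (auto simp: refl_on_def)
  show "sym R" by (auto intro: symI tensor_rel.sym)
  show "trans R" by (auto intro: transI tensor_rel.trans)
  show "R \<subseteq> L \<times> L" using rel_lists by (metis SigmaI subrelI)
qed

lemma cls_eq: "(l, m) \<in> R \<Longrightarrow> cls l = cls m"
  using equiv_class_eq[OF rel_equiv] by blast

lemma cls_closed: "l \<in> L \<Longrightarrow> cls l \<in> carrier T"
  by (simp add: tensor_def quotientI)

lemma cls_cases:
  assumes "t \<in> carrier T"
  obtains l where "l \<in> L" "t = cls l"
proof -
  have "t \<in> L // R" using assms by (simp add: tensor_def)
  then show thesis by (rule quotientE) (rule that)
qed

text \<open>The operations of \<open>tensor\<close> are unions over all representatives. When the
  summand depends only on the class, all members of the union coincide and it collapses to any one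
  of them.\<close>

lemma UN_cls:
  assumes "l \<in> L" "\<And>m. (l, m) \<in> R \<Longrightarrow> f m = f l"
  shows "(\<Union>m\<in>cls l. f m) = f l"
  using assms tensor_rel.refl[of l] by fastforce

lemma cls_append_cong: "(l, l') \<in> R \<Longrightarrow> (m, m') \<in> R \<Longrightarrow> cls (l' @ m') = cls (l @ m)"
  by (rule cls_eq[symmetric]) (rule tensor_rel.append)

lemma add_cls:
  assumes "l \<in> L" "m \<in> L"
  shows "cls l \<oplus>\<^bsub>T\<^esub> cls m = cls (l @ m)"
proof -
  have "(\<Union>m'\<in>cls m. cls (l' @ m')) = cls (l' @ m)" if "(l, l') \<in> R" for l'
  proof (rule UN_cls[OF assms(2)])
    fix m' assume "(m, m') \<in> R"
    moreover have "(l', l') \<in> R" using rel_lists[OF that] by (intro tensor_rel.refl) simp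
    ultimately show "cls (l' @ m') = cls (l' @ m)" by (rule cls_append_cong[rotated])
  qed
  then have "(\<Union>l'\<in>cls l. \<Union>m'\<in>cls m. cls (l' @ m')) = (\<Union>l'\<in>cls l. cls (l' @ m))"
    by simp
  also have "\<dots> = cls (l @ m)"
  proof (rule UN_cls[OF assms(1)])
    fix l' assume "(l, l') \<in> R"
    then show "cls (l' @ m) = cls (l @ m)" using tensor_rel.refl[OF assms(2)] by (rule cls_append_cong)
  qed
  finally show ?thesis by (simp add: tensor_def)
qed

lemma scal_lists: "c \<in> carrier K \<Longrightarrow> l \<in> L \<Longrightarrow> scal c l \<in> L"
  by (auto simp: lists_eq_set)

text \<open>Well-definedness of the scalar action, by induction on the derivation of an equivalence.
  The case \<open>smult\<close> uses commutativity of \<open>K\<close> to exchange two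
  scalars.\<close>

lemma scal_respects:
  assumes "c \<in> carrier K" "(l, m) \<in> R"
  shows "(scal c l, scal c m) \<in> R"
  using assms(2)
proof induction
  case (refl l) then show ?case using scal_lists assms(1) by (auto intro!: tensor_rel.refl)
next
  case (sym l m) show ?case by (rule tensor_rel.sym) fact
next
  case (trans l m n) show ?case by (rule tensor_rel.trans) fact+
next
  case (append l m l' m') then show ?case by (simp add: tensor_rel.append)
next
  case (commute l m) then show ?case
    using tensor_rel.commute[OF scal_lists[OF assms(1)] scal_lists[OF assms(1)]] by simp
next
  case (zero w) then show ?case using assms(1) by (simp add: tensor_rel.zero)
next
  case (add_left v v' w) then show ?case
    using assms(1) by (simp add: V.smult_r_distr tensor_rel.add_left)
next
  case (add_right v w w') then show ?case
    using assms(1) by (simp add: tensor_rel.add_right)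
next
  case (smult d v w)
  then have "c \<odot>\<^bsub>V\<^esub> (d \<odot>\<^bsub>V\<^esub> v) = d \<odot>\<^bsub>V\<^esub> (c \<odot>\<^bsub>V\<^esub> v)"
    using assms(1) by (simp add: V.smult_assoc1[symmetric] V.R.m_comm)
  then show ?case using smult assms(1) by (simp add: tensor_rel.smult)
qed

lemma smult_cls:
  assumes "c \<in> carrier K" "l \<in> L"
  shows "c \<odot>\<^bsub>T\<^esub> cls l = cls (scal c l)"
proof -
  have "(\<Union>m\<in>cls l. cls (scal c m)) = cls (scal c l)"
  proof (rule UN_cls[OF assms(2)])
    fix m assume "(l, m) \<in> R"
    then show "cls (scal c m) = cls (scal c l)" by (intro cls_eq[symmetric] scal_respects assms(1))
  qed
  then show ?thesis by (simp add: tensor_def)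
qed

lemma zero_cls: "\<zero>\<^bsub>T\<^esub> = cls []"
  by (simp add: tensor_def)

lemma rel_Cons: "(l, m) \<in> R \<Longrightarrow> v \<in> carrier V \<Longrightarrow> w \<in> carrier W \<Longrightarrow> ((v, w) # l, (v, w) # m) \<in> R"
  using tensor_rel.append[of "[(v, w)]" "[(v, w)]" K V W l m] tensor_rel.refl[of "[(v, w)]" V W K] by simp

text \<open>The inverse has to be constructed, since the generators of the relation contain no
  negation; negating all first components of a representative gives one.\<close>

lemma abelian_group_tensor: "abelian_group T"
proof (rule abelian_groupI)
  fix x y assume "x \<in> carrier T" "y \<in> carrier T"
  then show "x \<oplus>\<^bsub>T\<^esub> y \<in> carrier T"
    by (elim cls_cases) (auto simp: add_cls intro!: cls_closed)
next
  show "\<zero>\<^bsub>T\<^esub> \<in> carrier T" by (auto simp: zero_cls intro!: cls_closed)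
next
  fix x y z assume "x \<in> carrier T" "y \<in> carrier T" "z \<in> carrier T"
  then show "x \<oplus>\<^bsub>T\<^esub> y \<oplus>\<^bsub>T\<^esub> z = x \<oplus>\<^bsub>T\<^esub> (y \<oplus>\<^bsub>T\<^esub> z)"
    by (elim cls_cases) (simp add: add_cls)
next
  fix x y assume "x \<in> carrier T" "y \<in> carrier T"
  then show "x \<oplus>\<^bsub>T\<^esub> y = y \<oplus>\<^bsub>T\<^esub> x"
    by (elim cls_cases) (simp add: add_cls cls_eq tensor_rel.commute)
next
  fix x assume "x \<in> carrier T"
  then show "\<zero>\<^bsub>T\<^esub> \<oplus>\<^bsub>T\<^esub> x = x" by (elim cls_cases) (simp add: add_cls zero_cls)
next
  fix x assume "x \<in> carrier T"
  then obtain l where l: "l \<in> L" "x = cls l" by (rule cls_cases)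
  have nl: "negl m \<in> L" if "m \<in> L" for m using that by (auto simp: lists_eq_set)
  \<comment> \<open>The concatenation is shuffled by \<open>commute\<close> until
    \<open>(v, w)\<close> stands next to its negative; \<open>add_left\<close> merges the pair into
    an entry with first component zero, which \<open>zero\<close> removes.\<close>
  have "(negl m @ m, []) \<in> R" if "m \<in> L" for m using that
  proof (induction m)
    case Nil then show ?case by (simp add: tensor_rel.refl)
  next
    case (Cons p m)
    obtain v w where p: "p = (v, w)" "v \<in> carrier V" "w \<in> carrier W" using Cons.hyps(1) by auto
    have m: "negl m @ m \<in> L" "m \<in> L" "negl m \<in> L" using Cons.hyps(2) nl by auto
    have 1: "(((\<ominus>\<^bsub>V\<^esub> v, w) # negl m) @ ((v, w) # m), ((v, w) # m) @ ((\<ominus>\<^bsub>V\<^esub> v, w) # negl m)) \<in> R"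
      using p m by (intro tensor_rel.commute) auto
    have "(m @ ((\<ominus>\<^bsub>V\<^esub> v, w) # negl m), ((\<ominus>\<^bsub>V\<^esub> v, w) # negl m) @ m) \<in> R"
      using p m by (intro tensor_rel.commute) auto
    then have 2: "((v, w) # m @ ((\<ominus>\<^bsub>V\<^esub> v, w) # negl m), (v, w) # ((\<ominus>\<^bsub>V\<^esub> v, w) # negl m) @ m) \<in> R"
      using p by (intro rel_Cons) auto
    have 3: "([(v, w), (\<ominus>\<^bsub>V\<^esub> v, w)] @ (negl m @ m), [(v \<oplus>\<^bsub>V\<^esub> \<ominus>\<^bsub>V\<^esub> v, w)] @ []) \<in> R"
      using p Cons.IH by (intro tensor_rel.append tensor_rel.sym[OF tensor_rel.add_left]) auto
    have 4: "([(v \<oplus>\<^bsub>V\<^esub> \<ominus>\<^bsub>V\<^esub> v, w)], []) \<in> R"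
      using p by (simp add: V.M.r_neg tensor_rel.zero)
    show ?case using tensor_rel.trans[OF 1] tensor_rel.trans[OF 2] tensor_rel.trans[OF 3] 4 p(1) by simp
  qed
  then have "cls (negl l) \<oplus>\<^bsub>T\<^esub> x = \<zero>\<^bsub>T\<^esub>" using l nl by (simp add: add_cls zero_cls cls_eq)
  then show "\<exists>y\<in>carrier T. y \<oplus>\<^bsub>T\<^esub> x = \<zero>\<^bsub>T\<^esub>"
    by (rule bexI) (intro cls_closed nl l(1))
qed

text \<open>\<open>add_left\<close> splits the head into two entries standing next to each other;
  \<open>commute\<close> carries the second of them past \<open>scal c l\<close> to its own
  block.\<close>

lemma rel_smult_distr:
  assumes "c \<in> carrier K" "d \<in> carrier K" "l \<in> L"
  shows "(scal (c \<oplus>\<^bsub>K\<^esub> d) l, scal c l @ scal d l) \<in> R"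
  using assms(3)
proof (induction l)
  case Nil then show ?case by (simp add: tensor_rel.refl)
next
  case (Cons p l)
  obtain v w where p: "p = (v, w)" "v \<in> carrier V" "w \<in> carrier W" using Cons.hyps(1) by auto
  have l: "scal c l \<in> L" "scal d l \<in> L" using Cons.hyps(2) assms scal_lists by auto
  have 1: "([((c \<oplus>\<^bsub>K\<^esub> d) \<odot>\<^bsub>V\<^esub> v, w)] @ scal (c \<oplus>\<^bsub>K\<^esub> d) l,
      [(c \<odot>\<^bsub>V\<^esub> v, w), (d \<odot>\<^bsub>V\<^esub> v, w)] @ (scal c l @ scal d l)) \<in> R"
    using p Cons.IH assms by (intro tensor_rel.append) (auto simp: V.smult_l_distr intro!: tensor_rel.add_left)
  have "(((d \<odot>\<^bsub>V\<^esub> v, w) # scal c l) @ scal d l, (scal c l @ [(d \<odot>\<^bsub>V\<^esub> v, w)]) @ scal d l) \<in> R"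
    using p l assms tensor_rel.commute[of "[(d \<odot>\<^bsub>V\<^esub> v, w)]" V W "scal c l" K]
    by (intro tensor_rel.append tensor_rel.refl) auto
  then have 2: "((c \<odot>\<^bsub>V\<^esub> v, w) # ((d \<odot>\<^bsub>V\<^esub> v, w) # scal c l) @ scal d l,
      (c \<odot>\<^bsub>V\<^esub> v, w) # (scal c l @ [(d \<odot>\<^bsub>V\<^esub> v, w)]) @ scal d l) \<in> R"
    using p assms by (intro rel_Cons) auto
  show ?case using tensor_rel.trans[OF 1] 2 p(1) by simp
qed

lemma module_tensor: "module K T"
proof (rule moduleI)
  show "cring K" by (rule V.R.is_cring)
  show "abelian_group T" by (rule abelian_group_tensor)
next
  fix c x assume "c \<in> carrier K" "x \<in> carrier T"
  then show "c \<odot>\<^bsub>T\<^esub> x \<in> carrier T"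
    by (elim cls_cases) (simp add: smult_cls cls_closed scal_lists del: map_append)
next
  fix c d x assume "c \<in> carrier K" "d \<in> carrier K" "x \<in> carrier T"
  then show "(c \<oplus>\<^bsub>K\<^esub> d) \<odot>\<^bsub>T\<^esub> x = c \<odot>\<^bsub>T\<^esub> x \<oplus>\<^bsub>T\<^esub> d \<odot>\<^bsub>T\<^esub> x"
    by (elim cls_cases) (simp add: smult_cls scal_lists add_cls cls_eq rel_smult_distr)
next
  fix c x y assume "c \<in> carrier K" "x \<in> carrier T" "y \<in> carrier T"
  then show "c \<odot>\<^bsub>T\<^esub> (x \<oplus>\<^bsub>T\<^esub> y) = c \<odot>\<^bsub>T\<^esub> x \<oplus>\<^bsub>T\<^esub> c \<odot>\<^bsub>T\<^esub> y"
    by (elim cls_cases) (simp add: smult_cls scal_lists add_cls)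
next
  fix c d x assume cd: "c \<in> carrier K" "d \<in> carrier K" and "x \<in> carrier T"
  then obtain l where l: "l \<in> L" "x = cls l" by (auto elim: cls_cases)
  have "scal (c \<otimes>\<^bsub>K\<^esub> d) l = scal c (scal d l)"
    using l(1) cd by (auto simp: lists_eq_set V.smult_assoc1)
  then show "(c \<otimes>\<^bsub>K\<^esub> d) \<odot>\<^bsub>T\<^esub> x = c \<odot>\<^bsub>T\<^esub> (d \<odot>\<^bsub>T\<^esub> x)"
    using l cd by (simp add: smult_cls scal_lists del: map_map)
next
  fix x assume "x \<in> carrier T"
  then obtain l where l: "l \<in> L" "x = cls l" by (auto elim: cls_cases)
  have "scal \<one>\<^bsub>K\<^esub> l = l" using l(1) by (auto simp: lists_eq_set intro!: map_idI)
  then show "\<one>\<^bsub>K\<^esub> \<odot>\<^bsub>T\<^esub> x = x" using l by (simp add: smult_cls)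
qed

lemma pure2_closed: "v \<in> carrier V \<Longrightarrow> w \<in> carrier W \<Longrightarrow> pure2 K V W v w \<in> carrier T"
  unfolding pure2_def by (rule cls_closed) simp

lemma pure2_lin_left: "w \<in> carrier W \<Longrightarrow> lin K V T (\<lambda>v. pure2 K V W v w)"
proof (rule linI)
  fix x y assume "w \<in> carrier W" "x \<in> carrier V" "y \<in> carrier V"
  then show "pure2 K V W (x \<oplus>\<^bsub>V\<^esub> y) w = pure2 K V W x w \<oplus>\<^bsub>T\<^esub> pure2 K V W y w"
    by (simp add: pure2_def add_cls cls_eq tensor_rel.add_left)
next
  fix c x assume "w \<in> carrier W" "c \<in> carrier K" "x \<in> carrier V"
  then show "pure2 K V W (c \<odot>\<^bsub>V\<^esub> x) w = c \<odot>\<^bsub>T\<^esub> pure2 K V W x w"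
    by (simp add: pure2_def smult_cls)
qed (auto intro: V.module_axioms module_tensor pure2_closed)

text \<open>The scalar action of \<open>tensor\<close> is defined on first components, so
  homogeneity in the second argument has to pass through the generator \<open>smult\<close> of the
  relation.\<close>

lemma pure2_lin_right: "v \<in> carrier V \<Longrightarrow> lin K W T (pure2 K V W v)"
proof (rule linI)
  fix x y assume "v \<in> carrier V" "x \<in> carrier W" "y \<in> carrier W"
  then show "pure2 K V W v (x \<oplus>\<^bsub>W\<^esub> y) = pure2 K V W v x \<oplus>\<^bsub>T\<^esub> pure2 K V W v y"
    by (simp add: pure2_def add_cls cls_eq tensor_rel.add_right)
next
  fix c x assume "v \<in> carrier V" "c \<in> carrier K" "x \<in> carrier W"
  then have "pure2 K V W v (c \<odot>\<^bsub>W\<^esub> x) = pure2 K V W (c \<odot>\<^bsub>V\<^esub> v) x"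
    by (auto simp: pure2_def intro!: cls_eq tensor_rel.sym[OF tensor_rel.smult])
  then show "pure2 K V W v (c \<odot>\<^bsub>W\<^esub> x) = c \<odot>\<^bsub>T\<^esub> pure2 K V W v x"
    using \<open>v \<in> carrier V\<close> \<open>c \<in> carrier K\<close> \<open>x \<in> carrier W\<close> by (simp add: pure2_def smult_cls)
qed (auto intro: W.module_axioms module_tensor pure2_closed)

lemma cls_Cons: "v \<in> carrier V \<Longrightarrow> w \<in> carrier W \<Longrightarrow> l \<in> L \<Longrightarrow>
    cls ((v, w) # l) = pure2 K V W v w \<oplus>\<^bsub>T\<^esub> cls l"
  by (simp add: pure2_def add_cls)

text \<open>The class of a list is the sum of the pure tensors of its entries, so induction on a
  representative suffices.\<close>

lemma tensor_eqI:
  assumes "lin K T X F" "lin K T X G" "t \<in> carrier T"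
    "\<And>v w. v \<in> carrier V \<Longrightarrow> w \<in> carrier W \<Longrightarrow> F (pure2 K V W v w) = G (pure2 K V W v w)"
  shows "F t = G t"
proof -
  obtain l where l: "l \<in> L" "t = cls l" using assms(3) by (rule cls_cases)
  have "F (cls l) = G (cls l)" using l(1)
  proof (induction l)
    case Nil then show ?case using lin_zero[OF assms(1)] lin_zero[OF assms(2)] by (simp add: zero_cls)
  next
    case (Cons p l)
    obtain v w where p: "p = (v, w)" "v \<in> carrier V" "w \<in> carrier W" using Cons.hyps(1) by auto
    have c: "cls (p # l) = pure2 K V W v w \<oplus>\<^bsub>T\<^esub> cls l" "cls l \<in> carrier T" "pure2 K V W v w \<in> carrier T"
      using p Cons.hyps(2) by (auto simp only: cls_Cons intro!: cls_closed pure2_closed)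
    show ?case
      unfolding c(1) lin_add[OF assms(1) c(3,2)] lin_add[OF assms(2) c(3,2)] assms(4)[OF p(2,3)] Cons.IH ..
  qed
  then show ?thesis using l by simp
qed

section \<open>Evaluating bilinear maps on tensors\<close>

lemma formal_sum_Cons: "formal_sum X f ((v, w) # l) = f v w \<oplus>\<^bsub>X\<^esub> formal_sum X f l"
  by (simp add: formal_sum_def)

lemma lift2_lin:
  assumes "module K X" "bilinear_map K V W X f"
  shows "lin K T X (\<lambda>t. lift2 X t f)"
proof -
  note c = lift2_class[OF V.module_axioms W.module_axioms assms]
  interpret X: module K X by fact
  have f: "f v w \<in> carrier X" if "v \<in> carrier V" "w \<in> carrier W" for v w
    using assms(2) that by (auto simp: bilinear_map_def)
  show ?thesis
  proof (rule linI)
    fix t assume "t \<in> carrier T"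
    then show "lift2 X t f \<in> carrier X"
      by (elim cls_cases) (simp add: c formal_sum_closed[OF assms])
  next
    fix s t assume "s \<in> carrier T" "t \<in> carrier T"
    then show "lift2 X (s \<oplus>\<^bsub>T\<^esub> t) f = lift2 X s f \<oplus>\<^bsub>X\<^esub> lift2 X t f"
      by (elim cls_cases) (simp add: add_cls c formal_sum_append[OF assms])
  next
    fix a t assume a: "a \<in> carrier K" and "t \<in> carrier T"
    then obtain l where l: "l \<in> L" "t = cls l" by (auto elim: cls_cases)
    have "formal_sum X f (scal a l) = a \<odot>\<^bsub>X\<^esub> formal_sum X f l" using l(1)
    proof (induction l)
      case Nil then show ?case using a by (simp add: formal_sum_def)
    next
      case (Cons p l)
      obtain v w where p: "p = (v, w)" "v \<in> carrier V" "w \<in> carrier W" using Cons.hyps(1) by auto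
      have "f (a \<odot>\<^bsub>V\<^esub> v) w = a \<odot>\<^bsub>X\<^esub> f v w" using assms(2) p a unfolding bilinear_map_def by blast
      then show ?case using Cons p a f formal_sum_closed[OF assms]
        by (simp add: formal_sum_Cons X.smult_r_distr)
    qed
    then show "lift2 X (a \<odot>\<^bsub>T\<^esub> t) f = a \<odot>\<^bsub>X\<^esub> lift2 X t f"
      using l a by (simp add: smult_cls c scal_lists)
  qed (auto intro: module_tensor assms)
qed

lemma lift2_pure:
  assumes "module K X" "bilinear_map K V W X f" "v \<in> carrier V" "w \<in> carrier W"
  shows "lift2 X (pure2 K V W v w) f = f v w"
proof -
  interpret X: module K X by fact
  have f: "f v w \<in> carrier X" using assms by (auto simp: bilinear_map_def)
  show ?thesis unfolding pure2_def
    by (subst lift2_class[OF V.module_axioms W.module_axioms assms(1,2)])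
      (use assms f in \<open>auto simp: formal_sum_def\<close>)
qed

text \<open>\<open>lift2\<close> evaluates the representative picked by \<open>SOME\<close>. That it
  is a list over the carriers is enough for closure, congruence and linearity in a parameter, since
  these hold for the formal sum over any fixed list.\<close>

lemma some_rep:
  assumes "t \<in> carrier T"
  shows "(SOME l. l \<in> t) \<in> L"
proof -
  obtain l where l: "l \<in> L" "t = cls l" using assms by (rule cls_cases)
  then have "l \<in> t" by (simp add: tensor_rel.refl)
  then have "(SOME l. l \<in> t) \<in> t" by (rule someI)
  then show ?thesis using l rel_lists by auto
qed

lemma lift2_closed:
  assumes "module K X" "t \<in> carrier T" "\<And>v w. v \<in> carrier V \<Longrightarrow> w \<in> carrier W \<Longrightarrow> f v w \<in> carrier X"
  shows "lift2 X t f \<in> carrier X"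
proof -
  interpret X: module K X by fact
  have "formal_sum X f l \<in> carrier X" if "l \<in> L" for l
    using that by (induction l) (auto simp: formal_sum_def assms(3))
  then show ?thesis using some_rep[OF assms(2)] by (simp add: lift2_def)
qed

lemma lift2_cong:
  assumes "t \<in> carrier T" "\<And>v w. v \<in> carrier V \<Longrightarrow> w \<in> carrier W \<Longrightarrow> f v w = g v w"
  shows "lift2 X t f = lift2 X t g"
proof -
  have "formal_sum X f l = formal_sum X g l" if "l \<in> L" for l
    using that by (induction l) (auto simp: formal_sum_def assms(2))
  then show ?thesis using some_rep[OF assms(1)] by (simp add: lift2_def)
qed

text \<open>Here the tensor is fixed and the integrand varies linearly with \<open>u\<close>.
  Together with \<open>lift2_lin\<close>, where the tensor varies, this handles nested occurrences
  of \<open>lift2\<close>.\<close>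

lemma lin_lift2_body:
  assumes "module K U" "module K X" "t \<in> carrier T"
    "\<And>v w. v \<in> carrier V \<Longrightarrow> w \<in> carrier W \<Longrightarrow> lin K U X (\<lambda>u. f u v w)"
  shows "lin K U X (\<lambda>u. lift2 X t (f u))"
proof -
  have "lin K U X (\<lambda>u. formal_sum X (f u) l)" if "l \<in> L" for l
    using that by (induction l) (auto simp: formal_sum_def intro!: lin_plus assms lin_const_zero)
  then show ?thesis using some_rep[OF assms(3)] by (simp add: lift2_def)
qed

end

lemmas module_tensor = two_modules.module_tensor[OF two_modules.intro]
lemmas lift2_pure = two_modules.lift2_pure[OF two_modules.intro]
lemmas lift2_lin = two_modules.lift2_lin[OF two_modules.intro]
lemmas lift2_closed = two_modules.lift2_closed[OF two_modules.intro]
lemmas lift2_cong = two_modules.lift2_cong[OF two_modules.intro]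
lemmas lin_lift2_body = two_modules.lin_lift2_body[OF two_modules.intro]
lemmas pure2_closed = two_modules.pure2_closed[OF two_modules.intro]
lemmas tensor_eqI = two_modules.tensor_eqI[OF two_modules.intro]

lemma lin_pure2_left:
  "module K W \<Longrightarrow> lin K U V f \<Longrightarrow> w \<in> carrier W \<Longrightarrow> lin K U (tensor K V W) (\<lambda>u. pure2 K V W (f u) w)"
  by (rule lin_comp[OF two_modules.pure2_lin_left]) (auto intro: two_modules.intro lin_module)

lemma lin_pure2_right:
  "module K V \<Longrightarrow> lin K U W f \<Longrightarrow> v \<in> carrier V \<Longrightarrow> lin K U (tensor K V W) (\<lambda>u. pure2 K V W v (f u))"
  by (rule lin_comp[OF two_modules.pure2_lin_right]) (auto intro: two_modules.intro lin_module)

lemma lin_lift2_arg: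
  assumes "module K V" "module K W" "module K X" "lin K U (tensor K V W) g"
    "\<And>w. w \<in> carrier W \<Longrightarrow> lin K V X (\<lambda>v. f v w)" "\<And>v. v \<in> carrier V \<Longrightarrow> lin K W X (f v)"
  shows "lin K U X (\<lambda>u. lift2 X (g u) f)"
  by (rule lin_comp[OF lift2_lin assms(4)]) (use assms in \<open>auto intro: bilinear_mapI\<close>)

text \<open>A form of \<open>lift2_pure\<close> for backward chaining: bilinearity is split into two
  \<open>lin\<close> goals, to which the structural rules apply.\<close>

lemma lift2_pure_lin:
  assumes "module K V" "module K W" "module K X" "v \<in> carrier V" "w \<in> carrier W"
    "\<And>w. w \<in> carrier W \<Longrightarrow> lin K V X (\<lambda>v. f v w)" "\<And>v. v \<in> carrier V \<Longrightarrow> lin K W X (f v)"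
  shows "lift2 X (pure2 K V W v w) f = f v w"
  by (rule lift2_pure) (use assms in \<open>auto intro: bilinear_mapI\<close>)

lemma lin_cong:
  assumes "lin K V X f" "\<And>x. x \<in> carrier V \<Longrightarrow> g x = f x"
  shows "lin K V X g"
proof -
  interpret V: module K V using assms(1) by (rule lin_module)
  show ?thesis using assms unfolding lin_def by auto
qed

lemma k_algebra_module: "k_algebra K A \<Longrightarrow> module K A"
  by (rule k_algebra.axioms)

lemma k_algebra_ring: "k_algebra K A \<Longrightarrow> ring A"
  by (rule k_algebra.axioms)

lemma lin_mult_left:
  assumes "k_algebra K A" "lin K U A f" "c \<in> carrier A"
  shows "lin K U A (\<lambda>u. f u \<otimes>\<^bsub>A\<^esub> c)"
proof -
  interpret A: k_algebra K A by fact
  show ?thesis using assms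
    by (intro linI) (auto simp: lin_closed[OF assms(2)] lin_add[OF assms(2)] lin_smult[OF assms(2)]
        A.A.l_distr A.smult_mult_left intro: lin_module)
qed

lemma lin_mult_right:
  assumes "k_algebra K A" "lin K U A f" "c \<in> carrier A"
  shows "lin K U A (\<lambda>u. c \<otimes>\<^bsub>A\<^esub> f u)"
proof -
  interpret A: k_algebra K A by fact
  show ?thesis using assms
    by (intro linI) (auto simp: lin_closed[OF assms(2)] lin_add[OF assms(2)] lin_smult[OF assms(2)]
        A.A.r_distr A.smult_mult_right intro: lin_module)
qed

section \<open>Tensor products of algebras\<close>

locale two_algebras = V: k_algebra K V + W: k_algebra K W
  for K :: "'k ring" and V :: "('k, 'v) module" and W :: "('k, 'w) module"
begin

sublocale two_modules K V W ..

lemmas module_T = module_tensor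
lemmas mods = V.module_axioms W.module_axioms module_tensor V.k_algebra_axioms W.k_algebra_axioms

lemma cls_map:
  assumes "l \<in> L" "\<And>v w. v \<in> carrier V \<Longrightarrow> w \<in> carrier W \<Longrightarrow> g v \<in> carrier V \<and> h w \<in> carrier W"
  shows "cls (map (\<lambda>(v, w). (g v, h w)) l) = formal_sum T (\<lambda>v w. pure2 K V W (g v) (h w)) l \<and>
    map (\<lambda>(v, w). (g v, h w)) l \<in> L"
  using assms(1)
proof (induction l)
  case Nil then show ?case by (simp add: formal_sum_def zero_cls)
next
  case (Cons p l)
  obtain v w where p: "p = (v, w)" "v \<in> carrier V" "w \<in> carrier W" using Cons.hyps(1) by auto
  have gh: "g v \<in> carrier V" "h w \<in> carrier W" using assms(2)[OF p(2,3)] by auto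
  have l: "map (\<lambda>(v, w). (g v, h w)) l \<in> L" using Cons.IH by blast
  have "map (\<lambda>(v, w). (g v, h w)) (p # l) = (g v, h w) # map (\<lambda>(v, w). (g v, h w)) l"
    using p(1) by simp
  then show ?case using Cons.IH cls_Cons[OF gh l] p(1) gh
    by (simp add: formal_sum_Cons)
qed

abbreviation "mulf m v w \<equiv> formal_sum T (\<lambda>v' w'. pure2 K V W (v \<otimes>\<^bsub>V\<^esub> v') (w \<otimes>\<^bsub>W\<^esub> w')) m"
abbreviation "prodl l m \<equiv> [(v \<otimes>\<^bsub>V\<^esub> v', w \<otimes>\<^bsub>W\<^esub> w'). (v, w) \<leftarrow> l, (v', w') \<leftarrow> m]"

text \<open>Grouping the double comprehension by the entries of \<open>l\<close> exhibits it as an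
  iterated formal sum, the form in which \<open>lift2\<close> can take over.\<close>

lemma cls_prodl:
  assumes "l \<in> L" "m \<in> L"
  shows "cls (prodl l m) = formal_sum T (mulf m) l \<and> prodl l m \<in> L"
  using assms(1)
proof (induction l)
  case Nil then show ?case by (simp add: formal_sum_def zero_cls)
next
  case (Cons p l)
  obtain v w where p: "p = (v, w)" "v \<in> carrier V" "w \<in> carrier W" using Cons.hyps(1) by auto
  let ?m = "map (\<lambda>(v', w'). (v \<otimes>\<^bsub>V\<^esub> v', w \<otimes>\<^bsub>W\<^esub> w')) m"
  have m: "cls ?m = mulf m v w" "?m \<in> L"
    using cls_map[OF assms(2), of "\<lambda>v'. v \<otimes>\<^bsub>V\<^esub> v'" "\<lambda>w'. w \<otimes>\<^bsub>W\<^esub> w'"] p by auto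
  have e: "prodl (p # l) m = ?m @ prodl l m" using p(1) by simp
  have "cls (?m @ prodl l m) = mulf m v w \<oplus>\<^bsub>T\<^esub> formal_sum T (mulf m) l"
    using add_cls[OF m(2)] Cons.IH m(1) by metis
  moreover have "?m @ prodl l m \<in> L" using m(2) Cons.IH by (auto simp only: append_in_lists_conv)
  ultimately show ?case unfolding e using p(1) by (simp only: formal_sum_Cons simp_thms)
qed

text \<open>A candidate for the multiplication that is visibly well defined and bilinear, being
  built from \<open>lift2\<close>.\<close>

abbreviation "tmul s t \<equiv>
  lift2 T s (\<lambda>v w. lift2 T t (\<lambda>v' w'. pure2 K V W (v \<otimes>\<^bsub>V\<^esub> v') (w \<otimes>\<^bsub>W\<^esub> w')))"

lemma bil_inner:
  assumes "v \<in> carrier V" "w \<in> carrier W"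
  shows "bilinear_map K V W T (\<lambda>v' w'. pure2 K V W (v \<otimes>\<^bsub>V\<^esub> v') (w \<otimes>\<^bsub>W\<^esub> w'))"
  by (intro bilinear_mapI lin_pure2_left lin_pure2_right lin_mult_right lin_id mods
      V.A.m_closed W.A.m_closed assms)

lemma bil_outer:
  assumes "t \<in> carrier T"
  shows "bilinear_map K V W T (\<lambda>v w. lift2 T t (\<lambda>v' w'. pure2 K V W (v \<otimes>\<^bsub>V\<^esub> v') (w \<otimes>\<^bsub>W\<^esub> w')))"
  by (intro bilinear_mapI lin_lift2_body assms lin_pure2_left lin_pure2_right lin_mult_left lin_id mods
      V.A.m_closed W.A.m_closed)

lemma mulf_lift:
  assumes "m \<in> L" "v \<in> carrier V" "w \<in> carrier W"
  shows "mulf m v w = lift2 T (cls m) (\<lambda>v' w'. pure2 K V W (v \<otimes>\<^bsub>V\<^esub> v') (w \<otimes>\<^bsub>W\<^esub> w'))"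
  by (rule lift2_class[symmetric]) (intro mods bil_inner assms)+

lemma cls_prodl_tmul:
  assumes "l \<in> L" "m \<in> L"
  shows "cls (prodl l m) = tmul (cls l) (cls m)"
proof -
  have "formal_sum T (mulf m) l = formal_sum T (\<lambda>v w. lift2 T (cls m) (\<lambda>v' w'. pure2 K V W (v \<otimes>\<^bsub>V\<^esub> v') (w \<otimes>\<^bsub>W\<^esub> w'))) l"
    using assms(1)
  proof (induction l)
    case (Cons p l)
    obtain v w where p: "p = (v, w)" "v \<in> carrier V" "w \<in> carrier W" using Cons.hyps(1) by auto
    show ?case using Cons.IH p(1) by (simp only: formal_sum_Cons mulf_lift[OF assms(2) p(2,3)])
  qed (simp add: formal_sum_def)
  also have "\<dots> = tmul (cls l) (cls m)"
    by (rule lift2_class[symmetric]) (intro mods bil_outer assms cls_closed)+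
  finally show ?thesis using cls_prodl[OF assms] by simp
qed

text \<open>\<open>cls_prodl_tmul\<close> holds for every pair of representatives and its right side
  depends only on their classes, so all members of the union defining the product are equal. This
  yields well-definedness and bilinearity of the product at once.\<close>

lemma mult_tmul:
  assumes "s \<in> carrier T" "t \<in> carrier T"
  shows "s \<otimes>\<^bsub>T\<^esub> t = tmul s t"
proof -
  obtain l where l: "l \<in> L" "s = cls l" using assms(1) by (rule cls_cases)
  obtain m where m: "m \<in> L" "t = cls m" using assms(2) by (rule cls_cases)
  have e: "cls (prodl l' m') = tmul s t" if "(l, l') \<in> R" "(m, m') \<in> R" for l' m'
  proof -
    have "cls l' = s" "cls m' = t" using cls_eq[OF that(1)] cls_eq[OF that(2)] l m by auto
    then show ?thesis using cls_prodl_tmul[of l' m'] rel_lists[OF that(1)] rel_lists[OF that(2)] by simp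
  qed
  have ll: "(l, l) \<in> R" "(m, m) \<in> R" using l m by (auto intro!: tensor_rel.refl simp del: in_listsI)
  have "s \<otimes>\<^bsub>T\<^esub> t = (\<Union>l'\<in>cls l. \<Union>m'\<in>cls m. cls (prodl l' m'))"
    unfolding l(2) m(2) by (simp add: tensor_def)
  also have "\<dots> = (\<Union>l'\<in>cls l. \<Union>m'\<in>cls m. tmul s t)"
    by (intro SUP_cong refl e) auto
  also have "\<dots> = tmul s t" using ll by auto
  finally show ?thesis .
qed

lemma mult_lin_left: "t \<in> carrier T \<Longrightarrow> lin K T T (\<lambda>s. tmul s t)"
  by (rule lift2_lin[OF mods(3) bil_outer])

lemma mult_lin_right: "s \<in> carrier T \<Longrightarrow> lin K T T (\<lambda>t. tmul s t)"
  by (intro lin_lift2_body mods lift2_lin bil_inner)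

lemma tmul_pure:
  assumes "v \<in> carrier V" "w \<in> carrier W" "v' \<in> carrier V" "w' \<in> carrier W"
  shows "tmul (pure2 K V W v w) (pure2 K V W v' w') = pure2 K V W (v \<otimes>\<^bsub>V\<^esub> v') (w \<otimes>\<^bsub>W\<^esub> w')"
  using assms by (simp add: lift2_pure[OF mods(3) bil_outer] lift2_pure[OF mods(3) bil_inner] pure2_closed)

lemma mult_pure:
  assumes "v \<in> carrier V" "w \<in> carrier W" "v' \<in> carrier V" "w' \<in> carrier W"
  shows "pure2 K V W v w \<otimes>\<^bsub>T\<^esub> pure2 K V W v' w' = pure2 K V W (v \<otimes>\<^bsub>V\<^esub> v') (w \<otimes>\<^bsub>W\<^esub> w')"
  using tmul_pure[OF assms] mult_tmul[OF pure2_closed[OF assms(1,2)] pure2_closed[OF assms(3,4)]] by simp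

lemma mult_closed: "s \<in> carrier T \<Longrightarrow> t \<in> carrier T \<Longrightarrow> s \<otimes>\<^bsub>T\<^esub> t \<in> carrier T"
  by (simp add: mult_tmul lin_closed[OF mult_lin_left])

lemma mult_lin_left': "t \<in> carrier T \<Longrightarrow> lin K T T (\<lambda>s. s \<otimes>\<^bsub>T\<^esub> t)"
  by (rule lin_cong[OF mult_lin_left]) (simp_all add: mult_tmul)

lemma mult_lin_right': "s \<in> carrier T \<Longrightarrow> lin K T T (\<lambda>t. s \<otimes>\<^bsub>T\<^esub> t)"
  by (rule lin_cong[OF mult_lin_right]) (simp_all add: mult_tmul)

lemma one_T: "\<one>\<^bsub>T\<^esub> = pure2 K V W \<one>\<^bsub>V\<^esub> \<one>\<^bsub>W\<^esub>"
  by (simp add: tensor_def pure2_def)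

lemma T_assoc:
  assumes "s \<in> carrier T" "t \<in> carrier T" "r \<in> carrier T"
  shows "(s \<otimes>\<^bsub>T\<^esub> t) \<otimes>\<^bsub>T\<^esub> r = s \<otimes>\<^bsub>T\<^esub> (t \<otimes>\<^bsub>T\<^esub> r)"
proof (rule tensor_eqI[where X = T and F = "\<lambda>s. (s \<otimes>\<^bsub>T\<^esub> t) \<otimes>\<^bsub>T\<^esub> r" and G = "\<lambda>s. s \<otimes>\<^bsub>T\<^esub> (t \<otimes>\<^bsub>T\<^esub> r)", OF _ _ assms(1)])
  fix v w assume vw: "v \<in> carrier V" "w \<in> carrier W"
  let ?p = "pure2 K V W v w"
  have p: "?p \<in> carrier T" using vw by (rule pure2_closed)
  show "(?p \<otimes>\<^bsub>T\<^esub> t) \<otimes>\<^bsub>T\<^esub> r = ?p \<otimes>\<^bsub>T\<^esub> (t \<otimes>\<^bsub>T\<^esub> r)"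
  proof (rule tensor_eqI[where X = T and F = "\<lambda>t. (?p \<otimes>\<^bsub>T\<^esub> t) \<otimes>\<^bsub>T\<^esub> r" and G = "\<lambda>t. ?p \<otimes>\<^bsub>T\<^esub> (t \<otimes>\<^bsub>T\<^esub> r)", OF _ _ assms(2)])
    fix v' w' assume vw': "v' \<in> carrier V" "w' \<in> carrier W"
    let ?q = "pure2 K V W v' w'"
    have q: "?q \<in> carrier T" using vw' by (rule pure2_closed)
    show "(?p \<otimes>\<^bsub>T\<^esub> ?q) \<otimes>\<^bsub>T\<^esub> r = ?p \<otimes>\<^bsub>T\<^esub> (?q \<otimes>\<^bsub>T\<^esub> r)"
    proof (rule tensor_eqI[where X = T and F = "\<lambda>r. (?p \<otimes>\<^bsub>T\<^esub> ?q) \<otimes>\<^bsub>T\<^esub> r" and G = "\<lambda>r. ?p \<otimes>\<^bsub>T\<^esub> (?q \<otimes>\<^bsub>T\<^esub> r)", OF _ _ assms(3)])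
      fix v'' w'' assume "v'' \<in> carrier V" "w'' \<in> carrier W"
      then show "(?p \<otimes>\<^bsub>T\<^esub> ?q) \<otimes>\<^bsub>T\<^esub> pure2 K V W v'' w'' = ?p \<otimes>\<^bsub>T\<^esub> (?q \<otimes>\<^bsub>T\<^esub> pure2 K V W v'' w'')"
        using vw vw' by (simp add: mult_pure V.A.m_assoc W.A.m_assoc)
    qed (rule mult_lin_right' lin_comp[OF mult_lin_right' mult_lin_right'] mult_closed p q)+
  qed (rule lin_comp[OF mult_lin_left' mult_lin_right'] lin_comp[OF mult_lin_right' mult_lin_left'] p assms(3))+
qed (intro lin_comp[OF mult_lin_left' mult_lin_left'] mult_lin_left' mult_closed assms)+

lemma T_one:
  assumes "s \<in> carrier T"
  shows "\<one>\<^bsub>T\<^esub> \<otimes>\<^bsub>T\<^esub> s = s" "s \<otimes>\<^bsub>T\<^esub> \<one>\<^bsub>T\<^esub> = s"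
proof -
  have one: "\<one>\<^bsub>T\<^esub> \<in> carrier T" by (simp add: one_T pure2_closed)
  show "\<one>\<^bsub>T\<^esub> \<otimes>\<^bsub>T\<^esub> s = s"
    by (rule tensor_eqI[where X = T and F = "\<lambda>s. \<one>\<^bsub>T\<^esub> \<otimes>\<^bsub>T\<^esub> s" and G = "\<lambda>s. s", OF _ _ assms])
      (rule mult_lin_right'[OF one], rule lin_id[OF module_T], simp add: one_T mult_pure)
  show "s \<otimes>\<^bsub>T\<^esub> \<one>\<^bsub>T\<^esub> = s"
    by (rule tensor_eqI[where X = T and F = "\<lambda>s. s \<otimes>\<^bsub>T\<^esub> \<one>\<^bsub>T\<^esub>" and G = "\<lambda>s. s", OF _ _ assms])
      (rule mult_lin_left'[OF one], rule lin_id[OF module_T], simp add: one_T mult_pure)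
qed

lemma k_algebra_tensor: "k_algebra K T"
proof -
  interpret T: module K T by (rule module_T)
  have "ring T"
  proof (rule ringI)
    show "abelian_group T" by (rule abelian_group_tensor)
    show "monoid T"
      by (rule monoidI) (simp_all add: mult_closed T_assoc T_one, simp add: one_T pure2_closed)
  qed (auto simp: lin_add[OF mult_lin_left'] lin_add[OF mult_lin_right'])
  then show ?thesis
    by (intro k_algebra.intro k_algebra_axioms.intro module_T V.K.field_axioms)
      (auto simp: lin_smult[OF mult_lin_left'] lin_smult[OF mult_lin_right'])
qed

end

lemmas k_algebra_tensor = two_algebras.k_algebra_tensor[OF two_algebras.intro]
lemmas mult_pure = two_algebras.mult_pure[OF two_algebras.intro]
lemmas one_tensor = two_algebras.one_T[OF two_algebras.intro]

section \<open>Linear extensionality\<close>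

text \<open>Properties that pass from pure tensors to all tensors. Zero and sums are enough, because
  a tensor is a sum of pure ones with the scalars absorbed into their entries. Unlike an equation of
  linear maps, such a property may be quantified over parameters.\<close>

definition linP :: "'k ring \<Rightarrow> ('k, 'v) module \<Rightarrow> ('v \<Rightarrow> bool) \<Rightarrow> bool"
  where "linP K V P \<longleftrightarrow> P \<zero>\<^bsub>V\<^esub> \<and> (\<forall>x\<in>carrier V. \<forall>y\<in>carrier V. P x \<longrightarrow> P y \<longrightarrow> P (x \<oplus>\<^bsub>V\<^esub> y))"

lemma linP_eq:
  assumes "lin K V X f" "lin K V X g"
  shows "linP K V (\<lambda>x. f x = g x)"
  unfolding linP_def by (simp add: lin_zero[OF assms(1)] lin_zero[OF assms(2)] lin_add[OF assms(1)] lin_add[OF assms(2)])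

lemma linP_ball: "(\<And>y. y \<in> Y \<Longrightarrow> linP K V (\<lambda>x. P x y)) \<Longrightarrow> linP K V (\<lambda>x. \<forall>y\<in>Y. P x y)"
  unfolding linP_def by blast

lemma linP_comp:
  assumes "linP K X P" "lin K V X g"
  shows "linP K V (\<lambda>x. P (g x))"
  using assms(1) unfolding linP_def by (simp add: lin_zero[OF assms(2)] lin_add[OF assms(2)] lin_closed[OF assms(2)])

lemma tensor_induct [consumes 1, case_names V W linP pure]:
  assumes t: "t \<in> carrier (tensor K V W)" and V: "module K V" and W: "module K W"
    and P: "linP K (tensor K V W) P"
    and pure: "\<And>v w. v \<in> carrier V \<Longrightarrow> w \<in> carrier W \<Longrightarrow> P (pure2 K V W v w)"
  shows "P t"
proof -
  interpret two_modules K V W by (intro two_modules.intro V W)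
  obtain l where l: "l \<in> L" "t = cls l" using t by (rule cls_cases)
  have "P (cls l)" using l(1)
  proof (induction l)
    case Nil then show ?case using P unfolding linP_def by (simp add: zero_cls)
  next
    case (Cons p l)
    obtain v w where p: "p = (v, w)" "v \<in> carrier V" "w \<in> carrier W" using Cons.hyps(1) by auto
    have c: "cls (p # l) = pure2 K V W v w \<oplus>\<^bsub>T\<^esub> cls l" "cls l \<in> carrier T" "pure2 K V W v w \<in> carrier T"
      using p Cons.hyps(2) by (auto simp only: cls_Cons intro!: cls_closed pure2_closed)
    show ?case unfolding c(1) using P pure[OF p(2,3)] c(2,3) Cons.IH unfolding linP_def by blast
  qed
  then show ?thesis using l(2) by simp
qed

lemma tensor3_induct [consumes 1, case_names U V W linP pure]:
  assumes t: "t \<in> carrier (tensor3 K U V W)" and U: "module K U" and V: "module K V" and W: "module K W"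
    and P: "linP K (tensor3 K U V W) P"
    and pure: "\<And>u v w. u \<in> carrier U \<Longrightarrow> v \<in> carrier V \<Longrightarrow> w \<in> carrier W \<Longrightarrow> P (pure3 K U V W u v w)"
  shows "P t"
  using t
proof (induct t rule: tensor_induct)
  case (pure u s)
  show ?case using pure(2)
  proof (induct s rule: tensor_induct)
    \<comment> \<open>The inner induction runs over the property pulled back along the linear map
      that puts \<open>u\<close> in front.\<close>
    case linP show ?case
      by (rule linP_comp[OF P]) (intro lin_pure2_right lin_id module_tensor U V W pure)
  qed (intro V W assms(6) pure)+
qed (intro U V W P module_tensor)+

lemma tensor4_induct [consumes 1, case_names U V W X linP pure]:
  assumes t: "t \<in> carrier (tensor4 K U V W X)"
    and U: "module K U" and V: "module K V" and W: "module K W" and X: "module K X"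
    and P: "linP K (tensor4 K U V W X) P"
    and pure: "\<And>u v w x. u \<in> carrier U \<Longrightarrow> v \<in> carrier V \<Longrightarrow> w \<in> carrier W \<Longrightarrow> x \<in> carrier X \<Longrightarrow>
      P (pure4 K U V W X u v w x)"
  shows "P t"
  using t
proof (induct t rule: tensor_induct)
  case (pure u s)
  show ?case using pure(2)
  proof (induct s rule: tensor3_induct)
    case linP show ?case
      by (rule linP_comp[OF P]) (intro lin_pure2_right lin_id module_tensor U V W X pure)
  qed (intro V W X assms(7) pure)+
qed (intro U V W X P module_tensor)+

section \<open>Algebra maps\<close>

text \<open>Both algebra structures and linearity are bundled, so that a single fact of this form
  supplies the side conditions of later rules; \<open>am_iff\<close> connects it with
  \<open>algebra_map\<close>.\<close>

definition am :: "'k ring \<Rightarrow> ('k, 'a) module \<Rightarrow> ('k, 'b) module \<Rightarrow> ('a \<Rightarrow> 'b) \<Rightarrow> bool"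
  where "am K A B f \<longleftrightarrow> k_algebra K A \<and> k_algebra K B \<and> lin K A B f \<and> f \<one>\<^bsub>A\<^esub> = \<one>\<^bsub>B\<^esub> \<and>
    (\<forall>x\<in>carrier A. \<forall>y\<in>carrier A. f (x \<otimes>\<^bsub>A\<^esub> y) = f x \<otimes>\<^bsub>B\<^esub> f y)"

lemma am_algebra: assumes "am K A B f" shows "k_algebra K A" "k_algebra K B"
  using assms unfolding am_def by auto

lemma am_lin: "am K A B f \<Longrightarrow> lin K A B f" unfolding am_def by auto

lemma am_closed: "am K A B f \<Longrightarrow> x \<in> carrier A \<Longrightarrow> f x \<in> carrier B"
  by (rule lin_closed[OF am_lin])

lemma am_one: "am K A B f \<Longrightarrow> f \<one>\<^bsub>A\<^esub> = \<one>\<^bsub>B\<^esub>" unfolding am_def by auto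

lemma am_mult: "am K A B f \<Longrightarrow> x \<in> carrier A \<Longrightarrow> y \<in> carrier A \<Longrightarrow> f (x \<otimes>\<^bsub>A\<^esub> y) = f x \<otimes>\<^bsub>B\<^esub> f y"
  unfolding am_def by auto

lemma amI:
  assumes "k_algebra K A" "k_algebra K B" "lin K A B f" "f \<one>\<^bsub>A\<^esub> = \<one>\<^bsub>B\<^esub>"
    "\<And>x y. x \<in> carrier A \<Longrightarrow> y \<in> carrier A \<Longrightarrow> f (x \<otimes>\<^bsub>A\<^esub> y) = f x \<otimes>\<^bsub>B\<^esub> f y"
  shows "am K A B f"
  using assms unfolding am_def by auto

lemma am_iff:
  assumes "k_algebra K A" "k_algebra K B"
  shows "am K A B f \<longleftrightarrow> f \<in> algebra_map K A B"
proof -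
  interpret A: k_algebra K A by fact
  interpret B: k_algebra K B by fact
  show ?thesis
    unfolding am_def algebra_map_def lin_def ring_hom_def using assms A.module_axioms B.module_axioms
    by (auto simp: Pi_iff)
qed

lemma k_algebra_monoid: "k_algebra K A \<Longrightarrow> monoid A"
  using k_algebra_ring ring.is_monoid by blast

text \<open>The tool for inverting pentagons term by term: the images of a reassociator under the
  structure maps are units, and their inverses are the images of its inverse.\<close>

lemma am_Units:
  assumes "am K A B f" "x \<in> Units A"
  shows "f x \<in> Units B" "f (inv\<^bsub>A\<^esub> x) = inv\<^bsub>B\<^esub> (f x)"
proof -
  interpret A: monoid A using am_algebra[OF assms(1)] by (intro k_algebra_monoid)
  interpret B: monoid B using am_algebra[OF assms(1)] by (intro k_algebra_monoid)
  have x: "x \<in> carrier A" "inv\<^bsub>A\<^esub> x \<in> carrier A" using assms(2) by auto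
  have 1: "f (inv\<^bsub>A\<^esub> x) \<otimes>\<^bsub>B\<^esub> f x = \<one>\<^bsub>B\<^esub>" "f x \<otimes>\<^bsub>B\<^esub> f (inv\<^bsub>A\<^esub> x) = \<one>\<^bsub>B\<^esub>"
    using am_mult[OF assms(1) x(2,1)] am_mult[OF assms(1) x] assms(2) am_one[OF assms(1)]
    by (simp_all add: A.Units_l_inv A.Units_r_inv)
  have c: "f x \<in> carrier B" "f (inv\<^bsub>A\<^esub> x) \<in> carrier B" using x am_closed[OF assms(1)] by auto
  show u: "f x \<in> Units B" unfolding Units_def using c 1 by blast
  show "f (inv\<^bsub>A\<^esub> x) = inv\<^bsub>B\<^esub> (f x)" using B.inv_unique'[OF c 1(2,1)] by simp
qed

text \<open>Both sides of the multiplicativity law are bilinear in the two arguments, so it is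
  decided on pure tensors.\<close>

lemma am_tensorI:
  assumes "k_algebra K V" "k_algebra K W" "k_algebra K X" "lin K (tensor K V W) X F"
    "F (pure2 K V W \<one>\<^bsub>V\<^esub> \<one>\<^bsub>W\<^esub>) = \<one>\<^bsub>X\<^esub>"
    "\<And>v w v' w'. v \<in> carrier V \<Longrightarrow> w \<in> carrier W \<Longrightarrow> v' \<in> carrier V \<Longrightarrow> w' \<in> carrier W \<Longrightarrow>
      F (pure2 K V W (v \<otimes>\<^bsub>V\<^esub> v') (w \<otimes>\<^bsub>W\<^esub> w')) = F (pure2 K V W v w) \<otimes>\<^bsub>X\<^esub> F (pure2 K V W v' w')"
  shows "am K (tensor K V W) X F"
proof (rule amI)
  let ?T = "tensor K V W"
  have T: "k_algebra K ?T" by (rule k_algebra_tensor[OF assms(1,2)])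
  note m = k_algebra_module[OF assms(1)] k_algebra_module[OF assms(2)] k_algebra_module[OF assms(3)]
  show "k_algebra K ?T" "k_algebra K X" "lin K ?T X F" by fact+
  show "F \<one>\<^bsub>?T\<^esub> = \<one>\<^bsub>X\<^esub>" using assms by (simp add: one_tensor)
  fix x y assume x: "x \<in> carrier ?T" and y: "y \<in> carrier ?T"
  note l = lin_mult_left lin_mult_right lin_comp[OF assms(4)] lin_id T assms(3) module_tensor m
    lin_closed[OF assms(4)]
  show "F (x \<otimes>\<^bsub>?T\<^esub> y) = F x \<otimes>\<^bsub>X\<^esub> F y" using x
  proof (induct x rule: tensor_induct)
    case (pure v w)
    then have p: "pure2 K V W v w \<in> carrier ?T" using m by (simp add: pure2_closed)
    show ?case using y
    proof (induct y rule: tensor_induct)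
      case (pure v' w')
      show ?case using mult_pure[OF assms(1,2)] assms(6) pure \<open>v \<in> carrier V\<close> \<open>w \<in> carrier W\<close> by simp
    next
      case linP
      show ?case using p by - (rule linP_eq l | assumption)+
    qed fact+
  next
    case linP
    show ?case using y by - (rule linP_eq l | assumption)+
  qed fact+
qed

section \<open>Maps between tensor products\<close>

text \<open>With the spaces suppressed, \<open>tm2 g\<close> is \<open>id \<otimes> g\<close>, \<open>tm1 j\<close> is \<open>j \<otimes> id\<close>, and \<open>spl f\<close> is
  \<open>f \<otimes> id\<close> followed by rebracketing to the right; \<open>apd\<close> and \<open>snoc\<close> append a tensor factor on the right.\<close>

definition tm2 :: "'k ring \<Rightarrow> ('k, 'u) module \<Rightarrow> ('k, 'x) module \<Rightarrow> ('k, 'y) module \<Rightarrow> ('x \<Rightarrow> 'y) \<Rightarrow>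
    ('u \<times> 'x) list set \<Rightarrow> ('u \<times> 'y) list set"
  where "tm2 K U X Y g t = lift2 (tensor K U Y) t (\<lambda>u x. pure2 K U Y u (g x))"

definition tm1 :: "'k ring \<Rightarrow> ('k, 'u) module \<Rightarrow> ('k, 'y) module \<Rightarrow> ('k, 'x) module \<Rightarrow> ('u \<Rightarrow> 'y) \<Rightarrow>
    ('u \<times> 'x) list set \<Rightarrow> ('y \<times> 'x) list set"
  where "tm1 K U Y X j t = lift2 (tensor K Y X) t (\<lambda>u x. pure2 K Y X (j u) x)"

definition apd :: "'k ring \<Rightarrow> ('k, 'p) module \<Rightarrow> ('k, 'q) module \<Rightarrow> ('k, 'v) module \<Rightarrow>
    ('p \<times> 'q) list set \<Rightarrow> 'v \<Rightarrow> ('p \<times> ('q \<times> 'v) list set) list set"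
  where "apd K P Q V t v = lift2 (tensor3 K P Q V) t (\<lambda>p q. pure3 K P Q V p q v)"

definition spl :: "'k ring \<Rightarrow> ('k, 'u) module \<Rightarrow> ('k, 'p) module \<Rightarrow> ('k, 'q) module \<Rightarrow> ('k, 'v) module \<Rightarrow>
    ('u \<Rightarrow> ('p \<times> 'q) list set) \<Rightarrow> ('u \<times> 'v) list set \<Rightarrow> ('p \<times> ('q \<times> 'v) list set) list set"
  where "spl K U P Q V f t = lift2 (tensor3 K P Q V) t (\<lambda>u v. apd K P Q V (f u) v)"

definition snoc :: "'k ring \<Rightarrow> ('k, 'w) module \<Rightarrow> ('k, 'x) module \<Rightarrow> 'x \<Rightarrow> 'w \<Rightarrow> ('w \<times> 'x) list set"
  where "snoc K W X x w = pure2 K W X w x"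

lemma lin_tm2:
  assumes "lin K X Y g" "module K U"
  shows "lin K (tensor K U X) (tensor K U Y) (tm2 K U X Y g)"
  unfolding tm2_def using lin_module[OF assms(1)] assms
  by (intro lift2_lin bilinear_mapI lin_pure2_left lin_pure2_right module_tensor lin_id lin_closed[OF assms(1)])

lemma tm2_pure:
  assumes "lin K X Y g" "module K U" "u \<in> carrier U" "x \<in> carrier X"
  shows "tm2 K U X Y g (pure2 K U X u x) = pure2 K U Y u (g x)"
  unfolding tm2_def using lin_module[OF assms(1)] assms
  by (intro lift2_pure_lin lin_pure2_left lin_pure2_right module_tensor lin_id lin_closed[OF assms(1)])

lemma lin_tm1:
  assumes "lin K U Y j" "module K X"
  shows "lin K (tensor K U X) (tensor K Y X) (tm1 K U Y X j)"
  unfolding tm1_def using lin_module[OF assms(1)] assms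
  by (intro lift2_lin bilinear_mapI lin_pure2_left lin_pure2_right module_tensor lin_id lin_closed[OF assms(1)])

lemma tm1_pure:
  assumes "lin K U Y j" "module K X" "u \<in> carrier U" "x \<in> carrier X"
  shows "tm1 K U Y X j (pure2 K U X u x) = pure2 K Y X (j u) x"
  unfolding tm1_def using lin_module[OF assms(1)] assms
  by (intro lift2_pure_lin lin_pure2_left lin_pure2_right module_tensor lin_id lin_closed[OF assms(1)])

lemma lin_apd_left:
  assumes "module K P" "module K Q" "module K V" "lin K U (tensor K P Q) f" "v \<in> carrier V"
  shows "lin K U (tensor3 K P Q V) (\<lambda>u. apd K P Q V (f u) v)"
  unfolding apd_def using assms
  by - (rule lin_lift2_arg lin_pure2_left lin_pure2_right module_tensor lin_id pure2_closed | assumption)+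

lemma lin_apd_right:
  assumes "module K P" "module K Q" "lin K U V f" "t \<in> carrier (tensor K P Q)"
  shows "lin K U (tensor3 K P Q V) (\<lambda>u. apd K P Q V t (f u))"
  unfolding apd_def using assms lin_module[OF assms(3)]
  by (intro lin_lift2_body[where V = P and W = Q] lin_pure2_right module_tensor)

lemma apd_closed:
  assumes "module K P" "module K Q" "module K V" "t \<in> carrier (tensor K P Q)" "v \<in> carrier V"
  shows "apd K P Q V t v \<in> carrier (tensor3 K P Q V)"
  using lin_closed[OF lin_apd_right[OF assms(1,2) lin_id[OF assms(3)] assms(4)] assms(5)] .

lemma apd_pure:
  assumes "module K P" "module K Q" "module K V" "p \<in> carrier P" "q \<in> carrier Q" "v \<in> carrier V"
  shows "apd K P Q V (pure2 K P Q p q) v = pure3 K P Q V p q v"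
  unfolding apd_def using assms
  by (intro lift2_pure_lin lin_pure2_left lin_pure2_right module_tensor lin_id pure2_closed)

lemma lin_spl:
  assumes "lin K U (tensor K P Q) f" "module K P" "module K Q" "module K V"
  shows "lin K (tensor K U V) (tensor3 K P Q V) (spl K U P Q V f)"
  unfolding spl_def using lin_module[OF assms(1)] assms
  by (intro lift2_lin bilinear_mapI lin_apd_left lin_apd_right module_tensor lin_id lin_closed[OF assms(1)])

lemma spl_pure:
  assumes "lin K U (tensor K P Q) f" "module K P" "module K Q" "module K V" "u \<in> carrier U" "v \<in> carrier V"
  shows "spl K U P Q V f (pure2 K U V u v) = apd K P Q V (f u) v"
  unfolding spl_def using lin_module[OF assms(1)] assms
  by (intro lift2_pure_lin lin_apd_left lin_apd_right module_tensor lin_id lin_closed[OF assms(1)])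

lemma lin_snoc:
  assumes "module K W" "module K X" "x \<in> carrier X"
  shows "lin K W (tensor K W X) (snoc K W X x)"
  unfolding snoc_def using assms by (intro lin_pure2_left lin_id)

lemma lin_snoc_arg:
  assumes "module K W" "w \<in> carrier W" "lin K U X f"
  shows "lin K U (tensor K W X) (\<lambda>u. snoc K W X (f u) w)"
  unfolding snoc_def using assms by (intro lin_pure2_right)

text \<open>On a pure tensor \<open>spl\<close> is \<open>apd\<close> of the split first factor, so
  this law is exactly what makes \<open>spl\<close> of an algebra map an algebra map.\<close>

lemma apd_mult:
  assumes "k_algebra K P" "k_algebra K Q" "k_algebra K V" "s \<in> carrier (tensor K P Q)"
    "t \<in> carrier (tensor K P Q)" "v \<in> carrier V" "w \<in> carrier V"
  shows "apd K P Q V (s \<otimes>\<^bsub>tensor K P Q\<^esub> t) (v \<otimes>\<^bsub>V\<^esub> w) =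
    apd K P Q V s v \<otimes>\<^bsub>tensor3 K P Q V\<^esub> apd K P Q V t w"
proof -
  note m = assms(1-3)[THEN k_algebra_module]
  interpret V: k_algebra K V by fact
  interpret P: k_algebra K P by fact
  interpret Q: k_algebra K Q by fact
  note l = linP_eq lin_mult_left lin_mult_right lin_apd_left lin_apd_right lin_id k_algebra_tensor
    assms(1-3) module_tensor m apd_closed pure2_closed
  show ?thesis using assms(4)
  proof (induct s rule: tensor_induct)
    case (pure p q)
    note pq = pure
    show ?case using assms(5)
    proof (induct t rule: tensor_induct)
      case (pure p' q')
      show ?case using pure pq assms m
        by (simp add: mult_pure apd_pure k_algebra_tensor pure2_closed)
    next
      case linP
      show ?case using assms(6,7) pq by - (rule l V.A.m_closed | assumption)+
    qed (intro m)+
  next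
    case linP
    show ?case using assms(5-7) by - (rule l V.A.m_closed | assumption)+
  qed (intro m)+
qed

lemma am_tm2:
  assumes "am K X Y g" "k_algebra K U"
  shows "am K (tensor K U X) (tensor K U Y) (tm2 K U X Y g)"
proof -
  note a = am_algebra[OF assms(1)] assms(2) and g = am_lin[OF assms(1)]
  interpret X: k_algebra K X by (rule a)
  interpret U: k_algebra K U by (rule a)
  note m = a[THEN k_algebra_module]
  show ?thesis
    by (rule am_tensorI) (simp_all add: tm2_pure[OF g] lin_tm2[OF g] m a k_algebra_tensor
        am_one[OF assms(1)] one_tensor am_mult[OF assms(1)] mult_pure lin_closed[OF g])
qed

lemma am_tm1:
  assumes "am K U Y j" "k_algebra K X"
  shows "am K (tensor K U X) (tensor K Y X) (tm1 K U Y X j)"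
proof -
  note a = am_algebra[OF assms(1)] assms(2) and g = am_lin[OF assms(1)]
  interpret X: k_algebra K X by (rule a)
  interpret U: k_algebra K U by (rule a)
  note m = a[THEN k_algebra_module]
  show ?thesis
    by (rule am_tensorI) (simp_all add: tm1_pure[OF g] lin_tm1[OF g] m a k_algebra_tensor
        am_one[OF assms(1)] one_tensor am_mult[OF assms(1)] mult_pure lin_closed[OF g])
qed

lemma am_spl:
  assumes "am K U (tensor K P Q) f" "k_algebra K P" "k_algebra K Q" "k_algebra K V"
  shows "am K (tensor K U V) (tensor3 K P Q V) (spl K U P Q V f)"
proof -
  note a = am_algebra[OF assms(1)] assms(2-4) and g = am_lin[OF assms(1)]
  interpret P: k_algebra K P by (rule a)
  interpret Q: k_algebra K Q by (rule a)
  interpret U: k_algebra K U by (rule a)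
  interpret V: k_algebra K V by (rule a)
  note m = a[THEN k_algebra_module]
  show ?thesis
    by (rule am_tensorI) (simp_all add: spl_pure[OF g] lin_spl[OF g] m a k_algebra_tensor
        am_one[OF assms(1)] one_tensor am_mult[OF assms(1)] apd_mult apd_pure lin_closed[OF g])
qed

lemma am_snoc:
  assumes "k_algebra K W" "k_algebra K X"
  shows "am K W (tensor K W X) (snoc K W X \<one>\<^bsub>X\<^esub>)"
proof -
  interpret W: k_algebra K W by fact
  interpret X: k_algebra K X by fact
  show ?thesis using assms
    by (intro amI k_algebra_tensor lin_snoc k_algebra_module X.A.one_closed)
      (simp_all add: snoc_def one_tensor mult_pure)
qed

lemma am_cons:
  assumes "k_algebra K W" "k_algebra K X"
  shows "am K X (tensor K W X) (pure2 K W X \<one>\<^bsub>W\<^esub>)"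
proof -
  interpret W: k_algebra K W by fact
  interpret X: k_algebra K X by fact
  show ?thesis using assms
    by (intro amI k_algebra_tensor lin_pure2_right k_algebra_module W.A.one_closed lin_id)
      (simp_all add: one_tensor mult_pure)
qed

text \<open>A linear form is not an instance of \<open>lin\<close>: its target is the field
  \<open>K\<close>, a ring record without a scalar multiplication.\<close>

definition functional :: "'k ring \<Rightarrow> ('k, 'u) module \<Rightarrow> ('u \<Rightarrow> 'k) \<Rightarrow> bool"
  where "functional K U e \<longleftrightarrow> module K U \<and> (\<forall>x\<in>carrier U. e x \<in> carrier K) \<and>
    (\<forall>x\<in>carrier U. \<forall>y\<in>carrier U. e (x \<oplus>\<^bsub>U\<^esub> y) = e x \<oplus>\<^bsub>K\<^esub> e y) \<and>
    (\<forall>c\<in>carrier K. \<forall>x\<in>carrier U. e (c \<odot>\<^bsub>U\<^esub> x) = c \<otimes>\<^bsub>K\<^esub> e x)"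

lemma functional_closed: "functional K U e \<Longrightarrow> x \<in> carrier U \<Longrightarrow> e x \<in> carrier K"
  unfolding functional_def by auto

lemma lin_functional:
  assumes "functional K U e" "lin K V U f" "module K X" "c \<in> carrier X"
  shows "lin K V X (\<lambda>v. e (f v) \<odot>\<^bsub>X\<^esub> c)"
proof -
  interpret X: module K X by fact
  have "lin K U X (\<lambda>u. e u \<odot>\<^bsub>X\<^esub> c)"
    using assms(1,3,4) unfolding functional_def
    by (intro linI) (auto simp: X.smult_l_distr X.smult_assoc1)
  then show ?thesis by (rule lin_comp[OF _ assms(2)])
qed

lemma smult_closed: "module K X \<Longrightarrow> c \<in> carrier K \<Longrightarrow> x \<in> carrier X \<Longrightarrow> c \<odot>\<^bsub>X\<^esub> x \<in> carrier X"
  by (rule module.smult_closed)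

lemma lin_contract1_2:
  assumes "functional K U e" "module K U" "module K V"
  shows "lin K (tensor K U V) V (contract1_2 V e)"
  unfolding contract1_2_def using assms
  by (intro lift2_lin bilinear_mapI lin_functional[OF assms(1)] lin_smult_const lin_id functional_closed[OF assms(1)])

lemma contract1_2_pure:
  assumes "functional K U e" "module K U" "module K V" "u \<in> carrier U" "v \<in> carrier V"
  shows "contract1_2 V e (pure2 K U V u v) = e u \<odot>\<^bsub>V\<^esub> v"
  unfolding contract1_2_def using assms
  by (intro lift2_pure_lin lin_functional[OF assms(1)] lin_smult_const lin_id functional_closed[OF assms(1)])

lemma lin_contract2_2:
  assumes "functional K V e" "module K U" "module K V"
  shows "lin K (tensor K U V) U (contract2_2 U e)"
  unfolding contract2_2_def using assms
  by (intro lift2_lin bilinear_mapI lin_functional[OF assms(1)] lin_smult_const lin_id functional_closed[OF assms(1)])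

lemma contract2_2_pure:
  assumes "functional K V e" "module K U" "module K V" "u \<in> carrier U" "v \<in> carrier V"
  shows "contract2_2 U e (pure2 K U V u v) = e v \<odot>\<^bsub>U\<^esub> u"
  unfolding contract2_2_def using assms
  by (intro lift2_pure_lin lin_functional[OF assms(1)] lin_smult_const lin_id functional_closed[OF assms(1)])

definition character :: "'k ring \<Rightarrow> ('k, 'u) module \<Rightarrow> ('u \<Rightarrow> 'k) \<Rightarrow> bool"
  where "character K U e \<longleftrightarrow> k_algebra K U \<and> functional K U e \<and> e \<one>\<^bsub>U\<^esub> = \<one>\<^bsub>K\<^esub> \<and>
    (\<forall>x\<in>carrier U. \<forall>y\<in>carrier U. e (x \<otimes>\<^bsub>U\<^esub> y) = e x \<otimes>\<^bsub>K\<^esub> e y)"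

lemma smult_mult_smult:
  assumes "k_algebra K A" "c \<in> carrier K" "d \<in> carrier K" "x \<in> carrier A" "y \<in> carrier A"
  shows "(c \<otimes>\<^bsub>K\<^esub> d) \<odot>\<^bsub>A\<^esub> (x \<otimes>\<^bsub>A\<^esub> y) = (c \<odot>\<^bsub>A\<^esub> x) \<otimes>\<^bsub>A\<^esub> (d \<odot>\<^bsub>A\<^esub> y)"
proof -
  interpret A: k_algebra K A by fact
  have "(c \<odot>\<^bsub>A\<^esub> x) \<otimes>\<^bsub>A\<^esub> (d \<odot>\<^bsub>A\<^esub> y) = d \<odot>\<^bsub>A\<^esub> (c \<odot>\<^bsub>A\<^esub> (x \<otimes>\<^bsub>A\<^esub> y))"
    using assms(2-) by (simp add: A.smult_mult_left A.smult_mult_right)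
  also have "\<dots> = (d \<otimes>\<^bsub>K\<^esub> c) \<odot>\<^bsub>A\<^esub> (x \<otimes>\<^bsub>A\<^esub> y)"
    using assms(2-) by (simp add: A.smult_assoc1)
  finally show ?thesis using assms(2-) by (simp add: A.K.m_comm)
qed

lemma am_contract1_2:
  assumes "character K U e" "k_algebra K V"
  shows "am K (tensor K U V) V (contract1_2 V e)"
proof -
  have e: "functional K U e" and a: "k_algebra K U" using assms unfolding character_def by auto
  interpret U: k_algebra K U by (rule a)
  interpret V: k_algebra K V by fact
  show ?thesis
    by (rule am_tensorI)
      (use assms in \<open>simp_all add: a e lin_contract1_2 contract1_2_pure k_algebra_module
        character_def smult_mult_smult functional_closed[OF e]\<close>)
qed

lemma am_contract2_2:
  assumes "character K V e" "k_algebra K U"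
  shows "am K (tensor K U V) U (contract2_2 U e)"
proof -
  have e: "functional K V e" and a: "k_algebra K V" using assms unfolding character_def by auto
  interpret U: k_algebra K U by fact
  interpret V: k_algebra K V by (rule a)
  show ?thesis
    by (rule am_tensorI)
      (use assms in \<open>simp_all add: a e lin_contract2_2 contract2_2_pure k_algebra_module
        character_def smult_mult_smult functional_closed[OF e]\<close>)
qed

section \<open>The maps of the definitions\<close>

lemma split1_2_eq: "split1_2 K P Q V f t = spl K U P Q V f t"
  unfolding split1_2_def spl_def apd_def ..

text \<open>Expanding \<open>s\<close> into pure tensors and reassembling it changes nothing;
  \<open>h\<close> records the linear map applied to the reassembled tensor. In this way the
  Sweedler forms of the definitions contract to composed maps.\<close>

lemma lift2_pure2_right:
  assumes "module K U" "module K P" "module K Q" "u \<in> carrier U" "s \<in> carrier (tensor K P Q)"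
    "\<And>s. s \<in> carrier (tensor K P Q) \<Longrightarrow> h s \<in> carrier W" "lin K (tensor K P Q) W h"
  shows "lift2 (tensor K U W) s (\<lambda>p q. pure2 K U W u (h (pure2 K P Q p q))) = pure2 K U W u (h s)"
  using assms(5)
proof (induct s rule: tensor_induct)
  case linP
  show ?case
    by (rule linP_eq lin_lift2_arg lin_pure2_left lin_pure2_right module_tensor lin_id lin_comp[OF assms(7)]
        lin_module[OF assms(7)] assms(1-4) | assumption)+
next
  case (pure v w)
  show ?case
    by (rule lift2_pure_lin lin_pure2_left lin_pure2_right module_tensor lin_id lin_comp[OF assms(7)]
        lin_module[OF assms(7)] assms(1-4) pure | assumption)+
qed (intro assms)+

lemma split2_2_eq:
  assumes "lin K X (tensor K P Q) f" "module K U" "module K P" "module K Q" "t \<in> carrier (tensor K U X)"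
  shows "split2_2 K U P Q f t = tm2 K U X (tensor K P Q) f t"
  unfolding split2_2_def tm2_def using assms lin_closed[OF assms(1)]
  by (intro lift2_cong[OF assms(2) lin_module(1)[OF assms(1)] assms(5)] lift2_pure2_right
      [where h = "\<lambda>s. s"] lin_id module_tensor)

text \<open>The sums run first over \<open>s\<close> and then over \<open>t\<close>, whereas
  \<open>apd\<close> sums over \<open>t\<close> and keeps \<open>s\<close> whole. By linearity
  \<open>s\<close> may be assumed pure, and then there is nothing to exchange.\<close>

lemma lift2_apd:
  assumes "module K P" "module K Q" "module K V" "module K W" "s \<in> carrier (tensor K V W)"
    "t \<in> carrier (tensor K P Q)"
  shows "lift2 (tensor4 K P Q V W) s (\<lambda>v w. lift2 (tensor4 K P Q V W) t (\<lambda>p q. pure4 K P Q V W p q v w)) =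
    apd K P Q (tensor K V W) t s"
  using assms(5)
proof (induct s rule: tensor_induct)
  case linP
  show ?case
    by (rule linP_eq lin_lift2_arg lin_lift2_body lin_pure2_left lin_pure2_right lin_apd_right module_tensor lin_id
        pure2_closed assms | assumption)+
next
  case (pure v w)
  show ?case unfolding apd_def
    by (rule lift2_pure_lin lin_lift2_body lin_pure2_left lin_pure2_right module_tensor lin_id
        pure2_closed assms pure | assumption)+
qed (intro assms)+

lemma split1_3_eq:
  assumes "lin K U (tensor K P Q) f" "module K P" "module K Q" "module K V" "module K W"
    "t \<in> carrier (tensor3 K U V W)"
  shows "split1_3 K P Q V W f t = spl K U P Q (tensor K V W) f t"
  unfolding split1_3_def spl_def lift3_def using assms
  by (intro lift2_cong[OF lin_module(1)[OF assms(1)] module_tensor[OF assms(4,5)] assms(6)] lift2_apd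
      lin_closed[OF assms(1)])

lemma lift2_split:
  assumes "module K U" "lin K V (tensor K P Q) f" "module K P" "module K Q" "module K W" "u \<in> carrier U"
    "s \<in> carrier (tensor K V W)"
  shows "lift2 (tensor4 K U P Q W) s (\<lambda>v w. lift2 (tensor4 K U P Q W) (f v) (\<lambda>p q. pure4 K U P Q W u p q w)) =
    pure2 K U (tensor3 K P Q W) u (spl K V P Q W f s)"
  using assms(7)
proof (induct s rule: tensor_induct)
  case linP
  show ?case
    by (rule linP_eq lin_lift2_arg lin_lift2_body lin_pure2_left lin_pure2_right lin_comp[OF lin_spl]
        module_tensor lin_id pure2_closed lin_closed[OF assms(2)] lin_comp[OF assms(2)] lin_module(1)[OF assms(2)] assms | assumption)+
next
  case (pure v w)
  have "lift2 (tensor4 K U P Q W) (pure2 K V W v w) (\<lambda>v w. lift2 (tensor4 K U P Q W) (f v) (\<lambda>p q. pure4 K U P Q W u p q w))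
    = lift2 (tensor4 K U P Q W) (f v) (\<lambda>p q. pure4 K U P Q W u p q w)"
    by (rule lift2_pure_lin lin_lift2_arg lin_lift2_body lin_pure2_left lin_pure2_right
        module_tensor lin_id pure2_closed lin_closed[OF assms(2)] lin_comp[OF assms(2)] lin_module(1)[OF assms(2)] assms pure | assumption)+
  \<comment> \<open>Writing the integrand through \<open>apd\<close> gives it the shape required by
    \<open>lift2_pure2_right\<close>, with appending \<open>w\<close> as the linear map
    \<open>h\<close>.\<close>
  also have "\<dots> = lift2 (tensor4 K U P Q W) (f v) (\<lambda>p q. pure2 K U (tensor3 K P Q W) u (apd K P Q W (pure2 K P Q p q) w))"
    by (intro lift2_cong[where K = K and V = P and W = Q])
      (simp_all add: assms(1,3-6) lin_closed[OF assms(2)] pure apd_pure)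
  also have "\<dots> = pure2 K U (tensor3 K P Q W) u (apd K P Q W (f v) w)"
    by (rule lift2_pure2_right[where h = "\<lambda>s. apd K P Q W s w"]) (rule assms(1,3-6) apd_closed lin_apd_left pure lin_id lin_closed[OF assms(2)]
      module_tensor | assumption)+
  also have "\<dots> = pure2 K U (tensor3 K P Q W) u (spl K V P Q W f (pure2 K V W v w))"
    by (simp add: spl_pure[OF assms(2-5)] pure)
  finally show ?case .
qed (intro assms lin_module(1)[OF assms(2)])+

lemma split2_3_eq:
  assumes "lin K V (tensor K P Q) f" "module K U" "module K P" "module K Q" "module K W"
    "t \<in> carrier (tensor3 K U V W)"
  shows "split2_3 K U P Q W f t = tm2 K U (tensor K V W) (tensor3 K P Q W) (spl K V P Q W f) t"
  unfolding split2_3_def tm2_def lift3_def using assms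
  by (intro lift2_cong[OF assms(2) module_tensor[OF lin_module(1)[OF assms(1)] assms(5)] assms(6)] lift2_split)

lemma lift2_tm2:
  assumes "module K U" "lin K X Y f" "module K V" "u \<in> carrier U" "s \<in> carrier (tensor K V X)"
  shows "lift2 (tensor3 K U V Y) s (\<lambda>v w. pure3 K U V Y u v (f w)) = pure2 K U (tensor K V Y) u (tm2 K V X Y f s)"
  using assms(5)
proof (induct s rule: tensor_induct)
  case linP
  show ?case
    by (rule linP_eq lin_lift2_arg lin_pure2_left lin_pure2_right lin_comp[OF lin_tm2] module_tensor lin_id
        pure2_closed lin_closed[OF assms(2)] lin_comp[OF assms(2)] lin_module[OF assms(2)] assms | assumption)+
next
  case (pure v w)
  show ?case unfolding tm2_pure[OF assms(2,3) pure]
    by (rule lift2_pure_lin lin_pure2_left lin_pure2_right module_tensor lin_id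
        pure2_closed lin_closed[OF assms(2)] lin_comp[OF assms(2)] lin_module[OF assms(2)] assms pure | assumption)+
qed (intro assms lin_module[OF assms(2)])+

lemma split3_3_eq:
  assumes "lin K X (tensor K P Q) f" "module K U" "module K V" "module K P" "module K Q"
    "t \<in> carrier (tensor3 K U V X)"
  shows "split3_3 K U V P Q f t = tm2 K U (tensor K V X) (tensor3 K V P Q) (tm2 K V X (tensor K P Q) f) t"
proof -
  have "lift2 (tensor4 K U V P Q) (f w) (\<lambda>p q. pure4 K U V P Q u v p q) = pure3 K U V (tensor K P Q) u v (f w)"
    if "u \<in> carrier U" "v \<in> carrier V" "w \<in> carrier X" for u v w
    using that assms by (intro lift2_pure2_right[where h = "pure2 K V (tensor K P Q) v"] pure2_closed
        module_tensor lin_pure2_right lin_id lin_closed[OF assms(1)])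
  then have "lift2 (tensor4 K U V P Q) s (\<lambda>v w. lift2 (tensor4 K U V P Q) (f w) (\<lambda>p q. pure4 K U V P Q u v p q)) =
    pure2 K U (tensor3 K V P Q) u (tm2 K V X (tensor K P Q) f s)"
    if "u \<in> carrier U" "s \<in> carrier (tensor K V X)" for u s
    using that assms lin_module(1)[OF assms(1)]
    by (subst lift2_tm2[symmetric]) (simp_all, intro lift2_cong[where K = K and V = V and W = X], simp_all)
  then show ?thesis unfolding split3_3_def tm2_def[of K U] lift3_def
    by (intro lift2_cong[OF assms(2) module_tensor[OF assms(3) lin_module(1)[OF assms(1)]] assms(6)])
qed

lemma append_factor_eq:
  assumes "module K U" "module K V" "module K W" "module K X" "x \<in> carrier X" "t \<in> carrier (tensor3 K U V W)"
  shows "append_factor K U V W X t x =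
    tm2 K U (tensor K V W) (tensor3 K V W X) (tm2 K V W (tensor K W X) (snoc K W X x)) t"
  unfolding append_factor_def tm2_def[of K U] lift3_def
proof (rule lift2_cong[OF assms(1) module_tensor[OF assms(2,3)] assms(6)])
  fix u s assume "u \<in> carrier U" "s \<in> carrier (tensor K V W)"
  from lift2_tm2[OF assms(1) lin_snoc[OF assms(3-5)] assms(2) this]
  show "lift2 (tensor4 K U V W X) s (\<lambda>v w. pure4 K U V W X u v w x) =
      pure2 K U (tensor3 K V W X) u (tm2 K V W (tensor K W X) (snoc K W X x) s)"
    by (simp add: snoc_def)
qed

lemma contract1_3_eq:
  assumes "functional K U e" "module K V" "module K W" "t \<in> carrier (tensor3 K U V W)"
  shows "contract1_3 K V W e t = contract1_2 (tensor K V W) e t"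
  unfolding contract1_3_def contract1_2_def lift3_def
proof (rule lift2_cong[OF _ _ assms(4)])
  have U: "module K U" using assms(1) unfolding functional_def by blast
  then show "module K U" .
  show "module K (tensor K V W)" by (intro module_tensor assms)
  fix u s assume u: "u \<in> carrier U" and s: "s \<in> carrier (tensor K V W)"
  note eu = functional_closed[OF assms(1) u]
  show "lift2 (tensor K V W) s (\<lambda>v w. e u \<odot>\<^bsub>tensor K V W\<^esub> pure2 K V W v w) = e u \<odot>\<^bsub>tensor K V W\<^esub> s"
    using s
  proof (induct s rule: tensor_induct)
    case linP
    show ?case by (rule linP_eq lin_lift2_arg lin_smult_const lin_pure2_left lin_pure2_right module_tensor lin_id
          pure2_closed assms eu | assumption)+
  next
    case (pure v w)
    show ?case by (rule lift2_pure_lin lin_smult_const lin_pure2_left lin_pure2_right module_tensor lin_id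
          pure2_closed assms eu pure | assumption)+
  qed (intro assms)+
qed

lemma contract2_3_eq:
  assumes "module K U" "functional K V e" "module K W" "t \<in> carrier (tensor3 K U V W)"
  shows "contract2_3 K U W e t = tm2 K U (tensor K V W) W (contract1_2 W e) t"
  unfolding contract2_3_def tm2_def lift3_def
proof (rule lift2_cong[OF _ _ assms(4)])
  have V: "module K V" using assms(2) unfolding functional_def by blast
  show "module K U" "module K (tensor K V W)" by (intro module_tensor assms V)+
  fix u s assume u: "u \<in> carrier U" and s: "s \<in> carrier (tensor K V W)"
  note ec = functional_closed[OF assms(2)] and el = lin_functional[OF assms(2)]
  show "lift2 (tensor K U W) s (\<lambda>v w. e v \<odot>\<^bsub>tensor K U W\<^esub> pure2 K U W u w) = pure2 K U W u (contract1_2 W e s)"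
    using s
  proof (induct s rule: tensor_induct)
    case linP
    show ?case by (rule linP_eq lin_lift2_arg lin_smult_const lin_pure2_left lin_pure2_right
        lin_comp[OF lin_contract1_2[OF assms(2)]] el module_tensor lin_id
          pure2_closed assms ec V u | assumption)+
  next
    case (pure v w)
    have "lift2 (tensor K U W) (pure2 K V W v w) (\<lambda>v w. e v \<odot>\<^bsub>tensor K U W\<^esub> pure2 K U W u w) =
        e v \<odot>\<^bsub>tensor K U W\<^esub> pure2 K U W u w" by (rule lift2_pure_lin lin_smult_const lin_pure2_left lin_pure2_right el module_tensor lin_id
          pure2_closed assms ec V u pure | assumption)+
    also have "\<dots> = pure2 K U W u (e v \<odot>\<^bsub>W\<^esub> w)"
      using lin_smult[OF lin_pure2_right[OF assms(1) lin_id[OF assms(3)] u]] ec pure by simp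
    finally show ?case using contract1_2_pure[OF assms(2) V assms(3) pure] by simp
  qed (intro assms V)+
qed

lemma contract3_3_eq:
  assumes "module K U" "module K V" "functional K W e" "t \<in> carrier (tensor3 K U V W)"
  shows "contract3_3 K U V e t = tm2 K U (tensor K V W) V (contract2_2 V e) t"
  unfolding contract3_3_def tm2_def lift3_def
proof (rule lift2_cong[OF _ _ assms(4)])
  have W: "module K W" using assms(3) unfolding functional_def by blast
  show "module K U" "module K (tensor K V W)" by (intro module_tensor assms W)+
  fix u s assume u: "u \<in> carrier U" and s: "s \<in> carrier (tensor K V W)"
  note ec = functional_closed[OF assms(3)] and el = lin_functional[OF assms(3)]
  show "lift2 (tensor K U V) s (\<lambda>v w. e w \<odot>\<^bsub>tensor K U V\<^esub> pure2 K U V u v) = pure2 K U V u (contract2_2 V e s)"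
    using s
  proof (induct s rule: tensor_induct)
    case linP
    show ?case by (rule linP_eq lin_lift2_arg lin_smult_const lin_pure2_left lin_pure2_right
        lin_comp[OF lin_contract2_2[OF assms(3)]] el module_tensor lin_id
          pure2_closed assms ec W u | assumption)+
  next
    case (pure v w)
    have "lift2 (tensor K U V) (pure2 K V W v w) (\<lambda>v w. e w \<odot>\<^bsub>tensor K U V\<^esub> pure2 K U V u v) =
        e w \<odot>\<^bsub>tensor K U V\<^esub> pure2 K U V u v" by (rule lift2_pure_lin lin_smult_const lin_pure2_left lin_pure2_right el module_tensor lin_id
          pure2_closed assms ec W u pure | assumption)+
    also have "\<dots> = pure2 K U V u (e w \<odot>\<^bsub>V\<^esub> v)"
      using lin_smult[OF lin_pure2_right[OF assms(1) lin_id[OF assms(2)] u]] ec pure by simp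
    finally show ?case using contract2_2_pure[OF assms(3,2) W pure] by simp
  qed (intro assms W)+
qed

section \<open>Reassociators\<close>

text \<open>Four rearrangements of one pentagon, distinguished by the factors that stay uninverted:
  none; \<open>r\<close>; \<open>t\<close> and \<open>p\<close>; \<open>r\<close> and
  \<open>s\<close>. All four occur, because products and coactions of crossed products contain
  inverse reassociators, while \<Phi> acting on \<open>M\<close> from the left and the reassociators
  of the new coactions enter directly.\<close>

lemma (in monoid) pentagon_inverses:
  assumes u: "p \<in> Units G" "q \<in> Units G" "r \<in> Units G" "s \<in> Units G" "t \<in> Units G"
    and eq: "p \<otimes> q \<otimes> r = s \<otimes> t"
  shows "inv r \<otimes> inv q \<otimes> inv p = inv t \<otimes> inv s" "r \<otimes> inv t \<otimes> inv s = inv q \<otimes> inv p"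
    "t \<otimes> inv r \<otimes> inv q = inv s \<otimes> p" "inv q \<otimes> inv p \<otimes> s = r \<otimes> inv t"
proof -
  note c = u[THEN Units_closed] u[THEN Units_inv_closed]
  have inv_mult: "inv (x \<otimes> y) = inv y \<otimes> inv x" if "x \<in> Units G" "y \<in> Units G" for x y
    using that by (intro inv_unique'[symmetric]) (auto simp: m_assoc[symmetric] Units_closed,
      auto simp: m_assoc Units_closed)
  have cancel: "x \<otimes> (inv x \<otimes> y) = y" "inv x \<otimes> (x \<otimes> y) = y" if "x \<in> Units G" "y \<in> carrier G" for x y
    using that by (simp_all add: m_assoc[symmetric] Units_closed)
  have "inv (p \<otimes> q \<otimes> r) = inv r \<otimes> inv q \<otimes> inv p" using u c by (simp add: inv_mult m_assoc)
  moreover have "inv (s \<otimes> t) = inv t \<otimes> inv s" using u by (simp add: inv_mult)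
  ultimately show 1: "inv r \<otimes> inv q \<otimes> inv p = inv t \<otimes> inv s" using eq by simp
  have 2: "inv t \<otimes> inv s = inv r \<otimes> (inv q \<otimes> inv p)" using 1 c by (simp add: m_assoc)
  show 3: "r \<otimes> inv t \<otimes> inv s = inv q \<otimes> inv p" using c u by (simp add: m_assoc 2 cancel)
  have "t \<otimes> inv r \<otimes> inv q = t \<otimes> (inv r \<otimes> inv q \<otimes> inv p) \<otimes> p"
    using c u by (simp add: m_assoc)
  also have "\<dots> = inv s \<otimes> p" unfolding 1 using c u by (simp add: m_assoc cancel)
  finally show "t \<otimes> inv r \<otimes> inv q = inv s \<otimes> p" .
  show "inv q \<otimes> inv p \<otimes> s = r \<otimes> inv t" unfolding 3[symmetric] using c u by (simp add: m_assoc)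
qed

text \<open>Turns a quasi-coassociativity law, which is an intertwining relation for a reassociator,
  into one for its inverse, the element that occurs in the crossed product.\<close>

lemma (in monoid) intertwine_inv:
  assumes "p \<in> Units G" "x \<in> carrier G" "y \<in> carrier G" "p \<otimes> x = y \<otimes> p"
  shows "inv p \<otimes> y = x \<otimes> inv p"
proof -
  note c = assms(1)[THEN Units_closed] assms(1)[THEN Units_inv_closed]
  have "inv p \<otimes> y = inv p \<otimes> (y \<otimes> p) \<otimes> inv p" using assms c by (simp add: m_assoc)
  also have "\<dots> = (inv p \<otimes> p) \<otimes> x \<otimes> inv p" unfolding assms(4)[symmetric] using assms c by (simp only: m_assoc m_closed)
  finally show ?thesis using assms by simp
qed

text \<open>These are \<open>id \<otimes> id \<otimes> g\<close>, \<open>id \<otimes> f \<otimes> id\<close>, \<open>f \<otimes> id \<otimes> id\<close> and \<open>t \<mapsto> t \<otimes> 1\<close>.\<close>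

abbreviation id2 where
  "id2 K U V X Y g \<equiv> tm2 K U (tensor K V X) (tensor K V Y) (tm2 K V X Y g)"

abbreviation mid where
  "mid K U V P Q W f \<equiv> tm2 K U (tensor K V W) (tensor3 K P Q W) (spl K V P Q W f)"

abbreviation fst3 where
  "fst3 K U P Q V W f \<equiv> spl K U P Q (tensor K V W) f"

abbreviation app where
  "app K U V W X \<equiv> id2 K U V W (tensor K W X) (snoc K W X \<one>\<^bsub>X\<^esub>)"

lemma am_id2: "am K X Y g \<Longrightarrow> k_algebra K U \<Longrightarrow> k_algebra K V \<Longrightarrow>
    am K (tensor3 K U V X) (tensor3 K U V Y) (id2 K U V X Y g)"
  by (intro am_tm2)

lemma am_mid: "am K V (tensor K P Q) f \<Longrightarrow> k_algebra K U \<Longrightarrow> k_algebra K P \<Longrightarrow> k_algebra K Q \<Longrightarrow> k_algebra K W \<Longrightarrow>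
    am K (tensor3 K U V W) (tensor4 K U P Q W) (mid K U V P Q W f)"
  by (intro am_tm2 am_spl)

lemma am_fst3: "am K U (tensor K P Q) f \<Longrightarrow> k_algebra K P \<Longrightarrow> k_algebra K Q \<Longrightarrow> k_algebra K V \<Longrightarrow> k_algebra K W \<Longrightarrow>
    am K (tensor3 K U V W) (tensor4 K P Q V W) (fst3 K U P Q V W f)"
  by (intro am_spl k_algebra_tensor)

lemma am_app: "k_algebra K U \<Longrightarrow> k_algebra K V \<Longrightarrow> k_algebra K W \<Longrightarrow> k_algebra K X \<Longrightarrow>
    am K (tensor3 K U V W) (tensor4 K U V W X) (app K U V W X)"
  by (intro am_id2 am_snoc)

section \<open>Axioms restated for composite maps and inverse reassociators\<close>

context quasi_bialgebra
begin
abbreviation "HH \<equiv> tensor K H H"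
abbreviation "HHH \<equiv> tensor3 K H H H"

lemma Hh: "k_algebra K H" ..

lemma am_comult: "am K H HH \<Delta>"
  using comult_map am_iff[OF Hh k_algebra_tensor[OF Hh Hh]] by blast

lemma character_counit: "character K H \<epsilon>"
  using counit_hom counit_smult Hh H.module_axioms
  unfolding character_def functional_def ring_hom_def by auto

lemma functional_counit: "functional K H \<epsilon>"
  using character_counit unfolding character_def by blast

lemma counit_one: "\<epsilon> \<one>\<^bsub>H\<^esub> = \<one>\<^bsub>K\<^esub>"
  using character_counit unfolding character_def by blast

lemmas am_counit1 = am_contract1_2[OF character_counit]
  and am_counit2 = am_contract2_2[OF character_counit]

lemma reassoc_closed: "\<Phi> \<in> carrier HHH" "inv\<^bsub>HHH\<^esub> \<Phi> \<in> carrier HHH"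
proof -
  interpret T: monoid "HHH" by (intro k_algebra_monoid[where K = K] k_algebra_tensor Hh)
  show "\<Phi> \<in> carrier HHH" "inv\<^bsub>HHH\<^esub> \<Phi> \<in> carrier HHH"
    using reassoc_invertible by (auto intro: T.Units_closed)
qed

end

context right_comodule_algebra
begin
abbreviation "AH \<equiv> tensor K A H"
abbreviation "AHH \<equiv> tensor3 K A H H"
abbreviation "AHHH \<equiv> tensor4 K A H H H"

lemma Aa: "k_algebra K A" ..

lemma am_rho: "am K A AH rho"
  using coaction_map am_iff[OF Aa k_algebra_tensor[OF Aa Hh]] by blast

text \<open>The last two equations are axioms. Contracting with the counit is an algebra map, so it
  sends the inverse of \<open>\<Phi>r\<close> to the inverse of the unit, which gives the first
  two.\<close>

lemma counit_rho_inv: "tm2 K A HH H (contract1_2 H \<epsilon>) (inv\<^bsub>AHH\<^esub> \<Phi>r) = \<one>\<^bsub>AH\<^esub>"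
    "tm2 K A HH H (contract2_2 H \<epsilon>) (inv\<^bsub>AHH\<^esub> \<Phi>r) = \<one>\<^bsub>AH\<^esub>"
    "tm2 K A HH H (contract1_2 H \<epsilon>) \<Phi>r = \<one>\<^bsub>AH\<^esub>"
    "tm2 K A HH H (contract2_2 H \<epsilon>) \<Phi>r = \<one>\<^bsub>AH\<^esub>"
proof -
  interpret T: monoid "AHH" by (intro k_algebra_monoid[where K = K] k_algebra_tensor Hh Aa)
  interpret T': monoid "AH" by (intro k_algebra_monoid[where K = K] k_algebra_tensor Hh Aa)
  note c = T.Units_closed[OF coaction_reassoc_invertible]
  note u = am_Units(2)[OF am_tm2[OF am_counit1[OF Hh] Aa] coaction_reassoc_invertible]
    am_Units(2)[OF am_tm2[OF am_counit2[OF Hh] Aa] coaction_reassoc_invertible]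
  show e: "tm2 K A HH H (contract1_2 H \<epsilon>) \<Phi>r = \<one>\<^bsub>AH\<^esub>"
    "tm2 K A HH H (contract2_2 H \<epsilon>) \<Phi>r = \<one>\<^bsub>AH\<^esub>"
    using coaction_reassoc_counit_middle coaction_reassoc_counit_outer functional_counit c
      k_algebra_module[OF Hh] k_algebra_module[OF Aa]
    by (simp_all add: contract2_3_eq contract3_3_eq)
  show "tm2 K A HH H (contract1_2 H \<epsilon>) (inv\<^bsub>AHH\<^esub> \<Phi>r) = \<one>\<^bsub>AH\<^esub>"
    "tm2 K A HH H (contract2_2 H \<epsilon>) (inv\<^bsub>AHH\<^esub> \<Phi>r) = \<one>\<^bsub>AH\<^esub>"
    unfolding u e by simp_all
qed

lemma rho_reassoc_closed: "\<Phi>r \<in> carrier AHH" "inv\<^bsub>AHH\<^esub> \<Phi>r \<in> carrier AHH"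
proof -
  interpret T: monoid "AHH" by (intro k_algebra_monoid[where K = K] k_algebra_tensor Hh Aa)
  show "\<Phi>r \<in> carrier AHH" "inv\<^bsub>AHH\<^esub> \<Phi>r \<in> carrier AHH"
    using coaction_reassoc_invertible by (auto intro: T.Units_closed)
qed

lemma rho_coassoc:
  assumes "a \<in> carrier A"
  shows "\<Phi>r \<otimes>\<^bsub>AHH\<^esub> spl K A A H H rho (rho a) = tm2 K A H HH \<Delta> (rho a) \<otimes>\<^bsub>AHH\<^esub> \<Phi>r"
    and "inv\<^bsub>AHH\<^esub> \<Phi>r \<otimes>\<^bsub>AHH\<^esub> tm2 K A H HH \<Delta> (rho a) =
      spl K A A H H rho (rho a) \<otimes>\<^bsub>AHH\<^esub> inv\<^bsub>AHH\<^esub> \<Phi>r"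
proof -
  interpret T: monoid "AHH" by (intro k_algebra_monoid[where K = K] k_algebra_tensor Hh Aa)
  have ra: "rho a \<in> carrier AH" using am_closed[OF am_rho assms] .
  show e: "\<Phi>r \<otimes>\<^bsub>AHH\<^esub> spl K A A H H rho (rho a) = tm2 K A H HH \<Delta> (rho a) \<otimes>\<^bsub>AHH\<^esub> \<Phi>r"
    using coaction_quasi_coassoc[OF assms] split2_2_eq[OF am_lin[OF am_comult] _ _ _ ra]
      k_algebra_module[OF Hh] k_algebra_module[OF Aa] by (simp add: split1_2_eq[where U = A])
  show "inv\<^bsub>AHH\<^esub> \<Phi>r \<otimes>\<^bsub>AHH\<^esub> tm2 K A H HH \<Delta> (rho a) =
      spl K A A H H rho (rho a) \<otimes>\<^bsub>AHH\<^esub> inv\<^bsub>AHH\<^esub> \<Phi>r"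
    by (intro T.intertwine_inv coaction_reassoc_invertible e am_closed[OF am_spl[OF am_rho Aa Hh Hh] ra]
        am_closed[OF am_tm2[OF am_comult Aa] ra])
qed

text \<open>The form needed for associativity in the first factor: the product contains the inverse
  of \<open>\<Phi>r\<close>, and rebracketing in \<open>M\<close> lets the inverse of \<Phi> act
  from the right.\<close>

lemma rho_pentagon:
  defines "\<psi> \<equiv> inv\<^bsub>AHH\<^esub> \<Phi>r" and "T \<equiv> AHHH"
  shows "app K A H H H \<psi> \<otimes>\<^bsub>T\<^esub> mid K A H H H H \<Delta> \<psi> \<otimes>\<^bsub>T\<^esub> pure2 K A HHH \<one>\<^bsub>A\<^esub> (inv\<^bsub>HHH\<^esub> \<Phi>) =
    fst3 K A A H H H rho \<psi> \<otimes>\<^bsub>T\<^esub> id2 K A H H HH \<Delta> \<psi>"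
proof -
  interpret T: monoid T unfolding T_def by (intro k_algebra_monoid[where K = K] k_algebra_tensor Hh Aa)
  note m = k_algebra_module[OF Hh] k_algebra_module[OF Aa] rho_reassoc_closed(1)
  interpret H: monoid H by (intro k_algebra_monoid[where K = K] Hh)
  have e: "pure2 K A HHH \<one>\<^bsub>A\<^esub> \<Phi> \<otimes>\<^bsub>T\<^esub> mid K A H H H H \<Delta> \<Phi>r \<otimes>\<^bsub>T\<^esub> app K A H H H \<Phi>r =
     id2 K A H H HH \<Delta> \<Phi>r \<otimes>\<^bsub>T\<^esub> fst3 K A A H H H rho \<Phi>r"
    using coaction_pentagon m
    by (simp add: T_def split2_3_eq[OF am_lin[OF am_comult]] split3_3_eq[OF am_lin[OF am_comult]]
       split1_3_eq[OF am_lin[OF am_rho]] append_factor_eq)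
  note u = am_Units[OF am_cons[OF Aa k_algebra_tensor[OF Hh k_algebra_tensor[OF Hh Hh]]] reassoc_invertible]
     am_Units[OF am_mid[OF am_comult Aa Hh Hh Hh] coaction_reassoc_invertible]
     am_Units[OF am_app[OF Aa Hh Hh Hh] coaction_reassoc_invertible]
     am_Units[OF am_id2[OF am_comult Aa Hh] coaction_reassoc_invertible]
     am_Units[OF am_fst3[OF am_rho Aa Hh Hh Hh] coaction_reassoc_invertible]
  show ?thesis unfolding \<psi>_def u(2,4,6,8,10) T_def[symmetric]
    by (rule T.pentagon_inverses(1)) (use u e in \<open>simp_all add: T_def\<close>)
qed

end

context left_comodule_algebra
begin
abbreviation "HB \<equiv> tensor K H B"
abbreviation "HHB \<equiv> tensor3 K H H B"
abbreviation "HHHB \<equiv> tensor4 K H H H B"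

lemma Bb: "k_algebra K B" ..

lemma am_lam: "am K B HB lam"
  using coaction_map am_iff[OF Bb k_algebra_tensor[OF Hh Bb]] by blast

lemma lam_reassoc_closed: "\<Phi>l \<in> carrier HHB" "inv\<^bsub>HHB\<^esub> \<Phi>l \<in> carrier HHB"
proof -
  interpret T: monoid "HHB" by (intro k_algebra_monoid[where K = K] k_algebra_tensor Hh Bb)
  show "\<Phi>l \<in> carrier HHB" "inv\<^bsub>HHB\<^esub> \<Phi>l \<in> carrier HHB"
    using coaction_reassoc_invertible by (auto intro: T.Units_closed)
qed

lemma counit_lam_inv: "tm2 K H HB B (contract1_2 B \<epsilon>) (inv\<^bsub>HHB\<^esub> \<Phi>l) = \<one>\<^bsub>HB\<^esub>"
    "contract1_2 HB \<epsilon> (inv\<^bsub>HHB\<^esub> \<Phi>l) = \<one>\<^bsub>HB\<^esub>"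
    "tm2 K H HB B (contract1_2 B \<epsilon>) \<Phi>l = \<one>\<^bsub>HB\<^esub>"
    "contract1_2 HB \<epsilon> \<Phi>l = \<one>\<^bsub>HB\<^esub>"
proof -
  interpret T': monoid "HB" by (intro k_algebra_monoid[where K = K] k_algebra_tensor Hh Bb)
  note c = lam_reassoc_closed(1)
  note u = am_Units(2)[OF am_tm2[OF am_counit1[OF Bb] Hh] coaction_reassoc_invertible]
    am_Units(2)[OF am_counit1[OF k_algebra_tensor[OF Hh Bb]] coaction_reassoc_invertible]
  show e: "tm2 K H HB B (contract1_2 B \<epsilon>) \<Phi>l = \<one>\<^bsub>HB\<^esub>"
    "contract1_2 HB \<epsilon> \<Phi>l = \<one>\<^bsub>HB\<^esub>"
    using coaction_reassoc_counit_middle coaction_reassoc_counit_outer functional_counit c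
      k_algebra_module[OF Hh] k_algebra_module[OF Bb]
    by (simp_all add: contract2_3_eq contract1_3_eq)
  show "tm2 K H HB B (contract1_2 B \<epsilon>) (inv\<^bsub>HHB\<^esub> \<Phi>l) = \<one>\<^bsub>HB\<^esub>"
    "contract1_2 HB \<epsilon> (inv\<^bsub>HHB\<^esub> \<Phi>l) = \<one>\<^bsub>HB\<^esub>"
    unfolding u e by simp_all
qed

lemma lam_coassoc:
  assumes "b \<in> carrier B"
  shows "\<Phi>l \<otimes>\<^bsub>HHB\<^esub> spl K H H H B \<Delta> (lam b) = tm2 K H B HB lam (lam b) \<otimes>\<^bsub>HHB\<^esub> \<Phi>l"
    and "inv\<^bsub>HHB\<^esub> \<Phi>l \<otimes>\<^bsub>HHB\<^esub> tm2 K H B HB lam (lam b) =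
      spl K H H H B \<Delta> (lam b) \<otimes>\<^bsub>HHB\<^esub> inv\<^bsub>HHB\<^esub> \<Phi>l"
proof -
  interpret T: monoid "HHB" by (intro k_algebra_monoid[where K = K] k_algebra_tensor Hh Bb)
  have ra: "lam b \<in> carrier HB" using am_closed[OF am_lam assms] .
  show e: "\<Phi>l \<otimes>\<^bsub>HHB\<^esub> spl K H H H B \<Delta> (lam b) = tm2 K H B HB lam (lam b) \<otimes>\<^bsub>HHB\<^esub> \<Phi>l"
    using coaction_quasi_coassoc[OF assms] split2_2_eq[OF am_lin[OF am_lam] _ _ _ ra]
      k_algebra_module[OF Hh] k_algebra_module[OF Bb] by (simp add: split1_2_eq[where U = H])
  show "inv\<^bsub>HHB\<^esub> \<Phi>l \<otimes>\<^bsub>HHB\<^esub> tm2 K H B HB lam (lam b) =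
      spl K H H H B \<Delta> (lam b) \<otimes>\<^bsub>HHB\<^esub> inv\<^bsub>HHB\<^esub> \<Phi>l"
    by (intro T.intertwine_inv coaction_reassoc_invertible e am_closed[OF am_spl[OF am_comult Hh Hh Bb] ra]
        am_closed[OF am_tm2[OF am_lam Hh] ra])
qed

text \<open>In contrast to \<open>rho_pentagon\<close>, \<Phi> stays uninverted, because
  rebracketing in \<open>M\<close> lets \<Phi> itself act from the left.\<close>

lemma lam_pentagon:
  defines "\<psi> \<equiv> inv\<^bsub>HHB\<^esub> \<Phi>l" and "T \<equiv> HHHB"
  shows "app K H H H B \<Phi> \<otimes>\<^bsub>T\<^esub> fst3 K H H H H B \<Delta> \<psi> \<otimes>\<^bsub>T\<^esub> id2 K H H B HB lam \<psi> =
    mid K H H H H B \<Delta> \<psi> \<otimes>\<^bsub>T\<^esub> pure2 K H HHB \<one>\<^bsub>H\<^esub> \<psi>"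
proof -
  interpret T: monoid T unfolding T_def by (intro k_algebra_monoid[where K = K] k_algebra_tensor Hh Bb)
  note m = k_algebra_module[OF Hh] k_algebra_module[OF Bb] lam_reassoc_closed(1) reassoc_closed(1)
  interpret B: monoid B by (intro k_algebra_monoid[where K = K] Bb)
  have e: "pure2 K H HHB \<one>\<^bsub>H\<^esub> \<Phi>l \<otimes>\<^bsub>T\<^esub> mid K H H H H B \<Delta> \<Phi>l \<otimes>\<^bsub>T\<^esub> app K H H H B \<Phi> =
     id2 K H H B HB lam \<Phi>l \<otimes>\<^bsub>T\<^esub> fst3 K H H H H B \<Delta> \<Phi>l"
    using coaction_pentagon m
    by (simp add: T_def split2_3_eq[OF am_lin[OF am_comult]] split3_3_eq[OF am_lin[OF am_lam]]
       split1_3_eq[OF am_lin[OF am_comult]] append_factor_eq)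
  note u = am_Units[OF am_cons[OF Hh k_algebra_tensor[OF Hh k_algebra_tensor[OF Hh Bb]]] coaction_reassoc_invertible]
     am_Units[OF am_mid[OF am_comult Hh Hh Hh Bb] coaction_reassoc_invertible]
     am_Units[OF am_app[OF Hh Hh Hh Bb] reassoc_invertible]
     am_Units[OF am_id2[OF am_lam Hh Hh] coaction_reassoc_invertible]
     am_Units[OF am_fst3[OF am_comult Hh Hh Hh Bb] coaction_reassoc_invertible]
  show ?thesis unfolding \<psi>_def u(2,4,6,8,10) T_def[symmetric]
    by (rule T.pentagon_inverses(2)) (use u e in \<open>simp_all add: T_def\<close>)
qed

end

text \<open>This and the next lemmas are the monoid laws with \<open>k_algebra K A\<close> as a
  hypothesis, so that they apply to all iterated tensor products at once.\<close>

lemma alg_mult_closed: "k_algebra K A \<Longrightarrow> x \<in> carrier A \<Longrightarrow> y \<in> carrier A \<Longrightarrow> x \<otimes>\<^bsub>A\<^esub> y \<in> carrier A"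
  by (meson k_algebra_monoid monoid.m_closed)

lemma alg_one_closed: "k_algebra K A \<Longrightarrow> \<one>\<^bsub>A\<^esub> \<in> carrier A"
  by (meson k_algebra_monoid monoid.one_closed)

lemma alg_assoc: "k_algebra K A \<Longrightarrow> x \<in> carrier A \<Longrightarrow> y \<in> carrier A \<Longrightarrow> z \<in> carrier A \<Longrightarrow>
    x \<otimes>\<^bsub>A\<^esub> y \<otimes>\<^bsub>A\<^esub> z = x \<otimes>\<^bsub>A\<^esub> (y \<otimes>\<^bsub>A\<^esub> z)"
  by (meson k_algebra_monoid monoid.m_assoc)

lemma alg_one: assumes "k_algebra K A" "x \<in> carrier A"
  shows "\<one>\<^bsub>A\<^esub> \<otimes>\<^bsub>A\<^esub> x = x" "x \<otimes>\<^bsub>A\<^esub> \<one>\<^bsub>A\<^esub> = x"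
  using assms by (meson k_algebra_monoid monoid.l_one monoid.r_one)+

lemmas alg_tensor = alg_mult_closed[OF k_algebra_tensor] alg_one_closed[OF k_algebra_tensor]
  alg_assoc[OF k_algebra_tensor] alg_one[OF k_algebra_tensor]

lemma tm2_closed: "lin K X Y g \<Longrightarrow> module K U \<Longrightarrow> t \<in> carrier (tensor K U X) \<Longrightarrow>
    tm2 K U X Y g t \<in> carrier (tensor K U Y)"
  by (rule lin_closed[OF lin_tm2])

lemma tm1_closed: "lin K U Y j \<Longrightarrow> module K X \<Longrightarrow> t \<in> carrier (tensor K U X) \<Longrightarrow>
    tm1 K U Y X j t \<in> carrier (tensor K Y X)"
  by (rule lin_closed[OF lin_tm1])

lemma spl_closed: "lin K U (tensor K P Q) f \<Longrightarrow> module K P \<Longrightarrow> module K Q \<Longrightarrow> module K V \<Longrightarrow>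
    t \<in> carrier (tensor K U V) \<Longrightarrow> spl K U P Q V f t \<in> carrier (tensor3 K P Q V)"
  by (rule lin_closed[OF lin_spl])

lemmas lin_rules = linP_eq linP_ball lin_id lin_pure2_left lin_pure2_right lin_mult_left lin_mult_right
  lin_comp[OF lin_tm2] lin_comp[OF lin_tm1] lin_comp[OF lin_spl] lin_apd_left lin_apd_right
  lin_comp[OF lin_snoc] lin_snoc_arg lin_lift2_arg lin_lift2_body lin_smult_const

lemmas closed_rules = pure2_closed tm2_closed tm1_closed spl_closed apd_closed module_tensor k_algebra_tensor

section \<open>Two-sided actions on a bimodule algebra\<close>

context bimodule_algebra
begin

lemmas Mm = M.module_axioms
lemmas Hm = k_algebra_module[OF Hh]

text \<open>Makes \<open>M\<close> a left module over \<open>H\<close> tensored with its opposite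
  algebra (\<open>act_act\<close>), so that one action is tracked instead of two; \<open>la\<close>
  and \<open>ra\<close> are recovered by inserting the unit of \<open>H\<close>.\<close>

definition act :: "'h \<Rightarrow> 'm \<Rightarrow> 'h \<Rightarrow> 'm" where "act h x k = ra (la h x) k"

lemmas la_lin = bilinear_lin[OF la_bilinear Hm Mm Mm]
lemmas ra_lin = bilinear_lin[OF ra_bilinear Mm Hm Mm]
lemmas mult_lin = bilinear_lin[OF M_mult_bilinear Mm Mm Mm]

lemma la_closed: "h \<in> carrier H \<Longrightarrow> x \<in> carrier M \<Longrightarrow> la h x \<in> carrier M"
  by (rule lin_closed[OF la_lin(2)])

lemma ra_closed: "h \<in> carrier H \<Longrightarrow> x \<in> carrier M \<Longrightarrow> ra x h \<in> carrier M"
  by (rule lin_closed[OF ra_lin(1)])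

lemma mult_closed: "x \<in> carrier M \<Longrightarrow> y \<in> carrier M \<Longrightarrow> x \<otimes>\<^bsub>M\<^esub> y \<in> carrier M"
  by (rule lin_closed[OF mult_lin(1)])

lemma lin_M_mult:
  "lin K V M f \<Longrightarrow> y \<in> carrier M \<Longrightarrow> lin K V M (\<lambda>v. f v \<otimes>\<^bsub>M\<^esub> y)"
  "lin K V M f \<Longrightarrow> y \<in> carrier M \<Longrightarrow> lin K V M (\<lambda>v. y \<otimes>\<^bsub>M\<^esub> f v)"
  by (rule lin_comp[OF mult_lin(1)] lin_comp[OF mult_lin(2)]; assumption)+

lemma act_closed: "h \<in> carrier H \<Longrightarrow> k \<in> carrier H \<Longrightarrow> x \<in> carrier M \<Longrightarrow> act h x k \<in> carrier M"
  by (simp add: act_def la_closed ra_closed)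

lemma lin_act:
  "lin K V H f \<Longrightarrow> x \<in> carrier M \<Longrightarrow> k \<in> carrier H \<Longrightarrow> lin K V M (\<lambda>v. act (f v) x k)"
  "h \<in> carrier H \<Longrightarrow> lin K V M g \<Longrightarrow> k \<in> carrier H \<Longrightarrow> lin K V M (\<lambda>v. act h (g v) k)"
  "h \<in> carrier H \<Longrightarrow> x \<in> carrier M \<Longrightarrow> lin K V H f \<Longrightarrow> lin K V M (\<lambda>v. act h x (f v))"
  unfolding act_def
  by (rule lin_comp[OF ra_lin(1)] lin_comp[OF ra_lin(2)] lin_comp[OF la_lin(1)] lin_comp[OF la_lin(2)]
      la_closed | assumption)+

lemma act_act: "h \<in> carrier H \<Longrightarrow> k \<in> carrier H \<Longrightarrow> h' \<in> carrier H \<Longrightarrow> k' \<in> carrier H \<Longrightarrow> x \<in> carrier M \<Longrightarrow>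
   act h (act h' x k') k = act (h \<otimes>\<^bsub>H\<^esub> h') x (k' \<otimes>\<^bsub>H\<^esub> k)"
  by (simp add: act_def la_mult ra_mult la_ra la_closed ra_closed)

lemma act_one: "x \<in> carrier M \<Longrightarrow> act \<one>\<^bsub>H\<^esub> x \<one>\<^bsub>H\<^esub> = x"
  by (simp add: act_def la_one ra_one)

lemma la_act: "h \<in> carrier H \<Longrightarrow> x \<in> carrier M \<Longrightarrow> la h x = act h x \<one>\<^bsub>H\<^esub>"
  by (simp add: act_def ra_one la_closed)

lemma ra_act: "h \<in> carrier H \<Longrightarrow> x \<in> carrier M \<Longrightarrow> ra x h = act \<one>\<^bsub>H\<^esub> x h"
  by (simp add: act_def la_one)

lemma act_M_one:
  assumes "h \<in> carrier H" "k \<in> carrier H"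
  shows "act h \<one>\<^bsub>M\<^esub> k = (\<epsilon> h \<otimes>\<^bsub>K\<^esub> \<epsilon> k) \<odot>\<^bsub>M\<^esub> \<one>\<^bsub>M\<^esub>"
proof -
  note e = functional_closed[OF functional_counit]
  have "act h \<one>\<^bsub>M\<^esub> k = \<epsilon> h \<odot>\<^bsub>M\<^esub> ra \<one>\<^bsub>M\<^esub> k"
    using assms M_one_closed by (simp add: act_def la_M_one lin_smult[OF ra_lin(1)] e)
  then show ?thesis using assms M_one_closed by (simp add: ra_M_one M.smult_assoc1 e)
qed

text \<open>In \<open>N2\<close>, \<open>N3\<close> and the maps built from them, the first tensor acts from the right and the second
  one from the left.\<close>

definition N2 where "N2 x y s t = lift2 M t (\<lambda>h h'. lift2 M s (\<lambda>k k'. act h x k \<otimes>\<^bsub>M\<^esub> act h' y k'))"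

definition N3 where "N3 x y z s t = lift3 M t (\<lambda>h h' h''. lift3 M s (\<lambda>k k' k''.
  act h x k \<otimes>\<^bsub>M\<^esub> (act h' y k' \<otimes>\<^bsub>M\<^esub> act h'' z k'')))"

lemmas M_lin = lin_M_mult lin_act
lemmas M_closed = mult_closed act_closed Mm Hm Hh

lemma lin_N2:
  assumes "x \<in> carrier M" "y \<in> carrier M" "t \<in> carrier HH"
  shows "lin K U HH f \<Longrightarrow> lin K U M (\<lambda>u. N2 x y (f u) t)"
    "lin K U HH f \<Longrightarrow> lin K U M (\<lambda>u. N2 x y t (f u))"
  unfolding N2_def using assms lin_module
  by - (rule lin_rules closed_rules M_lin M_closed | assumption | (rule lin_module, assumption))+

lemma N2_pure:
  assumes "x \<in> carrier M" "y \<in> carrier M" "h \<in> carrier H" "h' \<in> carrier H" "k \<in> carrier H" "k' \<in> carrier H"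
  shows "N2 x y (pure2 K H H k k') (pure2 K H H h h') = act h x k \<otimes>\<^bsub>M\<^esub> act h' y k'"
  unfolding N2_def using assms
  by - (rule HOL.refl | rule HOL.trans[OF lift2_pure_lin] lin_rules closed_rules M_lin M_closed | assumption)+

lemma lin_N3:
  assumes "x \<in> carrier M" "y \<in> carrier M" "z \<in> carrier M" "t \<in> carrier HHH"
  shows "lin K U HHH f \<Longrightarrow> lin K U M (\<lambda>u. N3 x y z (f u) t)"
    "lin K U HHH f \<Longrightarrow> lin K U M (\<lambda>u. N3 x y z t (f u))"
  unfolding N3_def lift3_def using assms
  by - (rule lin_rules closed_rules M_lin M_closed | assumption | (rule lin_module, assumption))+

lemma N3_pure:
  assumes "x \<in> carrier M" "y \<in> carrier M" "z \<in> carrier M" "h \<in> carrier H" "h' \<in> carrier H" "h'' \<in> carrier H"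
    "k \<in> carrier H" "k' \<in> carrier H" "k'' \<in> carrier H"
  shows "N3 x y z (pure3 K H H H k k' k'') (pure3 K H H H h h' h'') =
    act h x k \<otimes>\<^bsub>M\<^esub> (act h' y k' \<otimes>\<^bsub>M\<^esub> act h'' z k'')"
  unfolding N3_def lift3_def using assms
  by - (rule HOL.refl | rule HOL.trans[OF lift2_pure_lin] lin_rules closed_rules M_lin M_closed | assumption)+

lemma act_mult:
  assumes "x \<in> carrier M" "y \<in> carrier M" "h \<in> carrier H" "k \<in> carrier H"
  shows "act h (x \<otimes>\<^bsub>M\<^esub> y) k = N2 x y (\<Delta> k) (\<Delta> h)"
proof -
  note Dk = am_closed[OF am_comult]
  \<comment> \<open>The tensor \<open>t\<close> stands for \<Delta> of \<open>h\<close>. Only this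
    coproduct is generalised; that of \<open>k\<close> appears through \<open>ra_M_mult\<close> once
    \<open>t\<close> is pure.\<close>
  have "ra (lift2 M t (\<lambda>h1 h2. la h1 x \<otimes>\<^bsub>M\<^esub> la h2 y)) k = N2 x y (\<Delta> k) t" if "t \<in> carrier HH" for t
    using that
  proof (induct t rule: tensor_induct)
    case linP
    show ?case using assms Dk
      by - (rule linP_eq lin_comp[OF ra_lin(1)] lin_N2 lin_comp[OF la_lin(1)] lin_rules closed_rules M_lin M_closed la_closed | assumption)+
  next
    case (pure h1 h2)
    have "lift2 M (pure2 K H H h1 h2) (\<lambda>h1 h2. la h1 x \<otimes>\<^bsub>M\<^esub> la h2 y) = la h1 x \<otimes>\<^bsub>M\<^esub> la h2 y"
      using assms pure
      by - (rule lift2_pure_lin lin_rules lin_comp[OF la_lin(1)] closed_rules M_lin M_closed la_closed | assumption)+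
    moreover have "N2 x y (\<Delta> k) (pure2 K H H h1 h2) = lift2 M (\<Delta> k) (\<lambda>k k'. act h1 x k \<otimes>\<^bsub>M\<^esub> act h2 y k')"
      unfolding N2_def using assms pure Dk[OF assms(4)]
      by - (rule lift2_pure_lin lin_rules closed_rules M_lin M_closed | assumption)+
    ultimately show ?case using assms pure by (simp add: ra_M_mult la_closed act_def)
  qed (rule Hm)+
  then show ?thesis using assms Dk by (simp add: act_def la_M_mult)
qed

lemma M_assoc:
  assumes "x \<in> carrier M" "y \<in> carrier M" "z \<in> carrier M"
  shows "x \<otimes>\<^bsub>M\<^esub> y \<otimes>\<^bsub>M\<^esub> z = N3 x y z (inv\<^bsub>HHH\<^esub> \<Phi>) \<Phi>"
  unfolding N3_def act_def by (rule M_quasi_assoc[OF assms])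

text \<open>By \<open>act_act\<close> an inner right action multiplies from the left and an inner
  left action from the right; hence the opposite positions of the two pure tensors.\<close>

lemma N3_act:
  assumes "x \<in> carrier M" "y \<in> carrier M" "z \<in> carrier M"
    "l \<in> carrier H" "l' \<in> carrier H" "l'' \<in> carrier H" "r \<in> carrier H" "r' \<in> carrier H" "r'' \<in> carrier H"
    "s \<in> carrier HHH" "t \<in> carrier HHH"
  shows "N3 (act l x r) (act l' y r') (act l'' z r'') s t =
    N3 x y z (pure3 K H H H r r' r'' \<otimes>\<^bsub>HHH\<^esub> s) (t \<otimes>\<^bsub>HHH\<^esub> pure3 K H H H l l' l'')"
  using assms(10)
proof (induct s rule: tensor3_induct)
  case linP
  show ?case using assms by - (rule linP_eq lin_N3 lin_rules closed_rules M_lin M_closed alg_tensor | assumption)+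
next
  case (pure k k' k'')
  note kk = pure
  show ?case using assms(11)
  proof (induct t rule: tensor3_induct)
    case linP
    show ?case using assms kk by - (rule linP_eq lin_N3 lin_rules closed_rules M_lin M_closed alg_tensor | assumption)+
  next
    case (pure h h' h'')
    show ?case using pure kk assms
      by (simp add: mult_pure pure2_closed N3_pure Hh Hm act_closed act_act alg_mult_closed[OF Hh] k_algebra_tensor)
  qed (rule Hm)+
qed (rule Hm)+

end

lemma snoc_apply: "w \<in> carrier W \<Longrightarrow> snoc K W X x w = pure2 K W X w x"
  by (simp add: snoc_def)

text \<open>Companion of \<open>mult_pure\<close> for right-nested products: it merges two pure
  factors at the head of a longer product.\<close>

lemma mult_pure_assoc:
  fixes K :: "'k ring"
  assumes "k_algebra K V" "k_algebra K W" "v \<in> carrier V" "w \<in> carrier W" "v' \<in> carrier V" "w' \<in> carrier W"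
    "t \<in> carrier (tensor K V W)"
  shows "pure2 K V W v w \<otimes>\<^bsub>tensor K V W\<^esub> (pure2 K V W v' w' \<otimes>\<^bsub>tensor K V W\<^esub> t) =
    pure2 K V W (v \<otimes>\<^bsub>V\<^esub> v') (w \<otimes>\<^bsub>W\<^esub> w') \<otimes>\<^bsub>tensor K V W\<^esub> t"
  using assms k_algebra_module[OF assms(1)] k_algebra_module[OF assms(2)]
  by (simp add: alg_tensor(3)[symmetric] pure2_closed mult_pure)

lemma apd_snoc:
  fixes K :: "'k ring"
  assumes "module K P" "module K Q" "module K V" "t \<in> carrier (tensor K P Q)" "v \<in> carrier V"
  shows "apd K P Q V t v = tm2 K P Q (tensor K Q V) (snoc K Q V v) t"
  using assms(4)
proof (induct t rule: tensor_induct)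
  case linP
  show ?case using assms by - (rule lin_rules closed_rules | assumption)+
next
  case (pure p q)
  then show ?case using assms by (simp add: apd_pure tm2_pure lin_snoc snoc_apply)
qed (rule assms)+

lemma pure2_smult:
  fixes K :: "'k ring"
  assumes "module K V" "module K W" "c \<in> carrier K" "v \<in> carrier V" "w \<in> carrier W"
  shows "pure2 K V W (c \<odot>\<^bsub>V\<^esub> v) w = c \<odot>\<^bsub>tensor K V W\<^esub> pure2 K V W v w"
    "pure2 K V W v (c \<odot>\<^bsub>W\<^esub> w) = c \<odot>\<^bsub>tensor K V W\<^esub> pure2 K V W v w"
  using assms lin_smult[OF lin_pure2_left[OF assms(2) lin_id[OF assms(1)] assms(5)]]
    lin_smult[OF lin_pure2_right[OF assms(1) lin_id[OF assms(2)] assms(4)]] by simp_all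

text \<open>Naturality of appending a fixed last factor. It lifts identities between threefold
  tensors, such as quasi-coassociativity, to the fourfold tensors in which pentagons live.\<close>

lemma snoc_maps:
  fixes K :: "'k ring"
  assumes "module K U" "module K V" "module K W" "w \<in> carrier W" "t \<in> carrier (tensor K U V)"
  shows "module K X \<Longrightarrow> x \<in> carrier X \<Longrightarrow>
      id2 K U V W (tensor K W X) (snoc K W X x) (tm2 K U V (tensor K V W) (snoc K V W w) t) = apd K U V (tensor K W X) t (pure2 K W X w x)"
    "module K P \<Longrightarrow> module K Q \<Longrightarrow> lin K V (tensor K P Q) f \<Longrightarrow>
      mid K U V P Q W f (tm2 K U V (tensor K V W) (snoc K V W w) t) = id2 K U P Q (tensor K Q W) (snoc K Q W w) (tm2 K U V (tensor K P Q) f t)"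
    "module K P \<Longrightarrow> module K Q \<Longrightarrow> lin K U (tensor K P Q) g \<Longrightarrow>
      fst3 K U P Q V W g (tm2 K U V (tensor K V W) (snoc K V W w) t) = id2 K P Q V (tensor K V W) (snoc K V W w) (spl K U P Q V g t)"
proof -
  note l = linP_eq lin_rules lin_tm2 lin_spl lin_snoc closed_rules assms(1-4)
  note simps = assms(1-4) tm2_pure spl_pure apd_pure lin_tm2 lin_spl lin_snoc snoc_apply pure2_closed module_tensor lin_closed
  show "id2 K U V W (tensor K W X) (snoc K W X x) (tm2 K U V (tensor K V W) (snoc K V W w) t) = apd K U V (tensor K W X) t (pure2 K W X w x)"
    if "module K X" "x \<in> carrier X" using assms(5)
  proof (induct t rule: tensor_induct)
    case linP show ?case using that by - (rule l | assumption)+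
  qed (simp_all add: simps that)
  show "mid K U V P Q W f (tm2 K U V (tensor K V W) (snoc K V W w) t) = id2 K U P Q (tensor K Q W) (snoc K Q W w) (tm2 K U V (tensor K P Q) f t)"
    if "module K P" "module K Q" "lin K V (tensor K P Q) f" using assms(5)
  proof (induct t rule: tensor_induct)
    case linP show ?case using that by - (rule l lin_comp[OF that(3)] | assumption)+
  qed (simp_all add: simps that lin_closed[OF that(3)] apd_snoc)
  show "fst3 K U P Q V W g (tm2 K U V (tensor K V W) (snoc K V W w) t) = id2 K P Q V (tensor K V W) (snoc K V W w) (spl K U P Q V g t)"
    if "module K P" "module K Q" "lin K U (tensor K P Q) g" using assms(5)
  proof (induct t rule: tensor_induct)
    case linP show ?case using that by - (rule l lin_comp[OF that(3)] | assumption)+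
  next
    case (pure u v)
    have "apd K P Q (tensor K V W) s (pure2 K V W v w) = id2 K P Q V (tensor K V W) (snoc K V W w) (apd K P Q V s v)"
      if "s \<in> carrier (tensor K P Q)" for s using that
    proof (induct s rule: tensor_induct)
      case linP show ?case using \<open>module K P\<close> \<open>module K Q\<close> pure by - (rule l | assumption)+
    qed (simp_all add: simps pure \<open>module K P\<close> \<open>module K Q\<close>)
    then show ?case using pure that by (simp add: simps lin_closed[OF that(3)])
  qed (rule assms)+
qed

text \<open>Appending \<open>x\<close> is in general not multiplicative, but in a product the
  appended factor may be placed wholly on the right, the left factor receiving the unit.\<close>

lemma id2_snoc_mult:
  assumes "k_algebra K U" "k_algebra K V" "k_algebra K W" "k_algebra K X" "x \<in> carrier X"
    "s \<in> carrier (tensor3 K U V W)" "t \<in> carrier (tensor3 K U V W)"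
  shows "id2 K U V W (tensor K W X) (snoc K W X x) (s \<otimes>\<^bsub>tensor3 K U V W\<^esub> t) =
    app K U V W X s \<otimes>\<^bsub>tensor4 K U V W X\<^esub> id2 K U V W (tensor K W X) (snoc K W X x) t"
proof -
  note m = assms(1-4) assms(1-4)[THEN k_algebra_module] assms(1-4)[THEN alg_one_closed] assms(1-4)[THEN alg_mult_closed] assms(5)
  note l = linP_eq lin_rules lin_tm2 lin_snoc closed_rules m alg_tensor(1,2)
  show ?thesis using assms(6)
  proof (induct s rule: tensor3_induct)
    case linP show ?case using assms(7) by - (rule l | assumption)+
  next
    case (pure u v w)
    note 1 = pure
    show ?case using assms(7)
    proof (induct t rule: tensor3_induct)
      case linP show ?case using 1 by - (rule l | assumption)+
    qed (simp_all add: 1 m mult_pure pure2_closed module_tensor k_algebra_tensor tm2_pure lin_tm2 lin_snoc snoc_apply alg_one[OF assms(4)])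
  qed (rule m)+
qed

text \<open>A crossed product is a tensor product record with a new multiplication and unit. Since
  \<open>module\<close> constrains neither, the vector space structure carries over.\<close>

lemma (in module) module_vs_cong:
  assumes "carrier M' = carrier M" "add M' = add M" "zero M' = zero M" "smult M' = smult M"
  shows "module R M'"
proof (rule moduleI)
  show "cring R" by (rule R.is_cring)
  show "abelian_group M'"
    by (rule abelian_groupI) (use M.add.l_inv_ex in \<open>simp_all add: assms M.a_ac M.add.m_assoc\<close>)
qed (simp_all add: assms smult_l_distr smult_r_distr smult_assoc1)

section \<open>Products of pure elements expressed through acting tensors\<close>

context bimodule_algebra
begin

text \<open>\<open>G1\<close> and \<open>G3\<close> are the analogues of \<open>G\<close> for one and three elements of \<open>M\<close>; they give the products
  with a pure element whose middle factor is \<open>1\<close> and the triple products.\<close>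

definition G where "G A B x y R L = lift3 (tensor3 K A M B) R (\<lambda>a p q. lift3 (tensor3 K A M B) L (\<lambda>p' q' b.
  pure3 K A M B a (act p' x p \<otimes>\<^bsub>M\<^esub> act q' y q) b))"

definition G1 where "G1 A B x R L = lift2 (tensor3 K A M B) R (\<lambda>a p. lift2 (tensor3 K A M B) L (\<lambda>p' b.
  pure3 K A M B a (act p' x p) b))"

definition G3 where "G3 A B x y z R L =
  lift2 (tensor3 K A M B) R (\<lambda>a s. lift3 (tensor3 K A M B) s (\<lambda>p q r.
  lift3 (tensor3 K A M B) L (\<lambda>p' q' t. lift2 (tensor3 K A M B) t (\<lambda>r' b.
  pure3 K A M B a (act p' x p \<otimes>\<^bsub>M\<^esub> (act q' y q \<otimes>\<^bsub>M\<^esub> act r' z r)) b))))"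

lemma lin_G:
  assumes "module K A" "module K B"
  shows "x \<in> carrier M \<Longrightarrow> y \<in> carrier M \<Longrightarrow> L \<in> carrier (tensor3 K H H B) \<Longrightarrow>
      lin K U (tensor3 K A H H) f \<Longrightarrow> lin K U (tensor3 K A M B) (\<lambda>u. G A B x y (f u) L)"
    "x \<in> carrier M \<Longrightarrow> y \<in> carrier M \<Longrightarrow> R \<in> carrier (tensor3 K A H H) \<Longrightarrow>
      lin K U (tensor3 K H H B) g \<Longrightarrow> lin K U (tensor3 K A M B) (\<lambda>u. G A B x y R (g u))"
    "y \<in> carrier M \<Longrightarrow> R \<in> carrier (tensor3 K A H H) \<Longrightarrow> L \<in> carrier (tensor3 K H H B) \<Longrightarrow>
      lin K U M h \<Longrightarrow> lin K U (tensor3 K A M B) (\<lambda>u. G A B (h u) y R L)"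
    "x \<in> carrier M \<Longrightarrow> R \<in> carrier (tensor3 K A H H) \<Longrightarrow> L \<in> carrier (tensor3 K H H B) \<Longrightarrow>
      lin K U M h \<Longrightarrow> lin K U (tensor3 K A M B) (\<lambda>u. G A B x (h u) R L)"
  unfolding G_def lift3_def using assms lin_module
  by - (rule lin_rules closed_rules M_lin M_closed | assumption | (rule lin_module, assumption))+

lemma G_pure:
  assumes "module K A" "module K B" "x \<in> carrier M" "y \<in> carrier M" "a \<in> carrier A" "p \<in> carrier H" "q \<in> carrier H"
    "p' \<in> carrier H" "q' \<in> carrier H" "b \<in> carrier B"
  shows "G A B x y (pure3 K A H H a p q) (pure3 K H H B p' q' b) =
    pure3 K A M B a (act p' x p \<otimes>\<^bsub>M\<^esub> act q' y q) b"
  unfolding G_def lift3_def using assms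
  by - (rule HOL.refl | rule HOL.trans[OF lift2_pure_lin] lin_rules closed_rules M_lin M_closed | assumption)+

lemma lin_G1:
  assumes "module K A" "module K B"
  shows "x \<in> carrier M \<Longrightarrow> L \<in> carrier (tensor K H B) \<Longrightarrow>
      lin K U (tensor K A H) f \<Longrightarrow> lin K U (tensor3 K A M B) (\<lambda>u. G1 A B x (f u) L)"
    "x \<in> carrier M \<Longrightarrow> R \<in> carrier (tensor K A H) \<Longrightarrow>
      lin K U (tensor K H B) g \<Longrightarrow> lin K U (tensor3 K A M B) (\<lambda>u. G1 A B x R (g u))"
    "R \<in> carrier (tensor K A H) \<Longrightarrow> L \<in> carrier (tensor K H B) \<Longrightarrow>
      lin K U M h \<Longrightarrow> lin K U (tensor3 K A M B) (\<lambda>u. G1 A B (h u) R L)"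
  unfolding G1_def lift3_def using assms lin_module
  by - (rule lin_rules closed_rules M_lin M_closed | assumption | (rule lin_module, assumption))+

lemma G1_pure:
  assumes "module K A" "module K B" "x \<in> carrier M" "a \<in> carrier A" "p \<in> carrier H"
    "p' \<in> carrier H" "b \<in> carrier B"
  shows "G1 A B x (pure2 K A H a p) (pure2 K H B p' b) = pure3 K A M B a (act p' x p) b"
  unfolding G1_def using assms
  by - (rule HOL.refl | rule HOL.trans[OF lift2_pure_lin] lin_rules closed_rules M_lin M_closed | assumption)+

lemma lin_G3:
  assumes "module K A" "module K B" "x \<in> carrier M" "y \<in> carrier M" "z \<in> carrier M"
  shows "L \<in> carrier (tensor4 K H H H B) \<Longrightarrow>
      lin K U (tensor4 K A H H H) f \<Longrightarrow> lin K U (tensor3 K A M B) (\<lambda>u. G3 A B x y z (f u) L)"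
    "R \<in> carrier (tensor4 K A H H H) \<Longrightarrow>
      lin K U (tensor4 K H H H B) g \<Longrightarrow> lin K U (tensor3 K A M B) (\<lambda>u. G3 A B x y z R (g u))"
  unfolding G3_def lift3_def using assms lin_module
  by - (rule lin_rules closed_rules M_lin M_closed | assumption | (rule lin_module, assumption))+

lemma G3_pure:
  assumes "module K A" "module K B" "x \<in> carrier M" "y \<in> carrier M" "z \<in> carrier M"
    "a \<in> carrier A" "p \<in> carrier H" "q \<in> carrier H" "r \<in> carrier H"
    "p' \<in> carrier H" "q' \<in> carrier H" "r' \<in> carrier H" "b \<in> carrier B"
  shows "G3 A B x y z (pure4 K A H H H a p q r) (pure4 K H H H B p' q' r' b) =
    pure3 K A M B a (act p' x p \<otimes>\<^bsub>M\<^esub> (act q' y q \<otimes>\<^bsub>M\<^esub> act r' z r)) b"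
  unfolding G3_def lift3_def using assms
  by - (rule HOL.refl | rule HOL.trans[OF lift2_pure_lin] lin_rules closed_rules M_lin M_closed | assumption)+

lemmas closed_G = lin_closed[OF lin_G(1)[OF _ _ _ _ _ lin_id]] lin_closed[OF lin_G1(1)[OF _ _ _ _ lin_id]]

text \<open>By \<open>act_M_one\<close> both actions on the unit of \<open>M\<close> are counit
  scalars, so the two legs meeting it are contracted. This reduces the unit law of the crossed
  product to counit axioms for the acting tensors.\<close>

lemma G_one_left:
  assumes "module K A" "module K B" "y \<in> carrier M" "R \<in> carrier (tensor3 K A H H)" "L \<in> carrier (tensor3 K H H B)"
  shows "G A B \<one>\<^bsub>M\<^esub> y R L = G1 A B y (tm2 K A HH H (contract1_2 H \<epsilon>) R) (contract1_2 (tensor K H B) \<epsilon> L)"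
proof -
  note l = linP_eq lin_G lin_G1 lin_rules lin_contract1_2[OF functional_counit] lin_comp[OF lin_contract1_2[OF functional_counit]]
     lin_closed[OF lin_contract1_2[OF functional_counit]] closed_rules M_closed assms(1-3) M_one_closed
  note c = functional_closed[OF functional_counit] contract1_2_pure[OF functional_counit] lin_contract1_2[OF functional_counit]
  show ?thesis using assms(4)
  proof (induct R rule: tensor3_induct)
    case linP
    show ?case using assms by - (rule l | assumption)+
  next
    case (pure a p q)
    note R = pure
    show ?case using assms(5)
    proof (induct L rule: tensor3_induct)
      case linP
      show ?case using R by - (rule l | assumption)+
    next
      case (pure p' q' b)
      have "contract1_2 (tensor K H B) \<epsilon> (pure3 K H H B p' q' b) = \<epsilon> p' \<odot>\<^bsub>tensor K H B\<^esub> pure2 K H B q' b"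
        "tm2 K A HH H (contract1_2 H \<epsilon>) (pure3 K A H H a p q) = \<epsilon> p \<odot>\<^bsub>tensor K A H\<^esub> pure2 K A H a q"
        using pure R assms by (simp_all add: c Hm module_tensor pure2_closed tm2_pure pure2_smult)
      then have "G1 A B y (tm2 K A HH H (contract1_2 H \<epsilon>) (pure3 K A H H a p q))
          (contract1_2 (tensor K H B) \<epsilon> (pure3 K H H B p' q' b)) =
        \<epsilon> p' \<odot>\<^bsub>tensor3 K A M B\<^esub> (\<epsilon> p \<odot>\<^bsub>tensor3 K A M B\<^esub> G1 A B y (pure2 K A H a q) (pure2 K H B q' b))"
        using pure R assms
        by (simp add: c Hm Mm module_tensor pure2_closed smult_closed[where K = K] lin_smult[OF lin_G1(1)[OF _ _ _ _ lin_id]]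
             lin_smult[OF lin_G1(2)[OF _ _ _ _ lin_id]])
      also have "\<dots> = pure3 K A M B a ((\<epsilon> p' \<otimes>\<^bsub>K\<^esub> \<epsilon> p) \<odot>\<^bsub>M\<^esub> act q' y q) b"
        using pure R assms
        by (simp add: c G1_pure Hm Mm module_tensor pure2_closed pure2_smult smult_closed[where K = K] act_closed M.smult_assoc1)
      also have "(\<epsilon> p' \<otimes>\<^bsub>K\<^esub> \<epsilon> p) \<odot>\<^bsub>M\<^esub> act q' y q = act p' \<one>\<^bsub>M\<^esub> p \<otimes>\<^bsub>M\<^esub> act q' y q"
        using pure R assms
        by (simp add: c act_M_one lin_smult[OF mult_lin(1)] M_one_closed act_closed M_one_left H.K.m_comm)
      finally show ?case using pure R assms by (simp add: G_pure M_one_closed)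
    qed (intro Hm assms)+
  qed (intro Hm assms)+
qed

text \<open>As in \<open>G_one_left\<close>, but now the legs acting on the second element are
  contracted: the last leg of \<open>R\<close> and the middle leg of \<open>L\<close>.\<close>

lemma G_one_right:
  assumes "module K A" "module K B" "x \<in> carrier M" "R \<in> carrier (tensor3 K A H H)" "L \<in> carrier (tensor3 K H H B)"
  shows "G A B x \<one>\<^bsub>M\<^esub> R L = G1 A B x (tm2 K A HH H (contract2_2 H \<epsilon>) R)
    (tm2 K H (tensor K H B) B (contract1_2 B \<epsilon>) L)"
proof -
  note l = linP_eq lin_G lin_G1 lin_rules lin_contract1_2[OF functional_counit] lin_comp[OF lin_contract1_2[OF functional_counit]]
     lin_closed[OF lin_contract1_2[OF functional_counit]] closed_rules M_closed assms(1-3) M_one_closed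
     lin_contract2_2[OF functional_counit] lin_comp[OF lin_contract2_2[OF functional_counit]]
     lin_closed[OF lin_contract2_2[OF functional_counit]]
  note c = functional_closed[OF functional_counit] contract1_2_pure[OF functional_counit] lin_contract1_2[OF functional_counit]
    contract2_2_pure[OF functional_counit] lin_contract2_2[OF functional_counit]
  show ?thesis using assms(4)
  proof (induct R rule: tensor3_induct)
    case linP
    show ?case using assms by - (rule l | assumption)+
  next
    case (pure a p q)
    note R = pure
    show ?case using assms(5)
    proof (induct L rule: tensor3_induct)
      case linP
      show ?case using R by - (rule l | assumption)+
    next
      case (pure p' q' b)
      have "tm2 K H (tensor K H B) B (contract1_2 B \<epsilon>) (pure3 K H H B p' q' b) = \<epsilon> q' \<odot>\<^bsub>tensor K H B\<^esub> pure2 K H B p' b"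
        "tm2 K A HH H (contract2_2 H \<epsilon>) (pure3 K A H H a p q) = \<epsilon> q \<odot>\<^bsub>tensor K A H\<^esub> pure2 K A H a p"
        using pure R assms by (simp_all add: c Hm module_tensor pure2_closed tm2_pure pure2_smult)
      then have "G1 A B x (tm2 K A HH H (contract2_2 H \<epsilon>) (pure3 K A H H a p q))
          (tm2 K H (tensor K H B) B (contract1_2 B \<epsilon>) (pure3 K H H B p' q' b)) =
        \<epsilon> q' \<odot>\<^bsub>tensor3 K A M B\<^esub> (\<epsilon> q \<odot>\<^bsub>tensor3 K A M B\<^esub> G1 A B x (pure2 K A H a p) (pure2 K H B p' b))"
        using pure R assms
        by (simp add: c Hm Mm module_tensor pure2_closed smult_closed[where K = K] lin_smult[OF lin_G1(1)[OF _ _ _ _ lin_id]]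
             lin_smult[OF lin_G1(2)[OF _ _ _ _ lin_id]])
      also have "\<dots> = pure3 K A M B a ((\<epsilon> q' \<otimes>\<^bsub>K\<^esub> \<epsilon> q) \<odot>\<^bsub>M\<^esub> act p' x p) b"
        using pure R assms
        by (simp add: c G1_pure Hm Mm module_tensor pure2_closed pure2_smult smult_closed[where K = K] act_closed M.smult_assoc1)
      also have "(\<epsilon> q' \<otimes>\<^bsub>K\<^esub> \<epsilon> q) \<odot>\<^bsub>M\<^esub> act p' x p = act p' x p \<otimes>\<^bsub>M\<^esub> act q' \<one>\<^bsub>M\<^esub> q"
        using pure R assms
        by (simp add: c act_M_one lin_smult[OF mult_lin(2)] M_one_closed act_closed M_one_right H.K.m_comm)
      finally show ?case using pure R assms by (simp add: G_pure M_one_closed)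
    qed (intro Hm assms)+
  qed (intro Hm assms)+
qed

text \<open>Separates the leg in \<open>B\<close> from the three legs in \<open>H\<close>, so that a
  product in the threefold tensor algebra, as produced by \<open>N3_act\<close>, can be read in the
  fourfold one.\<close>

lemma app_mult_pure:
  assumes "k_algebra K B" "S \<in> carrier HHH" "p \<in> carrier H" "q \<in> carrier H" "r \<in> carrier H" "b \<in> carrier B"
  shows "app K H H H B S \<otimes>\<^bsub>tensor4 K H H H B\<^esub> pure4 K H H H B p q r b =
    id2 K H H H (tensor K H B) (snoc K H B b) (S \<otimes>\<^bsub>HHH\<^esub> pure3 K H H H p q r)"
proof -
  note m = Hm k_algebra_module[OF assms(1)] Hh assms
  show ?thesis using assms(2)
  proof (induct S rule: tensor3_induct)
    case linP
    show ?case using assms(3-6) by - (rule linP_eq lin_rules closed_rules m lin_tm2 lin_snoc alg_one_closed[OF assms(1)] | assumption)+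
  next
    case (pure h h' h'')
    then show ?case using assms(3-6)
      by (simp add: mult_pure pure2_closed m module_tensor k_algebra_tensor tm2_pure lin_snoc lin_tm2
          snoc_apply alg_one_closed[OF assms(1)] alg_mult_closed[OF Hh] alg_one[OF assms(1)])
  qed (rule Hm)+
qed

lemma G3_N3:
  assumes "module K A" "module K B" "x \<in> carrier M" "y \<in> carrier M" "z \<in> carrier M"
    "a \<in> carrier A" "b \<in> carrier B" "R \<in> carrier HHH" "L \<in> carrier HHH"
  shows "G3 A B x y z (pure2 K A HHH a R) (id2 K H H H (tensor K H B) (snoc K H B b) L) =
    pure3 K A M B a (N3 x y z R L) b"
proof -
  note l = linP_eq lin_G3 lin_N3 lin_rules lin_tm2 lin_snoc closed_rules M_closed assms(1-7)
  show ?thesis using assms(8)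
  proof (induct R rule: tensor3_induct)
    case linP
    show ?case using assms(9) by - (rule l | assumption)+
  next
    case (pure p q r)
    note R = pure
    show ?case using assms(9)
    proof (induct L rule: tensor3_induct)
      case linP
      show ?case using R by - (rule l | assumption)+
    next
      case (pure p' q' r')
      then show ?case using R assms
        by (simp add: N3_pure G3_pure Hm pure2_closed module_tensor tm2_pure lin_snoc lin_tm2 snoc_apply)
    qed (rule Hm)+
  qed (rule Hm)+
qed

text \<open>The outer actions on the product split by \<Delta> (\<open>act_mult\<close>), the inner
  ones are absorbed by \<open>act_act\<close>, and \<open>M_assoc\<close> rebrackets. This is the
  one place where \<open>M\<close> is rebracketed; it contributes \<Phi> to the tensor acting from
  the left and its inverse to the one acting from the right.\<close>

lemma G_mult_left:
  assumes "k_algebra K A" "k_algebra K B" "x \<in> carrier M" "y \<in> carrier M" "z \<in> carrier M"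
    "l \<in> carrier H" "l' \<in> carrier H" "r \<in> carrier H" "r' \<in> carrier H"
    "R \<in> carrier (tensor3 K A H H)" "L \<in> carrier (tensor3 K H H B)"
  shows "G A B (act l x r \<otimes>\<^bsub>M\<^esub> act l' y r') z R L = G3 A B x y z
    (pure4 K A H H H \<one>\<^bsub>A\<^esub> r r' \<one>\<^bsub>H\<^esub> \<otimes>\<^bsub>tensor4 K A H H H\<^esub> (mid K A H H H H \<Delta> R \<otimes>\<^bsub>tensor4 K A H H H\<^esub>
      pure2 K A HHH \<one>\<^bsub>A\<^esub> (inv\<^bsub>HHH\<^esub> \<Phi>)))
    (app K H H H B \<Phi> \<otimes>\<^bsub>tensor4 K H H H B\<^esub> (fst3 K H H H H B \<Delta> L \<otimes>\<^bsub>tensor4 K H H H B\<^esub> pure4 K H H H B l l' \<one>\<^bsub>H\<^esub> \<one>\<^bsub>B\<^esub>))"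
proof -
  note m = assms(1,2) assms(1,2)[THEN k_algebra_module] Hm Hh Mm
  note one = alg_one_closed[OF Hh] alg_one_closed[OF assms(1)] alg_one_closed[OF assms(2)]
  note \<Delta> = am_lin[OF am_comult] am_closed[OF am_comult]
  note l = linP_eq lin_G lin_G3 lin_N2 lin_rules lin_tm2 lin_snoc lin_spl \<Delta>(1) lin_comp[OF \<Delta>(1)] closed_rules M_lin
    M_closed m one assms(3-9) alg_tensor reassoc_closed \<Delta>(2)
  note simps = m one mult_pure mult_pure_assoc pure2_closed module_tensor k_algebra_tensor tm2_pure spl_pure apd_pure lin_spl lin_snoc
    lin_tm2 snoc_apply \<Delta> assms(3-9) alg_mult_closed[OF Hh] alg_mult_closed[OF assms(1)] alg_mult_closed[OF assms(2)] alg_one[OF Hh]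
    alg_one[OF assms(1)] alg_one[OF assms(2)] act_closed mult_closed
  \<comment> \<open>The tensors \<open>s\<close> and \<open>t\<close> stand for the coproducts of
    the legs of \<open>R\<close> and \<open>L\<close> that act on the product; as arbitrary tensors
    they may be taken pure.\<close>
  have key: "pure3 K A M B a (N2 (act l x r) (act l' y r') s t \<otimes>\<^bsub>M\<^esub> act h z k) b = G3 A B x y z
    (pure4 K A H H H \<one>\<^bsub>A\<^esub> r r' \<one>\<^bsub>H\<^esub> \<otimes>\<^bsub>tensor4 K A H H H\<^esub> (pure2 K A HHH a (apd K H H H s k) \<otimes>\<^bsub>tensor4 K A H H H\<^esub>
      pure2 K A HHH \<one>\<^bsub>A\<^esub> (inv\<^bsub>HHH\<^esub> \<Phi>)))
    (app K H H H B \<Phi> \<otimes>\<^bsub>tensor4 K H H H B\<^esub> (apd K H H (tensor K H B) t (pure2 K H B h b) \<otimes>\<^bsub>tensor4 K H H H B\<^esub> pure4 K H H H B l l' \<one>\<^bsub>H\<^esub> \<one>\<^bsub>B\<^esub>))"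
    if hk: "a \<in> carrier A" "b \<in> carrier B" "h \<in> carrier H" "k \<in> carrier H" and s: "s \<in> carrier HH"
      and t: "t \<in> carrier HH" for a b h k s t
    using s
  proof (induct s rule: tensor_induct)
    case linP
    show ?case using hk t by - (rule l | assumption)+
  next
    case (pure k1 k2)
    note s = pure
    show ?case using t
    proof (induct t rule: tensor_induct)
      case linP
      show ?case using hk s by - (rule l | assumption)+
    next
      case (pure h1 h2)
      let ?R = "pure3 K H H H (r \<otimes>\<^bsub>H\<^esub> k1) (r' \<otimes>\<^bsub>H\<^esub> k2) k \<otimes>\<^bsub>HHH\<^esub> inv\<^bsub>HHH\<^esub> \<Phi>"
      let ?L = "\<Phi> \<otimes>\<^bsub>HHH\<^esub> pure3 K H H H (h1 \<otimes>\<^bsub>H\<^esub> l) (h2 \<otimes>\<^bsub>H\<^esub> l') h"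
      have "N2 (act l x r) (act l' y r') (pure2 K H H k1 k2) (pure2 K H H h1 h2) \<otimes>\<^bsub>M\<^esub> act h z k =
          act (h1 \<otimes>\<^bsub>H\<^esub> l) x (r \<otimes>\<^bsub>H\<^esub> k1) \<otimes>\<^bsub>M\<^esub> act (h2 \<otimes>\<^bsub>H\<^esub> l') y (r' \<otimes>\<^bsub>H\<^esub> k2) \<otimes>\<^bsub>M\<^esub> act h z k"
        using pure s hk by (simp add: N2_pure act_act simps)
      also have "\<dots> = N3 x y z ?R ?L"
        using pure s hk by (simp add: M_assoc N3_act reassoc_closed simps)
      finally have e: "pure3 K A M B a (N2 (act l x r) (act l' y r') (pure2 K H H k1 k2) (pure2 K H H h1 h2) \<otimes>\<^bsub>M\<^esub> act h z k) b =
        G3 A B x y z (pure2 K A HHH a ?R) (id2 K H H H (tensor K H B) (snoc K H B b) ?L)"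
        using pure s hk by (simp add: G3_N3 reassoc_closed simps alg_tensor del: mult_pure)
      show ?case unfolding e using pure s hk
        by (simp add: app_mult_pure[symmetric] reassoc_closed simps alg_tensor)
    qed (rule Hm)+
  qed (rule Hm)+
  show ?thesis using assms(10)
  proof (induct R rule: tensor3_induct)
    case linP
    show ?case using assms(11) by - (rule l | assumption)+
  next
    case (pure a p q)
    note R = pure
    show ?case using assms(11)
    proof (induct L rule: tensor3_induct)
      case linP
      show ?case using R by - (rule l | assumption)+
    next
      case (pure p' q' b)
      then show ?case using R by (simp add: G_pure simps act_mult key)
    qed (rule m)+
  qed (rule m)+
qed

text \<open>A product in the second slot already has the bracketing of \<open>G3\<close>, so the
  coproduct enters but no reassociator does.\<close>

lemma G_mult_right:
  assumes "k_algebra K A" "k_algebra K B" "x \<in> carrier M" "y \<in> carrier M" "z \<in> carrier M"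
    "l \<in> carrier H" "l' \<in> carrier H" "r \<in> carrier H" "r' \<in> carrier H"
    "R \<in> carrier (tensor3 K A H H)" "L \<in> carrier (tensor3 K H H B)"
  shows "G A B x (act l y r \<otimes>\<^bsub>M\<^esub> act l' z r') R L = G3 A B x y z
    (pure4 K A H H H \<one>\<^bsub>A\<^esub> \<one>\<^bsub>H\<^esub> r r' \<otimes>\<^bsub>tensor4 K A H H H\<^esub> id2 K A H H HH \<Delta> R)
    (mid K H H H H B \<Delta> L \<otimes>\<^bsub>tensor4 K H H H B\<^esub> pure4 K H H H B \<one>\<^bsub>H\<^esub> l l' \<one>\<^bsub>B\<^esub>)"
proof -
  note m = assms(1,2) assms(1,2)[THEN k_algebra_module] Hm Hh Mm
  note one = alg_one_closed[OF Hh] alg_one_closed[OF assms(1)] alg_one_closed[OF assms(2)]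
  note \<Delta> = am_lin[OF am_comult] am_closed[OF am_comult]
  note l = linP_eq lin_G lin_G3 lin_N2 lin_rules lin_tm2 lin_snoc lin_spl \<Delta>(1) lin_comp[OF \<Delta>(1)] closed_rules M_lin
    M_closed m one assms(3-9) alg_tensor reassoc_closed \<Delta>(2)
  note simps = m one mult_pure mult_pure_assoc pure2_closed module_tensor k_algebra_tensor tm2_pure spl_pure apd_pure lin_spl lin_snoc
    lin_tm2 snoc_apply \<Delta> assms(3-9) alg_mult_closed[OF Hh] alg_mult_closed[OF assms(1)] alg_mult_closed[OF assms(2)] alg_one[OF Hh]
    alg_one[OF assms(1)] alg_one[OF assms(2)] act_closed mult_closed
  have key: "pure3 K A M B a (act h x k \<otimes>\<^bsub>M\<^esub> N2 (act l y r) (act l' z r') s t) b = G3 A B x y z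
    (pure4 K A H H H \<one>\<^bsub>A\<^esub> \<one>\<^bsub>H\<^esub> r r' \<otimes>\<^bsub>tensor4 K A H H H\<^esub> pure3 K A H HH a k s)
    (pure2 K H (tensor3 K H H B) h (apd K H H B t b) \<otimes>\<^bsub>tensor4 K H H H B\<^esub> pure4 K H H H B \<one>\<^bsub>H\<^esub> l l' \<one>\<^bsub>B\<^esub>)"
    if hk: "a \<in> carrier A" "b \<in> carrier B" "h \<in> carrier H" "k \<in> carrier H" and s: "s \<in> carrier HH"
      and t: "t \<in> carrier HH" for a b h k s t
    using s
  proof (induct s rule: tensor_induct)
    case linP
    show ?case using hk t by - (rule l | assumption)+
  next
    case (pure k1 k2)
    note s = pure
    show ?case using t
    proof (induct t rule: tensor_induct)
      case linP
      show ?case using hk s by - (rule l | assumption)+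
    next
      case (pure h1 h2)
      show ?case using pure s hk by (simp add: N2_pure act_act G3_pure simps)
    qed (rule Hm)+
  qed (rule Hm)+
  show ?thesis using assms(10)
  proof (induct R rule: tensor3_induct)
    case linP
    show ?case using assms(11) by - (rule l | assumption)+
  next
    case (pure a p q)
    note R = pure
    show ?case using assms(11)
    proof (induct L rule: tensor3_induct)
      case linP
      show ?case using R by - (rule l | assumption)+
    next
      case (pure p' q' b)
      then show ?case using R by (simp add: G_pure simps act_mult key)
    qed (rule m)+
  qed (rule m)+
qed

end

section \<open>The crossed product is an algebra\<close>

locale crossed = bimodule_algebra K H \<Delta> \<epsilon> \<Phi> M la ra +
  A: right_comodule_algebra K H \<Delta> \<epsilon> \<Phi> A rho \<Phi>r + B: left_comodule_algebra K H \<Delta> \<epsilon> \<Phi> B lam \<Phi>l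
  for K :: "'k ring" and H :: "('k, 'h) module" and \<Delta> \<epsilon> \<Phi>
    and M :: "('k, 'm) module" and la ra
    and A :: "('k, 'a) module" and rho \<Phi>r and B :: "('k, 'b) module" and lam \<Phi>l
begin
abbreviation "AH \<equiv> tensor K A H"
abbreviation "HB \<equiv> tensor K H B"
abbreviation "AHH \<equiv> tensor3 K A H H"
abbreviation "HHB \<equiv> tensor3 K H H B"
abbreviation "AHHH \<equiv> tensor4 K A H H H"
abbreviation "HHHB \<equiv> tensor4 K H H H B"

abbreviation "pAMB \<equiv> pure3 K A M B"
abbreviation "T \<equiv> tensor3 K A M B"
abbreviation "P \<equiv> crossed_product K H A rho \<Phi>r M la ra B lam \<Phi>l"
abbreviation "\<psi>r \<equiv> inv\<^bsub>AHH\<^esub> \<Phi>r"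
abbreviation "\<psi>l \<equiv> inv\<^bsub>HHB\<^esub> \<Phi>l"

lemmas Aa = A.Aa and Bb = B.Bb
lemmas Am = k_algebra_module[OF Aa] and Bm = k_algebra_module[OF Bb]
lemmas ones = alg_one_closed[OF Hh] alg_one_closed[OF Aa] alg_one_closed[OF Bb] M_one_closed
lemmas mults = alg_mult_closed[OF Hh] alg_mult_closed[OF Aa] alg_mult_closed[OF Bb]
lemmas spaces = Hh Aa Bb Hm Am Bm Mm
lemmas lin_coactions = am_lin[OF am_comult] am_lin[OF A.am_rho] am_lin[OF B.am_lam]
lemmas lin_coactions' = lin_coactions[THEN lin_comp]
lemmas coactions_closed = am_closed[OF am_comult] am_closed[OF A.am_rho] am_closed[OF B.am_lam]
lemmas reassocs_closed = reassoc_closed A.rho_reassoc_closed B.lam_reassoc_closed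

lemma module_T: "module K T"
  by (intro module_tensor spaces)

lemma P_fields: "carrier P = carrier T" "add P = add T" "zero P = zero T" "smult P = smult T"
  "\<one>\<^bsub>P\<^esub> = pAMB \<one>\<^bsub>A\<^esub> \<one>\<^bsub>M\<^esub> \<one>\<^bsub>B\<^esub>"
  by (simp_all add: crossed_product_def Let_def)

lemma module_P: "module K P"
  by (rule module.module_vs_cong[OF module_T]) (rule P_fields)+

text \<open>Linearity does not see the multiplication, and \<open>P\<close> and \<open>T\<close>
  agree in everything else. Linear arguments are therefore carried out over \<open>T\<close>, to
  which the rules for tensor products apply.\<close>

lemma lin_P_iff: "lin K P X f \<longleftrightarrow> lin K T X f" "lin K X P g \<longleftrightarrow> lin K X T g"
  using module_P module_T by (simp_all add: lin_def P_fields)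

text \<open>In Sweedler notation \<open>a a'_0 x^1 \<otimes> a'_1 x^2 \<otimes> x^3\<close>, with
  \<open>x\<close> the inverse of \<open>\<Phi>r\<close>: all that is multiplied in \<open>A\<close>
  or acts from the right when two pure elements are multiplied.\<close>

definition RR where "RR a a' = pure3 K A H H a \<one>\<^bsub>H\<^esub> \<one>\<^bsub>H\<^esub> \<otimes>\<^bsub>AHH\<^esub>
  (tm2 K A H HH (snoc K H H \<one>\<^bsub>H\<^esub>) (rho a') \<otimes>\<^bsub>AHH\<^esub> \<psi>r)"

text \<open>In Sweedler notation \<open>x^1 \<otimes> x^2 b_[-1] \<otimes> x^3 b_[0] b'\<close>,
  with \<open>x\<close> the inverse of \<open>\<Phi>l\<close>: the part acting from the left or
  multiplied in \<open>B\<close>.\<close>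

definition LL where "LL b b' = \<psi>l \<otimes>\<^bsub>HHB\<^esub>
  (pure2 K H HB \<one>\<^bsub>H\<^esub> (lam b) \<otimes>\<^bsub>HHB\<^esub> pure3 K H H B \<one>\<^bsub>H\<^esub> \<one>\<^bsub>H\<^esub> b')"

lemmas lrules = lin_G lin_G1 lin_G3 lin_N2 lin_N3 lin_rules lin_tm2 lin_tm1 lin_spl lin_snoc
  lin_coactions lin_coactions' M_lin
lemmas crules = closed_rules M_closed spaces ones alg_tensor(1,2) mults reassocs_closed coactions_closed
  lin_snoc lin_coactions lin_tm2 lin_tm1 lin_spl module_T

lemma RR_closed: "a \<in> carrier A \<Longrightarrow> a' \<in> carrier A \<Longrightarrow> RR a a' \<in> carrier AHH"
  unfolding RR_def by (rule crules | assumption)+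

lemma LL_closed: "b \<in> carrier B \<Longrightarrow> b' \<in> carrier B \<Longrightarrow> LL b b' \<in> carrier HHB"
  unfolding LL_def by (rule crules | assumption)+

lemma lin_RR:
  "a' \<in> carrier A \<Longrightarrow> lin K U A f \<Longrightarrow> lin K U AHH (\<lambda>u. RR (f u) a')"
  "a \<in> carrier A \<Longrightarrow> lin K U A f \<Longrightarrow> lin K U AHH (\<lambda>u. RR a (f u))"
  unfolding RR_def by (rule lrules crules | assumption)+

lemma lin_LL:
  "b' \<in> carrier B \<Longrightarrow> lin K U B f \<Longrightarrow> lin K U HHB (\<lambda>u. LL (f u) b')"
  "b \<in> carrier B \<Longrightarrow> lin K U B f \<Longrightarrow> lin K U HHB (\<lambda>u. LL b (f u))"
  unfolding LL_def by (rule lrules crules | assumption)+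

lemmas simps = spaces ones mults mult_pure mult_pure_assoc pure2_closed module_tensor k_algebra_tensor tm2_pure
  spl_pure apd_pure lin_spl lin_snoc lin_tm2 snoc_apply lin_coactions coactions_closed alg_one[OF Hh] alg_one[OF Aa]
  alg_one[OF Bb] act_closed mult_closed

text \<open>The four inner sums of the multiplication, with the coaction values and inverse
  reassociators replaced by arbitrary tensors. All four may then be taken pure, and both sides
  unfold to the same pure tensor.\<close>

lemma core_eq:
  assumes "a \<in> carrier A" "x \<in> carrier M" "b' \<in> carrier B" "x' \<in> carrier M"
    and \<rho>: "\<rho> \<in> carrier AH" and \<mu>: "\<mu> \<in> carrier HB"
    and r: "r \<in> carrier AHH" and l: "l \<in> carrier HHB"
  shows "lift2 T \<rho> (\<lambda>a'0 a'1. lift2 T \<mu> (\<lambda>b_1 b0. lift3 T r (\<lambda>r1 r2 r3. lift3 T l (\<lambda>l1 l2 l3.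
      pAMB (a \<otimes>\<^bsub>A\<^esub> a'0 \<otimes>\<^bsub>A\<^esub> r1)
        (act l1 x (a'1 \<otimes>\<^bsub>H\<^esub> r2) \<otimes>\<^bsub>M\<^esub> act (l2 \<otimes>\<^bsub>H\<^esub> b_1) x' r3) (l3 \<otimes>\<^bsub>B\<^esub> b0 \<otimes>\<^bsub>B\<^esub> b'))))) =
    G A B x x' (pure3 K A H H a \<one>\<^bsub>H\<^esub> \<one>\<^bsub>H\<^esub> \<otimes>\<^bsub>AHH\<^esub>
        (tm2 K A H HH (snoc K H H \<one>\<^bsub>H\<^esub>) \<rho> \<otimes>\<^bsub>AHH\<^esub> r))
      (l \<otimes>\<^bsub>HHB\<^esub> (pure2 K H HB \<one>\<^bsub>H\<^esub> \<mu> \<otimes>\<^bsub>HHB\<^esub> pure3 K H H B \<one>\<^bsub>H\<^esub> \<one>\<^bsub>H\<^esub> b'))"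
  unfolding lift3_def using \<rho>
proof (induct \<rho> rule: tensor_induct)
  case linP
  show ?case using assms by - (rule lrules crules | assumption)+
next
  case (pure p q)
  note 1 = pure
  show ?case using \<mu>
  proof (induct \<mu> rule: tensor_induct)
    case linP
    show ?case using assms(1-4) r l 1 by - (rule lrules crules | assumption)+
  next
    case (pure h k)
    note 2 = pure
    show ?case using r
    proof (induct r rule: tensor3_induct)
      case linP
      show ?case using assms(1-4) l 1 2 by - (rule lrules crules | assumption)+
    next
      case (pure r1 r2 r3)
      note 3 = pure
      show ?case using l
      proof (induct l rule: tensor3_induct)
        case linP
        show ?case using assms(1-4) 1 2 3 by - (rule lrules crules | assumption)+
      next
        case (pure l1 l2 l3)
        show ?case (is "?l = ?r")
        proof -
          have "?l = pAMB (a \<otimes>\<^bsub>A\<^esub> p \<otimes>\<^bsub>A\<^esub> r1)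
            (act l1 x (q \<otimes>\<^bsub>H\<^esub> r2) \<otimes>\<^bsub>M\<^esub> act (l2 \<otimes>\<^bsub>H\<^esub> h) x' r3) (l3 \<otimes>\<^bsub>B\<^esub> k \<otimes>\<^bsub>B\<^esub> b')"
            using assms(1-4) 1 2 3 pure
            by - (rule HOL.refl | rule HOL.trans[OF lift2_pure_lin] lrules crules | assumption)+
          also have "\<dots> = ?r" using assms(1-4) 1 2 3 pure
            by (simp add: G_pure simps alg_assoc[OF Aa] alg_assoc[OF Bb])
          finally show ?thesis .
        qed
      qed (rule spaces)+
    qed (rule spaces)+
  qed (rule spaces)+
qed (rule spaces)+

definition pmul where "pmul s t = lift3 T s (\<lambda>a x b. lift3 T t (\<lambda>a' x' b'. G A B x x' (RR a a') (LL b b')))"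

lemma P_mult:
  assumes "s \<in> carrier T" "t \<in> carrier T"
  shows "s \<otimes>\<^bsub>P\<^esub> t = pmul s t"
proof -
  have "s \<otimes>\<^bsub>P\<^esub> t = lift3 T s (\<lambda>a x b. lift3 T t (\<lambda>a' x' b'.
          lift2 T (rho a') (\<lambda>a'0 a'1. lift2 T (lam b) (\<lambda>b_1 b0.
          lift3 T \<psi>r (\<lambda>r1 r2 r3. lift3 T \<psi>l (\<lambda>l1 l2 l3.
      pAMB (a \<otimes>\<^bsub>A\<^esub> a'0 \<otimes>\<^bsub>A\<^esub> r1)
        (act l1 x (a'1 \<otimes>\<^bsub>H\<^esub> r2) \<otimes>\<^bsub>M\<^esub> act (l2 \<otimes>\<^bsub>H\<^esub> b_1) x' r3) (l3 \<otimes>\<^bsub>B\<^esub> b0 \<otimes>\<^bsub>B\<^esub> b')))))))"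
    by (simp add: crossed_product_def Let_def act_def)
  also have "\<dots> = pmul s t"
    unfolding pmul_def lift3_def[of T s] lift3_def[of T t] RR_def LL_def
    by (intro lift2_cong[OF Am module_tensor[OF Mm Bm]] lift2_cong[OF Mm Bm] core_eq assms coactions_closed reassocs_closed)
  finally show ?thesis .
qed

lemma lin_pmul: "t \<in> carrier T \<Longrightarrow> lin K T T (\<lambda>s. pmul s t)" "s \<in> carrier T \<Longrightarrow> lin K T T (\<lambda>t. pmul s t)"
  unfolding pmul_def lift3_def
  by (rule lin_RR lin_LL RR_closed LL_closed lrules crules | assumption)+

lemma lin_P_mult: "t \<in> carrier T \<Longrightarrow> lin K T T (\<lambda>s. s \<otimes>\<^bsub>P\<^esub> t)" "s \<in> carrier T \<Longrightarrow> lin K T T (\<lambda>t. s \<otimes>\<^bsub>P\<^esub> t)"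
  by (rule lin_cong[OF lin_pmul(1)] lin_cong[OF lin_pmul(2)] P_mult | assumption)+

lemmas lin_P_mult' = lin_comp[OF lin_P_mult(1)] lin_comp[OF lin_P_mult(2)]

lemma P_mult_closed: "s \<in> carrier T \<Longrightarrow> t \<in> carrier T \<Longrightarrow> s \<otimes>\<^bsub>P\<^esub> t \<in> carrier T"
  by (rule lin_closed[OF lin_P_mult(1)])

lemma pure_closed: "a \<in> carrier A \<Longrightarrow> x \<in> carrier M \<Longrightarrow> b \<in> carrier B \<Longrightarrow> pAMB a x b \<in> carrier T"
  by (simp add: simps)

lemma P_pure:
  assumes "a \<in> carrier A" "x \<in> carrier M" "b \<in> carrier B" "a' \<in> carrier A" "x' \<in> carrier M" "b' \<in> carrier B"
  shows "pAMB a x b \<otimes>\<^bsub>P\<^esub> pAMB a' x' b' = G A B x x' (RR a a') (LL b b')"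
proof -
  have "pmul (pAMB a x b) (pAMB a' x' b') = G A B x x' (RR a a') (LL b b')"
    unfolding pmul_def lift3_def using assms
    by - (rule HOL.refl | rule HOL.trans[OF lift2_pure_lin] lin_RR lin_LL RR_closed LL_closed lrules crules | assumption)+
  then show ?thesis using assms by (simp add: P_mult pure_closed)
qed

lemmas am_A = am_app[OF Aa Hh Hh Hh] am_mid[OF am_comult Aa Hh Hh Hh] am_fst3[OF A.am_rho Aa Hh Hh Hh]
  am_id2[OF am_comult Aa Hh]
lemmas am_B = am_app[OF Hh Hh Hh Bb] am_mid[OF am_comult Hh Hh Hh Bb] am_fst3[OF am_comult Hh Hh Hh Bb]
  am_id2[OF B.am_lam Hh Hh]
lemmas am_mults = am_A[THEN am_mult] am_B[THEN am_mult]
lemmas comult_one = am_one[OF am_comult] am_one[OF A.am_rho] am_one[OF B.am_lam] one_tensor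

text \<open>The left bracketing of a triple product. Multiplying on the right brings in
  \<open>rho a\<close> through \<open>RR\<close> and applies \<open>lam\<close> to the last leg of
  \<open>L\<close> through \<open>LL\<close>; \<open>G_mult_left\<close> adds the coproducts and
  \<Phi>.\<close>

lemma G_times_pure:
  assumes "x \<in> carrier M" "y \<in> carrier M" "z \<in> carrier M" "a \<in> carrier A" "b \<in> carrier B"
    and R: "R \<in> carrier AHH" and L: "L \<in> carrier HHB"
  shows "G A B x y R L \<otimes>\<^bsub>P\<^esub> pAMB a z b = G3 A B x y z
    (app K A H H H R \<otimes>\<^bsub>AHHH\<^esub> (mid K A H H H H \<Delta>
      (tm2 K A H HH (snoc K H H \<one>\<^bsub>H\<^esub>) (rho a) \<otimes>\<^bsub>AHH\<^esub> \<psi>r) \<otimes>\<^bsub>AHHH\<^esub>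
      pure2 K A HHH \<one>\<^bsub>A\<^esub> (inv\<^bsub>HHH\<^esub> \<Phi>)))
    (app K H H H B \<Phi> \<otimes>\<^bsub>HHHB\<^esub> (fst3 K H H H H B \<Delta> \<psi>l \<otimes>\<^bsub>HHHB\<^esub>
      (id2 K H H B HB lam L \<otimes>\<^bsub>HHHB\<^esub> pure4 K H H H B \<one>\<^bsub>H\<^esub> \<one>\<^bsub>H\<^esub> \<one>\<^bsub>H\<^esub> b)))"
  using R
proof (induct R rule: tensor3_induct)
  case linP
  show ?case using assms by - (rule linP_eq lin_P_mult' lrules crules | assumption)+
next
  case (pure p q r)
  note 1 = pure
  show ?case using L
  proof (induct L rule: tensor3_induct)
    case linP
    show ?case using assms 1 by - (rule linP_eq lin_P_mult' lrules crules | assumption)+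
  next
    case (pure h k c)
    have "G A B x y (pure3 K A H H p q r) (pure3 K H H B h k c) \<otimes>\<^bsub>P\<^esub> pAMB a z b =
      G A B (act h x q \<otimes>\<^bsub>M\<^esub> act k y r) z (RR p a) (LL c b)"
      using assms 1 pure by (simp add: G_pure P_pure simps)
    then show ?case using assms 1 pure
      by (simp add: G_mult_left RR_closed LL_closed simps)
        (simp add: RR_def LL_def am_mults alg_tensor reassocs_closed simps tm2_closed spl_closed comult_one)
  qed (rule spaces)+
qed (rule spaces)+

text \<open>The right bracketing of a triple product: now \<open>rho\<close> is applied to the first
  leg of \<open>R\<close>, and \<open>lam b\<close> passes under the coproduct supplied by
  \<open>G_mult_right\<close>.\<close>

lemma pure_times_G:
  assumes "x \<in> carrier M" "y \<in> carrier M" "z \<in> carrier M" "a \<in> carrier A" "b \<in> carrier B"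
    and R: "R \<in> carrier AHH" and L: "L \<in> carrier HHB"
  shows "pAMB a x b \<otimes>\<^bsub>P\<^esub> G A B y z R L = G3 A B x y z
    (pure4 K A H H H a \<one>\<^bsub>H\<^esub> \<one>\<^bsub>H\<^esub> \<one>\<^bsub>H\<^esub> \<otimes>\<^bsub>AHHH\<^esub> (fst3 K A A H H H rho R \<otimes>\<^bsub>AHHH\<^esub>
      id2 K A H H HH \<Delta> \<psi>r))
    (mid K H H H H B \<Delta> \<psi>l \<otimes>\<^bsub>HHHB\<^esub> (pure2 K H HHB \<one>\<^bsub>H\<^esub> (spl K H H H B \<Delta> (lam b)) \<otimes>\<^bsub>HHHB\<^esub>
      pure2 K H HHB \<one>\<^bsub>H\<^esub> L))"
  using R
proof (induct R rule: tensor3_induct)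
  case linP
  show ?case using assms by - (rule linP_eq lin_P_mult' lrules crules | assumption)+
next
  case (pure p q r)
  note 1 = pure
  \<comment> \<open>Splitting the appended unit by \<Delta> leaves units in the last two legs, so
    \<open>q\<close> and \<open>r\<close> slide past them and join the coaction tensor.\<close>
  have e: "pure4 K A H H H \<one>\<^bsub>A\<^esub> \<one>\<^bsub>H\<^esub> q r \<otimes>\<^bsub>AHHH\<^esub> id2 K A H H HH \<Delta> (pure3 K A H H a \<one>\<^bsub>H\<^esub> \<one>\<^bsub>H\<^esub> \<otimes>\<^bsub>AHH\<^esub>
      (tm2 K A H HH (snoc K H H \<one>\<^bsub>H\<^esub>) \<rho> \<otimes>\<^bsub>AHH\<^esub> \<psi>r)) =
    pure4 K A H H H a \<one>\<^bsub>H\<^esub> \<one>\<^bsub>H\<^esub> \<one>\<^bsub>H\<^esub> \<otimes>\<^bsub>AHHH\<^esub> (apd K A H HH \<rho> (pure2 K H H q r) \<otimes>\<^bsub>AHHH\<^esub>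
      id2 K A H H HH \<Delta> \<psi>r)" if "\<rho> \<in> carrier AH" for \<rho>
    using that
  proof (induct \<rho> rule: tensor_induct)
    case linP
    show ?case using assms 1 by - (rule linP_eq lrules crules | assumption)+
  next
    case (pure u v)
    then show ?case using assms(4) 1
      by (simp add: am_mults alg_tensor reassocs_closed simps tm2_closed spl_closed comult_one)
  qed (rule spaces)+
  show ?case using L
  proof (induct L rule: tensor3_induct)
    case linP
    show ?case using assms 1 by - (rule linP_eq lin_P_mult' lrules crules | assumption)+
  next
    case (pure h k c)
    have "pAMB a x b \<otimes>\<^bsub>P\<^esub> G A B y z (pure3 K A H H p q r) (pure3 K H H B h k c) =
      G A B x (act h y q \<otimes>\<^bsub>M\<^esub> act k z r) (RR a p) (LL b c)"
      using assms 1 pure by (simp add: G_pure P_pure simps)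
    then show ?case using assms 1 pure
      by (simp add: G_mult_right RR_closed LL_closed simps)
        (simp add: RR_def LL_def e am_mult[OF am_B(2)] am_mult[OF am_spl[OF am_comult Hh Hh Bb]] tm2_closed alg_tensor reassocs_closed simps spl_closed comult_one)
  qed (rule spaces)+
qed (rule spaces)+

text \<open>Quasi-coassociativity carries the coaction of \<open>a''\<close> leftwards past the
  inverse reassociator, after which \<open>rho_pentagon\<close> applies to what remains. This is the
  half of associativity that concerns the tensors acting from the right.\<close>

lemma RR_assoc:
  assumes "a \<in> carrier A" "a' \<in> carrier A" "a'' \<in> carrier A"
  shows "app K A H H H (RR a a') \<otimes>\<^bsub>AHHH\<^esub> (mid K A H H H H \<Delta>
      (tm2 K A H HH (snoc K H H \<one>\<^bsub>H\<^esub>) (rho a'') \<otimes>\<^bsub>AHH\<^esub> \<psi>r) \<otimes>\<^bsub>AHHH\<^esub>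
      pure2 K A HHH \<one>\<^bsub>A\<^esub> (inv\<^bsub>HHH\<^esub> \<Phi>)) =
    pure4 K A H H H a \<one>\<^bsub>H\<^esub> \<one>\<^bsub>H\<^esub> \<one>\<^bsub>H\<^esub> \<otimes>\<^bsub>AHHH\<^esub> (fst3 K A A H H H rho (RR a' a'') \<otimes>\<^bsub>AHHH\<^esub>
      id2 K A H H HH \<Delta> \<psi>r)" (is "?l = ?r")
proof -
  let ?T = "AHHH"
  let ?app = "app K A H H H" and ?spl = "spl K A A H H rho (rho a'')" and ?d = "tm2 K A H HH \<Delta> (rho a'')"
  let ?a = "pure4 K A H H H a \<one>\<^bsub>H\<^esub> \<one>\<^bsub>H\<^esub> \<one>\<^bsub>H\<^esub>" and ?\<rho> = "apd K A H HH (rho a') (pure2 K H H \<one>\<^bsub>H\<^esub> \<one>\<^bsub>H\<^esub>)"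
  let ?m = "mid K A H H H H \<Delta> \<psi>r" and ?c = "pure2 K A HHH \<one>\<^bsub>A\<^esub> (inv\<^bsub>HHH\<^esub> \<Phi>)"
  let ?f = "fst3 K A A H H H rho \<psi>r" and ?i = "id2 K A H H HH \<Delta> \<psi>r"
  have c: "rho a'' \<in> carrier AH" "rho a' \<in> carrier AH"
    "?spl \<in> carrier AHH" "?d \<in> carrier AHH"
    "?app ?spl \<in> carrier ?T" "?app ?d \<in> carrier ?T" "?app \<psi>r \<in> carrier ?T"
    "?a \<in> carrier ?T" "?\<rho> \<in> carrier ?T" "?m \<in> carrier ?T" "?c \<in> carrier ?T" "?f \<in> carrier ?T" "?i \<in> carrier ?T"
    using assms by - (rule crules | assumption)+
  \<comment> \<open>These pull the appended unit out of each coaction term, so that products can be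
    formed inside \<open>?app\<close>, where \<open>A.rho_coassoc\<close> is available.\<close>
  note sm = snoc_maps[OF Am Hm Hm ones(1) c(1)] snoc_maps[OF Am Hm Hm ones(1) c(2)]
  interpret T: monoid ?T by (intro k_algebra_monoid[where K = K] k_algebra_tensor spaces)
  have "?app \<psi>r \<otimes>\<^bsub>?T\<^esub> (?app ?d \<otimes>\<^bsub>?T\<^esub> (?m \<otimes>\<^bsub>?T\<^esub> ?c)) = ?app (\<psi>r \<otimes>\<^bsub>AHH\<^esub> ?d) \<otimes>\<^bsub>?T\<^esub> (?m \<otimes>\<^bsub>?T\<^esub> ?c)"
    using c by (simp add: am_mult[OF am_A(1)] reassocs_closed T.m_assoc)
  also have "\<dots> = ?app ?spl \<otimes>\<^bsub>?T\<^esub> (?app \<psi>r \<otimes>\<^bsub>?T\<^esub> ?m \<otimes>\<^bsub>?T\<^esub> ?c)"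
    using c assms by (simp add: A.rho_coassoc am_mult[OF am_A(1)] reassocs_closed T.m_assoc)
  also have "\<dots> = ?app ?spl \<otimes>\<^bsub>?T\<^esub> (?f \<otimes>\<^bsub>?T\<^esub> ?i)"
    by (simp only: A.rho_pentagon)
  finally have e: "?app \<psi>r \<otimes>\<^bsub>?T\<^esub> (?app ?d \<otimes>\<^bsub>?T\<^esub> (?m \<otimes>\<^bsub>?T\<^esub> ?c)) = ?app ?spl \<otimes>\<^bsub>?T\<^esub> (?f \<otimes>\<^bsub>?T\<^esub> ?i)" .
  have "?l = ?a \<otimes>\<^bsub>?T\<^esub> (?\<rho> \<otimes>\<^bsub>?T\<^esub> (?app \<psi>r \<otimes>\<^bsub>?T\<^esub> (?app ?d \<otimes>\<^bsub>?T\<^esub> (?m \<otimes>\<^bsub>?T\<^esub> ?c))))"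
    using assms c by (simp add: RR_def am_mult[OF am_A(1)] am_mult[OF am_A(2)] alg_tensor reassocs_closed tm2_closed sm simps)
  also have "\<dots> = ?r"
    unfolding e using assms c by (simp add: RR_def am_mult[OF am_A(3)] alg_tensor reassocs_closed tm2_closed sm simps)
  finally show ?thesis .
qed

text \<open>The other half of associativity, with the two steps in reverse order:
  \<open>B.lam_pentagon\<close> comes first, then quasi-coassociativity of \<open>lam\<close> with a
  unit placed in front.\<close>

lemma LL_assoc:
  assumes "b \<in> carrier B" "b' \<in> carrier B" "b'' \<in> carrier B"
  shows "app K H H H B \<Phi> \<otimes>\<^bsub>HHHB\<^esub> (fst3 K H H H H B \<Delta> \<psi>l \<otimes>\<^bsub>HHHB\<^esub>
      (id2 K H H B HB lam (LL b b') \<otimes>\<^bsub>HHHB\<^esub> pure4 K H H H B \<one>\<^bsub>H\<^esub> \<one>\<^bsub>H\<^esub> \<one>\<^bsub>H\<^esub> b'')) =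
    mid K H H H H B \<Delta> \<psi>l \<otimes>\<^bsub>HHHB\<^esub> (pure2 K H HHB \<one>\<^bsub>H\<^esub> (spl K H H H B \<Delta> (lam b)) \<otimes>\<^bsub>HHHB\<^esub>
      pure2 K H HHB \<one>\<^bsub>H\<^esub> (LL b' b''))" (is "?l = ?r")
proof -
  let ?T = "HHHB" and ?S = "HHB"
  let ?app = "app K H H H B \<Phi>" and ?spl = "spl K H H H B \<Delta> (lam b)" and ?d = "tm2 K H B HB lam (lam b)"
  let ?m = "mid K H H H H B \<Delta> \<psi>l" and ?c = "pure2 K H ?S \<one>\<^bsub>H\<^esub>"
  let ?f = "fst3 K H H H H B \<Delta> \<psi>l" and ?i = "id2 K H H B HB lam \<psi>l"
  let ?X = "pure4 K H H H B \<one>\<^bsub>H\<^esub> \<one>\<^bsub>H\<^esub> \<one>\<^bsub>H\<^esub> b''" and ?Y = "pure3 K H H HB \<one>\<^bsub>H\<^esub> \<one>\<^bsub>H\<^esub> (lam b')"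
  have c: "lam b \<in> carrier HB" "lam b' \<in> carrier HB"
    "?spl \<in> carrier ?S" "?d \<in> carrier ?S" "?app \<in> carrier ?T" "?c ?spl \<in> carrier ?T" "?c ?d \<in> carrier ?T" "?c \<psi>l \<in> carrier ?T"
    "?m \<in> carrier ?T" "?f \<in> carrier ?T" "?i \<in> carrier ?T" "?X \<in> carrier ?T" "?Y \<in> carrier ?T"
    using assms by - (rule crules | assumption)+
  interpret T: monoid ?T by (intro k_algebra_monoid[where K = K] k_algebra_tensor spaces)
  note cons = am_mult[OF am_cons[OF Hh k_algebra_tensor[OF Hh k_algebra_tensor[OF Hh Bb]]], symmetric]
  have LL: "pure2 K H HB \<one>\<^bsub>H\<^esub> (lam b) \<in> carrier ?S" "pure3 K H H B \<one>\<^bsub>H\<^esub> \<one>\<^bsub>H\<^esub> b' \<in> carrier ?S"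
    "pure2 K H HB \<one>\<^bsub>H\<^esub> (lam b') \<in> carrier ?S" "pure3 K H H B \<one>\<^bsub>H\<^esub> \<one>\<^bsub>H\<^esub> b'' \<in> carrier ?S"
    using assms by - (rule crules | assumption)+
  have 1: "id2 K H H B HB lam (LL b b') = ?i \<otimes>\<^bsub>?T\<^esub> (?c ?d \<otimes>\<^bsub>?T\<^esub> ?Y)"
    unfolding LL_def using assms c(1) LL
    by (simp add: am_mult[OF am_B(4)] alg_tensor reassocs_closed spaces k_algebra_tensor) (simp add: spaces ones tm2_pure lin_coactions lin_tm2 pure2_closed module_tensor)
  have 2: "?c (LL b' b'') = ?c \<psi>l \<otimes>\<^bsub>?T\<^esub> (?Y \<otimes>\<^bsub>?T\<^esub> ?X)"
    unfolding LL_def using LL by (simp add: cons alg_tensor reassocs_closed spaces k_algebra_tensor)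
  have "?l = ?app \<otimes>\<^bsub>?T\<^esub> ?f \<otimes>\<^bsub>?T\<^esub> ?i \<otimes>\<^bsub>?T\<^esub> (?c ?d \<otimes>\<^bsub>?T\<^esub> (?Y \<otimes>\<^bsub>?T\<^esub> ?X))"
    unfolding 1 using c by (simp add: T.m_assoc)
  also have "\<dots> = ?m \<otimes>\<^bsub>?T\<^esub> ((?c \<psi>l \<otimes>\<^bsub>?T\<^esub> ?c ?d) \<otimes>\<^bsub>?T\<^esub> (?Y \<otimes>\<^bsub>?T\<^esub> ?X))"
    unfolding B.lam_pentagon using c by (simp add: T.m_assoc)
  also have "?c \<psi>l \<otimes>\<^bsub>?T\<^esub> ?c ?d = ?c ?spl \<otimes>\<^bsub>?T\<^esub> ?c \<psi>l"
    using c assms by (simp only: cons reassocs_closed B.lam_coassoc(2))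
  finally show ?thesis unfolding 2 using c by (simp add: T.m_assoc)
qed

lemma P_assoc:
  assumes "s \<in> carrier T" "t \<in> carrier T" "u \<in> carrier T"
  shows "s \<otimes>\<^bsub>P\<^esub> t \<otimes>\<^bsub>P\<^esub> u = s \<otimes>\<^bsub>P\<^esub> (t \<otimes>\<^bsub>P\<^esub> u)"
proof -
  note l = linP_eq lin_P_mult' lin_id module_T P_mult_closed pure_closed
  show ?thesis using assms(1)
  proof (induct s rule: tensor3_induct)
    case linP show ?case using assms by - (rule l | assumption)+
  next
    case (pure a x b)
    note 1 = pure
    show ?case using assms(2)
    proof (induct t rule: tensor3_induct)
      case linP show ?case using assms 1 by - (rule l | assumption)+
    next
      case (pure a' x' b')
      note 2 = pure
      show ?case using assms(3)
      proof (induct u rule: tensor3_induct)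
        case linP show ?case using 1 2 by - (rule l | assumption)+
      next
        case (pure a'' x'' b'')
        then show ?case using 1 2
          by (simp add: P_pure G_times_pure pure_times_G RR_closed LL_closed RR_assoc LL_assoc)
      qed (rule spaces)+
    qed (rule spaces)+
  qed (rule spaces)+
qed

section \<open>The unit of the crossed product\<close>

abbreviation "snocr \<rho> \<equiv> tm2 K A H HH (snoc K H H \<one>\<^bsub>H\<^esub>) \<rho>"

text \<open>Contraction is an algebra map that kills the inverse reassociator. On the coaction term
  it either removes the leg in \<open>H\<close>, by the counit axiom, or removes only the appended
  unit, in which case \<open>rho a'\<close> survives.\<close>

lemma RR_counit:
  assumes "a \<in> carrier A" "a' \<in> carrier A"
  shows "tm2 K A HH H (contract1_2 H \<epsilon>) (RR a a') = pure2 K A H (a \<otimes>\<^bsub>A\<^esub> a') \<one>\<^bsub>H\<^esub>"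
    "tm2 K A HH H (contract2_2 H \<epsilon>) (RR a a') = pure2 K A H a \<one>\<^bsub>H\<^esub> \<otimes>\<^bsub>AH\<^esub> rho a'"
proof -
  note am1 = am_tm2[OF am_counit1[OF Hh] Aa] and am2 = am_tm2[OF am_counit2[OF Hh] Aa]
  note cl = lin_contract1_2[OF functional_counit] lin_contract2_2[OF functional_counit]
  note cp = contract1_2_pure[OF functional_counit] contract2_2_pure[OF functional_counit]
  have e1: "tm2 K A HH H (contract1_2 H \<epsilon>) (snocr \<rho>) = pure2 K A H (contract2_2 A \<epsilon> \<rho>) \<one>\<^bsub>H\<^esub>"
    and e2: "tm2 K A HH H (contract2_2 H \<epsilon>) (snocr \<rho>) = \<rho>" if "\<rho> \<in> carrier AH" for \<rho>
  proof -
    show "tm2 K A HH H (contract1_2 H \<epsilon>) (snocr \<rho>) = pure2 K A H (contract2_2 A \<epsilon> \<rho>) \<one>\<^bsub>H\<^esub>"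
      using that
    proof (induct \<rho> rule: tensor_induct)
      case linP show ?case by (rule linP_eq lin_comp[OF cl(2)] cl lrules crules | assumption)+
    qed (simp_all add: simps cl cp pure2_smult functional_closed[OF functional_counit])
    show "tm2 K A HH H (contract2_2 H \<epsilon>) (snocr \<rho>) = \<rho>"
      using that
    proof (induct \<rho> rule: tensor_induct)
      case linP show ?case by (rule linP_eq cl lrules crules | assumption)+
    qed (simp_all add: simps cl cp counit_one)
  qed
  have c: "rho a' \<in> carrier AH" "snocr (rho a') \<in> carrier AHH"
    "pure3 K A H H a \<one>\<^bsub>H\<^esub> \<one>\<^bsub>H\<^esub> \<in> carrier AHH"
    "snocr (rho a') \<otimes>\<^bsub>AHH\<^esub> \<psi>r \<in> carrier AHH"
    using assms by - (rule crules | assumption)+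
  show "tm2 K A HH H (contract1_2 H \<epsilon>) (RR a a') = pure2 K A H (a \<otimes>\<^bsub>A\<^esub> a') \<one>\<^bsub>H\<^esub>"
    unfolding RR_def using assms c
    by (simp add: am_mult[OF am1] reassocs_closed e1 A.counit_rho_inv A.coaction_counit simps cl cp counit_one alg_tensor)
  show "tm2 K A HH H (contract2_2 H \<epsilon>) (RR a a') = pure2 K A H a \<one>\<^bsub>H\<^esub> \<otimes>\<^bsub>AH\<^esub> rho a'"
    unfolding RR_def using assms c
    by (simp add: am_mult[OF am2] reassocs_closed e2 A.counit_rho_inv simps cl cp counit_one alg_tensor)
qed

lemma LL_counit:
  assumes "b \<in> carrier B" "b' \<in> carrier B"
  shows "tm2 K H HB B (contract1_2 B \<epsilon>) (LL b b') = pure2 K H B \<one>\<^bsub>H\<^esub> (b \<otimes>\<^bsub>B\<^esub> b')"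
    "contract1_2 HB \<epsilon> (LL b b') = lam b \<otimes>\<^bsub>HB\<^esub> pure2 K H B \<one>\<^bsub>H\<^esub> b'"
proof -
  note am1 = am_tm2[OF am_counit1[OF Bb] Hh] and am2 = am_counit1[OF k_algebra_tensor[OF Hh Bb]]
  note cl = lin_contract1_2[OF functional_counit]
  note cp = contract1_2_pure[OF functional_counit]
  have K: "\<one>\<^bsub>K\<^esub> \<odot>\<^bsub>HB\<^esub> t = t" if "t \<in> carrier HB" for t
    using module.smult_one[OF module_tensor[OF Hm Bm] that] .
  have c: "lam b \<in> carrier HB" "pure2 K H HB \<one>\<^bsub>H\<^esub> (lam b) \<in> carrier HHB"
    "pure3 K H H B \<one>\<^bsub>H\<^esub> \<one>\<^bsub>H\<^esub> b' \<in> carrier HHB"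
    "pure2 K H HB \<one>\<^bsub>H\<^esub> (lam b) \<otimes>\<^bsub>HHB\<^esub> pure3 K H H B \<one>\<^bsub>H\<^esub> \<one>\<^bsub>H\<^esub> b' \<in> carrier HHB"
    using assms by - (rule crules | assumption)+
  show "tm2 K H HB B (contract1_2 B \<epsilon>) (LL b b') = pure2 K H B \<one>\<^bsub>H\<^esub> (b \<otimes>\<^bsub>B\<^esub> b')"
    unfolding LL_def using assms c
    by (simp add: am_mult[OF am1] am_mult[OF am_counit1[OF Bb]] one_tensor reassocs_closed B.counit_lam_inv B.coaction_counit simps cl cp counit_one alg_tensor
        module.smult_one[OF Bm])
  show "contract1_2 HB \<epsilon> (LL b b') = lam b \<otimes>\<^bsub>HB\<^esub> pure2 K H B \<one>\<^bsub>H\<^esub> b'"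
    unfolding LL_def using assms c
    by (simp add: am_mult[OF am2] reassocs_closed B.counit_lam_inv simps cl cp counit_one alg_tensor K)
qed

text \<open>With \<open>a\<close> and \<open>b\<close> arbitrary this covers more than the unit
  laws: it also governs the embeddings \<open>j\<close> and the products with the reassociators of
  the new coactions.\<close>

lemma P_one_middle:
  assumes "a \<in> carrier A" "b \<in> carrier B" "a' \<in> carrier A" "x' \<in> carrier M" "b' \<in> carrier B"
  shows "pAMB a \<one>\<^bsub>M\<^esub> b \<otimes>\<^bsub>P\<^esub> pAMB a' x' b' =
    G1 A B x' (pure2 K A H (a \<otimes>\<^bsub>A\<^esub> a') \<one>\<^bsub>H\<^esub>) (lam b \<otimes>\<^bsub>HB\<^esub> pure2 K H B \<one>\<^bsub>H\<^esub> b')"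
    "pAMB a' x' b' \<otimes>\<^bsub>P\<^esub> pAMB a \<one>\<^bsub>M\<^esub> b =
    G1 A B x' (pure2 K A H a' \<one>\<^bsub>H\<^esub> \<otimes>\<^bsub>AH\<^esub> rho a) (pure2 K H B \<one>\<^bsub>H\<^esub> (b' \<otimes>\<^bsub>B\<^esub> b))"
  using assms by (simp_all add: P_pure ones G_one_left G_one_right RR_closed LL_closed spaces RR_counit LL_counit)

lemma P_unit:
  assumes "s \<in> carrier T"
  shows "\<one>\<^bsub>P\<^esub> \<otimes>\<^bsub>P\<^esub> s = s" "s \<otimes>\<^bsub>P\<^esub> \<one>\<^bsub>P\<^esub> = s"
proof -
  note l = linP_eq lin_P_mult' lin_id module_T P_mult_closed pure_closed ones
  show "\<one>\<^bsub>P\<^esub> \<otimes>\<^bsub>P\<^esub> s = s" unfolding P_fields using assms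
  proof (induct s rule: tensor3_induct)
    case linP show ?case by (rule l | assumption)+
  qed (simp_all add: P_one_middle comult_one G1_pure act_one simps)
  show "s \<otimes>\<^bsub>P\<^esub> \<one>\<^bsub>P\<^esub> = s" unfolding P_fields using assms
  proof (induct s rule: tensor3_induct)
    case linP show ?case by (rule l | assumption)+
  qed (simp_all add: P_one_middle comult_one G1_pure act_one simps)
qed

theorem k_algebra_P: "k_algebra K P"
proof -
  interpret P: module K P by (rule module_P)
  have one: "\<one>\<^bsub>P\<^esub> \<in> carrier P" unfolding P_fields by (intro pure_closed ones)
  note c = P_fields(1)
  note l = lin_P_mult[folded lin_P_iff] lin_P_mult[folded c lin_P_iff]
  have "ring P"
  proof (rule ringI)
    show "abelian_group P" ..
    show "monoid P" using one
      by (intro monoidI) (simp_all add: c P_mult_closed P_assoc P_unit)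
  qed (simp_all only: lin_add[OF l(3)] lin_add[OF l(4)])
  then show ?thesis
    by (intro k_algebra.intro k_algebra_axioms.intro module_P H.K.field_axioms)
      (simp_all only: lin_smult[OF l(3)] lin_smult[OF l(4)])
qed

end

section \<open>Comodule algebra axioms in terms of composite maps\<close>

context quasi_bialgebra
begin

text \<open>The Sweedler-style maps of the locale are replaced by \<open>spl\<close>,
  \<open>tm2\<close> and their composites, for which multiplicativity and naturality are at
  hand.\<close>

lemma right_comodule_algebraI:
  assumes A: "k_algebra K A" and rho: "am K A (tensor K A H) rho" and \<Phi>r: "\<Phi>r \<in> Units (tensor3 K A H H)"
    and "\<And>a. a \<in> carrier A \<Longrightarrow> \<Phi>r \<otimes>\<^bsub>tensor3 K A H H\<^esub> spl K A A H H rho (rho a) =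
      tm2 K A H HH \<Delta> (rho a) \<otimes>\<^bsub>tensor3 K A H H\<^esub> \<Phi>r"
    and "pure2 K A HHH \<one>\<^bsub>A\<^esub> \<Phi> \<otimes>\<^bsub>tensor4 K A H H H\<^esub> mid K A H H H H \<Delta> \<Phi>r \<otimes>\<^bsub>tensor4 K A H H H\<^esub> app K A H H H \<Phi>r =
     id2 K A H H HH \<Delta> \<Phi>r \<otimes>\<^bsub>tensor4 K A H H H\<^esub> fst3 K A A H H H rho \<Phi>r"
    and "\<And>a. a \<in> carrier A \<Longrightarrow> contract2_2 A \<epsilon> (rho a) = a"
    and "tm2 K A HH H (contract1_2 H \<epsilon>) \<Phi>r = \<one>\<^bsub>tensor K A H\<^esub>"
    and "tm2 K A HH H (contract2_2 H \<epsilon>) \<Phi>r = \<one>\<^bsub>tensor K A H\<^esub>"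
  shows "right_comodule_algebra K H \<Delta> \<epsilon> \<Phi> A rho \<Phi>r"
proof -
  interpret T: monoid "tensor3 K A H H" by (intro k_algebra_monoid[where K = K] k_algebra_tensor Hh A)
  note c = T.Units_closed[OF \<Phi>r] and m = k_algebra_module[OF Hh] k_algebra_module[OF A]
  note eqs = split1_2_eq[where U = A] split2_2_eq[OF am_lin[OF am_comult]] split2_3_eq[OF am_lin[OF am_comult]]
    split3_3_eq[OF am_lin[OF am_comult]] split1_3_eq[OF am_lin[OF rho]] append_factor_eq
    contract2_3_eq contract3_3_eq
  show ?thesis
    by (intro right_comodule_algebra.intro right_comodule_algebra_axioms.intro quasi_bialgebra_axioms A \<Phi>r)
      (use assms c m functional_counit am_closed[OF rho] alg_one_closed[OF Hh] am_iff[OF A k_algebra_tensor[OF A Hh], of rho]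
       in \<open>simp_all add: eqs\<close>)
qed

lemma left_comodule_algebraI:
  assumes B: "k_algebra K B" and lam: "am K B (tensor K H B) lam" and \<Phi>l: "\<Phi>l \<in> Units (tensor3 K H H B)"
    and "\<And>b. b \<in> carrier B \<Longrightarrow> tm2 K H B (tensor K H B) lam (lam b) \<otimes>\<^bsub>tensor3 K H H B\<^esub> \<Phi>l =
       \<Phi>l \<otimes>\<^bsub>tensor3 K H H B\<^esub> spl K H H H B \<Delta> (lam b)"
    and "pure2 K H (tensor3 K H H B) \<one>\<^bsub>H\<^esub> \<Phi>l \<otimes>\<^bsub>tensor4 K H H H B\<^esub> mid K H H H H B \<Delta> \<Phi>l \<otimes>\<^bsub>tensor4 K H H H B\<^esub> app K H H H B \<Phi> =
     id2 K H H B (tensor K H B) lam \<Phi>l \<otimes>\<^bsub>tensor4 K H H H B\<^esub> fst3 K H H H H B \<Delta> \<Phi>l"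
    and "\<And>b. b \<in> carrier B \<Longrightarrow> contract1_2 B \<epsilon> (lam b) = b"
    and "tm2 K H (tensor K H B) B (contract1_2 B \<epsilon>) \<Phi>l = \<one>\<^bsub>tensor K H B\<^esub>"
    and "contract1_2 (tensor K H B) \<epsilon> \<Phi>l = \<one>\<^bsub>tensor K H B\<^esub>"
  shows "left_comodule_algebra K H \<Delta> \<epsilon> \<Phi> B lam \<Phi>l"
proof -
  interpret T: monoid "tensor3 K H H B" by (intro k_algebra_monoid[where K = K] k_algebra_tensor Hh B)
  note c = T.Units_closed[OF \<Phi>l] and m = k_algebra_module[OF Hh] k_algebra_module[OF B]
  note eqs = split1_2_eq[where U = H] split2_2_eq[OF am_lin[OF lam]] split2_3_eq[OF am_lin[OF am_comult]]
    split3_3_eq[OF am_lin[OF lam]] split1_3_eq[OF am_lin[OF am_comult]] append_factor_eq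
    contract2_3_eq contract1_3_eq
  show ?thesis
    by (intro left_comodule_algebra.intro left_comodule_algebra_axioms.intro quasi_bialgebra_axioms B \<Phi>l)
      (use assms c m functional_counit am_closed[OF lam] alg_one_closed[OF B] reassoc_closed am_iff[OF B k_algebra_tensor[OF Hh B], of lam]
       in \<open>simp_all add: eqs\<close>)
qed

end

lemma (in right_comodule_algebra) rho_pentagon':
  "pure2 K A (tensor3 K H H H) \<one>\<^bsub>A\<^esub> \<Phi> \<otimes>\<^bsub>tensor4 K A H H H\<^esub> mid K A H H H H \<Delta> \<Phi>r \<otimes>\<^bsub>tensor4 K A H H H\<^esub> app K A H H H \<Phi>r =
     id2 K A H H (tensor K H H) \<Delta> \<Phi>r \<otimes>\<^bsub>tensor4 K A H H H\<^esub> fst3 K A A H H H rho \<Phi>r"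
  using coaction_pentagon k_algebra_module[OF Hh] k_algebra_module[OF Aa] rho_reassoc_closed(1) alg_one_closed[OF Hh]
  by (simp add: split2_3_eq[OF am_lin[OF am_comult]] split3_3_eq[OF am_lin[OF am_comult]]
       split1_3_eq[OF am_lin[OF am_rho]] append_factor_eq)

lemma (in left_comodule_algebra) lam_pentagon':
  "pure2 K H (tensor3 K H H B) \<one>\<^bsub>H\<^esub> \<Phi>l \<otimes>\<^bsub>tensor4 K H H H B\<^esub> mid K H H H H B \<Delta> \<Phi>l \<otimes>\<^bsub>tensor4 K H H H B\<^esub> app K H H H B \<Phi> =
     id2 K H H B (tensor K H B) lam \<Phi>l \<otimes>\<^bsub>tensor4 K H H H B\<^esub> fst3 K H H H H B \<Delta> \<Phi>l"
  using coaction_pentagon k_algebra_module[OF Hh] k_algebra_module[OF Bb] lam_reassoc_closed(1) alg_one_closed[OF Bb] reassoc_closed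
  by (simp add: split2_3_eq[OF am_lin[OF am_comult]] split3_3_eq[OF am_lin[OF am_lam]]
       split1_3_eq[OF am_lin[OF am_comult]] append_factor_eq)

section \<open>Bicomodule algebras\<close>

context bicomodule_algebra
begin
abbreviation "BH \<equiv> tensor K B H"
abbreviation "HB \<equiv> tensor K H B"
abbreviation "HH \<equiv> tensor K H H"
abbreviation "BHH \<equiv> tensor3 K B H H"
abbreviation "HBH \<equiv> tensor3 K H B H"
abbreviation "HHB \<equiv> tensor3 K H H B"
abbreviation "HBHH \<equiv> tensor4 K H B H H"
abbreviation "HHBH \<equiv> tensor4 K H H B H"

lemmas Hh = left.Hh and Bb = left.Bb
lemmas Hm = k_algebra_module[OF Hh] and Bm = k_algebra_module[OF Bb]

abbreviation "\<theta> \<equiv> inv\<^bsub>HBH\<^esub> \<Phi>lr"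

lemma bi_reassoc_closed: "\<Phi>lr \<in> carrier HBH" "\<theta> \<in> carrier HBH"
proof -
  interpret T: monoid "HBH" by (intro k_algebra_monoid[where K = K] k_algebra_tensor Hh Bb)
  show "\<Phi>lr \<in> carrier HBH" "\<theta> \<in> carrier HBH"
    using bi_reassoc_invertible by (auto intro: T.Units_closed)
qed

lemma bi_coassoc:
  assumes "u \<in> carrier B"
  shows "\<theta> \<otimes>\<^bsub>HBH\<^esub> tm2 K H B BH rho (lam u) = spl K B H B H lam (rho u) \<otimes>\<^bsub>HBH\<^esub> \<theta>"
proof -
  interpret T: monoid "HBH" by (intro k_algebra_monoid[where K = K] k_algebra_tensor Hh Bb)
  note c = am_closed[OF right.am_rho assms] am_closed[OF left.am_lam assms]
  have e: "\<Phi>lr \<otimes>\<^bsub>HBH\<^esub> spl K B H B H lam (rho u) = tm2 K H B BH rho (lam u) \<otimes>\<^bsub>HBH\<^esub> \<Phi>lr"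
    using bi_quasi_coassoc[OF assms] c Hm Bm
    by (simp add: split1_2_eq[where U = B] split2_2_eq[OF am_lin[OF right.am_rho]])
  show ?thesis
    by (intro T.intertwine_inv bi_reassoc_invertible e am_closed[OF am_spl[OF left.am_lam Hh Bb Hh]]
        am_closed[OF am_tm2[OF right.am_rho Hh]] c)
qed

lemma bi_pentagon_left':
  "pure2 K H HBH \<one>\<^bsub>H\<^esub> \<Phi>lr \<otimes>\<^bsub>HHBH\<^esub> mid K H B H B H lam \<Phi>lr \<otimes>\<^bsub>HHBH\<^esub> app K H H B H \<Phi>l =
     id2 K H H B BH rho \<Phi>l \<otimes>\<^bsub>HHBH\<^esub> fst3 K H H H B H \<Delta> \<Phi>lr"
  using bi_pentagon_left Hm Bm bi_reassoc_closed left.lam_reassoc_closed alg_one_closed[OF Hh]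
  by (simp add: split2_3_eq[OF am_lin[OF left.am_lam]] split3_3_eq[OF am_lin[OF right.am_rho]]
       split1_3_eq[OF am_lin[OF left.am_comult]] append_factor_eq)

lemma bi_pentagon_right':
  "pure2 K H BHH \<one>\<^bsub>H\<^esub> \<Phi>r \<otimes>\<^bsub>HBHH\<^esub> mid K H B B H H rho \<Phi>lr \<otimes>\<^bsub>HBHH\<^esub> app K H B H H \<Phi>lr =
     id2 K H B H HH \<Delta> \<Phi>lr \<otimes>\<^bsub>HBHH\<^esub> fst3 K B H B H H lam \<Phi>r"
  using bi_pentagon_right Hm Bm bi_reassoc_closed right.rho_reassoc_closed alg_one_closed[OF Hh]
  by (simp add: split2_3_eq[OF am_lin[OF right.am_rho]] split3_3_eq[OF am_lin[OF left.am_comult]]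
       split1_3_eq[OF am_lin[OF left.am_lam]] append_factor_eq)

text \<open>The first form serves multiplicativity of the right coaction on a crossed product
  (\<open>TR_mult\<close>), the second quasi-coassociativity of the left coaction
  (\<open>TL_coassoc\<close>).\<close>

lemma bi_left_inverses:
  defines "\<psi> \<equiv> inv\<^bsub>HHB\<^esub> \<Phi>l" and "T \<equiv> HHBH"
  shows "app K H H B H \<psi> \<otimes>\<^bsub>T\<^esub> mid K H B H B H lam \<theta> \<otimes>\<^bsub>T\<^esub> pure2 K H HBH \<one>\<^bsub>H\<^esub> \<theta> =
    fst3 K H H H B H \<Delta> \<theta> \<otimes>\<^bsub>T\<^esub> id2 K H H B BH rho \<psi>"
    "mid K H B H B H lam \<theta> \<otimes>\<^bsub>T\<^esub> pure2 K H HBH \<one>\<^bsub>H\<^esub> \<theta> \<otimes>\<^bsub>T\<^esub> id2 K H H B BH rho \<Phi>l =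
    app K H H B H \<Phi>l \<otimes>\<^bsub>T\<^esub> fst3 K H H H B H \<Delta> \<theta>"
proof -
  interpret T: monoid T unfolding T_def by (intro k_algebra_monoid[where K = K] k_algebra_tensor Hh Bb)
  note u = am_Units[OF am_cons[OF Hh k_algebra_tensor[OF Hh k_algebra_tensor[OF Bb Hh]]] bi_reassoc_invertible]
     am_Units[OF am_mid[OF left.am_lam Hh Hh Bb Hh] bi_reassoc_invertible]
     am_Units[OF am_app[OF Hh Hh Bb Hh] left.coaction_reassoc_invertible]
     am_Units[OF am_id2[OF right.am_rho Hh Hh] left.coaction_reassoc_invertible]
     am_Units[OF am_fst3[OF left.am_comult Hh Hh Bb Hh] bi_reassoc_invertible]
  note p = T.pentagon_inverses[OF _ _ _ _ _ bi_pentagon_left'[folded T_def]]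
  show "app K H H B H \<psi> \<otimes>\<^bsub>T\<^esub> mid K H B H B H lam \<theta> \<otimes>\<^bsub>T\<^esub> pure2 K H HBH \<one>\<^bsub>H\<^esub> \<theta> =
    fst3 K H H H B H \<Delta> \<theta> \<otimes>\<^bsub>T\<^esub> id2 K H H B BH rho \<psi>"
    unfolding \<psi>_def u(2,4,6,8,10) T_def[symmetric] by (rule p(1)) (use u in \<open>simp_all add: T_def\<close>)
  show "mid K H B H B H lam \<theta> \<otimes>\<^bsub>T\<^esub> pure2 K H HBH \<one>\<^bsub>H\<^esub> \<theta> \<otimes>\<^bsub>T\<^esub> id2 K H H B BH rho \<Phi>l =
    app K H H B H \<Phi>l \<otimes>\<^bsub>T\<^esub> fst3 K H H H B H \<Delta> \<theta>"
    unfolding u(2,4,6,8,10) T_def[symmetric] by (rule p(4)) (use u in \<open>simp_all add: T_def\<close>)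
qed

text \<open>The roles are exchanged here: the first form serves multiplicativity of the left
  coaction (\<open>TL_mult\<close>), the second quasi-coassociativity of the right coaction
  (\<open>TR_coassoc\<close>).\<close>

lemma bi_right_inverses:
  defines "\<psi> \<equiv> inv\<^bsub>BHH\<^esub> \<Phi>r" and "T \<equiv> HBHH"
  shows "app K H B H H \<theta> \<otimes>\<^bsub>T\<^esub> mid K H B B H H rho \<theta> \<otimes>\<^bsub>T\<^esub> pure2 K H BHH \<one>\<^bsub>H\<^esub> \<psi> =
     fst3 K B H B H H lam \<psi> \<otimes>\<^bsub>T\<^esub> id2 K H B H HH \<Delta> \<theta>"
    "fst3 K B H B H H lam \<Phi>r \<otimes>\<^bsub>T\<^esub> app K H B H H \<theta> \<otimes>\<^bsub>T\<^esub> mid K H B B H H rho \<theta> =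
     id2 K H B H HH \<Delta> \<theta> \<otimes>\<^bsub>T\<^esub> pure2 K H BHH \<one>\<^bsub>H\<^esub> \<Phi>r"
proof -
  interpret T: monoid T unfolding T_def by (intro k_algebra_monoid[where K = K] k_algebra_tensor Hh Bb)
  note u = am_Units[OF am_cons[OF Hh k_algebra_tensor[OF Bb k_algebra_tensor[OF Hh Hh]]] right.coaction_reassoc_invertible]
     am_Units[OF am_mid[OF right.am_rho Hh Bb Hh Hh] bi_reassoc_invertible]
     am_Units[OF am_app[OF Hh Bb Hh Hh] bi_reassoc_invertible]
     am_Units[OF am_id2[OF left.am_comult Hh Bb] bi_reassoc_invertible]
     am_Units[OF am_fst3[OF left.am_lam Hh Bb Hh Hh] right.coaction_reassoc_invertible]
  note p = T.pentagon_inverses[OF _ _ _ _ _ bi_pentagon_right'[folded T_def]]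
  show "app K H B H H \<theta> \<otimes>\<^bsub>T\<^esub> mid K H B B H H rho \<theta> \<otimes>\<^bsub>T\<^esub> pure2 K H BHH \<one>\<^bsub>H\<^esub> \<psi> =
     fst3 K B H B H H lam \<psi> \<otimes>\<^bsub>T\<^esub> id2 K H B H HH \<Delta> \<theta>"
    unfolding \<psi>_def u(2,4,6,8,10) T_def[symmetric] by (rule p(1)) (use u in \<open>simp_all add: T_def\<close>)
  show "fst3 K B H B H H lam \<Phi>r \<otimes>\<^bsub>T\<^esub> app K H B H H \<theta> \<otimes>\<^bsub>T\<^esub> mid K H B B H H rho \<theta> =
     id2 K H B H HH \<Delta> \<theta> \<otimes>\<^bsub>T\<^esub> pure2 K H BHH \<one>\<^bsub>H\<^esub> \<Phi>r"
    unfolding u(2,4,6,8,10) T_def[symmetric] by (rule p(3)) (use u in \<open>simp_all add: T_def\<close>)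
qed

lemmas counit_lin = lin_contract1_2[OF left.functional_counit] lin_contract2_2[OF left.functional_counit]
lemmas counit_pure = contract1_2_pure[OF left.functional_counit] contract2_2_pure[OF left.functional_counit]
lemmas counit_closed = functional_closed[OF left.functional_counit]
lemmas bi_lin = am_lin[OF left.am_comult] am_lin[OF left.am_lam] am_lin[OF right.am_rho]
lemmas bi_lrules = counit_lin counit_lin[THEN lin_comp] lin_rules lin_tm2 lin_tm1 lin_spl lin_snoc bi_lin bi_lin[THEN lin_comp]
lemmas bi_coactions_closed = am_closed[OF left.am_comult] am_closed[OF left.am_lam] am_closed[OF right.am_rho]
lemmas bi_spaces = Hh Bb Hm Bm
lemmas bi_ones = alg_one_closed[OF Hh] alg_one_closed[OF Bb]
lemmas bi_crules = closed_rules bi_spaces bi_ones alg_tensor(1,2) bi_coactions_closed bi_reassoc_closed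
   left.lam_reassoc_closed right.rho_reassoc_closed
lemmas bi_simps = bi_spaces bi_ones bi_coactions_closed pure2_closed module_tensor k_algebra_tensor tm2_pure tm1_pure
  spl_pure apd_pure lin_spl lin_snoc lin_tm2 lin_tm1 snoc_apply bi_lin counit_lin counit_pure counit_closed
  pure2_smult smult_closed[where K = K] left.counit_one

text \<open>Appending \<open>v\<close> does not touch the contracted leg. Applied to a coaction or a
  coproduct, the right-hand sides are then evaluated by the counit axioms.\<close>

lemma contract_apd:
  fixes V :: "('k, 'v) module" and U :: "('k, 'u) module"
  assumes "module K U" "module K V" "v \<in> carrier V"
  shows "t \<in> carrier (tensor K U H) \<Longrightarrow>
      tm2 K U (tensor K H V) V (contract1_2 V \<epsilon>) (apd K U H V t v) = pure2 K U V (contract2_2 U \<epsilon> t) v"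
    "s \<in> carrier (tensor K H U) \<Longrightarrow>
      contract1_2 (tensor K U V) \<epsilon> (apd K H U V s v) = pure2 K U V (contract1_2 U \<epsilon> s) v"
proof -
  show "tm2 K U (tensor K H V) V (contract1_2 V \<epsilon>) (apd K U H V t v) = pure2 K U V (contract2_2 U \<epsilon> t) v"
    if "t \<in> carrier (tensor K U H)"
    using that
  proof (induct t rule: tensor_induct)
    case linP show ?case using assms by - (rule linP_eq bi_lrules bi_crules | assumption)+
  qed (simp_all add: assms bi_simps)
  show "contract1_2 (tensor K U V) \<epsilon> (apd K H U V s v) = pure2 K U V (contract1_2 U \<epsilon> s) v"
    if "s \<in> carrier (tensor K H U)"
    using that
  proof (induct s rule: tensor_induct)
    case linP show ?case using assms by - (rule linP_eq bi_lrules bi_crules | assumption)+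
  qed (simp_all add: assms bi_simps)
qed

lemma monoid_cancel_one:
  assumes "monoid G" "u \<in> Units G" "x \<in> carrier G"
  shows "u \<otimes>\<^bsub>G\<^esub> x = u \<Longrightarrow> x = \<one>\<^bsub>G\<^esub>" "x \<otimes>\<^bsub>G\<^esub> u = u \<Longrightarrow> x = \<one>\<^bsub>G\<^esub>"
proof -
  interpret monoid G by fact
  show "x = \<one>\<^bsub>G\<^esub>" if "u \<otimes>\<^bsub>G\<^esub> x = u"
    using assms that Units_l_cancel[of u x "\<one>\<^bsub>G\<^esub>"] by (simp add: Units_closed)
  show "x = \<one>\<^bsub>G\<^esub>" if "x \<otimes>\<^bsub>G\<^esub> u = u"
  proof -
    have "x = x \<otimes>\<^bsub>G\<^esub> u \<otimes>\<^bsub>G\<^esub> inv\<^bsub>G\<^esub> u" using assms by (simp add: m_assoc Units_closed)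
    then show ?thesis using that assms by simp
  qed
qed

text \<open>Contracting one inner leg of a mixed pentagon by the counit turns every term but one
  into \<open>\<Phi>lr\<close> or the unit; the remaining term is the contraction in question with a
  unit inserted, and the invertible \<open>\<Phi>lr\<close> cancels.\<close>

lemma counit_bi_reassoc:
  "tm2 K H BH B (contract2_2 B \<epsilon>) \<Phi>lr = \<one>\<^bsub>HB\<^esub>"
  "contract1_2 BH \<epsilon> \<Phi>lr = \<one>\<^bsub>BH\<^esub>"
proof -
  interpret T: monoid "HBH" by (intro k_algebra_monoid[where K = K] k_algebra_tensor Hh Bb)
  let ?T = "HBH"
  \<comment> \<open>Contracts the third of the four legs. There \<open>rho\<close>, \<Delta> and the
    middle leg of \<open>\<Phi>r\<close> each fall under a counit axiom, and only the term with an
    appended unit produces \<open>?\<kappa>\<close>.\<close>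
  let ?c = "tm2 K H BHH BH (tm2 K B HH H (contract1_2 H \<epsilon>))"
  let ?\<kappa> = "tm2 K H BH B (contract2_2 B \<epsilon>) \<Phi>lr"
  have amc: "am K HBHH ?T ?c" by (intro am_tm2 left.am_counit1 Hh Bb)
  have c: "pure2 K H BHH \<one>\<^bsub>H\<^esub> \<Phi>r \<in> carrier HBHH" "mid K H B B H H rho \<Phi>lr \<in> carrier HBHH"
    "app K H B H H \<Phi>lr \<in> carrier HBHH" "id2 K H B H HH \<Delta> \<Phi>lr \<in> carrier HBHH"
    "fst3 K B H B H H lam \<Phi>r \<in> carrier HBHH"
    "tm2 K H B BH (snoc K B H \<one>\<^bsub>H\<^esub>) ?\<kappa> \<in> carrier ?T"
    by (rule bi_lrules bi_crules | assumption)+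
  have 1: "?c (pure2 K H BHH \<one>\<^bsub>H\<^esub> \<Phi>r) = \<one>\<^bsub>?T\<^esub>"
    using right.rho_reassoc_closed by (simp add: bi_simps right.counit_rho_inv one_tensor)
  have 2: "?c (mid K H B B H H rho s) = s" if "s \<in> carrier ?T" for s using that
  proof (induct s rule: tensor3_induct)
    case linP show ?case by (rule linP_eq bi_lrules bi_crules | assumption)+
  qed (simp_all add: bi_simps apd_closed contract_apd right.coaction_counit)
  have 3: "?c (app K H B H H s) = tm2 K H B BH (snoc K B H \<one>\<^bsub>H\<^esub>) (tm2 K H BH B (contract2_2 B \<epsilon>) s)"
    if "s \<in> carrier ?T" for s using that
  proof (induct s rule: tensor3_induct)
    case linP show ?case by (rule linP_eq bi_lrules bi_crules | assumption)+
  qed (simp_all add: bi_simps lin_smult[OF lin_snoc] lin_smult[OF lin_tm2])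
  have 4: "?c (id2 K H B H HH \<Delta> s) = s" if "s \<in> carrier ?T" for s using that
  proof (induct s rule: tensor3_induct)
    case linP show ?case by (rule linP_eq bi_lrules bi_crules | assumption)+
  qed (simp_all add: bi_simps left.counit_left)
  have 5: "?c (fst3 K B H B H H lam s) = spl K B H B H lam (tm2 K B HH H (contract1_2 H \<epsilon>) s)"
    if "s \<in> carrier BHH" for s using that
  proof (induct s rule: tensor3_induct)
    case linP show ?case by (rule linP_eq bi_lrules bi_crules | assumption)+
  next
    case (pure b h k)
    have "?c (apd K H B HH t (pure2 K H H h k)) = apd K H B H t (\<epsilon> h \<odot>\<^bsub>H\<^esub> k)" if "t \<in> carrier HB" for t
      using that
    proof (induct t rule: tensor_induct)
      case linP show ?case using pure by - (rule linP_eq bi_lrules bi_crules smult_closed counit_closed | assumption)+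
    qed (simp_all add: bi_simps pure)
    then show ?case using pure by (simp add: bi_simps lin_smult[OF lin_spl] lin_smult[OF lin_apd_right[OF _ _ lin_id]])
  qed (rule bi_spaces)+
  have "\<Phi>lr \<otimes>\<^bsub>?T\<^esub> tm2 K H B BH (snoc K B H \<one>\<^bsub>H\<^esub>) ?\<kappa> = \<Phi>lr \<otimes>\<^bsub>?T\<^esub> \<one>\<^bsub>?T\<^esub>"
    using arg_cong[OF bi_pentagon_right', of ?c] c bi_reassoc_closed
    by (simp add: am_mult[OF amc] alg_tensor bi_spaces k_algebra_tensor 1 2 3 4 5 right.rho_reassoc_closed right.counit_rho_inv
        am_one[OF am_spl[OF left.am_lam Hh Bb Hh]])
  then have "tm2 K H B BH (snoc K B H \<one>\<^bsub>H\<^esub>) ?\<kappa> = \<one>\<^bsub>?T\<^esub>"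
    using bi_reassoc_invertible bi_reassoc_closed c by (intro monoid_cancel_one(1)[OF T.monoid_axioms]) simp_all
  \<comment> \<open>Contracting the appended unit recovers \<open>?\<kappa>\<close> itself from the
    equation just obtained.\<close>
  moreover have "tm2 K H BH B (contract2_2 B \<epsilon>) (tm2 K H B BH (snoc K B H \<one>\<^bsub>H\<^esub>) s) = s"
    if "s \<in> carrier HB" for s using that
  proof (induct s rule: tensor_induct)
    case linP show ?case by (rule linP_eq bi_lrules bi_crules | assumption)+
  qed (simp_all add: bi_simps)
  moreover have "?\<kappa> \<in> carrier HB" by (rule bi_lrules bi_crules | assumption)+
  ultimately show "?\<kappa> = \<one>\<^bsub>HB\<^esub>"
    using am_one[OF am_tm2[OF left.am_counit2[OF Bb] Hh]] by metis
next
  interpret T: monoid "HBH" by (intro k_algebra_monoid[where K = K] k_algebra_tensor Hh Bb)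
  let ?T = "HBH"
  \<comment> \<open>Now the second of the four legs of the left mixed pentagon. The unknown
    contraction arises in the first term, with a unit in front, and \<open>\<Phi>lr\<close> is
    cancelled on its right.\<close>
  let ?c = "tm2 K H HBH BH (contract1_2 BH \<epsilon>)"
  let ?\<kappa> = "contract1_2 BH \<epsilon> \<Phi>lr"
  have amc: "am K HHBH ?T ?c" by (intro am_tm2 left.am_counit1 Hh Bb k_algebra_tensor)
  have k: "?\<kappa> \<in> carrier BH"
    using lin_closed[OF counit_lin(1)[OF Hm module_tensor[OF Bm Hm]]] bi_reassoc_closed by blast
  have c: "pure2 K H HBH \<one>\<^bsub>H\<^esub> \<Phi>lr \<in> carrier HHBH" "mid K H B H B H lam \<Phi>lr \<in> carrier HHBH"
    "app K H H B H \<Phi>l \<in> carrier HHBH" "id2 K H H B BH rho \<Phi>l \<in> carrier HHBH"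
    "fst3 K H H H B H \<Delta> \<Phi>lr \<in> carrier HHBH"
    "pure2 K H BH \<one>\<^bsub>H\<^esub> ?\<kappa> \<in> carrier ?T"
    using k by - (rule bi_lrules bi_crules | assumption)+
  have 1: "?c (pure2 K H HBH \<one>\<^bsub>H\<^esub> \<Phi>lr) = pure2 K H BH \<one>\<^bsub>H\<^esub> ?\<kappa>"
    using bi_reassoc_closed by (simp add: bi_simps)
  have 2: "?c (mid K H B H B H lam s) = s" if "s \<in> carrier ?T" for s using that
  proof (induct s rule: tensor3_induct)
    case linP show ?case by (rule linP_eq bi_lrules bi_crules | assumption)+
  qed (simp_all add: bi_simps apd_closed contract_apd left.coaction_counit)
  have 3: "?c (app K H H B H s) = tm2 K H B BH (snoc K B H \<one>\<^bsub>H\<^esub>) (tm2 K H HB B (contract1_2 B \<epsilon>) s)"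
    "?c (id2 K H H B BH rho s) = tm2 K H B BH rho (tm2 K H HB B (contract1_2 B \<epsilon>) s)"
    if "s \<in> carrier HHB" for s
  proof -
    show "?c (app K H H B H s) = tm2 K H B BH (snoc K B H \<one>\<^bsub>H\<^esub>) (tm2 K H HB B (contract1_2 B \<epsilon>) s)"
      using that
    proof (induct s rule: tensor3_induct)
      case linP show ?case by (rule linP_eq bi_lrules bi_crules | assumption)+
    qed (simp_all add: bi_simps lin_smult[OF lin_snoc] lin_smult[OF lin_tm2])
    show "?c (id2 K H H B BH rho s) = tm2 K H B BH rho (tm2 K H HB B (contract1_2 B \<epsilon>) s)"
      using that
    proof (induct s rule: tensor3_induct)
      case linP show ?case by (rule linP_eq bi_lrules bi_crules | assumption)+
    qed (simp_all add: bi_simps lin_smult[OF bi_lin(3)] lin_smult[OF lin_tm2])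
  qed
  have 4: "?c (fst3 K H H H B H \<Delta> s) = s" if "s \<in> carrier ?T" for s using that
  proof (induct s rule: tensor3_induct)
    case linP show ?case by (rule linP_eq bi_lrules bi_crules | assumption)+
  qed (simp_all add: bi_simps contract_apd left.counit_right)
  have "pure2 K H BH \<one>\<^bsub>H\<^esub> ?\<kappa> \<otimes>\<^bsub>?T\<^esub> \<Phi>lr = \<one>\<^bsub>?T\<^esub> \<otimes>\<^bsub>?T\<^esub> \<Phi>lr"
    using arg_cong[OF bi_pentagon_left', of ?c] c bi_reassoc_closed
    by (simp add: am_mult[OF amc] alg_tensor bi_spaces k_algebra_tensor 1 2 3 4 left.lam_reassoc_closed left.counit_lam_inv
        am_one[OF am_tm2[OF right.am_rho Hh]] am_one[OF am_tm2[OF am_snoc[OF Bb Hh] Hh]])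
  then have "pure2 K H BH \<one>\<^bsub>H\<^esub> ?\<kappa> = \<one>\<^bsub>?T\<^esub>"
    using bi_reassoc_invertible bi_reassoc_closed c by (intro monoid_cancel_one(2)[OF T.monoid_axioms]) simp_all
  moreover have "contract1_2 BH \<epsilon> (pure2 K H BH \<one>\<^bsub>H\<^esub> ?\<kappa>) = ?\<kappa>"
    using k by (simp add: bi_simps module.smult_one[OF module_tensor[OF Bm Hm]])
  ultimately show "?\<kappa> = \<one>\<^bsub>BH\<^esub>"
    using am_one[OF left.am_counit1[OF k_algebra_tensor[OF Bb Hh]]] by metis
qed

lemma counit_theta:
  "tm2 K H BH B (contract2_2 B \<epsilon>) \<theta> = \<one>\<^bsub>HB\<^esub>"
  "contract1_2 BH \<epsilon> \<theta> = \<one>\<^bsub>BH\<^esub>"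
proof -
  interpret T: monoid "HB" by (intro k_algebra_monoid[where K = K] k_algebra_tensor Hh Bb)
  interpret T': monoid "BH" by (intro k_algebra_monoid[where K = K] k_algebra_tensor Hh Bb)
  show "tm2 K H BH B (contract2_2 B \<epsilon>) \<theta> = \<one>\<^bsub>HB\<^esub>"
    using am_Units(2)[OF am_tm2[OF left.am_counit2[OF Bb] Hh] bi_reassoc_invertible] by (simp add: counit_bi_reassoc)
  show "contract1_2 BH \<epsilon> \<theta> = \<one>\<^bsub>BH\<^esub>"
    using am_Units(2)[OF left.am_counit1[OF k_algebra_tensor[OF Bb Hh]] bi_reassoc_invertible] by (simp add: counit_bi_reassoc)
qed

end

section \<open>The right coaction on a crossed product\<close>

locale crossed_right = crossed K H \<Delta> \<epsilon> \<Phi> M la ra A rho \<Phi>r B lam \<Phi>l +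
  bi: bicomodule_algebra K H \<Delta> \<epsilon> \<Phi> B lam rhoB \<Phi>l \<Phi>rB \<Phi>lr
  for K :: "'k ring" and H :: "('k, 'h) module" and \<Delta> \<epsilon> \<Phi>
    and M :: "('k, 'm) module" and la ra
    and A :: "('k, 'a) module" and rho \<Phi>r and B :: "('k, 'b) module" and lam rhoB \<Phi>l \<Phi>rB \<Phi>lr
begin
abbreviation "BH \<equiv> tensor K B H"
abbreviation "PH \<equiv> tensor K P H"
abbreviation "BHH \<equiv> tensor3 K B H H"
abbreviation "HBH \<equiv> tensor3 K H B H"
abbreviation "PHH \<equiv> tensor3 K P H H"
abbreviation "BHHH \<equiv> tensor4 K B H H H"
abbreviation "HBHH \<equiv> tensor4 K H B H H"
abbreviation "HHBH \<equiv> tensor4 K H H B H"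
abbreviation "PHHH \<equiv> tensor4 K P H H H"

abbreviation "\<theta> \<equiv> inv\<^bsub>HBH\<^esub> \<Phi>lr"
abbreviation "rhoP \<equiv> crossed_coaction_right K H P A M la B rhoB \<Phi>lr"
abbreviation "\<Phi>rP \<equiv> crossed_reassoc_right K H P A M B \<Phi>rB"
abbreviation "j b \<equiv> pAMB \<one>\<^bsub>A\<^esub> \<one>\<^bsub>M\<^esub> b"

lemmas Pa = k_algebra_P and Pm = module_P

lemma lin_toP: "lin K U T f \<Longrightarrow> lin K U P f" "lin K T X g \<Longrightarrow> lin K P X g"
  by (simp_all add: lin_P_iff)

lemma carrier_P: "x \<in> carrier T \<Longrightarrow> x \<in> carrier P"
  by (simp only: P_fields)

lemmas lin_co = lin_coactions am_lin[OF bi.right.am_rho]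
lemmas lin_rules_bi = lrules lin_co lin_co[THEN lin_comp] bi.counit_lin bi.counit_lin[THEN lin_comp]
lemmas closed_rules_bi = crules am_closed[OF bi.right.am_rho] bi.bi_reassoc_closed bi.right.rho_reassoc_closed Pa Pm
  RR_closed LL_closed P_mult_closed
lemmas simps_bi = simps am_lin[OF bi.right.am_rho] am_closed[OF bi.right.am_rho] Pa Pm P_fields(1) pure_closed

text \<open>The right coaction of a pure element is \<open>E a x (TR b)\<close>, its two iterates are values of \<open>F\<close>, and products of
  such coactions are values of \<open>Q\<close>.\<close>

definition E where "E a x S = lift3 PH S (\<lambda>s b k. pure2 K P H (pAMB a (act s x \<one>\<^bsub>H\<^esub>) b) k)"

definition F where "F a x S = lift2 PHH S (\<lambda>s t. lift3 PHH t
  (\<lambda>b k k'. pure3 K P H H (pAMB a (act s x \<one>\<^bsub>H\<^esub>) b) k k'))"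

definition Q where "Q x y R S = lift3 PH R (\<lambda>a p q. lift2 PH S (\<lambda>p' t.
  lift3 PH t (\<lambda>q' b k. pure2 K P H (pAMB a (act p' x p \<otimes>\<^bsub>M\<^esub> act q' y q) b) k)))"

lemma lin_E:
  "a \<in> carrier A \<Longrightarrow> x \<in> carrier M \<Longrightarrow> lin K U HBH f \<Longrightarrow> lin K U PH (\<lambda>u. E a x (f u))"
  "a \<in> carrier A \<Longrightarrow> S \<in> carrier HBH \<Longrightarrow> lin K U M g \<Longrightarrow> lin K U PH (\<lambda>u. E a (g u) S)"
  "x \<in> carrier M \<Longrightarrow> S \<in> carrier HBH \<Longrightarrow> lin K U A h \<Longrightarrow> lin K U PH (\<lambda>u. E (h u) x S)"
  unfolding E_def lift3_def
  by - (rule lin_rules_bi lin_toP carrier_P closed_rules_bi | assumption | (rule lin_module, assumption))+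

lemma E_pure:
  "a \<in> carrier A \<Longrightarrow> x \<in> carrier M \<Longrightarrow> s \<in> carrier H \<Longrightarrow> b \<in> carrier B \<Longrightarrow> k \<in> carrier H \<Longrightarrow>
    E a x (pure3 K H B H s b k) = pure2 K P H (pAMB a (act s x \<one>\<^bsub>H\<^esub>) b) k"
  unfolding E_def lift3_def
  by - (rule HOL.refl | rule HOL.trans[OF lift2_pure_lin] lin_rules_bi lin_toP carrier_P closed_rules_bi | assumption)+

lemma lin_F:
  "a \<in> carrier A \<Longrightarrow> x \<in> carrier M \<Longrightarrow> lin K U HBHH f \<Longrightarrow> lin K U PHH (\<lambda>u. F a x (f u))"
  unfolding F_def lift3_def
  by - (rule lin_rules_bi lin_toP carrier_P closed_rules_bi | assumption | (rule lin_module, assumption))+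

lemma F_pure:
  "a \<in> carrier A \<Longrightarrow> x \<in> carrier M \<Longrightarrow> s \<in> carrier H \<Longrightarrow> b \<in> carrier B \<Longrightarrow> k \<in> carrier H \<Longrightarrow> k' \<in> carrier H \<Longrightarrow>
    F a x (pure4 K H B H H s b k k') = pure3 K P H H (pAMB a (act s x \<one>\<^bsub>H\<^esub>) b) k k'"
  unfolding F_def lift3_def
  by - (rule HOL.refl | rule HOL.trans[OF lift2_pure_lin] lin_rules_bi lin_toP carrier_P closed_rules_bi | assumption)+

lemma lin_Q:
  "x \<in> carrier M \<Longrightarrow> y \<in> carrier M \<Longrightarrow> S \<in> carrier HHBH \<Longrightarrow> lin K U AHH f \<Longrightarrow>
    lin K U PH (\<lambda>u. Q x y (f u) S)"
  "x \<in> carrier M \<Longrightarrow> y \<in> carrier M \<Longrightarrow> R \<in> carrier AHH \<Longrightarrow> lin K U HHBH g \<Longrightarrow>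
    lin K U PH (\<lambda>u. Q x y R (g u))"
  unfolding Q_def lift3_def
  by - (rule lin_rules_bi lin_toP carrier_P closed_rules_bi | assumption | (rule lin_module, assumption))+

lemma Q_pure:
  "x \<in> carrier M \<Longrightarrow> y \<in> carrier M \<Longrightarrow> a \<in> carrier A \<Longrightarrow> p \<in> carrier H \<Longrightarrow> q \<in> carrier H \<Longrightarrow>
    p' \<in> carrier H \<Longrightarrow> q' \<in> carrier H \<Longrightarrow> b \<in> carrier B \<Longrightarrow> k \<in> carrier H \<Longrightarrow>
    Q x y (pure3 K A H H a p q) (pure4 K H H B H p' q' b k) =
    pure2 K P H (pAMB a (act p' x p \<otimes>\<^bsub>M\<^esub> act q' y q) b) k"
  unfolding Q_def lift3_def
  by - (rule HOL.refl | rule HOL.trans[OF lift2_pure_lin] lin_rules_bi lin_toP carrier_P closed_rules_bi | assumption)+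

text \<open>In Sweedler notation
  \<open>\<theta>^1 \<otimes> \<theta>^2 b_0 \<otimes> \<theta>^3 b_1\<close>: the part of the right
  coaction that depends on \<open>b\<close>, with its first leg acting on the factor in
  \<open>M\<close>.\<close>

definition TR where "TR b = \<theta> \<otimes>\<^bsub>HBH\<^esub> pure2 K H BH \<one>\<^bsub>H\<^esub> (rhoB b)"

lemma TR_closed: "b \<in> carrier B \<Longrightarrow> TR b \<in> carrier HBH"
  unfolding TR_def by (rule closed_rules_bi | assumption)+

lemma lin_TR: "lin K U B f \<Longrightarrow> lin K U HBH (\<lambda>u. TR (f u))"
  unfolding TR_def by (rule lin_rules_bi closed_rules_bi | assumption)+

lemma rhoP_eq:
  assumes "t \<in> carrier T"
  shows "rhoP t = lift3 PH t (\<lambda>a x b. E a x (TR b))"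
proof -
  \<comment> \<open>\<open>S\<close> and \<open>\<rho>\<close> stand for \<theta> and
    \<open>rhoB b\<close>; as arbitrary tensors they may be taken pure.\<close>
  have core: "lift3 PH S (\<lambda>s c k. lift2 PH \<rho> (\<lambda>b0 b1.
      pure2 K P H (pAMB a (la s x) (c \<otimes>\<^bsub>B\<^esub> b0)) (k \<otimes>\<^bsub>H\<^esub> b1))) =
    E a x (S \<otimes>\<^bsub>HBH\<^esub> pure2 K H BH \<one>\<^bsub>H\<^esub> \<rho>)"
    if a: "a \<in> carrier A" "x \<in> carrier M" and S: "S \<in> carrier HBH" and \<rho>: "\<rho> \<in> carrier BH"
    for a x S \<rho>
    unfolding lift3_def using S
  proof (induct S rule: tensor3_induct)
    case linP show ?case using a \<rho>
      by - (rule lin_E lin_rules_bi lin_comp[OF la_lin(1)] lin_toP carrier_P la_closed closed_rules_bi | assumption)+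
  next
    case (pure s c k)
    note 1 = pure
    show ?case using \<rho>
    proof (induct \<rho> rule: tensor_induct)
      case linP show ?case using a 1
        by - (rule lin_E lin_rules_bi lin_comp[OF la_lin(1)] lin_toP carrier_P la_closed closed_rules_bi | assumption)+
    next
      case (pure b0 b1)
      show ?case (is "?l = ?r")
      proof -
        have "?l = pure2 K P H (pAMB a (la s x) (c \<otimes>\<^bsub>B\<^esub> b0)) (k \<otimes>\<^bsub>H\<^esub> b1)"
          using a 1 pure
          by - (rule HOL.refl | rule HOL.trans[OF lift2_pure_lin] lin_rules_bi lin_comp[OF la_lin(1)] lin_toP carrier_P la_closed closed_rules_bi | assumption)+
        also have "\<dots> = ?r" using a 1 pure by (simp add: simps_bi E_pure la_act)
        finally show ?thesis .
      qed
    qed (rule spaces)+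
  qed (rule spaces)+
  show ?thesis unfolding crossed_coaction_right_def Let_def TR_def lift3_def[of "PH" t]
    by (intro lift2_cong[OF Am module_tensor[OF Mm Bm]] lift2_cong[OF Mm Bm] core assms
        am_closed[OF bi.right.am_rho] bi.bi_reassoc_closed)
qed

lemma lin_rhoP: "lin K T PH rhoP"
proof -
  have "lin K T PH (\<lambda>t. lift3 PH t (\<lambda>a x b. E a x (TR b)))"
    unfolding lift3_def by (rule lin_E lin_TR TR_closed lin_rules_bi closed_rules_bi | assumption)+
  then show ?thesis by (rule lin_cong) (rule rhoP_eq)
qed

lemma rhoP_pure:
  assumes "a \<in> carrier A" "x \<in> carrier M" "b \<in> carrier B"
  shows "rhoP (pAMB a x b) = E a x (TR b)"
proof -
  have "lift3 PH (pAMB a x b) (\<lambda>a x b. E a x (TR b)) = E a x (TR b)"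
    unfolding lift3_def using assms
    by - (rule HOL.refl | rule HOL.trans[OF lift2_pure_lin] lin_E lin_TR TR_closed lin_rules_bi closed_rules_bi | assumption)+
  then show ?thesis using assms by (simp add: rhoP_eq pure_closed)
qed

lemmas lin_rules_P = lin_E lin_F lin_Q lin_TR lin_comp[OF lin_rhoP] lin_rhoP lin_rules_bi lin_P_mult' lin_toP
lemmas closed_rules_P = TR_closed lin_closed[OF lin_rhoP] closed_rules_bi carrier_P
  lin_closed[OF lin_E(1)[OF _ _ lin_id]]

text \<open>The first leg of \<theta> acts on a product in \<open>M\<close> and therefore splits by
  \<Delta>, while \<open>rhoB\<close> is applied to the last leg of \<open>L\<close>.
  \<open>R\<close> is merely carried along.\<close>

lemma rhoP_G:
  assumes "x \<in> carrier M" "y \<in> carrier M" and R: "R \<in> carrier AHH" and L: "L \<in> carrier HHB"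
  shows "rhoP (G A B x y R L) = Q x y R (fst3 K H H H B H \<Delta> \<theta> \<otimes>\<^bsub>HHBH\<^esub> id2 K H H B BH rhoB L)"
  using R
proof (induct R rule: tensor3_induct)
  case linP show ?case using assms by - (rule lin_rules_P closed_rules_P | assumption)+
next
  case (pure a r r')
  note 1 = pure
  show ?case using L
  proof (induct L rule: tensor3_induct)
    case linP show ?case using assms(1,2) 1 by - (rule lin_rules_P closed_rules_P | assumption)+
  next
    case (pure l l' b)
    note 2 = pure
    have N: "pure2 K P H (pAMB a (N2 (act l x r) (act l' y r') (pure2 K H H \<one>\<^bsub>H\<^esub> \<one>\<^bsub>H\<^esub>) t) c) k =
        Q x y (pure3 K A H H a r r') (apd K H H BH t (pure2 K B H c k) \<otimes>\<^bsub>HHBH\<^esub> pure4 K H H B H l l' \<one>\<^bsub>B\<^esub> \<one>\<^bsub>H\<^esub>)"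
      if "c \<in> carrier B" "k \<in> carrier H" "t \<in> carrier HH" for c k t
      using that(3)
    proof (induct t rule: tensor_induct)
      case linP show ?case using assms(1,2) 1 2 that(1,2) by - (rule lin_rules_P closed_rules_P | assumption)+
    qed (use assms(1,2) 1 2 that(1,2) in \<open>simp_all add: simps_bi N2_pure Q_pure act_act\<close>)
    have key: "E a (act l x r \<otimes>\<^bsub>M\<^esub> act l' y r') S =
        Q x y (pure3 K A H H a r r') (fst3 K H H H B H \<Delta> S \<otimes>\<^bsub>HHBH\<^esub> pure4 K H H B H l l' \<one>\<^bsub>B\<^esub> \<one>\<^bsub>H\<^esub>)"
      if "S \<in> carrier HBH" for S
      using that
    proof (induct S rule: tensor3_induct)
      case linP show ?case using assms(1,2) 1 2 by - (rule lin_rules_P closed_rules_P | assumption)+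
    qed (use assms(1,2) 1 2 in \<open>simp_all add: simps_bi E_pure act_mult comult_one N\<close>)
    have c: "rhoB b \<in> carrier BH" "\<theta> \<in> carrier HBH"
      "fst3 K H H H B H \<Delta> \<theta> \<in> carrier HHBH"
      using 2 by - (rule closed_rules_P | assumption)+
    have "fst3 K H H H B H \<Delta> (TR b) \<otimes>\<^bsub>HHBH\<^esub> pure4 K H H B H l l' \<one>\<^bsub>B\<^esub> \<one>\<^bsub>H\<^esub> =
      fst3 K H H H B H \<Delta> \<theta> \<otimes>\<^bsub>HHBH\<^esub> id2 K H H B BH rhoB (pure3 K H H B l l' b)"
      unfolding TR_def using 2 c
      by (simp add: am_mult[OF am_fst3[OF am_comult Hh Hh Bb Hh]] alg_tensor alg_one[OF k_algebra_tensor] simps_bi comult_one)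
        (simp add: one_tensor[symmetric] alg_tensor simps_bi)
    then show ?case using assms(1,2) 1 2 by (simp add: simps_bi G_pure rhoP_pure key TR_closed)
  qed (rule spaces)+
qed (rule spaces)+

text \<open>Multiplying in \<open>P\<close> brings in \<open>LL\<close>, which applies
  \<open>lam\<close> to the middle leg of \<open>S\<close>. The tensor acting from the right is
  \<open>RR a a'\<close>, as for the product before coacting; so multiplicativity of the coaction
  reduces to a comparison of tensors acting from the left.\<close>

lemma E_mult:
  assumes "a \<in> carrier A" "x \<in> carrier M" "a' \<in> carrier A" "x' \<in> carrier M"
    and S: "S \<in> carrier HBH" and S': "S' \<in> carrier HBH"
  shows "E a x S \<otimes>\<^bsub>PH\<^esub> E a' x' S' = Q x x' (RR a a') (app K H H B H \<psi>l \<otimes>\<^bsub>HHBH\<^esub>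
    (mid K H B H B H lam S \<otimes>\<^bsub>HHBH\<^esub> pure2 K H HBH \<one>\<^bsub>H\<^esub> S'))"
  using S
proof (induct S rule: tensor3_induct)
  case linP show ?case using assms by - (rule lin_rules_P closed_rules_P | assumption)+
next
  case (pure s c k)
  note 1 = pure
  show ?case using S'
  proof (induct S' rule: tensor3_induct)
    case linP show ?case using assms(1-4) 1 by - (rule lin_rules_P closed_rules_P | assumption)+
  next
    case (pure s' c' k')
    note 2 = pure
    note a = assms(1-4) 1 2 alg_mult_closed[OF Hh 1(3) 2(3)]
    have e1: "pure2 K P H (G A B (act s x \<one>\<^bsub>H\<^esub>) (act s' x' \<one>\<^bsub>H\<^esub>) R V) l =
        Q x x' R (id2 K H H B BH (snoc K B H l) V \<otimes>\<^bsub>HHBH\<^esub> pure4 K H H B H s s' \<one>\<^bsub>B\<^esub> \<one>\<^bsub>H\<^esub>)"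
      if R: "R \<in> carrier AHH" and V: "V \<in> carrier HHB" and l: "l \<in> carrier H" for R V l
      using R
    proof (induct R rule: tensor3_induct)
      case linP show ?case using a V l by - (rule lin_rules_P closed_rules_P | assumption)+
    next
      case (pure u v w)
      note 3 = pure
      show ?case using V
      proof (induct V rule: tensor3_induct)
        case linP show ?case using a l 3 by - (rule lin_rules_P closed_rules_P | assumption)+
      qed (use a l 3 in \<open>simp_all add: simps_bi G_pure Q_pure act_act\<close>)
    qed (rule spaces)+
    have e2: "id2 K H H B BH (snoc K B H (k \<otimes>\<^bsub>H\<^esub> k')) (pure2 K H HB \<one>\<^bsub>H\<^esub> \<mu> \<otimes>\<^bsub>HHB\<^esub>
        pure3 K H H B \<one>\<^bsub>H\<^esub> \<one>\<^bsub>H\<^esub> c') \<otimes>\<^bsub>HHBH\<^esub> pure4 K H H B H s s' \<one>\<^bsub>B\<^esub> \<one>\<^bsub>H\<^esub> =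
      pure2 K H HBH s (apd K H B H \<mu> k) \<otimes>\<^bsub>HHBH\<^esub> pure4 K H H B H \<one>\<^bsub>H\<^esub> s' c' k'"
      if "\<mu> \<in> carrier HB" for \<mu> using that
    proof (induct \<mu> rule: tensor_induct)
      case linP show ?case using a by - (rule lin_rules_P closed_rules_P | assumption)+
    qed (use a in \<open>simp_all add: simps_bi\<close>)
    have c: "lam c \<in> carrier HB" "app K H H B H \<psi>l \<in> carrier HHBH"
       "pure2 K H HB \<one>\<^bsub>H\<^esub> (lam c) \<otimes>\<^bsub>HHB\<^esub> pure3 K H H B \<one>\<^bsub>H\<^esub> \<one>\<^bsub>H\<^esub> c' \<in> carrier HHB"
       "id2 K H H B BH (snoc K B H (k \<otimes>\<^bsub>H\<^esub> k')) (pure2 K H HB \<one>\<^bsub>H\<^esub> (lam c) \<otimes>\<^bsub>HHB\<^esub>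
        pure3 K H H B \<one>\<^bsub>H\<^esub> \<one>\<^bsub>H\<^esub> c') \<in> carrier HHBH"
       "pure4 K H H B H s s' \<one>\<^bsub>B\<^esub> \<one>\<^bsub>H\<^esub> \<in> carrier HHBH"
      using a by - (rule closed_rules_P | assumption)+
    have e3: "id2 K H H B BH (snoc K B H (k \<otimes>\<^bsub>H\<^esub> k')) (LL c c') \<otimes>\<^bsub>HHBH\<^esub> pure4 K H H B H s s' \<one>\<^bsub>B\<^esub> \<one>\<^bsub>H\<^esub> =
      app K H H B H \<psi>l \<otimes>\<^bsub>HHBH\<^esub> (mid K H B H B H lam (pure3 K H B H s c k) \<otimes>\<^bsub>HHBH\<^esub>
      pure2 K H HBH \<one>\<^bsub>H\<^esub> (pure3 K H B H s' c' k'))"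
      unfolding LL_def id2_snoc_mult[OF Hh Hh Bb Hh alg_mult_closed[OF Hh 1(3) 2(3)] reassocs_closed(6) c(3)]
      using c a e2[OF c(1)] by (simp add: alg_tensor(3) spaces k_algebra_tensor) (simp add: simps_bi)
    have "E a x (pure3 K H B H s c k) \<otimes>\<^bsub>PH\<^esub> E a' x' (pure3 K H B H s' c' k') =
        pure2 K P H (G A B (act s x \<one>\<^bsub>H\<^esub>) (act s' x' \<one>\<^bsub>H\<^esub>) (RR a a') (LL c c')) (k \<otimes>\<^bsub>H\<^esub> k')"
      using a by (simp add: E_pure mult_pure Pa P_pure carrier_P pure_closed simps_bi)
    also have "\<dots> = Q x x' (RR a a') (app K H H B H \<psi>l \<otimes>\<^bsub>HHBH\<^esub> (mid K H B H B H lam (pure3 K H B H s c k) \<otimes>\<^bsub>HHBH\<^esub>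
      pure2 K H HBH \<one>\<^bsub>H\<^esub> (pure3 K H B H s' c' k')))"
      using a by (simp add: e1 RR_closed LL_closed e3)
    finally show ?case .
  qed (rule spaces)+
qed (rule spaces)+

text \<open>A mixed pentagon rewrites the two terms in front, and \<open>bi_coassoc\<close> then
  exchanges \<theta> with the iterated coactions of \<open>b\<close>.\<close>

lemma TR_mult:
  assumes "b \<in> carrier B" "b' \<in> carrier B"
  shows "fst3 K H H H B H \<Delta> \<theta> \<otimes>\<^bsub>HHBH\<^esub> id2 K H H B BH rhoB (LL b b') =
    app K H H B H \<psi>l \<otimes>\<^bsub>HHBH\<^esub>
    (mid K H B H B H lam (TR b) \<otimes>\<^bsub>HHBH\<^esub> pure2 K H HBH \<one>\<^bsub>H\<^esub> (TR b'))" (is "?l = ?r")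
proof -
  let ?T = "HHBH" and ?c = "pure2 K H HBH \<one>\<^bsub>H\<^esub>"
  let ?f = "fst3 K H H H B H \<Delta> \<theta>" and ?i = "id2 K H H B BH rhoB \<psi>l"
  let ?a = "app K H H B H \<psi>l" and ?m = "mid K H B H B H lam \<theta>"
  let ?d = "tm2 K H B BH rhoB (lam b)" and ?s = "spl K B H B H lam (rhoB b)"
  let ?Y = "pure2 K H BH \<one>\<^bsub>H\<^esub> (rhoB b')"
  have c: "lam b \<in> carrier HB" "rhoB b \<in> carrier BH" "rhoB b' \<in> carrier BH"
    "?f \<in> carrier ?T" "?i \<in> carrier ?T" "?a \<in> carrier ?T" "?m \<in> carrier ?T" "?d \<in> carrier HBH"
    "?s \<in> carrier HBH" "?Y \<in> carrier HBH" "?c ?Y \<in> carrier ?T" "?c ?d \<in> carrier ?T" "?c ?s \<in> carrier ?T"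
    "?c \<theta> \<in> carrier ?T" "\<theta> \<in> carrier HBH" "pure2 K H BH \<one>\<^bsub>H\<^esub> (rhoB b) \<in> carrier HBH"
    "pure2 K H HB \<one>\<^bsub>H\<^esub> (lam b) \<in> carrier HHB" "pure3 K H H B \<one>\<^bsub>H\<^esub> \<one>\<^bsub>H\<^esub> b' \<in> carrier HHB"
    using assms by - (rule closed_rules_P lin_rules_P | assumption)+
  interpret T: monoid ?T by (intro k_algebra_monoid[where K = K] k_algebra_tensor spaces)
  note cons = am_mult[OF am_cons[OF Hh k_algebra_tensor[OF Hh k_algebra_tensor[OF Bb Hh]]], symmetric]
  have 1: "id2 K H H B BH rhoB (LL b b') = ?i \<otimes>\<^bsub>?T\<^esub> (?c ?d \<otimes>\<^bsub>?T\<^esub> ?c ?Y)"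
    unfolding LL_def using assms c
    by (simp add: am_mult[OF am_id2[OF bi.right.am_rho Hh Hh]] alg_tensor reassocs_closed spaces k_algebra_tensor)
      (simp add: spaces ones tm2_pure am_lin[OF bi.right.am_rho] lin_tm2 pure2_closed module_tensor)
  have 2: "mid K H B H B H lam (TR b) = ?m \<otimes>\<^bsub>?T\<^esub> ?c ?s"
    unfolding TR_def using c
    by (simp add: am_mult[OF am_mid[OF B.am_lam Hh Hh Bb Hh]])
      (simp add: spaces ones tm2_pure lin_coactions lin_spl module_tensor)
  have 3: "?c (TR b') = ?c \<theta> \<otimes>\<^bsub>?T\<^esub> ?c ?Y"
    unfolding TR_def using c by (simp add: cons)
  have "?l = (?f \<otimes>\<^bsub>?T\<^esub> ?i) \<otimes>\<^bsub>?T\<^esub> (?c ?d \<otimes>\<^bsub>?T\<^esub> ?c ?Y)" unfolding 1 using c by (simp add: T.m_assoc)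
  also have "\<dots> = ?a \<otimes>\<^bsub>?T\<^esub> (?m \<otimes>\<^bsub>?T\<^esub> ((?c \<theta> \<otimes>\<^bsub>?T\<^esub> ?c ?d) \<otimes>\<^bsub>?T\<^esub> ?c ?Y))"
    unfolding bi.bi_left_inverses(1)[symmetric] using c by (simp add: T.m_assoc)
  also have "?c \<theta> \<otimes>\<^bsub>?T\<^esub> ?c ?d = ?c ?s \<otimes>\<^bsub>?T\<^esub> ?c \<theta>"
    using c assms by (simp only: cons bi.bi_coassoc)
  finally show ?thesis unfolding 2 3 using c by (simp add: T.m_assoc)
qed

text \<open>Products in \<open>P\<close> are twisted, but between units of \<open>M\<close> the
  acting legs contract to counits, so that \<open>B\<close> embeds multiplicatively.\<close>

lemma am_j: "am K B P j"
proof (rule amI)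
  show "lin K B P j" by (rule lin_rules_P closed_rules_P | assumption)+
  fix b b' assume b: "b \<in> carrier B" "b' \<in> carrier B"
  then show "j (b \<otimes>\<^bsub>B\<^esub> b') = j b \<otimes>\<^bsub>P\<^esub> j b'"
    by (simp add: P_one_middle comult_one G1_pure act_one simps)
qed (simp_all add: spaces Pa P_fields)

text \<open>The first equation prepares the counit law. In the second, the action on the unit of
  \<open>M\<close> turns the first leg into a counit scalar, which relates the coaction to
  \<open>j\<close>.\<close>

lemma contract_E:
  assumes "a \<in> carrier A" "x \<in> carrier M" "S \<in> carrier HBH"
  shows "contract2_2 P \<epsilon> (E a x S) = G1 A B x (pure2 K A H a \<one>\<^bsub>H\<^esub>) (tm2 K H BH B (contract2_2 B \<epsilon>) S)"
    "E \<one>\<^bsub>A\<^esub> \<one>\<^bsub>M\<^esub> S = tm1 K B P H j (contract1_2 BH \<epsilon> S)"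
proof -
  show "contract2_2 P \<epsilon> (E a x S) = G1 A B x (pure2 K A H a \<one>\<^bsub>H\<^esub>) (tm2 K H BH B (contract2_2 B \<epsilon>) S)"
    using assms(3)
  proof (induct S rule: tensor3_induct)
    case linP show ?case using assms(1,2) by - (rule lin_rules_P closed_rules_P lin_G1[folded lin_P_iff] | assumption)+
  next
    case (pure s c k)
    have "\<epsilon> k \<odot>\<^bsub>P\<^esub> t = \<epsilon> k \<odot>\<^bsub>T\<^esub> t" for t by (simp only: P_fields)
    then show ?case using pure assms(1,2)
      by (simp add: E_pure simps_bi bi.counit_pure bi.counit_lin pure2_smult bi.counit_closed lin_smult[OF lin_G1(2)[OF _ _ _ _ lin_id]] G1_pure)
  qed (rule spaces)+
  show "E \<one>\<^bsub>A\<^esub> \<one>\<^bsub>M\<^esub> S = tm1 K B P H j (contract1_2 BH \<epsilon> S)"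
    using assms(3)
  proof (induct S rule: tensor3_induct)
    case linP show ?case by (rule linP_eq lin_comp[OF lin_tm1[OF am_lin[OF am_j]]] lin_rules_P closed_rules_P | assumption)+
  next
    case (pure s c k)
    have "E \<one>\<^bsub>A\<^esub> \<one>\<^bsub>M\<^esub> (pure3 K H B H s c k) = pure2 K P H (\<epsilon> s \<odot>\<^bsub>P\<^esub> j c) k"
      using pure by (simp add: E_pure simps_bi act_M_one bi.counit_closed counit_one pure2_smult P_fields(4))
    then show ?case using pure
      by (simp add: simps_bi bi.counit_pure bi.counit_lin bi.counit_closed lin_smult[OF lin_tm1[OF am_lin[OF am_j]]]
          tm1_pure[OF am_lin[OF am_j]] pure2_smult)
  qed (rule spaces)+
qed

text \<open>Rests on \<open>counit_theta\<close>: acting on the unit of \<open>M\<close> contracts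
  the first leg of \<theta> and thereby makes \<theta> trivial. This is the relation along which the
  pentagon is transported.\<close>

lemma rhoP_j: "b \<in> carrier B \<Longrightarrow> rhoP (j b) = tm1 K B P H j (rhoB b)"
proof -
  assume b: "b \<in> carrier B"
  have c: "rhoB b \<in> carrier BH" "pure2 K H BH \<one>\<^bsub>H\<^esub> (rhoB b) \<in> carrier HBH"
    using b by - (rule closed_rules_P | assumption)+
  have "contract1_2 BH \<epsilon> (TR b) = rhoB b"
    unfolding TR_def using c b
    by (simp add: am_mult[OF am_counit1[OF k_algebra_tensor[OF Bb Hh]]] bi.counit_theta bi.bi_reassoc_closed
        bi.counit_pure counit_one spaces ones module_tensor module.smult_one[OF module_tensor[OF Bm Hm]] alg_tensor k_algebra_tensor)
  then show ?thesis using b by (simp add: rhoP_pure ones contract_E(2)[OF ones(2) ones(4)] TR_closed)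
qed

lemma am_rhoP: "am K P PH rhoP"
proof (rule amI)
  show "lin K P PH rhoP" using lin_rhoP by (simp only: lin_P_iff)
  have "\<one>\<^bsub>P\<^esub> = j \<one>\<^bsub>B\<^esub>" by (simp only: P_fields)
  \<comment> \<open>The unit lies in the image of \<open>j\<close>, so its coaction is computed in
    \<open>B\<close>.\<close>
  then show "rhoP \<one>\<^bsub>P\<^esub> = \<one>\<^bsub>PH\<^esub>"
    by (simp add: rhoP_j ones am_one[OF bi.right.am_rho] am_one[OF am_tm1[OF am_j Hh]])
  fix s t assume "s \<in> carrier P" "t \<in> carrier P"
  then have s: "s \<in> carrier T" and t: "t \<in> carrier T" by (simp_all only: P_fields)
  show "rhoP (s \<otimes>\<^bsub>P\<^esub> t) = rhoP s \<otimes>\<^bsub>PH\<^esub> rhoP t" using s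
  proof (induct s rule: tensor3_induct)
    case linP show ?case using t by - (rule lin_rules_P closed_rules_P | assumption)+
  next
    case (pure a x b)
    note 1 = pure
    show ?case using t
    proof (induct t rule: tensor3_induct)
      case linP show ?case using 1 by - (rule lin_rules_P closed_rules_P pure_closed | assumption)+
    next
      case (pure a' x' b')
      then show ?case using 1
        by (simp add: P_pure rhoP_G RR_closed LL_closed rhoP_pure E_mult TR_closed TR_mult)
    qed (rule spaces)+
  qed (rule spaces)+
qed (intro Pa k_algebra_tensor Hh)+

text \<open>Coacting once more on the first leg creates a second \<theta> and the coaction of the
  middle leg of \<open>S\<close>. The new \<theta> acts on \<open>x\<close> after \<open>S\<close>
  has acted, hence stands on the left.\<close>

lemma spl_E:
  assumes "a \<in> carrier A" "x \<in> carrier M" "S \<in> carrier HBH"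
  shows "spl K P P H H rhoP (E a x S) = F a x (app K H B H H \<theta> \<otimes>\<^bsub>HBHH\<^esub> mid K H B B H H rhoB S)"
  using assms(3)
proof (induct S rule: tensor3_induct)
  case linP show ?case using assms(1,2) by - (rule linP_eq lin_comp[OF lin_spl[OF am_lin[OF am_rhoP]]] lin_rules_P closed_rules_P | assumption)+
next
  case (pure s c k)
  note 1 = pure
  have e1: "apd K P H H (E a (act s x \<one>\<^bsub>H\<^esub>) U) k = F a x (id2 K H B H HH (snoc K H H k) U \<otimes>\<^bsub>HBHH\<^esub>
      pure4 K H B H H s \<one>\<^bsub>B\<^esub> \<one>\<^bsub>H\<^esub> \<one>\<^bsub>H\<^esub>)" if "U \<in> carrier HBH" for U
    using that
  proof (induct U rule: tensor3_induct)
    case linP show ?case using assms(1,2) 1 by - (rule lin_rules_P closed_rules_P | assumption)+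
  qed (use assms(1,2) 1 in \<open>simp_all add: simps_bi E_pure F_pure act_act\<close>)
  have e2: "id2 K H B H HH (snoc K H H k) (pure2 K H BH \<one>\<^bsub>H\<^esub> \<rho>) \<otimes>\<^bsub>HBHH\<^esub>
      pure4 K H B H H s \<one>\<^bsub>B\<^esub> \<one>\<^bsub>H\<^esub> \<one>\<^bsub>H\<^esub> = pure2 K H BHH s (apd K B H H \<rho> k)" if "\<rho> \<in> carrier BH" for \<rho>
    using that
  proof (induct \<rho> rule: tensor_induct)
    case linP show ?case using 1 by - (rule lin_rules_P closed_rules_P | assumption)+
  qed (use 1 in \<open>simp_all add: simps_bi\<close>)
  have c: "rhoB c \<in> carrier BH" "app K H B H H \<theta> \<in> carrier HBHH"
    "pure2 K H BH \<one>\<^bsub>H\<^esub> (rhoB c) \<in> carrier HBH"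
    "id2 K H B H HH (snoc K H H k) (pure2 K H BH \<one>\<^bsub>H\<^esub> (rhoB c)) \<in> carrier HBHH"
    "pure4 K H B H H s \<one>\<^bsub>B\<^esub> \<one>\<^bsub>H\<^esub> \<one>\<^bsub>H\<^esub> \<in> carrier HBHH"
    using 1 by - (rule closed_rules_P | assumption)+
  have "id2 K H B H HH (snoc K H H k) (TR c) \<otimes>\<^bsub>HBHH\<^esub> pure4 K H B H H s \<one>\<^bsub>B\<^esub> \<one>\<^bsub>H\<^esub> \<one>\<^bsub>H\<^esub> =
    app K H B H H \<theta> \<otimes>\<^bsub>HBHH\<^esub> mid K H B B H H rhoB (pure3 K H B H s c k)"
    unfolding TR_def id2_snoc_mult[OF Hh Bb Hh Hh 1(3) bi.bi_reassoc_closed(2) c(3)]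
    using c 1 e2[OF c(1)] by (simp add: alg_tensor(3) spaces k_algebra_tensor) (simp add: simps_bi)
  then show ?case using 1 assms(1,2)
    by (simp add: E_pure spl_pure[OF am_lin[OF am_rhoP]] carrier_P pure_closed spaces Pm rhoP_pure act_closed ones e1 TR_closed)
qed (rule spaces)+

lemma tm2_E:
  assumes "a \<in> carrier A" "x \<in> carrier M" "S \<in> carrier HBH"
  shows "tm2 K P H HH \<Delta> (E a x S) = F a x (id2 K H B H HH \<Delta> S)"
  using assms(3)
proof (induct S rule: tensor3_induct)
  case linP show ?case using assms(1,2) by - (rule lin_rules_P closed_rules_P | assumption)+
next
  case (pure s c k)
  note 1 = pure
  have "pure2 K P HH (pAMB a (act s x \<one>\<^bsub>H\<^esub>) c) t = F a x (pure3 K H B HH s c t)"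
    if "t \<in> carrier HH" for t using that
  proof (induct t rule: tensor_induct)
    case linP show ?case using assms(1,2) 1 by - (rule lin_rules_P closed_rules_P | assumption)+
  qed (use assms(1,2) 1 in \<open>simp_all add: simps_bi F_pure\<close>)
  then show ?case using 1 assms(1,2) by (simp add: E_pure simps_bi)
qed (rule spaces)+

text \<open>Multiplication by the image of \<open>j\<close> is asymmetric: from the left,
  \<open>lam\<close> of its first leg also acts on \<open>x\<close>, whereas from the right that leg
  merely multiplies the factor in \<open>B\<close>.\<close>

lemma F_mult:
  assumes "a \<in> carrier A" "x \<in> carrier M" and Z: "Z \<in> carrier BHH" and U: "U \<in> carrier HBHH"
  shows "tm1 K B P HH j Z \<otimes>\<^bsub>PHH\<^esub> F a x U = F a x (fst3 K B H B H H lam Z \<otimes>\<^bsub>HBHH\<^esub> U)"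
    "F a x U \<otimes>\<^bsub>PHH\<^esub> tm1 K B P HH j Z =
      F a x (U \<otimes>\<^bsub>HBHH\<^esub> pure2 K H BHH \<one>\<^bsub>H\<^esub> Z)"
proof -
  note lj = lin_tm1[OF am_lin[OF am_j]] lin_comp[OF lin_tm1[OF am_lin[OF am_j]]]
  note l = lj lin_rules_P closed_rules_P lin_closed[OF lj(1)] lin_closed[OF lin_F[OF _ _ lin_id]]
  show "tm1 K B P HH j Z \<otimes>\<^bsub>PHH\<^esub> F a x U = F a x (fst3 K B H B H H lam Z \<otimes>\<^bsub>HBHH\<^esub> U)"
    using Z
  proof (induct Z rule: tensor3_induct)
    case linP show ?case using assms(1,2) U by - (rule l | assumption)+
  next
    case (pure z p q)
    note 1 = pure
    show ?case using U
    proof (induct U rule: tensor4_induct)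
      case linP show ?case using assms(1,2) 1 by - (rule l | assumption)+
    next
      case (pure s c k k')
      note 2 = pure
      have "pure3 K P H H (G1 A B (act s x \<one>\<^bsub>H\<^esub>) (pure2 K A H a \<one>\<^bsub>H\<^esub>) (\<mu> \<otimes>\<^bsub>HB\<^esub> pure2 K H B \<one>\<^bsub>H\<^esub> c)) (p \<otimes>\<^bsub>H\<^esub> k) (q \<otimes>\<^bsub>H\<^esub> k') =
        F a x (apd K H B HH \<mu> (pure2 K H H p q) \<otimes>\<^bsub>HBHH\<^esub> pure4 K H B H H s c k k')"
        if "\<mu> \<in> carrier HB" for \<mu> using that
      proof (induct \<mu> rule: tensor_induct)
        case linP show ?case using assms(1,2) 1 2 by - (rule l | assumption)+
      qed (use assms(1,2) 1 2 in \<open>simp_all add: simps_bi G1_pure F_pure act_act\<close>)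
      then show ?case using assms(1,2) 1 2
        by (simp add: F_pure simps_bi tm1_pure[OF am_lin[OF am_j]] P_one_middle carrier_P)
    qed (rule spaces)+
  qed (rule spaces)+
  show "F a x U \<otimes>\<^bsub>PHH\<^esub> tm1 K B P HH j Z =
      F a x (U \<otimes>\<^bsub>HBHH\<^esub> pure2 K H BHH \<one>\<^bsub>H\<^esub> Z)"
    using Z
  proof (induct Z rule: tensor3_induct)
    case linP show ?case using assms(1,2) U by - (rule l | assumption)+
  next
    case (pure z p q)
    note 1 = pure
    show ?case using U
    proof (induct U rule: tensor4_induct)
      case linP show ?case using assms(1,2) 1 by - (rule l | assumption)+
    next
      case (pure s c k k')
      then show ?case using assms(1,2) 1
        by (simp add: F_pure simps_bi tm1_pure[OF am_lin[OF am_j]] P_one_middle comult_one G1_pure act_act)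
    qed (rule spaces)+
  qed (rule spaces)+
qed

lemma reassocP_eq: "\<Phi>rP = tm1 K B P HH j \<Phi>rB"
proof -
  have "lift2 PHH s (\<lambda>X2 X3. pure3 K P H H (j u) X2 X3) = pure2 K P HH (j u) s"
    if "u \<in> carrier B" "s \<in> carrier HH" for u s
    using that by (intro lift2_pure2_right[where h = "\<lambda>s. s"] Pm spaces lin_id module_tensor am_closed[OF am_j])
  then show ?thesis unfolding crossed_reassoc_right_def tm1_def lift3_def
    by (intro lift2_cong[OF Bm module_tensor[OF Hm Hm] bi.right.rho_reassoc_closed(1)])
qed

text \<open>A mixed pentagon carries \<open>\<Phi>rB\<close> across the two copies of \<theta>, and
  quasi-coassociativity in \<open>B\<close> carries it across the iterated coaction of
  \<open>b\<close>.\<close>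

lemma TR_coassoc:
  assumes "b \<in> carrier B"
  shows "fst3 K B H B H H lam \<Phi>rB \<otimes>\<^bsub>HBHH\<^esub> (app K H B H H \<theta> \<otimes>\<^bsub>HBHH\<^esub> mid K H B B H H rhoB (TR b)) =
    id2 K H B H HH \<Delta> (TR b) \<otimes>\<^bsub>HBHH\<^esub> pure2 K H BHH \<one>\<^bsub>H\<^esub> \<Phi>rB" (is "?l = ?r")
proof -
  let ?T = "HBHH" and ?c = "pure2 K H BHH \<one>\<^bsub>H\<^esub>"
  let ?f = "fst3 K B H B H H lam \<Phi>rB" and ?a = "app K H B H H \<theta>" and ?m = "mid K H B B H H rhoB \<theta>"
  let ?i = "id2 K H B H HH \<Delta> \<theta>" and ?s = "spl K B B H H rhoB (rhoB b)" and ?d = "tm2 K B H HH \<Delta> (rhoB b)"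
  have c: "rhoB b \<in> carrier BH" "?f \<in> carrier ?T" "?a \<in> carrier ?T" "?m \<in> carrier ?T" "?i \<in> carrier ?T"
    "?s \<in> carrier BHH" "?d \<in> carrier BHH" "?c ?s \<in> carrier ?T" "?c ?d \<in> carrier ?T" "?c \<Phi>rB \<in> carrier ?T"
    "\<theta> \<in> carrier HBH" "pure2 K H BH \<one>\<^bsub>H\<^esub> (rhoB b) \<in> carrier HBH"
    using assms by - (rule closed_rules_P lin_rules_P | assumption)+
  interpret T: monoid ?T by (intro k_algebra_monoid[where K = K] k_algebra_tensor spaces)
  note cons = am_mult[OF am_cons[OF Hh k_algebra_tensor[OF Bb k_algebra_tensor[OF Hh Hh]]], symmetric]
  have 1: "mid K H B B H H rhoB (TR b) = ?m \<otimes>\<^bsub>?T\<^esub> ?c ?s" "id2 K H B H HH \<Delta> (TR b) = ?i \<otimes>\<^bsub>?T\<^esub> ?c ?d"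
    unfolding TR_def using c
    by (simp_all add: am_mult[OF am_mid[OF bi.right.am_rho Hh Bb Hh Hh]] am_mult[OF am_id2[OF am_comult Hh Bb]])
      (simp_all add: spaces ones tm2_pure lin_coactions am_lin[OF bi.right.am_rho] lin_spl lin_tm2 module_tensor)
  have "?l = (?f \<otimes>\<^bsub>?T\<^esub> ?a \<otimes>\<^bsub>?T\<^esub> ?m) \<otimes>\<^bsub>?T\<^esub> ?c ?s" unfolding 1 using c by (simp add: T.m_assoc)
  also have "\<dots> = ?i \<otimes>\<^bsub>?T\<^esub> (?c \<Phi>rB \<otimes>\<^bsub>?T\<^esub> ?c ?s)" unfolding bi.bi_right_inverses(2) using c by (simp add: T.m_assoc)
  also have "?c \<Phi>rB \<otimes>\<^bsub>?T\<^esub> ?c ?s = ?c ?d \<otimes>\<^bsub>?T\<^esub> ?c \<Phi>rB"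
    using c assms bi.right.rho_reassoc_closed by (simp only: cons bi.right.rho_coassoc(1))
  finally show ?thesis unfolding 1 using c by (simp add: T.m_assoc)
qed

theorem right_comodule_algebra_P: "right_comodule_algebra K H \<Delta> \<epsilon> \<Phi> P rhoP \<Phi>rP"
proof (rule right_comodule_algebraI[OF Pa am_rhoP])
  let ?j = "tm1 K B P HH j" and ?j3 = "tm1 K B P HHH j"
  note amj = am_tm1[OF am_j k_algebra_tensor[OF Hh Hh]] and amj3 = am_tm1[OF am_j k_algebra_tensor[OF Hh k_algebra_tensor[OF Hh Hh]]]
  note lj = lin_tm1[OF am_lin[OF am_j]] lin_comp[OF lin_tm1[OF am_lin[OF am_j]]]
  note l = linP_eq lj lin_rules_P closed_rules_P lin_closed[OF lj(1)] lin_comp[OF lin_spl[OF am_lin[OF am_rhoP]]]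
  note jp = tm1_pure[OF am_lin[OF am_j]]
  show "\<Phi>rP \<in> Units PHH"
    unfolding reassocP_eq by (rule am_Units(1)[OF amj bi.right.coaction_reassoc_invertible])
  fix t assume "t \<in> carrier P"
  then have t: "t \<in> carrier T" by (simp only: P_fields)
  have c: "\<Phi>rB \<in> carrier BHH" by (rule bi.right.rho_reassoc_closed)
  have cP: "\<Phi>rP \<in> carrier PHH" unfolding reassocP_eq by (rule am_closed[OF amj c])
  show "\<Phi>rP \<otimes>\<^bsub>PHH\<^esub> spl K P P H H rhoP (rhoP t) = tm2 K P H HH \<Delta> (rhoP t) \<otimes>\<^bsub>PHH\<^esub> \<Phi>rP"
    using t
  proof (induct t rule: tensor3_induct)
    case linP show ?case using cP by - (rule l | assumption)+
  next
    case (pure a x b)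
    have c': "TR b \<in> carrier HBH" "app K H B H H \<theta> \<otimes>\<^bsub>HBHH\<^esub> mid K H B B H H rhoB (TR b) \<in> carrier HBHH"
      "id2 K H B H HH \<Delta> (TR b) \<in> carrier HBHH"
      using pure by - (rule closed_rules_P lin_rules_P bi.right.am_rho | assumption)+
    show ?case unfolding reassocP_eq using pure c c'
      by (simp add: rhoP_pure spl_E tm2_E F_mult TR_coassoc)
  qed (rule spaces)+
  show "contract2_2 P \<epsilon> (rhoP t) = t" using t
  proof (induct t rule: tensor3_induct)
    case linP show ?case by (rule l | assumption)+
  next
    case (pure a x b)
    have "tm2 K H BH B (contract2_2 B \<epsilon>) (TR b) = pure2 K H B \<one>\<^bsub>H\<^esub> b"
      unfolding TR_def using pure
      by (simp add: am_mult[OF am_tm2[OF am_counit2[OF Bb] Hh]] bi.counit_theta bi.bi_reassoc_closed simps_bi bi.counit_lin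
          bi.right.coaction_counit alg_tensor)
    then show ?case using pure by (simp add: rhoP_pure contract_E TR_closed G1_pure spaces ones act_one)
  qed (rule spaces)+
next
  let ?j = "tm1 K B P HH j" and ?j3 = "tm1 K B P HHH j" and ?T = "BHHH"
  note amj = am_tm1[OF am_j k_algebra_tensor[OF Hh Hh]] and amj3 = am_tm1[OF am_j k_algebra_tensor[OF Hh k_algebra_tensor[OF Hh Hh]]]
  note lj = lin_tm1[OF am_lin[OF am_j]] lin_comp[OF lin_tm1[OF am_lin[OF am_j]]]
  note l = linP_eq lj lin_rules_P closed_rules_P lin_closed[OF lj(1)] lin_comp[OF lin_spl[OF am_lin[OF am_rhoP]]]
  note jp = tm1_pure[OF am_lin[OF am_j]] am_closed[OF am_j]
  have c: "\<Phi>rB \<in> carrier BHH" by (rule bi.right.rho_reassoc_closed)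
  have cc: "pure2 K B HHH \<one>\<^bsub>B\<^esub> \<Phi> \<in> carrier ?T" "mid K B H H H H \<Delta> \<Phi>rB \<in> carrier ?T" "app K B H H H \<Phi>rB \<in> carrier ?T"
    "id2 K B H H HH \<Delta> \<Phi>rB \<in> carrier ?T" "fst3 K B B H H H rhoB \<Phi>rB \<in> carrier ?T"
    by (rule closed_rules_P lin_rules_P | assumption)+
  have 1: "pure2 K P HHH \<one>\<^bsub>P\<^esub> \<Phi> = ?j3 (pure2 K B HHH \<one>\<^bsub>B\<^esub> \<Phi>)"
    by (simp add: jp simps_bi reassocs_closed am_one[OF am_j])
  \<comment> \<open>Each map of the pentagon commutes with the embedding \<open>j\<close>;
    \<open>fst3\<close> is the one that involves the new coaction and needs
    \<open>rhoP_j\<close>.\<close>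
  have 2: "mid K P H H H H \<Delta> (?j Z) = ?j3 (mid K B H H H H \<Delta> Z)" "app K P H H H (?j Z) = ?j3 (app K B H H H Z)"
    "id2 K P H H HH \<Delta> (?j Z) = ?j3 (id2 K B H H HH \<Delta> Z)"
    "fst3 K P P H H H rhoP (?j Z) = ?j3 (fst3 K B B H H H rhoB Z)" if Z: "Z \<in> carrier BHH" for Z
  proof -
    show "mid K P H H H H \<Delta> (?j Z) = ?j3 (mid K B H H H H \<Delta> Z)" using Z
    proof (induct Z rule: tensor3_induct)
      case linP show ?case by (rule l | assumption)+
    qed (simp_all add: jp simps_bi apd_closed)
    show "app K P H H H (?j Z) = ?j3 (app K B H H H Z)" using Z
    proof (induct Z rule: tensor3_induct)
      case linP show ?case by (rule l | assumption)+
    qed (simp_all add: jp simps_bi)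
    show "id2 K P H H HH \<Delta> (?j Z) = ?j3 (id2 K B H H HH \<Delta> Z)" using Z
    proof (induct Z rule: tensor3_induct)
      case linP show ?case by (rule l | assumption)+
    qed (simp_all add: jp simps_bi)
    show "fst3 K P P H H H rhoP (?j Z) = ?j3 (fst3 K B B H H H rhoB Z)" using Z
    proof (induct Z rule: tensor3_induct)
      case linP show ?case by (rule l | assumption)+
    next
      case (pure b p q)
      have "apd K P H HH (tm1 K B P H j s) (pure2 K H H p q) = ?j3 (apd K B H HH s (pure2 K H H p q))"
        if "s \<in> carrier BH" for s using that
      proof (induct s rule: tensor_induct)
        case linP show ?case using pure by - (rule l | assumption)+
      qed (use pure in \<open>simp_all add: jp simps_bi\<close>)
      then show ?case using pure by (simp add: jp simps_bi spl_pure[OF am_lin[OF am_rhoP]] rhoP_j)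
    qed (rule spaces)+
  qed
  show "pure2 K P HHH \<one>\<^bsub>P\<^esub> \<Phi> \<otimes>\<^bsub>PHHH\<^esub> mid K P H H H H \<Delta> \<Phi>rP \<otimes>\<^bsub>PHHH\<^esub> app K P H H H \<Phi>rP =
     id2 K P H H HH \<Delta> \<Phi>rP \<otimes>\<^bsub>PHHH\<^esub> fst3 K P P H H H rhoP \<Phi>rP"
    unfolding reassocP_eq 1 2[OF c] using arg_cong[OF bi.right.rho_pentagon', of ?j3] cc
    by (simp add: am_mult[OF amj3] alg_tensor(1) spaces k_algebra_tensor)
  have 3: "tm2 K P HH H (contract1_2 H \<epsilon>) (?j Z) = tm1 K B P H j (tm2 K B HH H (contract1_2 H \<epsilon>) Z)"
     "tm2 K P HH H (contract2_2 H \<epsilon>) (?j Z) = tm1 K B P H j (tm2 K B HH H (contract2_2 H \<epsilon>) Z)"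
     if Z: "Z \<in> carrier BHH" for Z
  proof -
    show "tm2 K P HH H (contract1_2 H \<epsilon>) (?j Z) = tm1 K B P H j (tm2 K B HH H (contract1_2 H \<epsilon>) Z)" using Z
    proof (induct Z rule: tensor3_induct)
      case linP show ?case by (rule l | assumption)+
    qed (simp_all add: jp simps_bi bi.counit_lin bi.counit_pure bi.counit_closed smult_closed[where K = K])
    show "tm2 K P HH H (contract2_2 H \<epsilon>) (?j Z) = tm1 K B P H j (tm2 K B HH H (contract2_2 H \<epsilon>) Z)" using Z
    proof (induct Z rule: tensor3_induct)
      case linP show ?case by (rule l | assumption)+
    qed (simp_all add: jp simps_bi bi.counit_lin bi.counit_pure bi.counit_closed smult_closed[where K = K])
  qed
  show "tm2 K P HH H (contract1_2 H \<epsilon>) \<Phi>rP = \<one>\<^bsub>PH\<^esub>"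
    "tm2 K P HH H (contract2_2 H \<epsilon>) \<Phi>rP = \<one>\<^bsub>PH\<^esub>"
    unfolding reassocP_eq 3[OF c] bi.right.counit_rho_inv by (rule am_one[OF am_tm1[OF am_j Hh]])+
qed

end

section \<open>The left coaction on a crossed product\<close>

text \<open>The bicomodule algebra now occupies the first position, so \<open>A\<close> carries two
  coactions. Compared with the right coaction, tensors acting from the right take over the role of
  those acting from the left.\<close>

locale crossed_left = crossed K H \<Delta> \<epsilon> \<Phi> M la ra A rho \<Phi>r B lam \<Phi>l +
  bi: bicomodule_algebra K H \<Delta> \<epsilon> \<Phi> A lamA rho \<Phi>lA \<Phi>r \<Phi>lr
  for K :: "'k ring" and H :: "('k, 'h) module" and \<Delta> \<epsilon> \<Phi>
    and M :: "('k, 'm) module" and la ra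
    and A :: "('k, 'a) module" and lamA rho \<Phi>lA \<Phi>r \<Phi>lr and B :: "('k, 'b) module" and lam \<Phi>l
begin
abbreviation "HA \<equiv> tensor K H A"
abbreviation "HP \<equiv> tensor K H P"
abbreviation "HAH \<equiv> tensor3 K H A H"
abbreviation "HHA \<equiv> tensor3 K H H A"
abbreviation "HHP \<equiv> tensor3 K H H P"
abbreviation "HAHH \<equiv> tensor4 K H A H H"
abbreviation "HHAH \<equiv> tensor4 K H H A H"
abbreviation "HHHA \<equiv> tensor4 K H H H A"
abbreviation "HHHP \<equiv> tensor4 K H H H P"

abbreviation "\<theta> \<equiv> inv\<^bsub>HAH\<^esub> \<Phi>lr"
abbreviation "lamP \<equiv> crossed_coaction_left K H P A lamA \<Phi>lr M ra B"
abbreviation "\<Phi>lP \<equiv> crossed_reassoc_left K H P A M B \<Phi>lA"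
abbreviation "j a \<equiv> pAMB a \<one>\<^bsub>M\<^esub> \<one>\<^bsub>B\<^esub>"
abbreviation "snocl \<mu> \<equiv> tm2 K H A AH (snoc K A H \<one>\<^bsub>H\<^esub>) \<mu>"

lemmas Pa = k_algebra_P and Pm = module_P

lemma lin_toP: "lin K U T f \<Longrightarrow> lin K U P f" "lin K T X g \<Longrightarrow> lin K P X g"
  by (simp_all add: lin_P_iff)

lemma carrier_P: "x \<in> carrier T \<Longrightarrow> x \<in> carrier P"
  by (simp only: P_fields)

lemmas lin_co = lin_coactions am_lin[OF bi.left.am_lam]
lemmas lin_rules_bi = lrules lin_co lin_co[THEN lin_comp] bi.counit_lin bi.counit_lin[THEN lin_comp]
lemmas closed_rules_bi = crules am_closed[OF bi.left.am_lam] bi.bi_reassoc_closed bi.left.lam_reassoc_closed Pa Pm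
  RR_closed LL_closed P_mult_closed
lemmas simps_bi = simps am_lin[OF bi.left.am_lam] am_closed[OF bi.left.am_lam] Pa Pm P_fields(1) pure_closed

text \<open>As for the right coaction, \<open>E x c (TL a)\<close> is the coaction of a pure
  element, \<open>F\<close> describes its iterates and \<open>Q\<close> the products of such
  coactions. The legs coming from the coaction now act from the right.\<close>

definition E where "E x c S = lift3 HP S (\<lambda>s a k. pure2 K H P s (pAMB a (act \<one>\<^bsub>H\<^esub> x k) c))"

definition F where "F x c S = lift2 HHP S (\<lambda>s t. lift3 HHP t
  (\<lambda>s' a k. pure3 K H H P s s' (pAMB a (act \<one>\<^bsub>H\<^esub> x k) c)))"

definition Q where "Q x y S L = lift2 HP S (\<lambda>s t. lift3 HP t (\<lambda>a k k'.
  lift3 HP L (\<lambda>h h' b. pure2 K H P s (pAMB a (act h x k \<otimes>\<^bsub>M\<^esub> act h' y k') b))))"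

lemma lin_E:
  "c \<in> carrier B \<Longrightarrow> x \<in> carrier M \<Longrightarrow> lin K U HAH f \<Longrightarrow> lin K U HP (\<lambda>u. E x c (f u))"
  "c \<in> carrier B \<Longrightarrow> S \<in> carrier HAH \<Longrightarrow> lin K U M g \<Longrightarrow> lin K U HP (\<lambda>u. E (g u) c S)"
  "x \<in> carrier M \<Longrightarrow> S \<in> carrier HAH \<Longrightarrow> lin K U B h \<Longrightarrow> lin K U HP (\<lambda>u. E x (h u) S)"
  unfolding E_def lift3_def
  by - (rule lin_rules_bi lin_toP carrier_P closed_rules_bi | assumption | (rule lin_module, assumption))+

lemma E_pure:
  "c \<in> carrier B \<Longrightarrow> x \<in> carrier M \<Longrightarrow> s \<in> carrier H \<Longrightarrow> a \<in> carrier A \<Longrightarrow> k \<in> carrier H \<Longrightarrow>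
    E x c (pure3 K H A H s a k) = pure2 K H P s (pAMB a (act \<one>\<^bsub>H\<^esub> x k) c)"
  unfolding E_def lift3_def
  by - (rule HOL.refl | rule HOL.trans[OF lift2_pure_lin] lin_rules_bi lin_toP carrier_P closed_rules_bi | assumption)+

lemma lin_F:
  "c \<in> carrier B \<Longrightarrow> x \<in> carrier M \<Longrightarrow> lin K U HHAH f \<Longrightarrow> lin K U HHP (\<lambda>u. F x c (f u))"
  unfolding F_def lift3_def
  by - (rule lin_rules_bi lin_toP carrier_P closed_rules_bi | assumption | (rule lin_module, assumption))+

lemma F_pure:
  "c \<in> carrier B \<Longrightarrow> x \<in> carrier M \<Longrightarrow> s \<in> carrier H \<Longrightarrow> s' \<in> carrier H \<Longrightarrow> a \<in> carrier A \<Longrightarrow> k \<in> carrier H \<Longrightarrow>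
    F x c (pure4 K H H A H s s' a k) = pure3 K H H P s s' (pAMB a (act \<one>\<^bsub>H\<^esub> x k) c)"
  unfolding F_def lift3_def
  by - (rule HOL.refl | rule HOL.trans[OF lift2_pure_lin] lin_rules_bi lin_toP carrier_P closed_rules_bi | assumption)+

lemma lin_Q:
  "x \<in> carrier M \<Longrightarrow> y \<in> carrier M \<Longrightarrow> L \<in> carrier HHB \<Longrightarrow> lin K U HAHH f \<Longrightarrow>
    lin K U HP (\<lambda>u. Q x y (f u) L)"
  "x \<in> carrier M \<Longrightarrow> y \<in> carrier M \<Longrightarrow> S \<in> carrier HAHH \<Longrightarrow> lin K U HHB g \<Longrightarrow>
    lin K U HP (\<lambda>u. Q x y S (g u))"
  unfolding Q_def lift3_def
  by - (rule lin_rules_bi lin_toP carrier_P closed_rules_bi | assumption | (rule lin_module, assumption))+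

lemma Q_pure:
  "x \<in> carrier M \<Longrightarrow> y \<in> carrier M \<Longrightarrow> a \<in> carrier A \<Longrightarrow> s \<in> carrier H \<Longrightarrow> k \<in> carrier H \<Longrightarrow> k' \<in> carrier H \<Longrightarrow>
    h \<in> carrier H \<Longrightarrow> h' \<in> carrier H \<Longrightarrow> b \<in> carrier B \<Longrightarrow>
    Q x y (pure4 K H A H H s a k k') (pure3 K H H B h h' b) =
    pure2 K H P s (pAMB a (act h x k \<otimes>\<^bsub>M\<^esub> act h' y k') b)"
  unfolding Q_def lift3_def
  by - (rule HOL.refl | rule HOL.trans[OF lift2_pure_lin] lin_rules_bi lin_toP carrier_P closed_rules_bi | assumption)+

text \<open>In Sweedler notation \<open>a_[-1] \<theta>^1 \<otimes> a_[0] \<theta>^2 \<otimes>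
  \<theta>^3\<close>; the third leg acts on the factor in \<open>M\<close> from the right.\<close>

definition TL where "TL a = snocl (lamA a) \<otimes>\<^bsub>HAH\<^esub> \<theta>"

lemma TL_closed: "a \<in> carrier A \<Longrightarrow> TL a \<in> carrier HAH"
  unfolding TL_def by (rule closed_rules_bi | assumption)+

lemma lin_TL: "lin K U A f \<Longrightarrow> lin K U HAH (\<lambda>u. TL (f u))"
  unfolding TL_def by (rule lin_rules_bi closed_rules_bi | assumption)+

lemma lamP_eq:
  assumes "t \<in> carrier T"
  shows "lamP t = lift3 HP t (\<lambda>a x c. E x c (TL a))"
proof -
  have core: "lift3 HP S (\<lambda>s c k. lift2 HP \<mu> (\<lambda>b1 b0.
      pure2 K H P (b1 \<otimes>\<^bsub>H\<^esub> s) (pAMB (b0 \<otimes>\<^bsub>A\<^esub> c) (ra x k) b))) =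
    E x b (snocl \<mu> \<otimes>\<^bsub>HAH\<^esub> S)"
    if b: "x \<in> carrier M" "b \<in> carrier B" and S: "S \<in> carrier HAH" and \<mu>: "\<mu> \<in> carrier HA"
    for b x S \<mu>
    unfolding lift3_def using S
  proof (induct S rule: tensor3_induct)
    case linP show ?case using b \<mu>
      by - (rule lin_E lin_rules_bi lin_comp[OF ra_lin(2)] lin_toP carrier_P ra_closed closed_rules_bi | assumption)+
  next
    case (pure s c k)
    note 1 = pure
    show ?case using \<mu>
    proof (induct \<mu> rule: tensor_induct)
      case linP show ?case using b 1
        by - (rule lin_E lin_rules_bi lin_comp[OF ra_lin(2)] lin_toP carrier_P ra_closed closed_rules_bi | assumption)+
    next
      case (pure b1 b0)
      show ?case (is "?l = ?r")
      proof -
        have "?l = pure2 K H P (b1 \<otimes>\<^bsub>H\<^esub> s) (pAMB (b0 \<otimes>\<^bsub>A\<^esub> c) (ra x k) b)"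
          using b 1 pure
          by - (rule HOL.refl | rule HOL.trans[OF lift2_pure_lin] lin_rules_bi lin_comp[OF ra_lin(2)] lin_toP carrier_P ra_closed closed_rules_bi | assumption)+
        also have "\<dots> = ?r" using b 1 pure by (simp add: simps_bi E_pure ra_act)
        finally show ?thesis .
      qed
    qed (rule spaces)+
  qed (rule spaces)+
  show ?thesis unfolding crossed_coaction_left_def Let_def TL_def lift3_def[of "HP" t]
    by (intro lift2_cong[OF Am module_tensor[OF Mm Bm]] lift2_cong[OF Mm Bm] core assms
        am_closed[OF bi.left.am_lam] bi.bi_reassoc_closed)
qed

lemma lin_lamP: "lin K T HP lamP"
proof -
  have "lin K T HP (\<lambda>t. lift3 HP t (\<lambda>a x c. E x c (TL a)))"
    unfolding lift3_def by (rule lin_E lin_TL TL_closed lin_rules_bi closed_rules_bi | assumption)+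
  then show ?thesis by (rule lin_cong) (rule lamP_eq)
qed

lemma lamP_pure:
  assumes "a \<in> carrier A" "x \<in> carrier M" "c \<in> carrier B"
  shows "lamP (pAMB a x c) = E x c (TL a)"
proof -
  have "lift3 HP (pAMB a x c) (\<lambda>a x c. E x c (TL a)) = E x c (TL a)"
    unfolding lift3_def using assms
    by - (rule HOL.refl | rule HOL.trans[OF lift2_pure_lin] lin_E lin_TL TL_closed lin_rules_bi closed_rules_bi | assumption)+
  then show ?thesis using assms by (simp add: lamP_eq pure_closed)
qed

lemmas lin_rules_P = lin_E lin_F lin_Q lin_TL lin_comp[OF lin_lamP] lin_lamP lin_rules_bi lin_P_mult' lin_toP
lemmas closed_rules_P = TL_closed lin_closed[OF lin_lamP] closed_rules_bi carrier_P
  lin_closed[OF lin_E(1)[OF _ _ lin_id]]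

text \<open>The third leg of \<theta> acts on a product from the right and splits by \<Delta>,
  \<open>lamA\<close> is applied to the first leg of \<open>R\<close>, and \<open>L\<close> is
  carried along.\<close>

lemma lamP_G:
  assumes "x \<in> carrier M" "y \<in> carrier M" and R: "R \<in> carrier AHH" and L: "L \<in> carrier HHB"
  shows "lamP (G A B x y R L) = Q x y (fst3 K A H A H H lamA R \<otimes>\<^bsub>HAHH\<^esub> id2 K H A H HH \<Delta> \<theta>) L"
  using R
proof (induct R rule: tensor3_induct)
  case linP show ?case using assms by - (rule lin_rules_P closed_rules_P | assumption)+
next
  case (pure a r r')
  note 1 = pure
  show ?case using L
  proof (induct L rule: tensor3_induct)
    case linP show ?case using assms(1,2) 1 by - (rule lin_rules_P closed_rules_P | assumption)+
  next
    case (pure l l' b)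
    note 2 = pure
    have N: "pure2 K H P s (pAMB c (N2 (act l x r) (act l' y r') t (pure2 K H H \<one>\<^bsub>H\<^esub> \<one>\<^bsub>H\<^esub>)) b) =
        Q x y (pure4 K H A H H \<one>\<^bsub>H\<^esub> \<one>\<^bsub>A\<^esub> r r' \<otimes>\<^bsub>HAHH\<^esub> pure3 K H A HH s c t) (pure3 K H H B l l' b)"
      if "c \<in> carrier A" "s \<in> carrier H" "t \<in> carrier HH" for c s t
      using that(3)
    proof (induct t rule: tensor_induct)
      case linP show ?case using assms(1,2) 1 2 that(1,2) by - (rule lin_rules_P closed_rules_P | assumption)+
    qed (use assms(1,2) 1 2 that(1,2) in \<open>simp_all add: simps_bi N2_pure Q_pure act_act\<close>)
    have key: "E (act l x r \<otimes>\<^bsub>M\<^esub> act l' y r') b S =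
        Q x y (pure4 K H A H H \<one>\<^bsub>H\<^esub> \<one>\<^bsub>A\<^esub> r r' \<otimes>\<^bsub>HAHH\<^esub> id2 K H A H HH \<Delta> S) (pure3 K H H B l l' b)"
      if "S \<in> carrier HAH" for S
      using that
    proof (induct S rule: tensor3_induct)
      case linP show ?case using assms(1,2) 1 2 by - (rule lin_rules_P closed_rules_P | assumption)+
    qed (use assms(1,2) 1 2 in \<open>simp_all add: simps_bi E_pure act_mult comult_one N\<close>)
    have e: "pure4 K H A H H \<one>\<^bsub>H\<^esub> \<one>\<^bsub>A\<^esub> r r' \<otimes>\<^bsub>HAHH\<^esub> id2 K H A H HH \<Delta> (snocl \<mu>) =
       apd K H A HH \<mu> (pure2 K H H r r')" if "\<mu> \<in> carrier HA" for \<mu>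
      using that
    proof (induct \<mu> rule: tensor_induct)
      case linP show ?case using 1 by - (rule lin_rules_P closed_rules_P | assumption)+
    qed (use 1 in \<open>simp_all add: simps_bi comult_one\<close>)
    have c: "lamA a \<in> carrier HA" "\<theta> \<in> carrier HAH" "snocl (lamA a) \<in> carrier HAH"
      "id2 K H A H HH \<Delta> \<theta> \<in> carrier HAHH"
      "id2 K H A H HH \<Delta> (snocl (lamA a)) \<in> carrier HAHH"
      "pure4 K H A H H \<one>\<^bsub>H\<^esub> \<one>\<^bsub>A\<^esub> r r' \<in> carrier HAHH"
      using 1 by - (rule closed_rules_P | assumption)+
    have "pure4 K H A H H \<one>\<^bsub>H\<^esub> \<one>\<^bsub>A\<^esub> r r' \<otimes>\<^bsub>HAHH\<^esub> id2 K H A H HH \<Delta> (TL a) =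
      fst3 K A H A H H lamA (pure3 K A H H a r r') \<otimes>\<^bsub>HAHH\<^esub> id2 K H A H HH \<Delta> \<theta>"
      unfolding TL_def using 1 c
      by (simp add: am_mult[OF am_id2[OF am_comult Hh Aa]] alg_tensor(3)[symmetric] spaces k_algebra_tensor e[OF c(1)])
        (simp add: simps_bi)
    then show ?case using assms(1,2) 1 2 by (simp add: simps_bi G_pure lamP_pure key TL_closed)
  qed (rule spaces)+
qed (rule spaces)+

text \<open>This time \<open>LL c c'\<close> is the same as for the product before coacting and the
  comparison takes place in tensors acting from the right, where \<open>RR\<close> applies
  \<open>rho\<close> to the middle leg of \<open>S'\<close>.\<close>

lemma E_mult:
  assumes "c \<in> carrier B" "x \<in> carrier M" "c' \<in> carrier B" "x' \<in> carrier M"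
    and S: "S \<in> carrier HAH" and S': "S' \<in> carrier HAH"
  shows "E x c S \<otimes>\<^bsub>HP\<^esub> E x' c' S' = Q x x' (app K H A H H S \<otimes>\<^bsub>HAHH\<^esub>
    (mid K H A A H H rho S' \<otimes>\<^bsub>HAHH\<^esub> pure2 K H AHH \<one>\<^bsub>H\<^esub> \<psi>r)) (LL c c')"
  using S
proof (induct S rule: tensor3_induct)
  case linP show ?case using assms by - (rule lin_rules_P closed_rules_P | assumption)+
next
  case (pure s a k)
  note 1 = pure
  show ?case using S'
  proof (induct S' rule: tensor3_induct)
    case linP show ?case using assms(1-4) 1 by - (rule lin_rules_P closed_rules_P | assumption)+
  next
    case (pure s' a' k')
    note 2 = pure
    note a = assms(1-4) 1 2 alg_mult_closed[OF Hh 1(1) 2(1)]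
    have e1: "pure2 K H P l (G A B (act \<one>\<^bsub>H\<^esub> x k) (act \<one>\<^bsub>H\<^esub> x' k') R V) =
        Q x x' (pure4 K H A H H \<one>\<^bsub>H\<^esub> \<one>\<^bsub>A\<^esub> k k' \<otimes>\<^bsub>HAHH\<^esub> pure2 K H AHH l R) V"
      if R: "R \<in> carrier AHH" and V: "V \<in> carrier HHB" and l: "l \<in> carrier H" for R V l
      using R
    proof (induct R rule: tensor3_induct)
      case linP show ?case using a V l by - (rule lin_rules_P closed_rules_P | assumption)+
    next
      case (pure u v w)
      note 3 = pure
      show ?case using V
      proof (induct V rule: tensor3_induct)
        case linP show ?case using a l 3 by - (rule lin_rules_P closed_rules_P | assumption)+
      qed (use a l 3 in \<open>simp_all add: simps_bi G_pure Q_pure act_act\<close>)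
    qed (rule spaces)+
    \<comment> \<open>Regroups the legs by origin: those of \<open>S\<close> first, then those of
      \<open>S'\<close> with the coaction, and the inverse reassociator last.\<close>
    have e2: "pure4 K H A H H \<one>\<^bsub>H\<^esub> \<one>\<^bsub>A\<^esub> k k' \<otimes>\<^bsub>HAHH\<^esub> pure2 K H AHH (s \<otimes>\<^bsub>H\<^esub> s')
        (pure3 K A H H a \<one>\<^bsub>H\<^esub> \<one>\<^bsub>H\<^esub> \<otimes>\<^bsub>AHH\<^esub> (snocr \<rho> \<otimes>\<^bsub>AHH\<^esub> \<psi>r)) =
      pure4 K H A H H s a k \<one>\<^bsub>H\<^esub> \<otimes>\<^bsub>HAHH\<^esub> (pure2 K H AHH s' (apd K A H H \<rho> k') \<otimes>\<^bsub>HAHH\<^esub>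
        pure2 K H AHH \<one>\<^bsub>H\<^esub> \<psi>r)"
      if "\<rho> \<in> carrier AH" for \<rho> using that
    proof (induct \<rho> rule: tensor_induct)
      case linP show ?case using a by - (rule lin_rules_P closed_rules_P | assumption)+
    qed (use a in \<open>simp_all add: simps_bi reassocs_closed alg_tensor(1)\<close>)
    have e3: "pure4 K H A H H \<one>\<^bsub>H\<^esub> \<one>\<^bsub>A\<^esub> k k' \<otimes>\<^bsub>HAHH\<^esub> pure2 K H AHH (s \<otimes>\<^bsub>H\<^esub> s') (RR a a') =
      app K H A H H (pure3 K H A H s a k) \<otimes>\<^bsub>HAHH\<^esub>
    (mid K H A A H H rho (pure3 K H A H s' a' k') \<otimes>\<^bsub>HAHH\<^esub> pure2 K H AHH \<one>\<^bsub>H\<^esub> \<psi>r)"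
      unfolding RR_def using e2[OF am_closed[OF A.am_rho 2(2)]] a by (simp add: spaces ones tm2_pure lin_tm2 lin_spl lin_snoc
        spl_pure module_tensor pure2_closed snoc_apply lin_coactions)
    have "E x c (pure3 K H A H s a k) \<otimes>\<^bsub>HP\<^esub> E x' c' (pure3 K H A H s' a' k') =
        pure2 K H P (s \<otimes>\<^bsub>H\<^esub> s') (G A B (act \<one>\<^bsub>H\<^esub> x k) (act \<one>\<^bsub>H\<^esub> x' k') (RR a a') (LL c c'))"
      using a by (simp add: E_pure mult_pure Pa P_pure carrier_P pure_closed simps_bi)
    also have "\<dots> = Q x x' (app K H A H H (pure3 K H A H s a k) \<otimes>\<^bsub>HAHH\<^esub>
    (mid K H A A H H rho (pure3 K H A H s' a' k') \<otimes>\<^bsub>HAHH\<^esub> pure2 K H AHH \<one>\<^bsub>H\<^esub> \<psi>r)) (LL c c')"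
      using a by (simp add: e1 RR_closed LL_closed e3)
    finally show ?case .
  qed (rule spaces)+
qed (rule spaces)+

text \<open>A mixed pentagon replaces the two terms at the end by three, the first of which is
  \<theta> with an appended unit; \<open>bi_coassoc\<close> exchanges that \<theta> with the
  iterated coactions of \<open>a'\<close>.\<close>

lemma TL_mult:
  assumes "a \<in> carrier A" "a' \<in> carrier A"
  shows "fst3 K A H A H H lamA (RR a a') \<otimes>\<^bsub>HAHH\<^esub> id2 K H A H HH \<Delta> \<theta> =
    app K H A H H (TL a) \<otimes>\<^bsub>HAHH\<^esub>
    (mid K H A A H H rho (TL a') \<otimes>\<^bsub>HAHH\<^esub> pure2 K H AHH \<one>\<^bsub>H\<^esub> \<psi>r)" (is "?l = ?r")
proof -
  let ?T = "HAHH" and ?app = "app K H A H H" and ?c = "pure2 K H AHH \<one>\<^bsub>H\<^esub> \<psi>r"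
  let ?f = "fst3 K A H A H H lamA \<psi>r" and ?i = "id2 K H A H HH \<Delta> \<theta>" and ?m = "mid K H A A H H rho \<theta>"
  let ?X = "?app (snocl (lamA a))" and ?d = "tm2 K H A AH rho (lamA a')" and ?s = "spl K A H A H lamA (rho a')"
  have c: "lamA a \<in> carrier HA" "lamA a' \<in> carrier HA" "rho a' \<in> carrier AH" "\<theta> \<in> carrier HAH"
    "snocl (lamA a) \<in> carrier HAH" "snocl (lamA a') \<in> carrier HAH" "snocr (rho a') \<in> carrier AHH"
    "pure3 K A H H a \<one>\<^bsub>H\<^esub> \<one>\<^bsub>H\<^esub> \<in> carrier AHH" "\<psi>r \<in> carrier AHH"
    "?f \<in> carrier ?T" "?i \<in> carrier ?T" "?m \<in> carrier ?T" "?X \<in> carrier ?T" "?c \<in> carrier ?T" "?d \<in> carrier HAH"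
    "?s \<in> carrier HAH" "?app ?d \<in> carrier ?T" "?app ?s \<in> carrier ?T" "?app \<theta> \<in> carrier ?T"
    using assms by - (rule closed_rules_P lin_rules_P | assumption)+
  interpret T: monoid ?T by (intro k_algebra_monoid[where K = K] k_algebra_tensor spaces)
  note sm = snoc_maps[OF Hm Am Hm ones(1) c(1)] snoc_maps[OF Hm Am Hm ones(1) c(2)] snoc_maps[OF Am Hm Hm ones(1) c(3)]
  have 1: "fst3 K A H A H H lamA (RR a a') = ?X \<otimes>\<^bsub>?T\<^esub> (?app ?s \<otimes>\<^bsub>?T\<^esub> ?f)"
    unfolding RR_def using assms c
    by (simp add: am_mult[OF am_fst3[OF bi.left.am_lam Hh Aa Hh Hh]] alg_tensor(1) spaces k_algebra_tensor)
      (simp add: sm am_lin[OF bi.left.am_lam] spaces ones spl_pure module_tensor pure2_closed)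
  have 2: "?app (TL a) = ?X \<otimes>\<^bsub>?T\<^esub> ?app \<theta>"
    unfolding TL_def using c by (simp add: am_mult[OF am_app[OF Hh Aa Hh Hh]])
  have 3: "mid K H A A H H rho (TL a') = ?app ?d \<otimes>\<^bsub>?T\<^esub> ?m"
    unfolding TL_def using c by (simp add: am_mult[OF am_mid[OF A.am_rho Hh Aa Hh Hh]] sm spaces lin_coactions)
  have 4: "?app \<theta> \<otimes>\<^bsub>?T\<^esub> ?app ?d = ?app ?s \<otimes>\<^bsub>?T\<^esub> ?app \<theta>"
    using c assms by (simp only: am_mult[OF am_app[OF Hh Aa Hh Hh], symmetric] bi.bi_coassoc)
  have "?l = ?X \<otimes>\<^bsub>?T\<^esub> (?app ?s \<otimes>\<^bsub>?T\<^esub> (?f \<otimes>\<^bsub>?T\<^esub> ?i))" unfolding 1 using c by (simp add: T.m_assoc)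
  also have "\<dots> = ?X \<otimes>\<^bsub>?T\<^esub> ((?app ?s \<otimes>\<^bsub>?T\<^esub> ?app \<theta>) \<otimes>\<^bsub>?T\<^esub> (?m \<otimes>\<^bsub>?T\<^esub> ?c))"
    unfolding bi.bi_right_inverses(1)[symmetric] using c by (simp add: T.m_assoc)
  also have "\<dots> = ?r" unfolding 2 3 4[symmetric] using c by (simp add: T.m_assoc)
  finally show ?thesis .
qed

lemma am_j: "am K A P j"
proof (rule amI)
  show "lin K A P j" by (rule lin_rules_P closed_rules_P | assumption)+
  fix a a' assume a: "a \<in> carrier A" "a' \<in> carrier A"
  then show "j (a \<otimes>\<^bsub>A\<^esub> a') = j a \<otimes>\<^bsub>P\<^esub> j a'"
    by (simp add: P_one_middle(1) comult_one G1_pure act_one simps)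
qed (simp_all add: spaces Pa P_fields)

lemma contract_E:
  assumes "S \<in> carrier HAH"
  shows "c \<in> carrier B \<Longrightarrow> x \<in> carrier M \<Longrightarrow>
      contract1_2 P \<epsilon> (E x c S) = G1 A B x (contract1_2 AH \<epsilon> S) (pure2 K H B \<one>\<^bsub>H\<^esub> c)"
    "E \<one>\<^bsub>M\<^esub> \<one>\<^bsub>B\<^esub> S = tm2 K H A P j (tm2 K H AH A (contract2_2 A \<epsilon>) S)"
proof -
  show "contract1_2 P \<epsilon> (E x c S) = G1 A B x (contract1_2 AH \<epsilon> S) (pure2 K H B \<one>\<^bsub>H\<^esub> c)"
    if "c \<in> carrier B" "x \<in> carrier M"
    using assms
  proof (induct S rule: tensor3_induct)
    case linP show ?case using that by - (rule lin_rules_P closed_rules_P lin_G1[folded lin_P_iff] | assumption)+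
  next
    case (pure s a k)
    have "\<epsilon> s \<odot>\<^bsub>P\<^esub> t = \<epsilon> s \<odot>\<^bsub>T\<^esub> t" for t by (simp only: P_fields)
    then show ?case using pure that
      by (simp add: E_pure simps_bi bi.counit_pure bi.counit_lin pure2_smult bi.counit_closed lin_smult[OF lin_G1(1)[OF _ _ _ _ lin_id]] G1_pure)
  qed (rule spaces)+
  show "E \<one>\<^bsub>M\<^esub> \<one>\<^bsub>B\<^esub> S = tm2 K H A P j (tm2 K H AH A (contract2_2 A \<epsilon>) S)"
    using assms
  proof (induct S rule: tensor3_induct)
    case linP show ?case by (rule linP_eq lin_comp[OF lin_tm2[OF am_lin[OF am_j]]] lin_rules_P closed_rules_P | assumption)+
  next
    case (pure s a k)
    have "E \<one>\<^bsub>M\<^esub> \<one>\<^bsub>B\<^esub> (pure3 K H A H s a k) = pure2 K H P s (\<epsilon> k \<odot>\<^bsub>P\<^esub> j a)"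
      using pure by (simp add: E_pure simps_bi act_M_one bi.counit_closed counit_one pure2_smult P_fields(4))
    then show ?case using pure
      by (simp add: simps_bi bi.counit_pure bi.counit_lin bi.counit_closed lin_smult[OF lin_tm2[OF am_lin[OF am_j]]]
          tm2_pure[OF am_lin[OF am_j]] pure2_smult)
  qed (rule spaces)+
qed

lemma contract_snocl:
  assumes "\<mu> \<in> carrier HA"
  shows "tm2 K H AH A (contract2_2 A \<epsilon>) (snocl \<mu>) = \<mu>"
    "contract1_2 AH \<epsilon> (snocl \<mu>) = pure2 K A H (contract1_2 A \<epsilon> \<mu>) \<one>\<^bsub>H\<^esub>"
proof -
  show "tm2 K H AH A (contract2_2 A \<epsilon>) (snocl \<mu>) = \<mu>" using assms
  proof (induct \<mu> rule: tensor_induct)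
    case linP show ?case by (rule lin_rules_P closed_rules_P | assumption)+
  qed (simp_all add: simps_bi bi.counit_pure bi.counit_lin counit_one)
  show "contract1_2 AH \<epsilon> (snocl \<mu>) = pure2 K A H (contract1_2 A \<epsilon> \<mu>) \<one>\<^bsub>H\<^esub>" using assms
  proof (induct \<mu> rule: tensor_induct)
    case linP show ?case by (rule lin_rules_P closed_rules_P | assumption)+
  qed (simp_all add: simps_bi bi.counit_pure bi.counit_lin bi.counit_closed pure2_smult)
qed

lemma TL_parts:
  assumes "a \<in> carrier A"
  shows "lamA a \<in> carrier HA" "snocl (lamA a) \<in> carrier HAH" "\<theta> \<in> carrier HAH"
  using assms by - (rule closed_rules_P lin_rules_P | assumption)+

text \<open>Uses the other half of \<open>counit_theta\<close> than the right coaction does: here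
  the action on the unit of \<open>M\<close> contracts the third leg of \<theta>.\<close>

lemma lamP_j: "a \<in> carrier A \<Longrightarrow> lamP (j a) = tm2 K H A P j (lamA a)"
proof -
  assume a: "a \<in> carrier A"
  have "tm2 K H AH A (contract2_2 A \<epsilon>) (TL a) = lamA a"
    unfolding TL_def using TL_parts[OF a]
    by (simp add: am_mult[OF am_tm2[OF am_counit2[OF Aa] Hh]] bi.counit_theta contract_snocl alg_tensor spaces k_algebra_tensor)
  then show ?thesis using a by (simp add: lamP_pure ones contract_E(2) TL_closed)
qed

lemma am_lamP: "am K P HP lamP"
proof (rule amI)
  show "lin K P HP lamP" using lin_lamP by (simp only: lin_P_iff)
  have "\<one>\<^bsub>P\<^esub> = j \<one>\<^bsub>A\<^esub>" by (simp only: P_fields)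
  then show "lamP \<one>\<^bsub>P\<^esub> = \<one>\<^bsub>HP\<^esub>"
    by (simp add: lamP_j ones am_one[OF bi.left.am_lam] am_one[OF am_tm2[OF am_j Hh]])
  fix s t assume "s \<in> carrier P" "t \<in> carrier P"
  then have s: "s \<in> carrier T" and t: "t \<in> carrier T" by (simp_all only: P_fields)
  show "lamP (s \<otimes>\<^bsub>P\<^esub> t) = lamP s \<otimes>\<^bsub>HP\<^esub> lamP t" using s
  proof (induct s rule: tensor3_induct)
    case linP show ?case using t by - (rule lin_rules_P closed_rules_P | assumption)+
  next
    case (pure a x b)
    note 1 = pure
    show ?case using t
    proof (induct t rule: tensor3_induct)
      case linP show ?case using 1 by - (rule lin_rules_P closed_rules_P pure_closed | assumption)+
    next
      case (pure a' x' b')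
      then show ?case using 1
        by (simp add: P_pure lamP_G RR_closed LL_closed lamP_pure E_mult TL_closed TL_mult)
    qed (rule spaces)+
  qed (rule spaces)+
qed (intro Pa k_algebra_tensor Hh)+

text \<open>The second coaction acts on \<open>x\<close> from the right after \<open>S\<close> has
  acted, so its \<theta> ends up on the right, whereas for the right coaction it stands on the
  left.\<close>

lemma tm2_E:
  assumes "c \<in> carrier B" "x \<in> carrier M" "S \<in> carrier HAH"
  shows "tm2 K H P HP lamP (E x c S) = F x c (mid K H A H A H lamA S \<otimes>\<^bsub>HHAH\<^esub> pure2 K H HAH \<one>\<^bsub>H\<^esub> \<theta>)"
  using assms(3)
proof (induct S rule: tensor3_induct)
  case linP show ?case using assms(1,2) by - (rule linP_eq lin_comp[OF lin_tm2[OF am_lin[OF am_lamP]]] lin_rules_P closed_rules_P | assumption)+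
next
  case (pure s a k)
  note 1 = pure
  have e1: "pure2 K H HP s (E (act \<one>\<^bsub>H\<^esub> x k) c U) = F x c (pure4 K H H A H s \<one>\<^bsub>H\<^esub> \<one>\<^bsub>A\<^esub> k \<otimes>\<^bsub>HHAH\<^esub>
      pure2 K H HAH \<one>\<^bsub>H\<^esub> U)" if "U \<in> carrier HAH" for U
    using that
  proof (induct U rule: tensor3_induct)
    case linP show ?case using assms(1,2) 1 by - (rule lin_rules_P closed_rules_P | assumption)+
  qed (use assms(1,2) 1 in \<open>simp_all add: simps_bi E_pure F_pure act_act\<close>)
  have e2: "pure4 K H H A H s \<one>\<^bsub>H\<^esub> \<one>\<^bsub>A\<^esub> k \<otimes>\<^bsub>HHAH\<^esub> pure2 K H HAH \<one>\<^bsub>H\<^esub> (snocl \<mu>) =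
     pure2 K H HAH s (apd K H A H \<mu> k)" if "\<mu> \<in> carrier HA" for \<mu>
    using that
  proof (induct \<mu> rule: tensor_induct)
    case linP show ?case using 1 by - (rule lin_rules_P closed_rules_P | assumption)+
  qed (use 1 in \<open>simp_all add: simps_bi\<close>)
  note c = TL_parts[OF 1(2)]
  have cc: "pure4 K H H A H s \<one>\<^bsub>H\<^esub> \<one>\<^bsub>A\<^esub> k \<in> carrier HHAH" "pure2 K H HAH \<one>\<^bsub>H\<^esub> (snocl (lamA a)) \<in> carrier HHAH"
    "pure2 K H HAH \<one>\<^bsub>H\<^esub> \<theta> \<in> carrier HHAH"
    using 1 by - (rule closed_rules_P | assumption)+
  have "pure4 K H H A H s \<one>\<^bsub>H\<^esub> \<one>\<^bsub>A\<^esub> k \<otimes>\<^bsub>HHAH\<^esub> pure2 K H HAH \<one>\<^bsub>H\<^esub> (TL a) =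
    mid K H A H A H lamA (pure3 K H A H s a k) \<otimes>\<^bsub>HHAH\<^esub> pure2 K H HAH \<one>\<^bsub>H\<^esub> \<theta>"
    unfolding TL_def am_mult[OF am_cons[OF Hh k_algebra_tensor[OF Hh k_algebra_tensor[OF Aa Hh]]] c(2,3)]
    using cc c 1 by (simp add: alg_tensor(3)[symmetric] spaces k_algebra_tensor e2[OF c(1)])
      (simp add: tm2_pure spl_pure spaces module_tensor lin_spl am_lin[OF bi.left.am_lam] pure2_closed)
  then show ?case using 1 assms(1,2)
    by (simp add: E_pure tm2_pure[OF am_lin[OF am_lamP]] carrier_P pure_closed spaces Pm lamP_pure act_closed ones e1 TL_closed)
qed (rule spaces)+

lemma spl_E:
  assumes "c \<in> carrier B" "x \<in> carrier M" "S \<in> carrier HAH"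
  shows "spl K H H H P \<Delta> (E x c S) = F x c (fst3 K H H H A H \<Delta> S)"
  using assms(3)
proof (induct S rule: tensor3_induct)
  case linP show ?case using assms(1,2) by - (rule lin_rules_P closed_rules_P | assumption)+
next
  case (pure s a k)
  note 1 = pure
  have "apd K H H P t (pAMB a (act \<one>\<^bsub>H\<^esub> x k) c) = F x c (apd K H H AH t (pure2 K A H a k))"
    if "t \<in> carrier HH" for t using that
  proof (induct t rule: tensor_induct)
    case linP show ?case using assms(1,2) 1 by - (rule lin_rules_P closed_rules_P | assumption)+
  qed (use assms(1,2) 1 in \<open>simp_all add: simps_bi F_pure\<close>)
  then show ?case using 1 assms(1,2) by (simp add: E_pure simps_bi)
qed (rule spaces)+

text \<open>The asymmetry is reversed compared with the right coaction: multiplication from the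
  right lets \<open>rho\<close> of the leg in \<open>A\<close> act on \<open>x\<close>,
  multiplication from the left does not act on it.\<close>

lemma F_mult:
  assumes "c \<in> carrier B" "x \<in> carrier M" and Z: "Z \<in> carrier HHA" and U: "U \<in> carrier HHAH"
  shows "id2 K H H A P j Z \<otimes>\<^bsub>HHP\<^esub> F x c U = F x c (app K H H A H Z \<otimes>\<^bsub>HHAH\<^esub> U)"
    "F x c U \<otimes>\<^bsub>HHP\<^esub> id2 K H H A P j Z =
      F x c (U \<otimes>\<^bsub>HHAH\<^esub> id2 K H H A AH rho Z)"
proof -
  note lj = lin_tm2[OF lin_tm2[OF am_lin[OF am_j] Hm] Hm] lin_comp[OF lin_tm2[OF lin_tm2[OF am_lin[OF am_j] Hm] Hm]]
  note l = lj lin_rules_P closed_rules_P lin_closed[OF lj(1)] lin_closed[OF lin_F[OF _ _ lin_id]]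
  note jp = tm2_pure[OF am_lin[OF am_j]] tm2_pure[OF lin_tm2[OF am_lin[OF am_j] Hm]]
  show "id2 K H H A P j Z \<otimes>\<^bsub>HHP\<^esub> F x c U = F x c (app K H H A H Z \<otimes>\<^bsub>HHAH\<^esub> U)"
    using Z
  proof (induct Z rule: tensor3_induct)
    case linP show ?case using assms(1,2) U by - (rule l | assumption)+
  next
    case (pure p q z)
    note 1 = pure
    show ?case using U
    proof (induct U rule: tensor4_induct)
      case linP show ?case using assms(1,2) 1 by - (rule l | assumption)+
    next
      case (pure s s' a k)
      then show ?case using assms(1,2) 1
        by (simp add: F_pure simps_bi jp P_one_middle comult_one G1_pure act_act)
    qed (rule spaces)+
  qed (rule spaces)+
  show "F x c U \<otimes>\<^bsub>HHP\<^esub> id2 K H H A P j Z =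
      F x c (U \<otimes>\<^bsub>HHAH\<^esub> id2 K H H A AH rho Z)"
    using Z
  proof (induct Z rule: tensor3_induct)
    case linP show ?case using assms(1,2) U by - (rule l | assumption)+
  next
    case (pure p q z)
    note 1 = pure
    show ?case using U
    proof (induct U rule: tensor4_induct)
      case linP show ?case using assms(1,2) 1 by - (rule l | assumption)+
    next
      case (pure s s' a k)
      note 2 = pure
      have "pure3 K H H P (s \<otimes>\<^bsub>H\<^esub> p) (s' \<otimes>\<^bsub>H\<^esub> q) (G1 A B (act \<one>\<^bsub>H\<^esub> x k) (pure2 K A H a \<one>\<^bsub>H\<^esub> \<otimes>\<^bsub>AH\<^esub> \<rho>) (pure2 K H B \<one>\<^bsub>H\<^esub> c)) =
        F x c (pure4 K H H A H s s' a k \<otimes>\<^bsub>HHAH\<^esub> pure3 K H H AH p q \<rho>)"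
        if "\<rho> \<in> carrier AH" for \<rho> using that
      proof (induct \<rho> rule: tensor_induct)
        case linP show ?case using assms(1,2) 1 2 by - (rule l | assumption)+
      qed (use assms(1,2) 1 2 in \<open>simp_all add: simps_bi G1_pure F_pure act_act\<close>)
      then show ?case using assms(1,2) 1 2
        by (simp add: F_pure simps_bi jp P_one_middle carrier_P)
    qed (rule spaces)+
  qed (rule spaces)+
qed

lemma reassocP_eq: "\<Phi>lP = id2 K H H A P j \<Phi>lA"
  unfolding crossed_reassoc_left_def lift3_def tm2_def[of K H "HA"]
  by (intro lift2_cong[OF Hm module_tensor[OF Hm Am] bi.left.lam_reassoc_closed(1)] lift2_tm2 spaces am_lin[OF am_j])

text \<open>A mixed pentagon moves \<open>\<Phi>lA\<close> to the left across \<theta>, and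
  quasi-coassociativity in \<open>A\<close> moves it across the iterated coaction of
  \<open>a\<close>.\<close>

lemma TL_coassoc:
  assumes "a \<in> carrier A"
  shows "mid K H A H A H lamA (TL a) \<otimes>\<^bsub>HHAH\<^esub> pure2 K H HAH \<one>\<^bsub>H\<^esub> \<theta> \<otimes>\<^bsub>HHAH\<^esub>
      id2 K H H A AH rho \<Phi>lA =
    app K H H A H \<Phi>lA \<otimes>\<^bsub>HHAH\<^esub> fst3 K H H H A H \<Delta> (TL a)" (is "?l = ?r")
proof -
  let ?T = "HHAH" and ?app = "app K H H A H" and ?c = "pure2 K H HAH \<one>\<^bsub>H\<^esub> \<theta>"
  let ?f = "fst3 K H H H A H \<Delta> \<theta>" and ?i = "id2 K H H A AH rho \<Phi>lA" and ?m = "mid K H A H A H lamA \<theta>"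
  let ?d = "tm2 K H A HA lamA (lamA a)" and ?s = "spl K H H H A \<Delta> (lamA a)"
  have c: "?f \<in> carrier ?T" "?i \<in> carrier ?T" "?m \<in> carrier ?T" "?c \<in> carrier ?T" "?d \<in> carrier HHA"
    "?s \<in> carrier HHA" "?app ?d \<in> carrier ?T" "?app ?s \<in> carrier ?T" "?app \<Phi>lA \<in> carrier ?T" "\<Phi>lA \<in> carrier HHA"
    using assms by - (rule closed_rules_P lin_rules_P | assumption)+
  note c' = TL_parts[OF assms]
  interpret T: monoid ?T by (intro k_algebra_monoid[where K = K] k_algebra_tensor spaces)
  note sm = snoc_maps[OF Hm Am Hm ones(1) c'(1)]
  have 1: "mid K H A H A H lamA (TL a) = ?app ?d \<otimes>\<^bsub>?T\<^esub> ?m"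
    unfolding TL_def using c' by (simp add: am_mult[OF am_mid[OF bi.left.am_lam Hh Hh Aa Hh]] sm spaces am_lin[OF bi.left.am_lam])
  have 2: "fst3 K H H H A H \<Delta> (TL a) = ?app ?s \<otimes>\<^bsub>?T\<^esub> ?f"
    unfolding TL_def using c' by (simp add: am_mult[OF am_fst3[OF am_comult Hh Hh Aa Hh]] sm spaces lin_coactions)
  have "?l = ?app ?d \<otimes>\<^bsub>?T\<^esub> (?m \<otimes>\<^bsub>?T\<^esub> ?c \<otimes>\<^bsub>?T\<^esub> ?i)" unfolding 1 using c by (simp add: T.m_assoc)
  also have "\<dots> = (?app ?d \<otimes>\<^bsub>?T\<^esub> ?app \<Phi>lA) \<otimes>\<^bsub>?T\<^esub> ?f" unfolding bi.bi_left_inverses(2) using c by (simp add: T.m_assoc)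
  also have "?app ?d \<otimes>\<^bsub>?T\<^esub> ?app \<Phi>lA = ?app \<Phi>lA \<otimes>\<^bsub>?T\<^esub> ?app ?s"
    using c assms by (simp only: am_mult[OF am_app[OF Hh Hh Aa Hh], symmetric] bi.left.lam_coassoc(1))
  finally show ?thesis unfolding 2 using c by (simp add: T.m_assoc)
qed

theorem left_comodule_algebra_P: "left_comodule_algebra K H \<Delta> \<epsilon> \<Phi> P lamP \<Phi>lP"
proof (rule left_comodule_algebraI[OF Pa am_lamP])
  note amj = am_id2[OF am_j Hh Hh]
  note lj = am_lin[OF amj] lin_comp[OF am_lin[OF amj]] lin_comp[OF lin_tm2[OF am_lin[OF am_lamP]]]
  note l = linP_eq lj lin_rules_P closed_rules_P lin_closed[OF lj(1)]
  show "\<Phi>lP \<in> Units HHP"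
    unfolding reassocP_eq by (rule am_Units(1)[OF amj bi.left.coaction_reassoc_invertible])
  fix t assume "t \<in> carrier P"
  then have t: "t \<in> carrier T" by (simp only: P_fields)
  have c: "\<Phi>lA \<in> carrier HHA" by (rule bi.left.lam_reassoc_closed)
  have cP: "\<Phi>lP \<in> carrier HHP" unfolding reassocP_eq by (rule am_closed[OF amj c])
  show "tm2 K H P HP lamP (lamP t) \<otimes>\<^bsub>HHP\<^esub> \<Phi>lP = \<Phi>lP \<otimes>\<^bsub>HHP\<^esub> spl K H H H P \<Delta> (lamP t)"
    using t
  proof (induct t rule: tensor3_induct)
    case linP show ?case using cP by - (rule l | assumption)+
  next
    case (pure a x b)
    have c': "TL a \<in> carrier HAH" "mid K H A H A H lamA (TL a) \<otimes>\<^bsub>HHAH\<^esub> pure2 K H HAH \<one>\<^bsub>H\<^esub> \<theta> \<in> carrier HHAH"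
      "fst3 K H H H A H \<Delta> (TL a) \<in> carrier HHAH"
      using pure by - (rule closed_rules_P lin_rules_P | assumption)+
    show ?case unfolding reassocP_eq using pure c c'
      by (simp add: lamP_pure spl_E tm2_E F_mult TL_coassoc)
  qed (rule spaces)+
  show "contract1_2 P \<epsilon> (lamP t) = t" using t
  proof (induct t rule: tensor3_induct)
    case linP show ?case by (rule l | assumption)+
  next
    case (pure a x b)
    have "contract1_2 AH \<epsilon> (TL a) = pure2 K A H a \<one>\<^bsub>H\<^esub>"
      unfolding TL_def using TL_parts[OF pure(1)] pure
      by (simp add: am_mult[OF am_counit1[OF k_algebra_tensor[OF Aa Hh]]] bi.counit_theta contract_snocl
          bi.left.coaction_counit alg_tensor spaces k_algebra_tensor pure2_closed ones)
    then show ?case using pure by (simp add: lamP_pure contract_E(1) TL_closed G1_pure spaces ones act_one)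
  qed (rule spaces)+
next
  let ?j = "id2 K H H A P j" and ?T = "HHHA"
  let ?j3 = "tm2 K H HHA HHP ?j"
  note amj = am_id2[OF am_j Hh Hh] and amj3 = am_tm2[OF am_id2[OF am_j Hh Hh] Hh]
  note lj = am_lin[OF am_tm2[OF am_j Hh]] am_lin[OF amj] am_lin[OF amj3]
  note l = linP_eq lj lj[THEN lin_comp] lin_comp[OF lin_tm2[OF lin_tm2[OF am_lin[OF am_lamP] Hm] Hm]] lin_rules_P closed_rules_P lj[THEN lin_closed]
  note jp = tm2_pure[OF am_lin[OF am_j]] am_closed[OF am_j] am_lin[OF am_j] lin_tm2
  have c: "\<Phi>lA \<in> carrier HHA" by (rule bi.left.lam_reassoc_closed)
  have cc: "pure2 K H HHA \<one>\<^bsub>H\<^esub> \<Phi>lA \<in> carrier ?T" "mid K H H H H A \<Delta> \<Phi>lA \<in> carrier ?T" "app K H H H A \<Phi> \<in> carrier ?T"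
    "id2 K H H A HA lamA \<Phi>lA \<in> carrier ?T" "fst3 K H H H H A \<Delta> \<Phi>lA \<in> carrier ?T"
    by (rule closed_rules_P lin_rules_P | assumption)+
  \<comment> \<open>The appended unit is that of \<open>P\<close>, hence the image under
    \<open>j\<close> of the unit of \<open>A\<close>.\<close>
  have 1: "app K H H H P Z = ?j3 (app K H H H A Z)" if Z: "Z \<in> carrier HHH" for Z
    using Z
  proof (induct Z rule: tensor3_induct)
    case linP show ?case by (rule l alg_one_closed[OF Pa] | assumption)+
  next
    case (pure p q r)
    have "\<one>\<^bsub>P\<^esub> \<in> carrier T" using alg_one_closed[OF Pa] by (simp only: P_fields)
    then show ?case using pure by (simp add: jp simps_bi am_one[OF am_j, symmetric])
  qed (rule spaces)+
  have 2: "pure2 K H HHP \<one>\<^bsub>H\<^esub> (?j Z) = ?j3 (pure2 K H HHA \<one>\<^bsub>H\<^esub> Z)"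
    "mid K H H H H P \<Delta> (?j Z) = ?j3 (mid K H H H H A \<Delta> Z)"
    "id2 K H H P HP lamP (?j Z) = ?j3 (id2 K H H A HA lamA Z)"
    "fst3 K H H H H P \<Delta> (?j Z) = ?j3 (fst3 K H H H H A \<Delta> Z)" if Z: "Z \<in> carrier HHA" for Z
  proof -
    \<comment> \<open>Naturality of \<open>apd\<close> with an arbitrary \<open>s\<close> in the
      place of a coproduct.\<close>
    have a: "apd K H H HP s (pure2 K H P p (j q)) = ?j3 (apd K H H HA s (pure2 K H A p q))"
      "apd K H H P s (j q) = ?j (apd K H H A s q)"
      if s: "s \<in> carrier HH" and p: "p \<in> carrier H" "q \<in> carrier A" for s p q
    proof -
      show "apd K H H HP s (pure2 K H P p (j q)) = ?j3 (apd K H H HA s (pure2 K H A p q))" using s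
      proof (induct s rule: tensor_induct)
        case linP show ?case using p by - (rule l | assumption)+
      qed (use p in \<open>simp_all add: jp simps_bi\<close>)
      show "apd K H H P s (j q) = ?j (apd K H H A s q)" using s
      proof (induct s rule: tensor_induct)
        case linP show ?case using p by - (rule l | assumption)+
      qed (use p in \<open>simp_all add: jp simps_bi\<close>)
    qed
    show "pure2 K H HHP \<one>\<^bsub>H\<^esub> (?j Z) = ?j3 (pure2 K H HHA \<one>\<^bsub>H\<^esub> Z)"
      using Z by (simp add: jp simps_bi)
    show "mid K H H H H P \<Delta> (?j Z) = ?j3 (mid K H H H H A \<Delta> Z)" using Z
    proof (induct Z rule: tensor3_induct)
      case linP show ?case by (rule l | assumption)+
    qed (simp_all add: jp simps_bi apd_closed a)
    show "id2 K H H P HP lamP (?j Z) = ?j3 (id2 K H H A HA lamA Z)" using Z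
    proof (induct Z rule: tensor3_induct)
      case linP show ?case by (rule l | assumption)+
    qed (simp_all add: jp simps_bi am_lin[OF am_lamP] lamP_j)
    show "fst3 K H H H H P \<Delta> (?j Z) = ?j3 (fst3 K H H H H A \<Delta> Z)" using Z
    proof (induct Z rule: tensor3_induct)
      case linP show ?case by (rule l | assumption)+
    qed (simp_all add: jp simps_bi a)
  qed
  show "pure2 K H HHP \<one>\<^bsub>H\<^esub> \<Phi>lP \<otimes>\<^bsub>HHHP\<^esub> mid K H H H H P \<Delta> \<Phi>lP \<otimes>\<^bsub>HHHP\<^esub> app K H H H P \<Phi> =
     id2 K H H P HP lamP \<Phi>lP \<otimes>\<^bsub>HHHP\<^esub> fst3 K H H H H P \<Delta> \<Phi>lP"
    unfolding reassocP_eq 1[OF reassoc_closed(1)] 2[OF c] using arg_cong[OF bi.left.lam_pentagon', of ?j3] cc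
    by (simp add: am_mult[OF amj3] alg_tensor(1) spaces k_algebra_tensor)
  have 3: "tm2 K H HP P (contract1_2 P \<epsilon>) (?j Z) = tm2 K H A P j (tm2 K H HA A (contract1_2 A \<epsilon>) Z)"
     "contract1_2 HP \<epsilon> (?j Z) = tm2 K H A P j (contract1_2 HA \<epsilon> Z)"
     if Z: "Z \<in> carrier HHA" for Z
  proof -
    show "tm2 K H HP P (contract1_2 P \<epsilon>) (?j Z) = tm2 K H A P j (tm2 K H HA A (contract1_2 A \<epsilon>) Z)" using Z
    proof (induct Z rule: tensor3_induct)
      case linP show ?case by (rule l | assumption)+
    qed (simp_all add: jp simps_bi bi.counit_lin bi.counit_pure bi.counit_closed smult_closed[where K = K] lin_smult[OF am_lin[OF am_j]])
    show "contract1_2 HP \<epsilon> (?j Z) = tm2 K H A P j (contract1_2 HA \<epsilon> Z)" using Z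
    proof (induct Z rule: tensor3_induct)
      case linP show ?case by (rule l | assumption)+
    qed (simp_all add: jp simps_bi bi.counit_lin bi.counit_pure bi.counit_closed lin_smult[OF lin_tm2[OF am_lin[OF am_j]]])
  qed
  show "tm2 K H HP P (contract1_2 P \<epsilon>) \<Phi>lP = \<one>\<^bsub>HP\<^esub>"
    "contract1_2 HP \<epsilon> \<Phi>lP = \<one>\<^bsub>HP\<^esub>"
    unfolding reassocP_eq 3[OF c] bi.left.counit_lam_inv by (rule am_one[OF am_tm2[OF am_j Hh]])+
qed

end

section \<open>Iterated crossed products\<close>

locale iterated_crossed =
  AB: crossed_right K H \<Delta> \<epsilon> \<Phi> M la ra A rhoA \<Phi>rA B lamB rhoB \<Phi>lB \<Phi>rB \<Phi>lrB +
  BC: crossed_left K H \<Delta> \<epsilon> \<Phi> M la ra B lamB rhoB \<Phi>lB \<Phi>rB \<Phi>lrB C lamC \<Phi>lC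
  for K :: "'k ring" and H :: "('k, 'h) module" and \<Delta> \<epsilon> \<Phi>
    and M :: "('k, 'm) module" and la ra
    and A :: "('k, 'a) module" and rhoA \<Phi>rA
    and B :: "('k, 'b) module" and lamB rhoB \<Phi>lB \<Phi>rB \<Phi>lrB
    and C :: "('k, 'c) module" and lamC \<Phi>lC
begin
abbreviation "BH \<equiv> tensor K B H"
abbreviation "HB \<equiv> tensor K H B"
abbreviation "HH \<equiv> tensor K H H"
abbreviation "MB \<equiv> tensor K M B"
abbreviation "MC \<equiv> tensor K M C"
abbreviation "AHH \<equiv> tensor3 K A H H"
abbreviation "BHH \<equiv> tensor3 K B H H"
abbreviation "HBH \<equiv> tensor3 K H B H"
abbreviation "HHB \<equiv> tensor3 K H H B"
abbreviation "HHC \<equiv> tensor3 K H H C"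

abbreviation "pAMB \<equiv> pure3 K A M B"
abbreviation "pBMC \<equiv> pure3 K B M C"

text \<open>The comodule algebra structure on the inner product makes the outer one another instance
  of \<open>crossed\<close>, with the algebra laws already proved; likewise for
  \<open>Y\<close>.\<close>

sublocale X: crossed K H \<Delta> \<epsilon> \<Phi> M la ra AB.P AB.rhoP AB.\<Phi>rP C lamC \<Phi>lC
  using AB.crossed_axioms BC.crossed_axioms AB.right_comodule_algebra_P by (simp add: crossed_def)

sublocale Y: crossed K H \<Delta> \<epsilon> \<Phi> M la ra A rhoA \<Phi>rA BC.P BC.lamP BC.\<Phi>lP
  using AB.crossed_axioms BC.crossed_axioms BC.left_comodule_algebra_P by (simp add: crossed_def)

abbreviation "tid \<equiv> trivial_identification K A M B C BC.P"

definition "tid_inv s = lift3 X.T s (\<lambda>a x t. lift3 X.T t (\<lambda>b y c. pure3 K AB.P M C (pAMB a x b) y c))"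

text \<open>The carrier of an inner crossed product equals that of a tensor product without having
  its syntactic form, so the general rule has to be restated for it.\<close>

lemma lin_lift2_body_P:
  "module K U \<Longrightarrow> module K V \<Longrightarrow> t \<in> carrier AB.P \<Longrightarrow>
    (\<And>a s. a \<in> carrier A \<Longrightarrow> s \<in> carrier MB \<Longrightarrow> lin K U V (\<lambda>u. f u a s)) \<Longrightarrow> lin K U V (\<lambda>u. lift2 V t (f u))"
  "module K U \<Longrightarrow> module K V \<Longrightarrow> t' \<in> carrier BC.P \<Longrightarrow>
    (\<And>b s. b \<in> carrier B \<Longrightarrow> s \<in> carrier MC \<Longrightarrow> lin K U V (\<lambda>u. g u b s)) \<Longrightarrow> lin K U V (\<lambda>u. lift2 V t' (g u))"
  unfolding AB.P_fields BC.P_fields by (rule lin_lift2_body module_tensor AB.spaces BC.spaces | assumption)+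

lemma lin_lift2_body':
  fixes U :: "('k, 'u) module"
  assumes "t \<in> carrier (tensor K V W)" "module K V" "module K W" "module K U" "module K X"
    "\<And>v w. v \<in> carrier V \<Longrightarrow> w \<in> carrier W \<Longrightarrow> lin K U X (\<lambda>u. f u v w)"
  shows "lin K U X (\<lambda>u. lift2 X t (f u))"
  by (rule lin_lift2_body[where V = V and W = W]) fact+

lemma lin_lift2_arg':
  fixes U :: "('k, 'u) module"
  assumes "lin K U (tensor K V W) g" "module K V" "module K W" "module K X"
    "\<And>w. w \<in> carrier W \<Longrightarrow> lin K V X (\<lambda>v. f v w)" "\<And>v. v \<in> carrier V \<Longrightarrow> lin K W X (f v)"
  shows "lin K U X (\<lambda>u. lift2 X (g u) f)"
  by (rule lin_lift2_arg) fact+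

lemmas lin_rules_bi = lin_lift2_body_P lin_lift2_body' lin_lift2_arg' AB.lin_rules_P BC.lin_rules_P AB.lin_toP BC.lin_toP AB.lin_E AB.lin_TR BC.lin_E BC.lin_TL X.lin_P_mult' Y.lin_P_mult'
lemmas closed_rules_bi = AB.closed_rules_P BC.closed_rules_P AB.carrier_P BC.carrier_P X.module_T Y.module_T X.P_mult_closed Y.P_mult_closed AB.closed_G

section \<open>The trivial identification as a linear bijection\<close>

lemma lin_tid: "lin K X.T Y.T tid"
  unfolding trivial_identification_def lift3_def by (assumption | rule lin_rules_bi closed_rules_bi)+

lemma tid_pure:
  assumes "a \<in> carrier A" "x \<in> carrier M" "b \<in> carrier B" "y \<in> carrier M" "c \<in> carrier C"
  shows "tid (pure3 K AB.P M C (pAMB a x b) y c) = pure3 K A M BC.P a x (pBMC b y c)"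
  unfolding trivial_identification_def lift3_def using assms
  by - (rule HOL.refl | assumption | rule HOL.trans[OF lift2_pure_lin] lin_rules_bi closed_rules_bi)+

lemma lin_tid_inv: "lin K Y.T X.T tid_inv"
  unfolding tid_inv_def lift3_def by (assumption | rule lin_rules_bi closed_rules_bi)+

lemma tid_inv_pure:
  assumes "a \<in> carrier A" "x \<in> carrier M" "b \<in> carrier B" "y \<in> carrier M" "c \<in> carrier C"
  shows "tid_inv (pure3 K A M BC.P a x (pBMC b y c)) = pure3 K AB.P M C (pAMB a x b) y c"
  unfolding tid_inv_def lift3_def using assms
  by - (rule HOL.refl | assumption | rule HOL.trans[OF lift2_pure_lin] lin_rules_bi closed_rules_bi)+

text \<open>The first factor of a pure element is itself an arbitrary tensor in \<open>AB.P\<close>,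
  so it is decomposed by a second induction; \<open>linP_comp\<close> pulls the property back along
  its insertion.\<close>

lemma X_induct [consumes 1, case_names linP pure]:
  assumes s: "s \<in> carrier X.T" and P: "linP K X.T Q"
    and pure: "\<And>a x b y c. a \<in> carrier A \<Longrightarrow> x \<in> carrier M \<Longrightarrow> b \<in> carrier B \<Longrightarrow> y \<in> carrier M \<Longrightarrow> c \<in> carrier C \<Longrightarrow>
      Q (pure3 K AB.P M C (pAMB a x b) y c)"
  shows "Q s"
  using s
proof (induct s rule: tensor3_induct)
  case (pure p y c)
  have "p \<in> carrier AB.T" using pure(1) by (simp only: AB.P_fields)
  then show ?case
  proof (induct p rule: tensor3_induct)
    case linP show ?case by (rule linP_comp[OF P]) (rule lin_rules_bi closed_rules_bi | fact | assumption)+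
  next
    case (pure a x b)
    then show ?case by (rule assms(3)) fact+
  qed (rule AB.spaces)+
qed (rule P AB.spaces X.spaces BC.spaces)+

lemma Y_induct [consumes 1, case_names linP pure]:
  assumes s: "s \<in> carrier Y.T" and P: "linP K Y.T Q"
    and pure: "\<And>a x b y c. a \<in> carrier A \<Longrightarrow> x \<in> carrier M \<Longrightarrow> b \<in> carrier B \<Longrightarrow> y \<in> carrier M \<Longrightarrow> c \<in> carrier C \<Longrightarrow>
      Q (pure3 K A M BC.P a x (pBMC b y c))"
  shows "Q s"
  using s
proof (induct s rule: tensor3_induct)
  case (pure a x p)
  have "p \<in> carrier BC.T" using pure(3) by (simp only: BC.P_fields)
  then show ?case
  proof (induct p rule: tensor3_induct)
    case linP show ?case by (rule linP_comp[OF P]) (rule lin_rules_bi closed_rules_bi | fact | assumption)+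
  next
    case (pure b y c)
    show ?case by (rule assms(3)) fact+
  qed (rule BC.spaces)+
qed (rule P AB.spaces Y.spaces BC.spaces)+

lemma bij_tid: "bij_betw tid (carrier X.T) (carrier Y.T)"
proof (rule bij_betw_byWitness[where f' = tid_inv])
  show "\<forall>s\<in>carrier X.T. tid_inv (tid s) = s"
  proof
    fix s assume "s \<in> carrier X.T"
    then show "tid_inv (tid s) = s"
    proof (induct s rule: X_induct)
      case linP show ?case by (rule linP_eq lin_comp[OF lin_tid_inv] lin_tid lin_id X.module_T)+
    qed (simp add: tid_pure tid_inv_pure)
  qed
  show "\<forall>s\<in>carrier Y.T. tid (tid_inv s) = s"
  proof
    fix s assume "s \<in> carrier Y.T"
    then show "tid (tid_inv s) = s"
    proof (induct s rule: Y_induct)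
      case linP show ?case by (rule linP_eq lin_comp[OF lin_tid] lin_tid_inv lin_id Y.module_T)+
    qed (simp add: tid_pure tid_inv_pure)
  qed
qed (use lin_closed[OF lin_tid] lin_closed[OF lin_tid_inv] in blast)+

text \<open>\<open>D1\<close> and \<open>D2\<close> describe the outer tensors \<open>X.RR\<close> and \<open>Y.LL\<close> of the two iterated products.\<close>

definition D1 where "D1 x x' R V S Z = lift3 (tensor3 K AB.P H H) S (\<lambda>s1 s2 s3. lift3 (tensor3 K AB.P H H) Z (\<lambda>q1 q2 q3.
  pure3 K AB.P H H (AB.G A B x (AB.act s1 x' \<one>\<^bsub>H\<^esub>) R (V \<otimes>\<^bsub>HHB\<^esub> pure3 K H H B \<one>\<^bsub>H\<^esub> \<one>\<^bsub>H\<^esub> (s2 \<otimes>\<^bsub>B\<^esub> q1)))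
    (s3 \<otimes>\<^bsub>H\<^esub> q2) q3))"

definition D2 where "D2 y y' V S Z L = lift3 (tensor3 K H H BC.P) V (\<lambda>v1 v2 v3. lift3 (tensor3 K H H BC.P) S (\<lambda>s1 s2 s3.
  pure3 K H H BC.P v1 (v2 \<otimes>\<^bsub>H\<^esub> s1) (AB.G B C (AB.act \<one>\<^bsub>H\<^esub> y s3) y'
    (pure3 K B H H (v3 \<otimes>\<^bsub>B\<^esub> s2) \<one>\<^bsub>H\<^esub> \<one>\<^bsub>H\<^esub> \<otimes>\<^bsub>BHH\<^esub> Z) L)))"

lemma lin_D1:
  assumes "x \<in> carrier M" "x' \<in> carrier M"
  shows "V \<in> carrier HHB \<Longrightarrow> S \<in> carrier HBH \<Longrightarrow> Z \<in> carrier BHH \<Longrightarrow>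
      lin K U AHH f1 \<Longrightarrow> lin K U (tensor3 K AB.P H H) (\<lambda>u. D1 x x' (f1 u) V S Z)"
    "R \<in> carrier AHH \<Longrightarrow> S \<in> carrier HBH \<Longrightarrow> Z \<in> carrier BHH \<Longrightarrow>
      lin K U HHB f2 \<Longrightarrow> lin K U (tensor3 K AB.P H H) (\<lambda>u. D1 x x' R (f2 u) S Z)"
    "R \<in> carrier AHH \<Longrightarrow> V \<in> carrier HHB \<Longrightarrow> Z \<in> carrier BHH \<Longrightarrow>
      lin K U HBH f3 \<Longrightarrow> lin K U (tensor3 K AB.P H H) (\<lambda>u. D1 x x' R V (f3 u) Z)"
    "R \<in> carrier AHH \<Longrightarrow> V \<in> carrier HHB \<Longrightarrow> S \<in> carrier HBH \<Longrightarrow>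
      lin K U BHH f4 \<Longrightarrow> lin K U (tensor3 K AB.P H H) (\<lambda>u. D1 x x' R V S (f4 u))"
  unfolding D1_def lift3_def using assms
  by - (assumption | rule lin_rules_bi closed_rules_bi | (rule lin_module, assumption))+

lemma D1_pure:
  assumes "x \<in> carrier M" "x' \<in> carrier M" "R \<in> carrier AHH" "V \<in> carrier HHB"
    "s1 \<in> carrier H" "s2 \<in> carrier B" "s3 \<in> carrier H" "q1 \<in> carrier B" "q2 \<in> carrier H" "q3 \<in> carrier H"
  shows "D1 x x' R V (pure3 K H B H s1 s2 s3) (pure3 K B H H q1 q2 q3) =
    pure3 K AB.P H H (AB.G A B x (AB.act s1 x' \<one>\<^bsub>H\<^esub>) R (V \<otimes>\<^bsub>HHB\<^esub> pure3 K H H B \<one>\<^bsub>H\<^esub> \<one>\<^bsub>H\<^esub> (s2 \<otimes>\<^bsub>B\<^esub> q1)))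
    (s3 \<otimes>\<^bsub>H\<^esub> q2) q3"
  unfolding D1_def lift3_def using assms
  by - (rule HOL.refl | assumption | rule HOL.trans[OF lift2_pure_lin] lin_rules_bi closed_rules_bi)+

lemma lin_D2:
  assumes "y \<in> carrier M" "y' \<in> carrier M"
  shows "S \<in> carrier HBH \<Longrightarrow> Z \<in> carrier BHH \<Longrightarrow> L \<in> carrier HHC \<Longrightarrow>
      lin K U HHB f1 \<Longrightarrow> lin K U (tensor3 K H H BC.P) (\<lambda>u. D2 y y' (f1 u) S Z L)"
    "V \<in> carrier HHB \<Longrightarrow> Z \<in> carrier BHH \<Longrightarrow> L \<in> carrier HHC \<Longrightarrow>
      lin K U HBH f2 \<Longrightarrow> lin K U (tensor3 K H H BC.P) (\<lambda>u. D2 y y' V (f2 u) Z L)"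
    "V \<in> carrier HHB \<Longrightarrow> S \<in> carrier HBH \<Longrightarrow> L \<in> carrier HHC \<Longrightarrow>
      lin K U BHH f3 \<Longrightarrow> lin K U (tensor3 K H H BC.P) (\<lambda>u. D2 y y' V S (f3 u) L)"
    "V \<in> carrier HHB \<Longrightarrow> S \<in> carrier HBH \<Longrightarrow> Z \<in> carrier BHH \<Longrightarrow>
      lin K U HHC f4 \<Longrightarrow> lin K U (tensor3 K H H BC.P) (\<lambda>u. D2 y y' V S Z (f4 u))"
  unfolding D2_def lift3_def using assms
  by - (assumption | rule lin_rules_bi closed_rules_bi | (rule lin_module, assumption))+

lemma D2_pure:
  assumes "y \<in> carrier M" "y' \<in> carrier M" "Z \<in> carrier BHH" "L \<in> carrier HHC"
    "s1 \<in> carrier H" "s2 \<in> carrier B" "s3 \<in> carrier H" "v1 \<in> carrier H" "v2 \<in> carrier H" "v3 \<in> carrier B"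
  shows "D2 y y' (pure3 K H H B v1 v2 v3) (pure3 K H B H s1 s2 s3) Z L =
    pure3 K H H BC.P v1 (v2 \<otimes>\<^bsub>H\<^esub> s1) (AB.G B C (AB.act \<one>\<^bsub>H\<^esub> y s3) y'
    (pure3 K B H H (v3 \<otimes>\<^bsub>B\<^esub> s2) \<one>\<^bsub>H\<^esub> \<one>\<^bsub>H\<^esub> \<otimes>\<^bsub>BHH\<^esub> Z) L)"
  unfolding D2_def lift3_def using assms
  by - (rule HOL.refl | assumption | rule HOL.trans[OF lift2_pure_lin] lin_rules_bi closed_rules_bi)+

lemmas lin_rules_D = lin_D1 lin_D2 lin_comp[OF lin_tid] lin_tid lin_rules_bi
lemmas closed_rules_D = lin_closed[OF lin_D1(1)[OF _ _ _ _ _ lin_id]] lin_closed[OF lin_D2(1)[OF _ _ _ _ _ lin_id]] closed_rules_bi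
lemmas simps_bi = AB.simps_bi BC.simps_bi

text \<open>With reassociators and coactions replaced by arbitrary tensors both sides have the same
  legs; for pure tensors only \<open>act_act\<close> and associativity in \<open>H\<close> and
  \<open>B\<close> are left. In the application \<open>V\<close>, \<open>S\<close>, \<open>Z\<close>
  are the inverses of \<open>\<Phi>lB\<close>, \<open>\<Phi>lrB\<close>, \<open>\<Phi>rB\<close>,
  and \<open>\<mu>\<close>, \<open>\<rho>\<close> are \<open>lamB b\<close>,
  \<open>rhoB b'\<close>.\<close>

lemma tid_G:
  assumes m: "x \<in> carrier M" "x' \<in> carrier M" "y \<in> carrier M" "y' \<in> carrier M"
    and R: "R \<in> carrier AHH" and V: "V \<in> carrier HHB" and \<mu>: "\<mu> \<in> carrier HB"
    and S: "S \<in> carrier HBH" and \<rho>: "\<rho> \<in> carrier BH" and Z: "Z \<in> carrier BHH"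
    and L: "L \<in> carrier HHC"
  shows "tid (AB.G AB.P C y y' (D1 x x' R (V \<otimes>\<^bsub>HHB\<^esub> pure2 K H HB \<one>\<^bsub>H\<^esub> \<mu>)
      (S \<otimes>\<^bsub>HBH\<^esub> pure2 K H BH \<one>\<^bsub>H\<^esub> \<rho>) Z) L) =
    AB.G A BC.P x x' R (D2 y y' V (BC.snocl \<mu> \<otimes>\<^bsub>HBH\<^esub> S) (BC.snocr \<rho> \<otimes>\<^bsub>BHH\<^esub> Z) L)"
  using R
proof (induct R rule: tensor3_induct)
  case linP show ?case using assms by - (assumption | rule lin_rules_D closed_rules_D)+
next
  case (pure r1 r2 r3)
  note R = pure
  show ?case using V
  proof (induct V rule: tensor3_induct)
    case linP show ?case using R m \<mu> S \<rho> Z L by - (assumption | rule lin_rules_D closed_rules_D)+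
  next
    case (pure v1 v2 v3)
    note V = pure
    show ?case using \<mu>
    proof (induct \<mu> rule: tensor_induct)
      case linP show ?case using R V m S \<rho> Z L by - (assumption | rule lin_rules_D closed_rules_D)+
    next
      case (pure m1 m2)
      note \<mu> = pure
      show ?case using S
      proof (induct S rule: tensor3_induct)
        case linP show ?case using R V \<mu> m \<rho> Z L by - (assumption | rule lin_rules_D closed_rules_D)+
      next
        case (pure s1 s2 s3)
        note S = pure
        show ?case using \<rho>
        proof (induct \<rho> rule: tensor_induct)
          case linP show ?case using R V \<mu> S m Z L by - (assumption | rule lin_rules_D closed_rules_D)+
        next
          case (pure p1 p2)
          note \<rho> = pure
          show ?case using Z
          proof (induct Z rule: tensor3_induct)
            case linP show ?case using R V \<mu> S \<rho> m L by - (assumption | rule lin_rules_D closed_rules_D)+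
          next
            case (pure z1 z2 z3)
            note Z = pure
            show ?case using L
            proof (induct L rule: tensor3_induct)
              case linP show ?case using R V \<mu> S \<rho> Z m by - (assumption | rule lin_rules_D closed_rules_D)+
            next
              case (pure l1 l2 l3)
              then show ?case using R V \<mu> S \<rho> Z m
                by (simp add: D1_pure D2_pure AB.G_pure simps_bi AB.act_act tid_pure alg_assoc[OF AB.Hh] alg_assoc[OF AB.Bb]
                    AB.carrier_P BC.carrier_P)
            qed (rule AB.spaces BC.spaces)+
          qed (rule AB.spaces)+
        qed (rule AB.spaces)+
      qed (rule AB.spaces)+
    qed (rule AB.spaces)+
  qed (rule AB.spaces)+
qed (rule AB.spaces)+

section \<open>Products in the two iterated crossed products\<close>

lemma inv_reassocP:
  "X.\<psi>r = tm1 K B AB.P HH AB.j BC.\<psi>r" "Y.\<psi>l = id2 K H H B BC.P BC.j AB.\<psi>l"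
  unfolding AB.reassocP_eq BC.reassocP_eq
    am_Units(2)[OF am_tm1[OF AB.am_j k_algebra_tensor[OF AB.Hh AB.Hh]] AB.bi.right.coaction_reassoc_invertible]
    am_Units(2)[OF am_id2[OF BC.am_j AB.Hh AB.Hh] AB.B.coaction_reassoc_invertible] by (rule HOL.refl)+

text \<open>The tensor \<open>X.RR\<close> contains products in the inner crossed product. Its
  reassociator comes from the image of \<open>j\<close>, so \<open>P_one_middle\<close> merges that
  part into the factor in \<open>B\<close>, and one genuine inner product remains.\<close>

lemma X_RR:
  assumes "a \<in> carrier A" "x \<in> carrier M" "b \<in> carrier B" "a' \<in> carrier A" "x' \<in> carrier M" "b' \<in> carrier B"
  shows "X.RR (pAMB a x b) (pAMB a' x' b') =
    D1 x x' (AB.RR a a') (AB.\<psi>l \<otimes>\<^bsub>HHB\<^esub> pure2 K H HB \<one>\<^bsub>H\<^esub> (lamB b)) (AB.TR b') BC.\<psi>r"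
proof -
  let ?p = "pAMB a x b"
  have V: "AB.\<psi>l \<in> carrier HHB" "pure2 K H HB \<one>\<^bsub>H\<^esub> (lamB b) \<in> carrier HHB"
    "AB.\<psi>l \<otimes>\<^bsub>HHB\<^esub> pure2 K H HB \<one>\<^bsub>H\<^esub> (lamB b) \<in> carrier HHB"
    using assms by - (assumption | rule closed_rules_bi)+
  note lj = lin_comp[OF lin_tm1[OF am_lin[OF AB.am_j]]] lin_closed[OF lin_tm1[OF am_lin[OF AB.am_j]]]
  have "pure3 K AB.P H H ?p \<one>\<^bsub>H\<^esub> \<one>\<^bsub>H\<^esub> \<otimes>\<^bsub>tensor3 K AB.P H H\<^esub> (tm2 K AB.P H HH (snoc K H H \<one>\<^bsub>H\<^esub>) (AB.E a' x' S)
      \<otimes>\<^bsub>tensor3 K AB.P H H\<^esub> tm1 K B AB.P HH AB.j Z) =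
    D1 x x' (AB.RR a a') (AB.\<psi>l \<otimes>\<^bsub>HHB\<^esub> pure2 K H HB \<one>\<^bsub>H\<^esub> (lamB b)) S Z"
    if S: "S \<in> carrier HBH" and Z: "Z \<in> carrier BHH" for S Z
    using S
  proof (induct S rule: tensor3_induct)
    case linP show ?case using assms Z V by - (assumption | rule lj lin_rules_D closed_rules_D)+
  next
    case (pure s1 s2 s3)
    note S = pure
    show ?case using Z
    proof (induct Z rule: tensor3_induct)
      case linP show ?case using assms S V by - (assumption | rule lj lin_rules_D closed_rules_D)+
    next
      case (pure q1 q2 q3)
      note Z = pure
      have "pAMB a' (AB.act s1 x' \<one>\<^bsub>H\<^esub>) s2 \<otimes>\<^bsub>AB.P\<^esub> AB.j q1 = pAMB a' (AB.act s1 x' \<one>\<^bsub>H\<^esub>) (s2 \<otimes>\<^bsub>B\<^esub> q1)"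
        using assms S Z by (simp add: AB.P_one_middle simps_bi AB.comult_one AB.G1_pure AB.act_act)
      moreover have "AB.LL b (s2 \<otimes>\<^bsub>B\<^esub> q1) = AB.\<psi>l \<otimes>\<^bsub>HHB\<^esub> pure2 K H HB \<one>\<^bsub>H\<^esub> (lamB b) \<otimes>\<^bsub>HHB\<^esub>
          pure3 K H H B \<one>\<^bsub>H\<^esub> \<one>\<^bsub>H\<^esub> (s2 \<otimes>\<^bsub>B\<^esub> q1)"
        unfolding AB.LL_def using V S Z by (simp add: alg_tensor(3) AB.spaces k_algebra_tensor AB.pure_closed simps_bi)
      ultimately show ?case using assms S Z V
        by (simp add: D1_pure AB.RR_closed AB.E_pure AB.P_pure simps_bi tm1_pure[OF am_lin[OF AB.am_j]] AB.carrier_P)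
    qed (rule AB.spaces)+
  qed (rule AB.spaces)+
  then show ?thesis unfolding X.RR_def inv_reassocP AB.rhoP_pure[OF assms(4-6)]
    using assms by (simp add: AB.TR_closed AB.bi.right.rho_reassoc_closed)
qed

text \<open>The counterpart of \<open>X_RR\<close>: here the image of \<open>j\<close> stands on the
  left and merges into the first factor of the coaction term.\<close>

lemma Y_LL:
  assumes "b \<in> carrier B" "y \<in> carrier M" "c \<in> carrier C" "b' \<in> carrier B" "y' \<in> carrier M" "c' \<in> carrier C"
  shows "Y.LL (pBMC b y c) (pBMC b' y' c') =
    D2 y y' AB.\<psi>l (BC.TL b) (BC.snocr (rhoB b') \<otimes>\<^bsub>BHH\<^esub> BC.\<psi>r) (BC.LL c c')"
proof -
  let ?p = "pBMC b' y' c'"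
  have R: "BC.snocr (rhoB b') \<otimes>\<^bsub>BHH\<^esub> BC.\<psi>r \<in> carrier BHH"
    using assms by - (assumption | rule closed_rules_bi)+
  note lj = lin_comp[OF am_lin[OF am_id2[OF BC.am_j AB.Hh AB.Hh]]] lin_closed[OF am_lin[OF am_id2[OF BC.am_j AB.Hh AB.Hh]]]
    BC.LL_closed
  have "id2 K H H B BC.P BC.j V \<otimes>\<^bsub>tensor3 K H H BC.P\<^esub> (pure2 K H (tensor K H BC.P) \<one>\<^bsub>H\<^esub> (BC.E y c S) \<otimes>\<^bsub>tensor3 K H H BC.P\<^esub>
      pure3 K H H BC.P \<one>\<^bsub>H\<^esub> \<one>\<^bsub>H\<^esub> ?p) =
    D2 y y' V S (BC.snocr (rhoB b') \<otimes>\<^bsub>BHH\<^esub> BC.\<psi>r) (BC.LL c c')"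
    if V: "V \<in> carrier HHB" and S: "S \<in> carrier HBH" for V S
    using V
  proof (induct V rule: tensor3_induct)
    case linP show ?case using assms S R by - (assumption | rule lj lin_rules_D closed_rules_D)+
  next
    case (pure v1 v2 v3)
    note V = pure
    show ?case using S
    proof (induct S rule: tensor3_induct)
      case linP show ?case using assms V R by - (assumption | rule lj lin_rules_D closed_rules_D)+
    next
      case (pure s1 s2 s3)
      note S = pure
      let ?q = "pBMC s2 (AB.act \<one>\<^bsub>H\<^esub> y s3) c"
      have c: "?q \<in> carrier BC.T" "BC.j v3 \<in> carrier BC.T" "?p \<in> carrier BC.T"
        using assms S V by (simp_all add: simps_bi)
      have "BC.j v3 \<otimes>\<^bsub>BC.P\<^esub> ?q = pBMC (v3 \<otimes>\<^bsub>B\<^esub> s2) (AB.act \<one>\<^bsub>H\<^esub> y s3) c"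
        using assms S V by (simp add: BC.P_one_middle simps_bi BC.comult_one AB.G1_pure AB.act_act)
      \<comment> \<open>Associativity of the inner product allows \<open>BC.j v3\<close> to merge
        with the coaction term before the second element is multiplied.\<close>
      then have "BC.j v3 \<otimes>\<^bsub>BC.P\<^esub> (?q \<otimes>\<^bsub>BC.P\<^esub> ?p) = AB.G B C (AB.act \<one>\<^bsub>H\<^esub> y s3) y' (BC.RR (v3 \<otimes>\<^bsub>B\<^esub> s2) b') (BC.LL c c')"
        using assms S V BC.P_assoc[OF c(2,1,3)] by (simp add: BC.P_pure simps_bi)
      then show ?case using assms S V R c
        by (simp add: D2_pure BC.RR_def[of "v3 \<otimes>\<^bsub>B\<^esub> s2"] BC.E_pure BC.LL_closed simps_bi tm2_pure[OF am_lin[OF BC.am_j]] am_lin[OF BC.am_j]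
            BC.P_mult_closed BC.carrier_P mult_pure del: BC.P_fields(1))
    qed (rule AB.spaces)+
  qed (rule AB.spaces)+
  then show ?thesis unfolding Y.LL_def inv_reassocP BC.lamP_pure[OF assms(1-3)]
    using assms by (simp add: BC.TL_closed AB.B.lam_reassoc_closed)
qed

lemma algebra_iso_tid: "algebra_iso K X.P Y.P tid"
proof -
  have mult: "tid (s \<otimes>\<^bsub>X.P\<^esub> t) = tid s \<otimes>\<^bsub>Y.P\<^esub> tid t" if s: "s \<in> carrier X.T" and t: "t \<in> carrier X.T" for s t
    using s
  proof (induct s rule: X_induct)
    case linP show ?case using t
      by - (assumption | rule linP_eq lin_comp[OF lin_tid] X.lin_P_mult' Y.lin_P_mult' lin_tid lin_id X.module_T lin_closed[OF lin_tid])+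
  next
    case (pure a x b y c)
    note 1 = pure
    have s: "pure3 K AB.P M C (pAMB a x b) y c \<in> carrier X.T" "pure3 K A M BC.P a x (pBMC b y c) \<in> carrier Y.T"
      using pure by - (assumption | rule closed_rules_bi)+
    show ?case using t
    proof (induct t rule: X_induct)
      case linP show ?case unfolding tid_pure[OF 1] using s
        by - (assumption | rule linP_eq lin_comp[OF lin_tid] X.lin_P_mult' Y.lin_P_mult' lin_tid lin_id X.module_T lin_closed[OF lin_tid])+
    next
      case (pure a' x' b' y' c')
      note 2 = pure
      have "tid (pure3 K AB.P M C (pAMB a x b) y c \<otimes>\<^bsub>X.P\<^esub> pure3 K AB.P M C (pAMB a' x' b') y' c') =
        tid (AB.G AB.P C y y' (X.RR (pAMB a x b) (pAMB a' x' b')) (BC.LL c c'))"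
        using 1 2 by (simp add: X.P_pure AB.carrier_P AB.pure_closed)
      also have "\<dots> = AB.G A BC.P x x' (AB.RR a a') (Y.LL (pBMC b y c) (pBMC b' y' c'))"
        \<comment> \<open>Opening \<open>TR\<close> and \<open>TL\<close> exposes the one difference
          between the two sides: \<theta> is attached to \<open>rhoB b'\<close> in the first
          iterated product and to \<open>lamB b\<close> in the second.\<close>
        unfolding X_RR[OF 1(1-3) 2(1-3)] Y_LL[OF 1(3-5) 2(3-5)] AB.TR_def BC.TL_def
        using 1 2 by (intro tid_G AB.RR_closed BC.LL_closed closed_rules_bi)
      also have "\<dots> = pure3 K A M BC.P a x (pBMC b y c) \<otimes>\<^bsub>Y.P\<^esub> pure3 K A M BC.P a' x' (pBMC b' y' c')"
        using 1 2 by (simp add: Y.P_pure BC.carrier_P BC.pure_closed)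
      finally show ?case unfolding tid_pure[OF 1] tid_pure[OF 2] .
    qed
  qed
  have "am K X.P Y.P tid"
  proof (rule amI[OF X.k_algebra_P Y.k_algebra_P])
    show "lin K X.P Y.P tid" using lin_tid by (simp only: X.lin_P_iff Y.lin_P_iff)
    show "tid \<one>\<^bsub>X.P\<^esub> = \<one>\<^bsub>Y.P\<^esub>" unfolding X.P_fields Y.P_fields AB.P_fields BC.P_fields by (intro tid_pure AB.ones BC.ones)
  qed (simp add: mult X.P_fields)
  then show ?thesis
    using X.k_algebra_P Y.k_algebra_P bij_tid unfolding algebra_iso_def
    by (simp add: am_iff[OF X.k_algebra_P Y.k_algebra_P, symmetric] X.P_fields Y.P_fields)
qed

end

theorem theorem8p3:
  fixes K :: "'k ring" and H :: "('k, 'h) module" and M :: "('k, 'm) module"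
    and A :: "('k, 'a) module" and B :: "('k, 'b) module" and C :: "('k, 'c) module"
  assumes H: "quasi_bialgebra K H \<Delta> \<epsilon> \<Phi>"
    and M: "bimodule_algebra K H \<Delta> \<epsilon> \<Phi> M la ra"
    and A: "right_comodule_algebra K H \<Delta> \<epsilon> \<Phi> A rhoA \<Phi>rA"
    and B: "bicomodule_algebra K H \<Delta> \<epsilon> \<Phi> B lamB rhoB \<Phi>lB \<Phi>rB \<Phi>lrB"
    and C: "left_comodule_algebra K H \<Delta> \<epsilon> \<Phi> C lamC \<Phi>lC"
  shows "let
      AMB = crossed_product K H A rhoA \<Phi>rA M la ra B lamB \<Phi>lB;
      BMC = crossed_product K H B rhoB \<Phi>rB M la ra C lamC \<Phi>lC;
      rhoP = crossed_coaction_right K H AMB A M la B rhoB \<Phi>lrB;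
      \<Phi>rP = crossed_reassoc_right K H AMB A M B \<Phi>rB;
      lamP = crossed_coaction_left K H BMC B lamB \<Phi>lrB M ra C;
      \<Phi>lP = crossed_reassoc_left K H BMC B M C \<Phi>lB
    in
      right_comodule_algebra K H \<Delta> \<epsilon> \<Phi> AMB rhoP \<Phi>rP \<and>
      left_comodule_algebra K H \<Delta> \<epsilon> \<Phi> BMC lamP \<Phi>lP \<and>
      algebra_iso K
        (crossed_product K H AMB rhoP \<Phi>rP M la ra C lamC \<Phi>lC)
        (crossed_product K H A rhoA \<Phi>rA M la ra BMC lamP \<Phi>lP)
        (trivial_identification K A M B C BMC)"
proof -
  interpret iterated_crossed K H \<Delta> \<epsilon> \<Phi> M la ra A rhoA \<Phi>rA B lamB rhoB \<Phi>lB \<Phi>rB \<Phi>lrB C lamC \<Phi>lC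
    using assms by (simp add: iterated_crossed_def crossed_right_def crossed_left_def crossed_def bicomodule_algebra_def)
  show ?thesis unfolding Let_def
    by (intro conjI AB.right_comodule_algebra_P BC.left_comodule_algebra_P algebra_iso_tid)
qed

end
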